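(* Let $D$ be a homogeneous bounded domain in $\mathbb{C}^n$ and let $\mathcal{A}$ be a vector subspace of $C^\infty_b(D)$ which is closed under complex conjugation. Suppose that for every $h \in (0,1)$ the Toeplitz operator algebra $\mathcal{T}_h(\mathcal{A})$, acting on the weighted Bergman space $\mathcal{A}_h^2(D)$, is commutative. Suppose also that $\mathcal{A}$ satisfies the following richness condition: for some closed nowhere dense subset $S \subseteq D$ and for every $p \in D \setminus S$ there exist real-valued elements $a_1, \dots, a_n \in \mathcal{A}$ such that the differentials $d(a_1)_p, \dots, d(a_n)_p$ are linearly independent over $\mathbb{R}$. Then there is a Lagrangian foliation $\mathcal{F}$ of $D \setminus S$ such that $\mathcal{A}|_{D\setminus S} \subseteq \mathcal{A}_{\mathcal{F}}(D\setminus S)$; in other words, every element of $\mathcal{A}$ is constant along the leaves of $\mathcal{F}$.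
   Context: A bounded domain $D \subseteq \mathbb{C}^n$ is homogeneous if its group of biholomorphic automorphisms acts transitively on $D$. Let $K(z,\overline{\zeta})$ be the Bergman kernel of $D$, and let $d\mu(z) = K(z,\overline{z})\,dv(z)$ be the (weightless) Bergman volume, where $dv$ is Lebesgue measure. The domain $D$ is regarded as a symplectic manifold (of real dimension $2n$) with the Kähler form of its Bergman metric, $\omega = i\,\partial\overline{\partial}\log K(z,\overline{z})$ (a nonzero constant multiple gives the same Lagrangian submanifolds), and $D\setminus S$ carries the restricted symplectic form. For $h\in(0,1)$, $d\mu_h$ denotes the weighted volume element obtained from the Bergman kernel, $d\mu_h(z) = c(h)\,K(z,\overline{z})^{-1/h}\,d\mu(z)$ with $c(h)>0$ a normalizing constant. The weighted Bergman space $\mathcal{A}_h^2(D)$ is the closed subspace of holomorphic functions in $L^2(D,d\mu_h)$, and $B_D^{(h)} : L^2(D,d\mu_h)\to\mathcal{A}_h^2(D)$ is the orthogonal projection. For $a \in L^\infty(D,d\mu_h)$ the Toeplitz operator with (anti-Wick) symbol $a$ is $T_a^{(h)} : \mathcal{A}_h^2(D)\to\mathcal{A}_h^2(D)$, $\varphi \mapsto B_D^{(h)}(a\varphi)$. For a set $\mathcal{A}$ of bounded smooth symbols, $\mathcal{T}_h(\mathcal{A})$ is the algebra of operators on $\mathcal{A}_h^2(D)$ generated by the Toeplitz operators $T_a^{(h)}$, $a\in\mathcal{A}$. For a manifold $M$, $C^\infty(M)$ is the space of smooth complex-valued functions on $M$ and $C^\infty_b(M)$ is the subspace of bounded ones.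 A foliation $\mathcal{F}$ of a manifold $M$ is a decomposition of $M$ into connected (immersed) submanifolds, the leaves, given by a foliated atlas. A foliated chart is a smooth submersion $\varphi:U\to\mathbb{R}^k$ from an open $U\subseteq M$ onto an open subset of $\mathbb{R}^k$. Two foliated charts $\varphi,\psi$ with domains $U,V$ are compatible if there is a diffeomorphism $\xi:\varphi(U\cap V)\to\psi(U\cap V)$ with $\xi\circ\varphi=\psi$ on $U\cap V$. A foliated atlas is a family of compatible foliated charts, all with the same $k$, whose domains cover $M$. The plaques are the connected components of the fibers of the foliated charts, and the leaves are the equivalence classes of the relation: $x\sim y$ iff there is a finite sequence of plaques $P_0,\dots,P_l$ with $x\in P_0$, $y\in P_l$ and $P_{j-1}\cap P_j\neq\emptyset$ for $j=1,\dots,l$. A foliation of a symplectic manifold is Lagrangian if its leaves are Lagrangian submanifolds. For a foliation $\mathcal{F}$ of $M$, $\mathcal{A}_{\mathcal{F}}(M)$ is the vector subspace of $C^\infty(M)$ of functions which are constant along every leaf of $\mathcal{F}$. *)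

theory Defs
  imports "HOL-Analysis.Analysis"
begin

text \<open>
  Throughout, a function on a subset \<open>M\<close> of Euclidean space is represented by its extension by
  zero, so that two elements of a function space on \<open>M\<close> are equal iff they agree on \<open>M\<close>.
\<close>

section \<open>Smooth and holomorphic functions\<close>

text \<open>Both notions are meant for an open set \<open>U\<close>.\<close>

fun ck_on :: "nat \<Rightarrow> 'a::euclidean_space set \<Rightarrow> ('a \<Rightarrow> 'b::euclidean_space) \<Rightarrow> bool" where
  "ck_on 0 U f \<longleftrightarrow> continuous_on U f"
| "ck_on (Suc k) U f \<longleftrightarrow>
     (\<forall>x\<in>U. f differentiable (at x)) \<and> (\<forall>v. ck_on k U (\<lambda>x. frechet_derivative f (at x) v))"

definition smooth_on :: "'a::euclidean_space set \<Rightarrow> ('a \<Rightarrow> 'b::euclidean_space) \<Rightarrow> bool" where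
  "smooth_on U f \<longleftrightarrow> (\<forall>k. ck_on k U f)"

definition zero_ext :: "'a set \<Rightarrow> ('a \<Rightarrow> 'b::zero) \<Rightarrow> 'a \<Rightarrow> 'b" where
  "zero_ext M f = (\<lambda>x. if x \<in> M then f x else 0)"

definition smooth_functions :: "'a::euclidean_space set \<Rightarrow> ('a \<Rightarrow> complex) set" where
  "smooth_functions M = {f. smooth_on M f \<and> (\<forall>x. x \<notin> M \<longrightarrow> f x = 0)}"

definition bounded_smooth_functions :: "'a::euclidean_space set \<Rightarrow> ('a \<Rightarrow> complex) set" where
  "bounded_smooth_functions M = {f \<in> smooth_functions M. bounded (f ` M)}"

definition complex_function_subspace :: "('a \<Rightarrow> complex) set \<Rightarrow> bool" where
  "complex_function_subspace V \<longleftrightarrow>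
     (\<lambda>x. 0) \<in> V \<and>
     (\<forall>f\<in>V. \<forall>g\<in>V. (\<lambda>x. f x + g x) \<in> V) \<and>
     (\<forall>c. \<forall>f\<in>V. (\<lambda>x. c * f x) \<in> V)"

definition holomorphic_fun :: "(complex^'n) set \<Rightarrow> (complex^'n \<Rightarrow> complex) \<Rightarrow> bool" where
  "holomorphic_fun U f \<longleftrightarrow>
     (\<forall>z\<in>U. \<exists>L. (f has_derivative L) (at z) \<and> (\<forall>c v. L (c *s v) = c * L v))"

definition holomorphic_map :: "(complex^'n) set \<Rightarrow> (complex^'n \<Rightarrow> complex^'m) \<Rightarrow> bool" where
  "holomorphic_map U F \<longleftrightarrow> (\<forall>j. holomorphic_fun U (\<lambda>z. F z $ j))"


section \<open>Homogeneous bounded domains\<close>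

definition bounded_domain :: "(complex^'n) set \<Rightarrow> bool" where
  "bounded_domain D \<longleftrightarrow> open D \<and> connected D \<and> D \<noteq> {} \<and> bounded D"

definition biholomorphic_automorphism ::
    "(complex^'n) set \<Rightarrow> (complex^'n \<Rightarrow> complex^'n) \<Rightarrow> bool" where
  "biholomorphic_automorphism D F \<longleftrightarrow>
     bij_betw F D D \<and> holomorphic_map D F \<and> holomorphic_map D (inv_into D F)"

definition homogeneous_bounded_domain :: "(complex^'n) set \<Rightarrow> bool" where
  "homogeneous_bounded_domain D \<longleftrightarrow>
     bounded_domain D \<and>
     (\<forall>z\<in>D. \<forall>w\<in>D. \<exists>F. biholomorphic_automorphism D F \<and> F z = w)"


section \<open>Bergman spaces, Bergman kernel and weighted measures\<close>

definition square_integrable :: "'a measure \<Rightarrow> ('a \<Rightarrow> complex) \<Rightarrow> bool" where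
  "square_integrable M f \<longleftrightarrow> f \<in> borel_measurable M \<and> integrable M (\<lambda>z. (cmod (f z))\<^sup>2)"

definition l2_inner :: "'a measure \<Rightarrow> ('a \<Rightarrow> complex) \<Rightarrow> ('a \<Rightarrow> complex) \<Rightarrow> complex" where
  "l2_inner M f g = (LINT z|M. f z * cnj (g z))"

definition holomorphic_l2 ::
    "(complex^'n) set \<Rightarrow> (complex^'n) measure \<Rightarrow> (complex^'n \<Rightarrow> complex) set" where
  "holomorphic_l2 D M =
     {f. holomorphic_fun D f \<and> square_integrable M f \<and> (\<forall>z. z \<notin> D \<longrightarrow> f z = 0)}"

text \<open>
  \<open>bergman_kernel D z w\<close> is the value written \<open>K(z, w-bar)\<close> in the literature: it is
  holomorphic in \<open>z\<close>, antiholomorphic in \<open>w\<close>, and reproduces the unweighted Bergman space.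
\<close>

definition bergman_kernel :: "(complex^'n) set \<Rightarrow> complex^'n \<Rightarrow> complex^'n \<Rightarrow> complex" where
  "bergman_kernel D z w =
     (THE k. k \<in> holomorphic_l2 D (lebesgue_on D) \<and>
             (\<forall>f\<in>holomorphic_l2 D (lebesgue_on D). f w = l2_inner (lebesgue_on D) f k)) z"

text \<open>The kernel is real and positive on the diagonal.\<close>

definition bergman_diag :: "(complex^'n) set \<Rightarrow> complex^'n \<Rightarrow> real" where
  "bergman_diag D z = Re (bergman_kernel D z z)"

definition bergman_volume :: "(complex^'n) set \<Rightarrow> (complex^'n) measure" where
  "bergman_volume D = density (lebesgue_on D) (\<lambda>z. ennreal (bergman_diag D z))"

text \<open>The constant is chosen so that the weighted measure has total mass one.\<close>

definition normalizing_const :: "(complex^'n) set \<Rightarrow> real \<Rightarrow> real" where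
  "normalizing_const D h = 1 / (LINT z|bergman_volume D. bergman_diag D z powr (- 1 / h))"

definition weighted_volume :: "(complex^'n) set \<Rightarrow> real \<Rightarrow> (complex^'n) measure" where
  "weighted_volume D h =
     density (bergman_volume D)
       (\<lambda>z. ennreal (normalizing_const D h * bergman_diag D z powr (- 1 / h)))"

definition weighted_bergman_space ::
    "(complex^'n) set \<Rightarrow> real \<Rightarrow> (complex^'n \<Rightarrow> complex) set" where
  "weighted_bergman_space D h = holomorphic_l2 D (weighted_volume D h)"


section \<open>Toeplitz operators\<close>

definition bergman_projection ::
    "(complex^'n) set \<Rightarrow> real \<Rightarrow> (complex^'n \<Rightarrow> complex) \<Rightarrow> (complex^'n \<Rightarrow> complex)" where
  "bergman_projection D h f =
     (THE g. g \<in> weighted_bergman_space D h \<and>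
             (\<forall>\<psi>\<in>weighted_bergman_space D h.
                l2_inner (weighted_volume D h) (\<lambda>z. f z - g z) \<psi> = 0))"

definition toeplitz_operator ::
    "(complex^'n) set \<Rightarrow> real \<Rightarrow> (complex^'n \<Rightarrow> complex) \<Rightarrow>
     (complex^'n \<Rightarrow> complex) \<Rightarrow> (complex^'n \<Rightarrow> complex)" where
  "toeplitz_operator D h a \<phi> = bergman_projection D h (\<lambda>z. a z * \<phi> z)"

text \<open>
  Operators on the weighted Bergman space are total functions of which only the values on that
  space matter.
\<close>

inductive_set toeplitz_algebra ::
    "(complex^'n) set \<Rightarrow> real \<Rightarrow> (complex^'n \<Rightarrow> complex) set \<Rightarrow>
     ((complex^'n \<Rightarrow> complex) \<Rightarrow> (complex^'n \<Rightarrow> complex)) set"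
  for D h A where
  gen: "a \<in> A \<Longrightarrow> toeplitz_operator D h a \<in> toeplitz_algebra D h A"
| add: "X \<in> toeplitz_algebra D h A \<Longrightarrow> Y \<in> toeplitz_algebra D h A \<Longrightarrow>
        (\<lambda>\<phi> z. X \<phi> z + Y \<phi> z) \<in> toeplitz_algebra D h A"
| scale: "X \<in> toeplitz_algebra D h A \<Longrightarrow> (\<lambda>\<phi> z. c * X \<phi> z) \<in> toeplitz_algebra D h A"
| comp: "X \<in> toeplitz_algebra D h A \<Longrightarrow> Y \<in> toeplitz_algebra D h A \<Longrightarrow>
         X \<circ> Y \<in> toeplitz_algebra D h A"

definition commutative_on :: "'v set \<Rightarrow> ('v \<Rightarrow> 'v) set \<Rightarrow> bool" where
  "commutative_on H \<T> \<longleftrightarrow> (\<forall>X\<in>\<T>. \<forall>Y\<in>\<T>. \<forall>\<phi>\<in>H. X (Y \<phi>) = Y (X \<phi>))"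


section \<open>The Kaehler form of the Bergman metric\<close>

definition wirtinger :: "'n \<Rightarrow> (complex^'n \<Rightarrow> complex) \<Rightarrow> complex^'n \<Rightarrow> complex" where
  "wirtinger j f p =
     (frechet_derivative f (at p) (axis j 1) - \<i> * frechet_derivative f (at p) (axis j \<i>)) / 2"

definition wirtinger_bar :: "'n \<Rightarrow> (complex^'n \<Rightarrow> complex) \<Rightarrow> complex^'n \<Rightarrow> complex" where
  "wirtinger_bar j f p =
     (frechet_derivative f (at p) (axis j 1) + \<i> * frechet_derivative f (at p) (axis j \<i>)) / 2"

text \<open>
  The 2-form \<open>\<i> \<partial>\<partial>bar log K = \<i> \<Sum>\<^sub>j\<^sub>k (\<partial>\<^sub>j \<partial>bar\<^sub>k log K) dz\<^sub>j \<and> dzbar\<^sub>k\<close>, evaluated at the point \<open>p\<close> on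
  the tangent vectors \<open>u\<close> and \<open>v\<close>; the wedge product is
  \<open>(\<alpha> \<and> \<beta>)(u, v) = \<alpha> u * \<beta> v - \<alpha> v * \<beta> u\<close>. Its values are real.
\<close>

definition bergman_kaehler_form ::
    "(complex^'n) set \<Rightarrow> complex^'n \<Rightarrow> complex^'n \<Rightarrow> complex^'n \<Rightarrow> complex" where
  "bergman_kaehler_form D p u v =
     \<i> * (\<Sum>j\<in>UNIV. \<Sum>k\<in>UNIV.
            wirtinger j (wirtinger_bar k (\<lambda>z. complex_of_real (ln (bergman_diag D z)))) p *
            (u $ j * cnj (v $ k) - v $ j * cnj (u $ k)))"


section \<open>Foliations\<close>

text \<open>
  The codimension \<open>k\<close> of a foliation is \<open>DIM('b)\<close>, where \<open>'b\<close> is the common codomain of the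
  charts. A chart is a pair of a domain and a map; a foliation is given by its atlas.
\<close>

type_synonym ('a, 'b) fol_chart = "'a set \<times> ('a \<Rightarrow> 'b)"

definition foliated_chart ::
    "'a::euclidean_space set \<Rightarrow> ('a, 'b::euclidean_space) fol_chart \<Rightarrow> bool" where
  "foliated_chart M = (\<lambda>(U, \<phi>).
     open U \<and> U \<subseteq> M \<and> smooth_on U \<phi> \<and> open (\<phi> ` U) \<and>
     (\<forall>p\<in>U. surj (frechet_derivative \<phi> (at p))))"

definition diffeomorphism_between ::
    "'a::euclidean_space set \<Rightarrow> 'b::euclidean_space set \<Rightarrow> ('a \<Rightarrow> 'b) \<Rightarrow> bool" where
  "diffeomorphism_between V W \<xi> \<longleftrightarrow>
     bij_betw \<xi> V W \<and> smooth_on V \<xi> \<and> smooth_on W (inv_into V \<xi>)"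

definition compatible_charts ::
    "('a::euclidean_space, 'b::euclidean_space) fol_chart \<Rightarrow> ('a, 'b) fol_chart \<Rightarrow> bool" where
  "compatible_charts = (\<lambda>(U, \<phi>) (V, \<psi>).
     \<exists>\<xi>. diffeomorphism_between (\<phi> ` (U \<inter> V)) (\<psi> ` (U \<inter> V)) \<xi> \<and>
         (\<forall>x\<in>U \<inter> V. \<xi> (\<phi> x) = \<psi> x))"

definition foliated_atlas ::
    "'a::euclidean_space set \<Rightarrow> ('a, 'b::euclidean_space) fol_chart set \<Rightarrow> bool" where
  "foliated_atlas M \<F> \<longleftrightarrow>
     (\<forall>c\<in>\<F>. foliated_chart M c) \<and>
     (\<forall>c\<in>\<F>. \<forall>d\<in>\<F>. compatible_charts c d) \<and>
     (\<Union>(U, \<phi>)\<in>\<F>. U) = M"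

definition plaques :: "('a::euclidean_space, 'b::euclidean_space) fol_chart set \<Rightarrow> 'a set set" where
  "plaques \<F> = (\<Union>(U, \<phi>)\<in>\<F>. \<Union>y\<in>\<phi> ` U. components {x \<in> U. \<phi> x = y})"

definition same_leaf ::
    "('a::euclidean_space, 'b::euclidean_space) fol_chart set \<Rightarrow> 'a \<Rightarrow> 'a \<Rightarrow> bool" where
  "same_leaf \<F> x y \<longleftrightarrow>
     (\<exists>(l::nat) P. (\<forall>j\<le>l. P j \<in> plaques \<F>) \<and> x \<in> P 0 \<and> y \<in> P l \<and>
        (\<forall>j\<in>{1..l}. P (j - 1) \<inter> P j \<noteq> {}))"

definition leaves ::
    "'a::euclidean_space set \<Rightarrow> ('a, 'b::euclidean_space) fol_chart set \<Rightarrow> 'a set set" where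
  "leaves M \<F> = {{y. same_leaf \<F> x y} | x. x \<in> M}"

definition leafwise_constant_functions ::
    "'a::euclidean_space set \<Rightarrow> ('a, 'b::euclidean_space) fol_chart set \<Rightarrow> ('a \<Rightarrow> complex) set"
  where
  "leafwise_constant_functions M \<F> =
     {f \<in> smooth_functions M. \<forall>L\<in>leaves M \<F>. f constant_on L}"


section \<open>Lagrangian foliations\<close>

definition tangent_vectors :: "'a::euclidean_space set \<Rightarrow> 'a \<Rightarrow> 'a set" where
  "tangent_vectors P p =
     {v. \<exists>\<gamma> \<epsilon>. \<epsilon> > (0::real) \<and> smooth_on {-\<epsilon><..<\<epsilon>} \<gamma> \<and> \<gamma> ` {-\<epsilon><..<\<epsilon>} \<subseteq> P \<and>
               \<gamma> 0 = p \<and> (\<gamma> has_vector_derivative v) (at 0)}"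

definition lagrangian_subspace ::
    "('a::euclidean_space \<Rightarrow> 'a \<Rightarrow> complex) \<Rightarrow> 'a set \<Rightarrow> bool" where
  "lagrangian_subspace \<omega> V \<longleftrightarrow>
     subspace V \<and> 2 * dim V = DIM('a) \<and> (\<forall>u\<in>V. \<forall>v\<in>V. \<omega> u v = 0)"

text \<open>
  A leaf is an immersed submanifold in which the plaques it contains are open embedded
  submanifolds; its tangent space at \<open>p\<close> is therefore that of any of its plaques through \<open>p\<close>.
\<close>

definition lagrangian_foliation ::
    "'a::euclidean_space set \<Rightarrow> ('a \<Rightarrow> 'a \<Rightarrow> 'a \<Rightarrow> complex) \<Rightarrow>
     ('a, 'b::euclidean_space) fol_chart set \<Rightarrow> bool" where
  "lagrangian_foliation M \<omega> \<F> \<longleftrightarrow>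
     foliated_atlas M \<F> \<and>
     (\<forall>L\<in>leaves M \<F>. \<forall>P\<in>plaques \<F>. P \<subseteq> L \<longrightarrow>
        (\<forall>p\<in>P. lagrangian_subspace (\<omega> p) (tangent_vectors P p)))"

end

theory Submission
  imports Defs "HOL-Complex_Analysis.Complex_Analysis" "HOL-Real_Asymp.Real_Asymp" "HOL-Probability.Distributions"
begin

text \<open>
  The values \<open>h = 1 / N\<close> with integers \<open>N \<ge> 2\<close> carry the proof. For these the transitivity of the automorphism group
  forces the reproducing kernel of the weighted Bergman space to be a constant multiple of the power \<open>K z w ^ N\<close> of the
  Bergman kernel: the quotient of the two diagonals is invariant under automorphisms, and a sesquiholomorphic kernel is
  determined by its diagonal (\<open>W_ker_eq\<close>).

  Fix a point \<open>p\<close> and symbols \<open>a\<close>, \<open>b\<close>. The product of the Toeplitz operators of \<open>a\<close> and \<open>b\<close>, applied to the kernel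
  function of \<open>p\<close> and evaluated at \<open>p\<close>, is then a double integral of \<open>a z\<close> and \<open>b u\<close> against the \<open>N\<close>-th power of
  the normalised cyclic product \<open>\<Phi> p u z\<close> of the kernel values at \<open>z\<close>, \<open>u\<close> and \<open>p\<close>. Testing the extremal property of the
  kernel with coordinate functions shows that \<open>\<Phi>\<close> stays away from absolute value \<open>1\<close> except near \<open>u = z = p\<close>
  (\<open>beta_bound\<close>), so for large \<open>N\<close> only that region counts, at the scale \<open>1 / sqrt N\<close>. There \<open>\<Phi> ^ N\<close> tends to
  \<open>exp (H y x - H x x - H y y)\<close>, with \<open>H\<close> the hermitian form of the Bergman metric (\<open>Phi_limit\<close>). If \<open>a\<close> and \<open>b\<close>
  vanish at \<open>p\<close>, which subtracting constants achieves without changing the commutator, the leading coefficient of the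
  double integral is a Gaussian integral of the two differentials (\<open>II_limit\<close>). For real symbols with gradients \<open>s\<close>
  and \<open>t\<close>, meaning that \<open>2 Re (H v s)\<close> and \<open>2 Re (H v t)\<close> are the differentials, it is a positive multiple of
  \<open>H s t\<close> (\<open>gaussian_pairing\<close>). If the operators commute, then \<open>H s t = H t s\<close>, that is, \<open>Im (H s t) = 0\<close>. Since the
  Kaehler form is \<open>- 2 Im H\<close> (\<open>kaehler_form_eq\<close>), the real elements of the algebra of symbols Poisson-commute
  (\<open>gradients_commute\<close>).

  The rest is classical. Multiplying \<open>n\<close> independent gradients by \<open>\<i>\<close> gives a basis of the joint kernel of the
  differentials, which is therefore Lagrangian, and every other differential vanishes on it (\<open>isotropic_kernel\<close>). Hence
  \<open>n\<close> real symbols with independent differentials form a submersion with Lagrangian fibres. On a domain where it is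
  straightened to a linear map on a convex set, its fibres are connected (\<open>flow_box\<close>), so all symbols are constant on them.
  On overlaps the symbols that make up one such chart are thus functions of those that make up the other, and all
  these charts together are the atlas of the foliation (\<open>foliation_by_common_level_sets\<close>).
\<close>

section \<open>Volume and complex linear maps\<close>

text \<open>
  The type \<open>'n bit0\<close> has twice as many elements as \<open>'n\<close>, so an enumeration of the real basis identifies
  \<open>complex^'n\<close> with \<open>real^('n bit0)\<close>, where determinants and the change of variables formula are stated.
\<close>

definition real_index :: "'n::finite bit0 \<Rightarrow> complex^'n" where
  "real_index = (SOME \<sigma>. bij_betw \<sigma> UNIV Basis)"

lemma real_index_bij: "bij_betw (real_index :: 'n::finite bit0 \<Rightarrow> complex^'n) UNIV Basis"
proof -
  have "\<exists>\<sigma> :: 'n bit0 \<Rightarrow> complex^'n. bij_betw \<sigma> UNIV Basis"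
   by (rule finite_same_card_bij) (auto simp: mult.commute)
  thus ?thesis
   unfolding real_index_def by (rule someI_ex)
qed

lemma real_index_in_Basis [simp]: "real_index i \<in> Basis"
  using real_index_bij by (auto simp: bij_betw_def)

definition from_real :: "real^('n bit0) \<Rightarrow> complex^'n" where
  "from_real x = (\<Sum>i\<in>UNIV. x $ i *\<^sub>R real_index i)"

definition to_real :: "complex^'n \<Rightarrow> real^('n bit0)" where
  "to_real z = (\<chi> i. z \<bullet> real_index i)"

lemma real_index_inner:
  "real_index i \<bullet> (real_index j :: complex^'n) = (if i = j then 1 else 0)"
proof -
  have "real_index i \<in> (Basis :: (complex^'n) set)" "real_index j \<in> (Basis :: (complex^'n) set)"
   using real_index_bij by (auto simp: bij_betw_def)
  moreover have "inj (real_index :: 'n bit0 \<Rightarrow> complex^'n)"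
   using real_index_bij by (auto simp: bij_betw_def)
  ultimately show ?thesis
   by (auto simp: inner_Basis inj_eq)
qed

lemma linear_from_real: "linear from_real"
  by (rule linearI) (auto simp: from_real_def algebra_simps sum.distrib scaleR_sum_right)

lemma linear_to_real: "linear to_real"
  by (rule linearI) (auto simp: to_real_def vec_eq_iff algebra_simps)

lemma to_from_real [simp]: "to_real (from_real x) = x"
  by (simp add: to_real_def from_real_def vec_eq_iff inner_sum_left real_index_inner
    if_distrib[of "\<lambda>t. _ * t"] cong: if_cong)

lemma from_to_real [simp]: "from_real (to_real z) = z"
proof -
  have "from_real (to_real z) = (\<Sum>b\<in>Basis. (z \<bullet> b) *\<^sub>R b)"
   unfolding from_real_def to_real_def
   using sum.reindex_bij_betw[OF real_index_bij, of "\<lambda>b. (z \<bullet> b) *\<^sub>R b"] by simp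
  thus ?thesis by (simp add: euclidean_representation)
qed

lemma inner_to_real [simp]: "to_real z \<bullet> to_real w = z \<bullet> w"
proof -
  have "to_real z \<bullet> to_real w = (\<Sum>b\<in>Basis. (z \<bullet> b) * (w \<bullet> b))"
   unfolding to_real_def
   using sum.reindex_bij_betw[OF real_index_bij, of "\<lambda>b. (z \<bullet> b) * (w \<bullet> b)"]
   by (simp add: inner_vec_def)
  thus ?thesis by (simp add: euclidean_inner[of z w])
qed

lemma norm_to_real [simp]: "norm (to_real z) = norm z"
  by (simp add: norm_eq_sqrt_inner)

lemma norm_from_real [simp]: "norm (from_real x) = norm x"
  by (metis norm_to_real to_from_real)

lemma continuous_from_real: "continuous_on S from_real"
  and continuous_to_real: "continuous_on T to_real"
  using linear_continuous_on linear_from_real linear_to_real linear_linear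
  by (blast intro: linear_continuous_on)+

lemma measurable_from_real [measurable]: "from_real \<in> borel_measurable borel"
  and measurable_to_real [measurable]: "to_real \<in> borel_measurable borel"
  using continuous_from_real continuous_to_real borel_measurable_continuous_onI by blast+

lemma distr_from_real: "distr lborel borel from_real = (lborel :: (complex^'n) measure)"
proof (rule lborel_eqI [symmetric])
  fix l u :: "complex^'n"
  assume le: "\<And>b. b \<in> Basis \<Longrightarrow> l \<bullet> b \<le> u \<bullet> b"
  have eq: "from_real -` box l u = box (to_real l) (to_real u)"
  proof -
   have "from_real x \<in> box l u \<longleftrightarrow> x \<in> box (to_real l) (to_real u)" for x
   proof -
    have "from_real x \<in> box l u \<longleftrightarrow>
      (\<forall>i. l \<bullet> real_index i < from_real x \<bullet> real_index i \<and>
         from_real x \<bullet> real_index i < u \<bullet> real_index i)"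
     using real_index_bij[where 'n='n]
     unfolding mem_box bij_betw_def by (metis UNIV_I imageE image_eqI)
    also have "\<dots> \<longleftrightarrow> (\<forall>i. to_real l $ i < x $ i \<and> x $ i < to_real u $ i)"
     by (metis (no_types, lifting) to_from_real to_real_def vec_lambda_beta)
    finally show ?thesis by (simp add: mem_box_cart)
   qed
   thus ?thesis by auto
  qed
  have "emeasure (distr lborel borel from_real) (box l u) = emeasure lborel (box (to_real l) (to_real u))"
   by (subst emeasure_distr) (auto simp: eq)
  also have "\<dots> = (\<Prod>b\<in>Basis. (to_real u - to_real l) \<bullet> b)"
  proof (rule emeasure_lborel_box)
   fix b :: "real^('n bit0)" assume "b \<in> Basis"
   then obtain i where "b = axis i 1" by (auto simp: Basis_vec_def)
   thus "to_real l \<bullet> b \<le> to_real u \<bullet> b" using le by (simp add: inner_axis to_real_def)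
  qed
  also have "(\<Prod>b\<in>Basis. (to_real u - to_real l) \<bullet> b) = (\<Prod>i\<in>UNIV. (u - l) \<bullet> real_index i)"
  proof -
   have B: "(Basis :: (real^('n bit0)) set) = (\<lambda>i. axis i 1) ` UNIV"
    by (auto simp: Basis_vec_def)
   have "inj (\<lambda>i. axis i 1 :: real^('n bit0))"
    by (auto simp: inj_def axis_eq_axis)
   thus ?thesis
    unfolding B by (subst prod.reindex) (auto simp: inner_axis to_real_def inner_diff_left)
  qed
  also have "\<dots> = (\<Prod>b\<in>Basis. (u - l) \<bullet> b)"
   by (rule prod.reindex_bij_betw[OF real_index_bij])
  finally show "emeasure (distr lborel borel from_real) (box l u) = (\<Prod>b\<in>Basis. (u - l) \<bullet> b)" .
qed simp

text \<open>The factor by which \<open>T\<close> scales volume.\<close>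

definition real_det :: "(complex^'n \<Rightarrow> complex^'n) \<Rightarrow> real" where
  "real_det T = \<bar>det (matrix (to_real \<circ> T \<circ> from_real))\<bar>"

lemma linear_transport: "linear T \<Longrightarrow> linear (to_real \<circ> T \<circ> from_real)"
  by (intro linear_compose linear_from_real linear_to_real)

lemma real_det_compose:
  assumes "linear S" "linear T"
  shows "real_det (S \<circ> T) = real_det S * real_det T"
proof -
  have "to_real \<circ> (S \<circ> T) \<circ> from_real = (to_real \<circ> S \<circ> from_real) \<circ> (to_real \<circ> T \<circ> from_real)"
   by (auto simp: fun_eq_iff)
  thus ?thesis
   unfolding real_det_def
   using matrix_compose[OF linear_transport[OF assms(2)] linear_transport[OF assms(1)]]
   by (simp add: det_mul abs_mult)
qed

lemma real_det_isometry:
  assumes "linear T" "\<And>z. norm (T z) = norm z"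
  shows "real_det T = 1"
proof -
  have "orthogonal_transformation (to_real \<circ> T \<circ> from_real)"
   unfolding orthogonal_transformation using assms by (auto intro!: linear_transport)
  hence "orthogonal_matrix (matrix (to_real \<circ> T \<circ> from_real))"
   by (simp add: orthogonal_transformation_matrix)
  thus ?thesis
   unfolding real_det_def using det_orthogonal_matrix by fastforce
qed

lemma real_det_scaleR: "real_det (\<lambda>z :: complex^'n. r *\<^sub>R z) = \<bar>r\<bar> ^ (2 * CARD('n))"
proof -
  have "to_real \<circ> (\<lambda>z. r *\<^sub>R z) \<circ> (from_real :: _ \<Rightarrow> complex^'n) = (\<lambda>x. r *\<^sub>R x)"
   by (auto simp: fun_eq_iff linear_cmul[OF linear_to_real])
  thus ?thesis
   unfolding real_det_def by (simp add: det_matrix_scaleR power_abs)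
qed

lemma real_det_eq_0_iff:
  assumes "linear T"
  shows "real_det T = 0 \<longleftrightarrow> \<not> inj T"
proof -
  have "real_det T = 0 \<longleftrightarrow> \<not> inj (to_real \<circ> T \<circ> from_real)"
   unfolding real_det_def using det_nz_iff_inj[OF linear_transport[OF assms]] by auto
  also have "inj (to_real \<circ> T \<circ> from_real) \<longleftrightarrow> inj T"
  proof
   assume *: "inj (to_real \<circ> T \<circ> from_real)"
   show "inj T"
   proof (rule injI)
    fix x y assume "T x = T y"
    hence "to_real x = to_real y"
     using * by (metis (no_types, lifting) comp_apply from_to_real injD)
    thus "x = y" by (metis from_to_real)
   qed
  next
   assume *: "inj T"
   show "inj (to_real \<circ> T \<circ> from_real)"
    by (rule injI) (metis * comp_apply from_to_real injD to_from_real)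
  qed
  finally show ?thesis .
qed

lemma linear_matrix_vector: "linear (\<lambda>z. A *v z :: complex^'n)" for A :: "complex^'n^'n"
  by (rule linearI)
   (auto simp: matrix_vector_mult_def vec_eq_iff scaleR_sum_right sum.distrib algebra_simps)

definition col_matrix :: "'n \<Rightarrow> complex^'n \<Rightarrow> complex^'n^'n" where
  "col_matrix k v = (\<chi> i j. if j = k then v $ i else mat 1 $ i $ j)"

lemma det_col_matrix: "det (col_matrix k v) = v $ k"
proof -
  have "mat 1 *v v = v" by (rule matrix_vector_mul_lid)
  thus ?thesis using cramer_lemma[of k "mat 1" v] by (simp only: col_matrix_def det_I mult_1_right)
qed

lemma col_matrix_apply: "col_matrix k v *v z = z + z $ k *s (v - axis k 1)"
proof -
  have "(\<Sum>j\<in>UNIV. (if j = k then v $ i else mat 1 $ i $ j) * z $ j) = z $ i + z $ k * (v $ i - axis k 1 $ i)"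
   for i
  proof -
   have "(\<Sum>j\<in>UNIV. (if j = k then v $ i else mat 1 $ i $ j) * z $ j) =
     v $ i * z $ k + (\<Sum>j\<in>UNIV - {k}. mat 1 $ i $ j * z $ j)"
    by (subst sum.remove[of _ k]) auto
   also have "(\<Sum>j\<in>UNIV - {k}. mat 1 $ i $ j * z $ j) = (\<Sum>j\<in>UNIV. mat 1 $ i $ j * z $ j) - mat 1 $ i $ k * z $ k"
    by (subst sum.remove[of UNIV k]) auto
   also have "(\<Sum>j\<in>UNIV. mat 1 $ i $ j * z $ j) = z $ i"
    by (simp add: mat_def if_distrib[of "\<lambda>t. t * _"] cong: if_cong)
   finally show ?thesis
    by (auto simp: mat_def axis_def algebra_simps)
  qed
  thus ?thesis
   by (simp add: col_matrix_def matrix_vector_mult_def vec_eq_iff right_diff_distrib)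
qed

definition coord_scale :: "'n set \<Rightarrow> complex \<Rightarrow> complex^'n \<Rightarrow> complex^'n" where
  "coord_scale K c z = (\<chi> i. if i \<in> K then c * z $ i else z $ i)"

lemma linear_coord_scale: "linear (coord_scale K c)"
  by (rule linearI) (auto simp: coord_scale_def vec_eq_iff algebra_simps)

lemma coord_scale_compose:
  "coord_scale K c \<circ> coord_scale K d = coord_scale K (c * d)"
  "disjnt K L \<Longrightarrow> coord_scale K c \<circ> coord_scale L c = coord_scale (K \<union> L) c"
  by (auto simp: coord_scale_def vec_eq_iff fun_eq_iff disjnt_def)

lemma norm_vec_eqI: "(\<And>i. norm (z $ i) = norm (w $ i)) \<Longrightarrow> norm z = norm w"
  by (simp add: norm_vec_def)

definition coord_swap :: "'n \<Rightarrow> 'n \<Rightarrow> complex^'n \<Rightarrow> complex^'n" where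
  "coord_swap i k z = (\<chi> j. z $ Transposition.transpose i k j)"

lemma linear_coord_swap: "linear (coord_swap i k)"
  by (rule linearI) (auto simp: coord_swap_def vec_eq_iff algebra_simps)

lemma norm_coord_swap: "norm (coord_swap i k z) = norm z"
proof -
  have "(\<Sum>j\<in>UNIV. (norm (z $ Transposition.transpose i k j))\<^sup>2) = (\<Sum>j\<in>UNIV. (norm (z $ j))\<^sup>2)"
   by (rule sum.reindex_bij_betw[of "Transposition.transpose i k" UNIV UNIV "\<lambda>j. (norm (z $ j))\<^sup>2"])
    (simp add: bij_betw_def)
  thus ?thesis by (simp add: coord_swap_def norm_vec_def L2_set_def)
qed

lemma real_det_coord_swap [simp]: "real_det (coord_swap i k) = 1"
  by (rule real_det_isometry) (simp_all add: linear_coord_swap norm_coord_swap)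

text \<open>
  For \<open>c \<ge> 0\<close> the volume factor does not depend on the coordinate, by conjugation with a swap, and scaling all
  coordinates is a homothety, whose factor is known. The phase of \<open>c\<close> acts as an isometry.
\<close>

lemma real_det_coord_scale:
  fixes k :: "'a::finite"
  shows "real_det (coord_scale {k} c) = (cmod c)\<^sup>2"
proof -
  define r where "r = complex_of_real (cmod c)"
  define \<rho> where "\<rho> = real_det (coord_scale {k} r)"
  have eq: "real_det (coord_scale {l} r) = \<rho>" for l :: 'a
  proof -
   have "coord_scale {l} r = coord_swap k l \<circ> coord_scale {k} r \<circ> coord_swap k l"
   proof (intro ext, unfold vec_eq_iff, intro allI)
    fix z :: "complex^'a" and i :: 'a
    show "coord_scale {l} r z $ i = (coord_swap k l \<circ> coord_scale {k} r \<circ> coord_swap k l) z $ i"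
     by (cases "i = k"; cases "i = l"; cases "k = l")
      (simp_all add: coord_scale_def coord_swap_def Transposition.transpose_def)
   qed
   thus ?thesis
    by (simp add: real_det_compose linear_coord_swap linear_coord_scale linear_compose \<rho>_def)
  qed
  have "real_det (coord_scale K r) = \<rho> ^ card K" for K :: "'a set"
  proof (induction K rule: finite_induct[OF finite])
   case 1
   have "coord_scale {} r = (\<lambda>z::complex^'a. 1 *\<^sub>R z)"
    by (auto simp: coord_scale_def vec_eq_iff fun_eq_iff)
   thus ?case using real_det_scaleR[of 1, where 'n='a] by simp
  next
   case (2 l K)
   have "coord_scale (insert l K) r = coord_scale {l} r \<circ> coord_scale K r"
    using 2 by (subst coord_scale_compose(2)) auto
   hence "real_det (coord_scale (insert l K) r) = real_det (coord_scale {l} r) * real_det (coord_scale K r)"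
    by (metis linear_coord_scale real_det_compose)
   thus ?case using 2 by (simp add: eq)
  qed
  from this[of UNIV] have "\<rho> ^ CARD('a) = real_det (coord_scale (UNIV :: 'a set) r)" by simp
  also have "coord_scale UNIV r = (\<lambda>z::complex^'a. cmod c *\<^sub>R z)"
   unfolding r_def by (simp add: coord_scale_def vec_eq_iff fun_eq_iff scaleR_conv_of_real[where 'a=complex])
  also have "real_det \<dots> = ((cmod c)\<^sup>2) ^ CARD('a)"
   by (simp add: real_det_scaleR power_mult)
  finally have \<rho>: "\<rho> = (cmod c)\<^sup>2"
   by (rule power_eq_imp_eq_base) (auto simp: \<rho>_def real_det_def)
  define s where "s = (if c = 0 then 1 else sgn c)"
  have "c = s * r" "cmod s = 1"
   by (auto simp: s_def r_def sgn_eq norm_divide)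
  hence "coord_scale {k} c = coord_scale {k} s \<circ> coord_scale {k} r"
   by (simp add: coord_scale_compose)
  moreover have "real_det (coord_scale {k} s) = 1"
   by (rule real_det_isometry)
    (auto simp: linear_coord_scale coord_scale_def \<open>cmod s = 1\<close> norm_mult intro!: norm_vec_eqI)
  ultimately show ?thesis
   using \<rho> by (simp add: real_det_compose linear_coord_scale \<rho>_def)
qed

text \<open>
  The shears form a one-parameter group \<open>S t\<close>, and conjugation by a dilation turns \<open>S 1\<close> into \<open>S 2 = S 1 \<circ> S 1\<close>;
  hence the volume factor \<open>d\<close> of \<open>S 1\<close> satisfies \<open>d = d * d\<close>.
\<close>

lemma real_det_shear:
  fixes w :: "complex^'n"
  assumes "w $ k = 0"
  shows "real_det (\<lambda>z. z + z $ k *s w) = 1"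
proof -
  define S where "S = (\<lambda>t z. z + (t * z $ k) *s w)"
  have lin: "linear (S t)" for t
   by (rule linearI) (auto simp: S_def vec_eq_iff algebra_simps)
  have comp: "S t \<circ> S u = S (t + u)" for t u
   using assms by (auto simp: S_def vec_eq_iff fun_eq_iff algebra_simps)
  define C where "C = coord_scale (- {k}) (2::complex)"
  have linC: "linear C" by (simp add: C_def linear_coord_scale)
  have "C \<circ> S 1 = S 2 \<circ> C"
   using assms by (auto simp: C_def S_def coord_scale_def vec_eq_iff fun_eq_iff algebra_simps)
  hence "real_det C * real_det (S 1) = real_det (S 2) * real_det C"
   by (metis linC lin real_det_compose)
  moreover have "inj C"
   by (rule injI) (auto simp: C_def coord_scale_def vec_eq_iff split: if_splits)
  ultimately have 1: "real_det (S 1) = real_det (S 2)"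
   using real_det_eq_0_iff[OF linC] by auto
  have 2: "real_det (S 2) = real_det (S 1) * real_det (S 1)"
   using comp[of 1 1] real_det_compose[OF lin lin, of 1 1] by simp
  have "S 0 = id" by (auto simp: S_def fun_eq_iff)
  hence "S (-1) \<circ> S 1 = id" using comp[of "-1" 1] by simp
  hence "inj (S 1)" by (metis inj_on_id inj_on_imageI2)
  hence "real_det (S 1) \<noteq> 0" using real_det_eq_0_iff[OF lin] by blast
  with 1 2 have "real_det (S 1) = 1" by auto
  thus ?thesis by (simp add: S_def)
qed

lemma real_det_col_matrix: "real_det (\<lambda>z. col_matrix k v *v z) = (cmod (v $ k))\<^sup>2"
proof -
  define w where "w = v - v $ k *s axis k 1"
  have w: "w $ k = 0" by (simp add: w_def)
  have "(\<lambda>z. col_matrix k v *v z) = coord_scale {k} (v $ k) \<circ> (\<lambda>z. z + z $ k *s w)"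
   by (auto simp: col_matrix_apply coord_scale_def w_def vec_eq_iff fun_eq_iff axis_def algebra_simps)
  moreover have "linear (\<lambda>z. z + z $ k *s w)"
   by (rule linearI) (auto simp: vec_eq_iff algebra_simps)
  ultimately have "real_det (\<lambda>z. col_matrix k v *v z) =
    real_det (coord_scale {k} (v $ k)) * real_det (\<lambda>z. z + z $ k *s w)"
   using real_det_compose[OF linear_coord_scale] by metis
  thus ?thesis
   by (simp add: real_det_coord_scale real_det_shear[OF w])
qed

lemma matrix_vector_axis: "A *v axis j 1 = (column j A :: complex^'n)" for A :: "complex^'n^'n"
  by (simp add: matrix_vector_mult_def column_def vec_eq_iff axis_def if_distrib[of "\<lambda>t. _ * t"] cong: if_cong)

text \<open>
  Induction on the set of coordinate vectors that \<open>A\<close> moves. Composing with a coordinate swap and a matrix that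
  differs from the identity in one column makes \<open>A\<close> fix one more of them; where no pivot exists, \<open>A\<close> is singular and
  both sides vanish.
\<close>

lemma real_det_complex_linear:
  fixes A :: "complex^'n^'n"
  shows "real_det (\<lambda>z. A *v z) = (cmod (det A))\<^sup>2"
proof -
  have "\<forall>A :: complex^'n^'n. (\<forall>j. j \<notin> K \<longrightarrow> A *v axis j 1 = axis j 1) \<longrightarrow>
    real_det (\<lambda>z. A *v z) = (cmod (det A))\<^sup>2" for K :: "'n set"
  proof (induction K rule: finite_induct[OF finite])
   case 1
   show ?case
   proof safe
    fix A :: "complex^'n^'n" assume *: "\<forall>j. j \<notin> {} \<longrightarrow> A *v axis j 1 = axis j 1"
    have "A $ i $ j = mat 1 $ i $ j" for i j
    proof -
     have "column j A = axis j 1"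
      using *[rule_format, of j] by (simp add: matrix_vector_axis)
     hence "A $ i $ j = axis j 1 $ i" by (simp add: column_def vec_eq_iff)
     thus ?thesis by (simp add: mat_def axis_def)
    qed
    hence A: "A = mat 1" by (auto simp: vec_eq_iff)
    show "real_det (\<lambda>z. A *v z) = (cmod (det A))\<^sup>2"
     unfolding A using real_det_isometry[of "\<lambda>z::complex^'n. z"] by (simp add: linear_id[unfolded id_def])
   qed
  next
   case (2 k K)
   show ?case
   proof safe
    fix A :: "complex^'n^'n" assume *: "\<forall>j. j \<notin> insert k K \<longrightarrow> A *v axis j 1 = axis j 1"
    define v where "v = A *v axis k 1"
    show "real_det (\<lambda>z. A *v z) = (cmod (det A))\<^sup>2"
    proof (cases "\<exists>i\<in>insert k K. v $ i \<noteq> 0")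
     case True
     then obtain i where i: "i \<in> insert k K" "v $ i \<noteq> 0" by blast
     define P :: "complex^'n^'n" where "P = (\<chi> a b. if Transposition.transpose i k a = b then 1 else 0)"
     have P: "P *v z = coord_swap i k z" for z
      by (simp add: P_def coord_swap_def matrix_vector_mult_def if_distrib[of "\<lambda>t. t * _"] cong: if_cong)
     have "P ** P = mat 1"
      by (rule matrix_eq[THEN iffD2])
       (auto simp: matrix_vector_mul_assoc[symmetric] P coord_swap_def vec_eq_iff)
     hence "det P * det P = 1" by (metis det_I det_mul)
     hence detP: "cmod (det P) = 1"
      by (metis norm_mult norm_one norm_ge_zero mult_cancel_right1 power2_eq_square power2_eq_1_iff
        abs_of_nonneg abs_1 abs_minus_cancel)
     define v' where "v' = coord_swap i k v"
     have v'k: "v' $ k \<noteq> 0" using i by (simp add: v'_def coord_swap_def)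
     define b where "b = (1 / v' $ k) *s (axis k 1 - (v' - v' $ k *s axis k 1))"
     define A' where "A' = col_matrix k b ** (P ** A)"
     have A'v: "A' *v z = col_matrix k b *v (coord_swap i k (A *v z))" for z
      by (simp add: A'_def P matrix_vector_mul_assoc[symmetric])
     have "A' *v axis j 1 = axis j 1" if "j \<notin> K" for j
     proof (cases "j = k")
      case True
      have "A' *v axis k 1 = v' + v' $ k *s (b - axis k 1)"
       by (simp add: A'v v_def[symmetric] v'_def[symmetric] col_matrix_apply)
      also have "\<dots> = axis k 1"
       using v'k by (simp add: b_def vec_eq_iff algebra_simps)
      finally show ?thesis using True by simp
     next
      case False
      hence j: "j \<notin> insert k K" using that by auto
      have "coord_swap i k (axis j 1) = axis j 1"
      proof -
       have "Transposition.transpose i k a = j \<longleftrightarrow> a = j" for a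
        using j i(1) by (auto simp: Transposition.transpose_def)
       thus ?thesis by (auto simp: coord_swap_def vec_eq_iff axis_def)
      qed
      moreover have "axis j (1::complex) $ k = 0" using False by (simp add: axis_def)
      moreover have "A *v axis j 1 = axis j 1" using j * by blast
      ultimately show ?thesis
       by (simp add: A'v col_matrix_apply)
     qed
     hence "real_det (\<lambda>z. A' *v z) = (cmod (det A'))\<^sup>2" using 2 by blast
     moreover have "(\<lambda>z. A' *v z) = (\<lambda>z. col_matrix k b *v z) \<circ> (coord_swap i k \<circ> (\<lambda>z. A *v z))"
      by (auto simp: fun_eq_iff A'v)
     hence "real_det (\<lambda>z. A' *v z) = (cmod (b $ k))\<^sup>2 * real_det (\<lambda>z. A *v z)"
      by (metis real_det_compose linear_matrix_vector linear_coord_swap linear_compose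
        real_det_col_matrix real_det_coord_swap mult_1)
     moreover have "det A' = b $ k * (det P * det A)"
      by (simp add: A'_def det_mul det_col_matrix)
     moreover have "b $ k \<noteq> 0" using v'k by (simp add: b_def)
     ultimately show ?thesis
      by (simp add: norm_mult power_mult_distrib detP)
    next
     case False
     define z where "z = axis k 1 - (\<Sum>j\<in>-insert k K. v $ j *s axis j 1)"
     have "A *v z = v - (\<Sum>j\<in>-insert k K. v $ j *s (A *v axis j 1))"
      by (simp add: z_def linear_diff[OF linear_matrix_vector] linear_sum[OF linear_matrix_vector]
        v_def vector_scalar_commute)
     also have "\<dots> = v - (\<Sum>j\<in>-insert k K. v $ j *s axis j 1)"
      using * by (intro arg_cong2[where f="(-)"] refl sum.cong) auto
     also have "\<dots> = 0"
     proof -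
      have "(\<Sum>j\<in>-insert k K. v $ j *s axis j 1) $ i = v $ i" for i
       using False by (auto simp: axis_def sum.If_cases if_distrib[of "\<lambda>t. _ * t"] cong: if_cong)
      thus ?thesis by (simp add: vec_eq_iff)
     qed
     finally have Az: "A *v z = 0" .
     have "z $ k = 1"
      by (auto simp: z_def axis_def intro!: sum.neutral split: if_splits)
     hence "z \<noteq> 0" by auto
     have "\<not> inj (\<lambda>z. A *v z)"
      using Az \<open>z \<noteq> 0\<close> by (metis injD matrix_vector_mult_0_right)
     hence "real_det (\<lambda>z. A *v z) = 0"
      using real_det_eq_0_iff[OF linear_matrix_vector] by blast
     moreover have "det A = 0"
     proof (rule ccontr)
      assume "det A \<noteq> 0"
      hence "invertible A" by (simp add: invertible_det_nz)
      then obtain B where "B ** A = mat 1" by (auto simp: invertible_def)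
      hence "z = B *v (A *v z)" by (simp add: matrix_vector_mul_assoc)
      thus False using Az \<open>z \<noteq> 0\<close> by simp
     qed
     ultimately show ?thesis by simp
    qed
   qed
  qed
  from this[of UNIV] show ?thesis by blast
qed

lemma lborel_isometry:
  fixes T :: "complex^'n \<Rightarrow> complex^'n"
  assumes "linear T" "\<And>z. norm (T z) = norm z"
  shows "distr lborel borel T = lborel"
proof -
  define S where "S = to_real \<circ> T \<circ> from_real"
  have S: "orthogonal_transformation S"
   unfolding S_def orthogonal_transformation using assms by (auto intro!: linear_transport)
  have "distr lborel borel S = lborel"
  proof (rule lborel_eqI [symmetric])
   fix l u :: "real^('n bit0)"
   assume le: "\<And>b. b \<in> Basis \<Longrightarrow> l \<bullet> b \<le> u \<bullet> b"
   have bij: "bij S" by (rule orthogonal_transformation_bij[OF S])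
   have "orthogonal_transformation (inv S)" by (rule orthogonal_transformation_inv[OF S])
   have "emeasure (distr lborel borel S) (box l u) = emeasure lborel (S -` box l u)"
    using orthogonal_transformation_linear[OF S]
    by (subst emeasure_distr)
     (auto intro!: borel_measurable_continuous_onI linear_continuous_on simp: linear_linear)
   also have "S -` box l u = inv S ` box l u" using bij by (simp add: bij_vimage_eq_inv_image)
   also have "emeasure lborel (inv S ` box l u) = emeasure lebesgue (inv S ` box l u)"
   proof -
    have "S -` box l u \<inter> space borel \<in> sets borel"
     using orthogonal_transformation_linear[OF S]
     by (intro measurable_sets[of S borel borel])
      (auto intro!: borel_measurable_continuous_onI linear_continuous_on simp: linear_linear)
    thus ?thesis using bij by (simp add: bij_vimage_eq_inv_image)
   qed
   also have "\<dots> = ennreal (measure lebesgue (inv S ` box l u))"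
   proof -
    have "inv S ` box l u \<in> lmeasurable"
     by (rule measurable_orthogonal_image[OF \<open>orthogonal_transformation (inv S)\<close>]) auto
    thus ?thesis by (intro emeasure_eq_measure2) (auto simp: fmeasurable_def)
   qed
   also have "measure lebesgue (inv S ` box l u) = measure lebesgue (box l u)"
    by (rule measure_orthogonal_image[OF \<open>orthogonal_transformation (inv S)\<close>]) auto
   also have "\<dots> = (\<Prod>b\<in>Basis. (u - l) \<bullet> b)"
    using le by (simp add: measure_lborel_box)
   finally show "emeasure (distr lborel borel S) (box l u) = (\<Prod>b\<in>Basis. (u - l) \<bullet> b)" .
  qed simp
  have mT: "T \<in> borel_measurable borel" and mS: "S \<in> borel_measurable borel"
   using assms(1) orthogonal_transformation_linear[OF S]
   by (auto intro!: borel_measurable_continuous_onI linear_continuous_on simp: linear_linear)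
  have "distr lborel borel T = distr (distr lborel borel (from_real :: _ \<Rightarrow> complex^'n)) borel T"
   by (simp add: distr_from_real)
  also have "\<dots> = distr lborel borel (T \<circ> from_real)"
   using mT by (subst distr_distr) auto
  also have "T \<circ> from_real = from_real \<circ> S" by (auto simp: S_def fun_eq_iff)
  also have "distr lborel borel (from_real \<circ> S) = distr (distr lborel borel S) borel from_real"
   using mS by (subst distr_distr) auto
  also have "\<dots> = lborel" using \<open>distr lborel borel S = lborel\<close> by (simp add: distr_from_real)
  finally show ?thesis .
qed

lemma lborel_unimodular:
  assumes "cmod c = 1"
  shows "distr lborel borel (\<lambda>z::complex^'n. c *s z) = lborel"
  by (rule lborel_isometry)
   (auto intro!: linearI norm_vec_eqI simp: vec_eq_iff algebra_simps norm_mult assms)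

lemma set_integrable_lborel_iff_absolutely:
  fixes f :: "'a::euclidean_space \<Rightarrow> real"
  assumes "(\<lambda>z. indicator S z * f z) \<in> borel_measurable borel"
  shows "integrable lborel (\<lambda>z. indicator S z * f z) \<longleftrightarrow> f absolutely_integrable_on S"
   and "integrable lborel (\<lambda>z. indicator S z * f z) \<Longrightarrow>
    (LINT z|lborel. indicator S z * f z) = integral S f"
proof -
  show 1: "integrable lborel (\<lambda>z. indicator S z * f z) \<longleftrightarrow> f absolutely_integrable_on S"
   using assms by (simp add: set_integrable_def integrable_completion)
  assume "integrable lborel (\<lambda>z. indicator S z * f z)"
  with 1 have "f absolutely_integrable_on S" by simp
  hence "integral S f = (LINT z:S|lebesgue. f z)" by (simp add: set_lebesgue_integral_eq_integral)
  also have "\<dots> = (LINT z|lborel. indicator S z * f z)"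
   using assms by (simp add: set_lebesgue_integral_def integral_completion)
  finally show "(LINT z|lborel. indicator S z * f z) = integral S f" by simp
qed

lemma change_of_variables_complex:
  fixes F :: "complex^'n \<Rightarrow> complex^'n" and G :: "complex^'n \<Rightarrow> real"
  assumes D: "D \<in> sets borel"
   and der: "\<And>z. z \<in> D \<Longrightarrow> (F has_derivative F' z) (at z)"
   and inj: "inj_on F D"
   and D': "F ` D = D'"
   and mG: "(\<lambda>z. indicator D' z * G z) \<in> borel_measurable borel"
   and mj: "(\<lambda>z. indicator D z * (real_det (F' z) * G (F z))) \<in> borel_measurable borel"
   and int: "integrable lborel (\<lambda>z. indicator D' z * G z)"
  shows "integrable lborel (\<lambda>z. indicator D z * (real_det (F' z) * G (F z)))"
   and "(LINT z|lborel. indicator D z * (real_det (F' z) * G (F z))) = (LINT z|lborel. indicator D' z * G z)"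
proof -
  define g where "g = to_real \<circ> F \<circ> from_real"
  define E where "E = from_real -` D"
  have E: "E \<in> sets borel"
   using measurable_sets[OF measurable_from_real, of D] D by (simp add: E_def)
  have gE: "g ` E = from_real -` D'"
  proof -
   have "from_real -` D' \<subseteq> g ` E"
   proof
    fix x assume "x \<in> from_real -` D'"
    then obtain z where "z \<in> D" "from_real x = F z" using D' by auto
    hence "x = g (to_real z)" "to_real z \<in> E"
     by (auto simp: g_def E_def) (metis to_from_real)
    thus "x \<in> g ` E" by blast
   qed
   thus ?thesis using D' by (auto simp: g_def E_def)
  qed
  have derg: "(g has_derivative (to_real \<circ> F' (from_real x) \<circ> from_real)) (at x within E)" if "x \<in> E" for x
   unfolding g_def
   by (intro diff_chain_within linear_imp_has_derivative linear_from_real linear_to_real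
     has_derivative_at_withinI[OF der]) (use that in \<open>auto simp: E_def\<close>)
  have injg: "inj_on g E"
  proof (rule inj_onI)
   fix x y assume *: "x \<in> E" "y \<in> E" "g x = g y"
   hence "F (from_real x) = F (from_real y)"
    by (metis comp_apply from_to_real g_def)
   hence "from_real x = (from_real y :: complex^'n)" using inj * by (auto simp: inj_on_def E_def)
   thus "x = y" by (metis to_from_real)
  qed
  define f where "f x = (vec (G (from_real x)) :: real^1)" for x
  define j where "j x = \<bar>det (matrix (to_real \<circ> F' (from_real x) \<circ> from_real))\<bar>" for x
  have absvec: "(\<lambda>x. vec (h x) :: real^1) absolutely_integrable_on S \<longleftrightarrow> h absolutely_integrable_on S"
   and intvec: "h absolutely_integrable_on S \<Longrightarrow> integral S (\<lambda>x. vec (h x) :: real^1) = vec (integral S h)"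
   for h :: "real^('n bit0) \<Rightarrow> real" and S
  proof -
   have bl: "bounded_linear (\<lambda>x. vec x :: real^1)" "bounded_linear (\<lambda>v::real^1. v $ 1)"
    by (auto simp: linear_conv_bounded_linear[symmetric] vec_eq_iff intro!: linearI)
   show "(\<lambda>x. vec (h x) :: real^1) absolutely_integrable_on S \<longleftrightarrow> h absolutely_integrable_on S"
    using absolutely_integrable_linear[OF _ bl(1), where f=h]
     absolutely_integrable_linear[OF _ bl(2), where f="\<lambda>x. vec (h x)"]
    by (auto simp: o_def)
   assume "h absolutely_integrable_on S"
   hence "h integrable_on S" by (rule absolutely_integrable_on_def[THEN iffD1, THEN conjunct1])
   thus "integral S (\<lambda>x. vec (h x) :: real^1) = vec (integral S h)"
    using integral_linear[OF _ bl(1), of h S] by (simp add: o_def)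
  qed
  have transport: "integrable lborel h \<longleftrightarrow> integrable lborel (\<lambda>x. h (from_real x))"
   "(LINT z|lborel. h z) = (LINT x|lborel. h (from_real x))"
   if "h \<in> borel_measurable borel" for h :: "complex^'n \<Rightarrow> real"
  proof -
   have "integrable (distr lborel borel from_real) h \<longleftrightarrow> integrable lborel (\<lambda>x. h (from_real x))"
    using that by (intro integrable_distr_eq) auto
   thus "integrable lborel h \<longleftrightarrow> integrable lborel (\<lambda>x. h (from_real x))"
    by (simp add: distr_from_real)
   have "(LINT z|distr lborel borel from_real. h z) = (LINT x|lborel. h (from_real x))"
    using that by (intro integral_distr) auto
   thus "(LINT z|lborel. h z) = (LINT x|lborel. h (from_real x))" by (simp add: distr_from_real)
  qed
  have eqG: "indicator D' (from_real x) * G (from_real x) = indicator (g ` E) x * G (from_real x)" for x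
   unfolding gE by (simp add: indicator_def)
  have eqj: "indicator D (from_real x) * (real_det (F' (from_real x)) * G (F (from_real x))) =
     indicator E x * (j x * G (from_real (g x)))" for x
   by (simp add: E_def j_def g_def real_det_def indicator_def)
  have mG': "(\<lambda>x. indicator (g ` E) x * G (from_real x)) \<in> borel_measurable borel"
   and mj': "(\<lambda>x. indicator E x * (j x * G (from_real (g x)))) \<in> borel_measurable borel"
   using measurable_compose[OF measurable_from_real mG] measurable_compose[OF measurable_from_real mj]
   by (simp_all only: eqG eqj)
  have iG: "integrable lborel (\<lambda>x. indicator (g ` E) x * G (from_real x))"
   using int transport(1)[OF mG] by (simp add: eqG)
  hence absG: "(\<lambda>x. G (from_real x)) absolutely_integrable_on (g ` E)"
   using set_integrable_lborel_iff_absolutely(1)[OF mG'] by simp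
  have "f absolutely_integrable_on (g ` E)"
   unfolding f_def absvec by (rule absG)
  hence "(\<lambda>x. j x *\<^sub>R f (g x)) absolutely_integrable_on E \<and>
    integral E (\<lambda>x. j x *\<^sub>R f (g x)) = integral (g ` E) f"
   unfolding j_def
   using has_absolute_integral_change_of_variables[of E g, OF _ derg injg] E by auto
  moreover have "j x *\<^sub>R f (g x) = vec (j x * G (from_real (g x)))" for x
   by (simp add: f_def vec_eq_iff)
  ultimately have *: "(\<lambda>x. vec (j x * G (from_real (g x))) :: real^1) absolutely_integrable_on E"
   "integral E (\<lambda>x. vec (j x * G (from_real (g x)))) = integral (g ` E) f"
   by simp_all
  have absj: "(\<lambda>x. j x * G (from_real (g x))) absolutely_integrable_on E"
   using *(1) absvec by blast
  hence ij: "integrable lborel (\<lambda>x. indicator E x * (j x * G (from_real (g x))))"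
   using set_integrable_lborel_iff_absolutely(1)[OF mj'] by simp
  thus "integrable lborel (\<lambda>z. indicator D z * (real_det (F' z) * G (F z)))"
   using transport(1)[OF mj] by (simp add: eqj)
  have "integral E (\<lambda>x. j x * G (from_real (g x))) = integral (g ` E) (\<lambda>x. G (from_real x))"
   using *(2) intvec[OF absj] intvec[OF absG] by (simp add: f_def[abs_def] vec_eq_iff)
  thus "(LINT z|lborel. indicator D z * (real_det (F' z) * G (F z))) = (LINT z|lborel. indicator D' z * G z)"
   using transport(2)[OF mj] transport(2)[OF mG] set_integrable_lborel_iff_absolutely(2)[OF mj' ij]
    set_integrable_lborel_iff_absolutely(2)[OF mG' iG]
   by (simp add: eqG eqj)
qed

section \<open>Holomorphic functions of several variables\<close>

lemma norm_smult: "norm (c *s v) = cmod c * norm (v :: complex^'n)"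
  by (simp add: norm_vec_def norm_mult L2_set_def power_mult_distrib sum_distrib_left[symmetric] real_sqrt_mult)

lemma bounded_linear_smult_left: "bounded_linear (\<lambda>c. c *s (v :: complex^'n))"
  by (auto simp: linear_conv_bounded_linear[symmetric] vec_eq_iff algebra_simps intro!: linearI)

lemma bounded_linear_smult_right: "bounded_linear (\<lambda>v. c *s (v :: complex^'n))"
  by (auto simp: linear_conv_bounded_linear[symmetric] vec_eq_iff algebra_simps intro!: linearI)

lemma bounded_linear_vec_nth: "bounded_linear (\<lambda>v. (v :: complex^'n) $ i)"
  by (auto simp: linear_conv_bounded_linear[symmetric] intro!: linearI)

lemma scaleR_smult: "r *\<^sub>R (v :: complex^'n) = of_real r *s v"
  by (simp add: vec_eq_iff scaleR_conv_of_real[where 'a=complex])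

abbreviation (input) fd :: "('a::real_normed_vector \<Rightarrow> 'b::real_normed_vector) \<Rightarrow> 'a \<Rightarrow> 'a \<Rightarrow> 'b" where
  "fd f x \<equiv> frechet_derivative f (at x)"

lemma holomorphic_funD:
  assumes "holomorphic_fun U f" "z \<in> U"
  shows "(f has_derivative fd f z) (at z)"
   and "fd f z (c *s v) = c * fd f z v"
proof -
  obtain L where L: "(f has_derivative L) (at z)" "\<And>c v. L (c *s v) = c * L v"
   using assms by (auto simp: holomorphic_fun_def)
  moreover have "fd f z = L"
   using frechet_derivative_at[OF L(1)] by simp
  ultimately show "(f has_derivative fd f z) (at z)"
   "fd f z (c *s v) = c * fd f z v" by auto
qed

lemma holomorphic_funI:
  "(\<And>z. z \<in> U \<Longrightarrow> \<exists>L. (f has_derivative L) (at z) \<and> (\<forall>c v. L (c *s v) = c * L v)) \<Longrightarrow> holomorphic_fun U f"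
  by (auto simp: holomorphic_fun_def)

lemma holomorphic_fun_subset: "holomorphic_fun U f \<Longrightarrow> V \<subseteq> U \<Longrightarrow> holomorphic_fun V f"
  by (auto simp: holomorphic_fun_def)

lemma holomorphic_fun_local:
  assumes "\<And>z. z \<in> U \<Longrightarrow> \<exists>V. z \<in> V \<and> holomorphic_fun V f"
  shows "holomorphic_fun U f"
  using assms unfolding holomorphic_fun_def by blast

lemma holomorphic_fun_cong:
  assumes "open U" "\<And>z. z \<in> U \<Longrightarrow> f z = g z" "holomorphic_fun U f"
  shows "holomorphic_fun U g"
proof (rule holomorphic_funI)
  fix z assume z: "z \<in> U"
  obtain L where L: "(f has_derivative L) (at z)" "\<And>c v. L (c *s v) = c * L v"
   using assms(3) z by (auto simp: holomorphic_fun_def)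
  have "(g has_derivative L) (at z)"
   by (rule has_derivative_transform_within_open[OF L(1) assms(1) z assms(2)])
  thus "\<exists>L. (g has_derivative L) (at z) \<and> (\<forall>c v. L (c *s v) = c * L v)" using L(2) by blast
qed

lemma holomorphic_fun_continuous: "holomorphic_fun U f \<Longrightarrow> continuous_on U f"
  by (rule has_derivative_continuous_on, rule has_derivative_at_withinI, rule holomorphic_funD(1))

lemma holomorphic_fun_const: "holomorphic_fun U (\<lambda>_. c)"
  by (auto simp: holomorphic_fun_def intro!: exI[of _ "\<lambda>_. 0"])

lemma holomorphic_fun_nth: "holomorphic_fun U (\<lambda>z. z $ j)"
  by (intro holomorphic_funI exI[of _ "\<lambda>z. z $ j"])
   (auto intro: bounded_linear_imp_has_derivative bounded_linear_vec_nth)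

lemma holomorphic_fun_add:
  assumes "holomorphic_fun U f" "holomorphic_fun U g"
  shows "holomorphic_fun U (\<lambda>z. f z + g z)"
proof (rule holomorphic_funI)
  fix z assume z: "z \<in> U"
  show "\<exists>L. ((\<lambda>z. f z + g z) has_derivative L) (at z) \<and> (\<forall>c v. L (c *s v) = c * L v)"
   using holomorphic_funD[OF assms(1) z] holomorphic_funD[OF assms(2) z]
   by (intro exI[of _ "\<lambda>v. fd f z v + fd g z v"] conjI)
    (auto intro: has_derivative_add simp: algebra_simps)
qed

lemma holomorphic_fun_mult:
  assumes "holomorphic_fun U f" "holomorphic_fun U g"
  shows "holomorphic_fun U (\<lambda>z. f z * g z)"
proof (rule holomorphic_funI)
  fix z assume z: "z \<in> U"
  show "\<exists>L. ((\<lambda>z. f z * g z) has_derivative L) (at z) \<and> (\<forall>c v. L (c *s v) = c * L v)"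
   using holomorphic_funD[OF assms(1) z] holomorphic_funD[OF assms(2) z]
   by (intro exI[of _ "\<lambda>v. f z * fd g z v + fd f z v * g z"] conjI)
    (rule has_derivative_mult, auto simp: algebra_simps)
qed

lemma holomorphic_fun_cmult: "holomorphic_fun U f \<Longrightarrow> holomorphic_fun U (\<lambda>z. c * f z)"
  using holomorphic_fun_mult[OF holomorphic_fun_const] .

lemma holomorphic_fun_diff:
  "holomorphic_fun U f \<Longrightarrow> holomorphic_fun U g \<Longrightarrow> holomorphic_fun U (\<lambda>z. f z - g z)"
  using holomorphic_fun_add[OF _ holomorphic_fun_cmult[of U g "-1"]] by simp

lemma holomorphic_fun_power: "holomorphic_fun U f \<Longrightarrow> holomorphic_fun U (\<lambda>z. f z ^ k)"
  by (induction k) (auto intro: holomorphic_fun_const holomorphic_fun_mult)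

lemma holomorphic_fun_sum:
  "(\<And>i. i \<in> I \<Longrightarrow> holomorphic_fun U (f i)) \<Longrightarrow> holomorphic_fun U (\<lambda>z. \<Sum>i\<in>I. f i z)"
  by (induction I rule: infinite_finite_induct)
   (auto intro: holomorphic_fun_const holomorphic_fun_add)

lemma holomorphic_fun_prod:
  "(\<And>i. i \<in> I \<Longrightarrow> holomorphic_fun U (f i)) \<Longrightarrow> holomorphic_fun U (\<lambda>z. \<Prod>i\<in>I. f i z)"
  by (induction I rule: infinite_finite_induct)
   (auto intro: holomorphic_fun_const holomorphic_fun_mult)

lemma holomorphic_map_has_derivative:
  fixes F :: "complex^'n \<Rightarrow> complex^'m"
  assumes "holomorphic_map U F" "z \<in> U"
  shows "(F has_derivative (\<lambda>v. \<chi> j. fd (\<lambda>z. F z $ j) z v)) (at z)"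
proof (rule has_derivative_componentwise_within[THEN iffD2], rule ballI)
  fix b :: "complex^'m" assume "b \<in> Basis"
  then obtain j c where b: "b = axis j c" by (auto simp: Basis_vec_def)
  have "((\<lambda>z. F z $ j) has_derivative fd (\<lambda>z. F z $ j) z) (at z)"
   using assms holomorphic_funD(1) unfolding holomorphic_map_def by blast
  thus "((\<lambda>x. F x \<bullet> b) has_derivative
    (\<lambda>x. (\<chi> j. fd (\<lambda>z. F z $ j) z x) \<bullet> b)) (at z)"
   by (simp add: b inner_axis has_derivative_inner_left)
qed

lemma holomorphic_fun_compose:
  fixes F :: "complex^'n \<Rightarrow> complex^'m"
  assumes F: "holomorphic_map U F" "F ` U \<subseteq> V" and f: "holomorphic_fun V f"
  shows "holomorphic_fun U (\<lambda>z. f (F z))"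
proof (rule holomorphic_funI)
  fix z assume z: "z \<in> U"
  let ?L = "\<lambda>v. \<chi> j. fd (\<lambda>z. F z $ j) z v"
  have "?L (c *s v) = c *s ?L v" for c v
   using holomorphic_funD(2) F(1) z unfolding holomorphic_map_def by (fastforce simp: vec_eq_iff)
  hence "\<forall>c v. fd f (F z) (?L (c *s v)) = c * fd f (F z) (?L v)"
   using holomorphic_funD(2)[OF f] F(2) z by auto
  moreover have "((\<lambda>z. f (F z)) has_derivative (\<lambda>v. fd f (F z) (?L v))) (at z)"
   by (rule has_derivative_compose[OF holomorphic_map_has_derivative[OF F(1) z] holomorphic_funD(1)[OF f]])
    (use F(2) z in auto)
  ultimately show "\<exists>L. ((\<lambda>z. f (F z)) has_derivative L) (at z) \<and> (\<forall>c v. L (c *s v) = c * L v)"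
   by blast
qed

lemma holomorphic_fun_line:
  assumes "holomorphic_fun U f" "z + \<zeta> *s v \<in> U"
  shows "((\<lambda>\<zeta>. f (z + \<zeta> *s v)) has_field_derivative fd f (z + \<zeta> *s v) v) (at \<zeta>)"
proof -
  have "((\<lambda>\<zeta>. z + \<zeta> *s v) has_derivative (\<lambda>\<eta>. 0 + \<eta> *s v)) (at \<zeta>)"
   by (intro has_derivative_add has_derivative_const bounded_linear_imp_has_derivative bounded_linear_smult_left)
  hence "((\<lambda>\<zeta>. z + \<zeta> *s v) has_derivative (\<lambda>\<eta>. \<eta> *s v)) (at \<zeta>)" by simp
  hence "((\<lambda>\<zeta>. f (z + \<zeta> *s v)) has_derivative (\<lambda>\<eta>. fd f (z + \<zeta> *s v) (\<eta> *s v))) (at \<zeta>)"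
   by (rule has_derivative_compose) (rule holomorphic_funD(1)[OF assms])
  moreover have "(\<lambda>\<eta>. fd f (z + \<zeta> *s v) (\<eta> *s v)) =
    (*) (fd f (z + \<zeta> *s v) v)"
   by (simp add: fun_eq_iff holomorphic_funD(2)[OF assms])
  ultimately show ?thesis
   unfolding has_field_derivative_def by simp
qed

lemma holomorphic_on_line:
  assumes "holomorphic_fun U f" "\<And>\<zeta>. \<zeta> \<in> S \<Longrightarrow> z + \<zeta> *s v \<in> U"
  shows "(\<lambda>\<zeta>. f (z + \<zeta> *s v)) holomorphic_on S"
proof (unfold holomorphic_on_def field_differentiable_def, intro ballI exI)
  fix \<zeta> assume "\<zeta> \<in> S"
  thus "((\<lambda>\<zeta>. f (z + \<zeta> *s v)) has_field_derivative fd f (z + \<zeta> *s v) v) (at \<zeta> within S)"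
   by (rule has_field_derivative_at_within[OF holomorphic_fun_line[OF assms(1) assms(2)]])
qed

text \<open>Dividing out the zero of \<open>g - g 0\<close> and applying the maximum principle, once and twice.\<close>

lemma schwarz_estimate:
  assumes g: "g holomorphic_on ball 0 R" "1 < R" and B: "\<And>\<zeta>. cmod \<zeta> \<le> 1 \<Longrightarrow> cmod (g \<zeta>) \<le> B"
   and \<zeta>: "cmod \<zeta> \<le> 1"
  defines "h \<equiv> \<lambda>\<zeta>. if \<zeta> = 0 then deriv g 0 else (g \<zeta> - g 0) / (\<zeta> - 0)"
  shows "h holomorphic_on ball 0 R" "cmod (h \<zeta>) \<le> 2 * B" "g \<zeta> = g 0 + \<zeta> * h \<zeta>"
proof -
  show h: "h holomorphic_on ball 0 R"
   unfolding h_def by (rule pole_lemma[OF g(1)]) (use g(2) in auto)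
  show "g \<zeta> = g 0 + \<zeta> * h \<zeta>" by (simp add: h_def)
  show "cmod (h \<zeta>) \<le> 2 * B"
  proof (rule maximum_modulus_frontier[of h "cball 0 1"])
   show "h holomorphic_on interior (cball 0 1)"
    by (rule holomorphic_on_subset[OF h]) (use g(2) in auto)
   show "continuous_on (closure (cball 0 1)) h"
    by (rule holomorphic_on_imp_continuous_on, rule holomorphic_on_subset[OF h]) (use g(2) in auto)
   show "cmod (h z) \<le> 2 * B" if "z \<in> frontier (cball 0 1)" for z
   proof -
    have "cmod z = 1" using that by (simp add: frontier_cball)
    hence "cmod (h z) = cmod (g z - g 0)" by (auto simp: h_def norm_divide)
    also have "\<dots> \<le> cmod (g z) + cmod (g 0)" by (rule norm_triangle_ineq4)
    also have "\<dots> \<le> 2 * B" using B[of z] B[of 0] \<open>cmod z = 1\<close> by simp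
    finally show ?thesis .
   qed
  qed (use \<zeta> in auto)
qed

lemma taylor_estimate_1:
  assumes g: "g holomorphic_on ball 0 R" "1 < R" and B: "\<And>\<zeta>. cmod \<zeta> \<le> 1 \<Longrightarrow> cmod (g \<zeta>) \<le> B"
   and \<zeta>: "cmod \<zeta> \<le> 1"
  shows "cmod (g \<zeta> - g 0) \<le> 2 * B * cmod \<zeta>" "cmod (g \<zeta> - g 0 - \<zeta> * deriv g 0) \<le> 4 * B * (cmod \<zeta>)\<^sup>2"
   "cmod (deriv g 0) \<le> 2 * B"
proof -
  define h where "h = (\<lambda>\<zeta>. if \<zeta> = 0 then deriv g 0 else (g \<zeta> - g 0) / (\<zeta> - 0))"
  have h: "h holomorphic_on ball 0 R"
   unfolding h_def by (rule schwarz_estimate(1)[OF g B \<zeta>])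
  define k where "k = (\<lambda>\<zeta>. if \<zeta> = 0 then deriv h 0 else (h \<zeta> - h 0) / (\<zeta> - 0))"
  have hB: "cmod (h \<zeta>) \<le> 2 * B" if "cmod \<zeta> \<le> 1" for \<zeta>
   unfolding h_def by (rule schwarz_estimate(2)[OF g B that])
  have h0: "h 0 = deriv g 0" by (simp add: h_def)
  have gh: "g \<zeta> = g 0 + \<zeta> * h \<zeta>" by (simp add: h_def)
  have hk: "h \<zeta> = h 0 + \<zeta> * k \<zeta>" by (simp add: k_def)
  have kB: "cmod (k \<zeta>) \<le> 2 * (2 * B)"
   unfolding k_def by (rule schwarz_estimate(2)[OF h g(2) hB \<zeta>])
  show "cmod (g \<zeta> - g 0) \<le> 2 * B * cmod \<zeta>"
   using hB[OF \<zeta>] by (subst gh) (simp add: norm_mult mult.commute mult_left_mono)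
  show "cmod (deriv g 0) \<le> 2 * B" using hB[of 0] h0 by simp
  have "g \<zeta> - g 0 - \<zeta> * deriv g 0 = \<zeta>\<^sup>2 * k \<zeta>"
   unfolding gh hk h0 by (simp add: power2_eq_square algebra_simps)
  thus "cmod (g \<zeta> - g 0 - \<zeta> * deriv g 0) \<le> 4 * B * (cmod \<zeta>)\<^sup>2"
   using mult_right_mono[OF kB, of "(cmod \<zeta>)\<^sup>2"] by (simp add: norm_mult norm_power mult_ac)
qed

text \<open>
  The one-variable estimate on the complex line through \<open>z\<close> in the direction of \<open>v\<close>, rescaled so that the unit
  disc stays in the ball.
\<close>

lemma taylor_estimate:
  fixes f :: "complex^'n \<Rightarrow> complex"
  assumes f: "holomorphic_fun U f" and U: "open U" "cball z r \<subseteq> U" "0 < r"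
   and B: "\<And>w. w \<in> cball z r \<Longrightarrow> cmod (f w) \<le> B" and v: "norm v \<le> r"
  shows "cmod (f (z + v) - f z) \<le> 2 * B * (norm v / r)"
   "cmod (f (z + v) - f z - fd f z v) \<le> 4 * B * (norm v / r)\<^sup>2"
   "cmod (fd f z v) \<le> 2 * B * (norm v / r)"
proof -
  have "z \<in> U" using U by auto
  have *: "cmod (f (z + v) - f z) \<le> 2 * B * (norm v / r) \<and>
   cmod (f (z + v) - f z - fd f z v) \<le> 4 * B * (norm v / r)\<^sup>2 \<and>
   cmod (fd f z v) \<le> 2 * B * (norm v / r)"
  proof (cases "v = 0")
   case True
   have "fd f z 0 = 0"
    using holomorphic_funD(2)[OF f \<open>z \<in> U\<close>, of 0 0] by simp
   thus ?thesis using True by simp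
  next
   case False
   define u where "u = of_real (r / norm v) *s v"
   have nu: "norm u = r" using False U(3) by (simp add: u_def norm_smult norm_divide)
   obtain r' where r': "r < r'" "cball z r' \<subseteq> U"
   proof -
    have "compact (cball z r)" by simp
    obtain e where e: "e > 0" "(\<Union>x\<in>cball z r. ball x e) \<subseteq> U"
     using compact_subset_open_imp_ball_epsilon_subset[OF \<open>compact (cball z r)\<close> U(1,2)] by blast
    have "cball z (r + e/2) \<subseteq> (\<Union>x\<in>cball z r. ball x e)"
    proof
     fix y assume y: "y \<in> cball z (r + e/2)"
     show "y \<in> (\<Union>x\<in>cball z r. ball x e)"
     proof (cases "dist z y \<le> r")
      case True thus ?thesis using e by (auto intro!: bexI[of _ y])
     next
      case False
      define t where "t = r / dist z y"
      have t: "0 < t" "t < 1" using False U(3) by (auto simp: t_def divide_simps)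
      have "dist z (z + t *\<^sub>R (y - z)) = r"
       using False U(3) by (auto simp add: t_def dist_norm norm_minus_commute)
      moreover have "dist (z + t *\<^sub>R (y - z)) y < e"
      proof -
       have "z + t *\<^sub>R (y - z) - y = (1 - t) *\<^sub>R (z - y)" by (simp add: algebra_simps)
       hence "dist (z + t *\<^sub>R (y - z)) y = (1 - t) * dist z y"
        using t by (simp add: dist_norm)
       also have "\<dots> = dist z y - r" using False U(3) by (auto simp add: t_def field_simps)
       also have "\<dots> < e" using y e by auto
       finally show ?thesis .
      qed
      ultimately show ?thesis by (auto intro!: bexI[of _ "z + t *\<^sub>R (y - z)"])
     qed
    qed
    thus ?thesis using that[of "r + e/2"] e by auto
   qed
   define g where "g = (\<lambda>\<zeta>. f (z + \<zeta> *s u))"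
   have inU: "z + \<zeta> *s u \<in> U" if "\<zeta> \<in> ball 0 (r' / r)" for \<zeta>
   proof -
    have "dist z (z + \<zeta> *s u) \<le> r'"
     using that U(3) by (simp add: dist_norm norm_smult nu field_simps)
    thus ?thesis using r' by auto
   qed
   have "g holomorphic_on ball 0 (r' / r)"
    unfolding g_def by (rule holomorphic_on_line[OF f inU])
   moreover have "1 < r' / r" using r' U(3) by simp
   moreover have "cmod (g \<zeta>) \<le> B" if "cmod \<zeta> \<le> 1" for \<zeta>
    unfolding g_def using that U(3) by (intro B) (simp add: dist_norm norm_smult nu mult_left_le_one_le)
   ultimately have "g holomorphic_on ball 0 (r' / r)" "1 < r' / r"
    "\<And>\<zeta>. cmod \<zeta> \<le> 1 \<Longrightarrow> cmod (g \<zeta>) \<le> B" by blast+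
   note T = taylor_estimate_1[OF this]
   define s where "s = norm v / r"
   have s: "cmod (of_real s) \<le> 1" "cmod (of_real s) = s" using v U(3) by (auto simp: s_def norm_divide)
   have su: "of_real s *s u = v" using False U(3)
    by (simp add: s_def u_def of_real_mult[symmetric] del: of_real_mult of_real_divide)
   have dg: "deriv g 0 = fd f z u"
    unfolding g_def using holomorphic_fun_line[OF f, of z 0 u] \<open>z \<in> U\<close> by (intro DERIV_imp_deriv) auto
   have sd: "of_real s * deriv g 0 = fd f z v"
    unfolding dg su[symmetric] holomorphic_funD(2)[OF f \<open>z \<in> U\<close>] ..
   have "cmod (g (of_real s) - g 0) \<le> 2 * B * s"
    "cmod (g (of_real s) - g 0 - of_real s * deriv g 0) \<le> 4 * B * s\<^sup>2"
    "cmod (deriv g 0) \<le> 2 * B"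
    using T(1,2)[OF _ s(1)] T(3)[of 0] s by auto
   moreover from this(3) have "cmod (of_real s * deriv g 0) \<le> 2 * B * s"
    using s by (simp add: norm_mult mult.commute mult_left_mono)
   ultimately show ?thesis unfolding sd by (simp add: g_def su s_def[symmetric])
  qed
  from * show "cmod (f (z + v) - f z) \<le> 2 * B * (norm v / r)"
   "cmod (f (z + v) - f z - fd f z v) \<le> 4 * B * (norm v / r)\<^sup>2"
   "cmod (fd f z v) \<le> 2 * B * (norm v / r)" by auto
qed

lemma has_derivative_quadratic:
  fixes g :: "'a::euclidean_space \<Rightarrow> 'b::euclidean_space"
  assumes "bounded_linear L" "0 < r"
   and q: "\<And>v. norm v \<le> r \<Longrightarrow> norm (g (z + v) - g z - L v) \<le> C * (norm v)\<^sup>2"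
  shows "(g has_derivative L) (at z)"
  unfolding has_derivative_at
proof (intro conjI assms(1))
  have lim: "((\<lambda>v. \<bar>C\<bar> * norm v) \<longlongrightarrow> 0) (at (0::'a))"
   by (auto intro!: tendsto_eq_intros)
  have ev: "\<forall>\<^sub>F v in at 0. norm (norm (g (z + v) - g z - L v) / norm v) \<le> \<bar>C\<bar> * norm v"
   unfolding eventually_at
  proof (intro exI[of _ r] conjI ballI impI \<open>0 < r\<close>)
   fix v :: 'a assume v: "v \<noteq> 0 \<and> dist v 0 < r"
   have "norm (g (z + v) - g z - L v) \<le> C * (norm v)\<^sup>2" using v by (intro q) auto
   also have "\<dots> \<le> \<bar>C\<bar> * (norm v)\<^sup>2" by (intro mult_right_mono) auto
   finally show "norm (norm (g (z + v) - g z - L v) / norm v) \<le> \<bar>C\<bar> * norm v"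
    using v by (simp add: divide_simps power2_eq_square mult_ac)
  qed
  show "(\<lambda>v. norm (g (z + v) - g z - L v) / norm v) \<midarrow>0\<rightarrow> 0"
   by (rule Lim_null_comparison[OF ev lim])
qed

lemma holomorphic_fun_bounded_cball:
  assumes "holomorphic_fun U f" "cball z r \<subseteq> U"
  obtains B where "0 < B" "\<And>w. w \<in> cball z r \<Longrightarrow> cmod (f w) \<le> B"
proof -
  have "compact (f ` cball z r)"
   by (intro compact_continuous_image continuous_on_subset[OF holomorphic_fun_continuous[OF assms(1)]] assms(2)) auto
  then obtain B where "0 < B" "\<And>x. x \<in> f ` cball z r \<Longrightarrow> cmod x \<le> B"
   using compact_imp_bounded bounded_pos by metis
  thus ?thesis using that by blast
qed

text \<open>
  By the Taylor estimate the derivatives of the approximants form Cauchy sequences, and the constant in their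
  quadratic remainders depends only on a common bound, so the remainder estimate passes to the limit.
\<close>

lemma holomorphic_fun_limit:
  fixes f :: "nat \<Rightarrow> complex^'n \<Rightarrow> complex"
  assumes U: "open U" and hol: "\<And>n. holomorphic_fun U (f n)"
   and lim: "\<And>z. z \<in> U \<Longrightarrow> \<exists>r>0. cball z r \<subseteq> U \<and> uniform_limit (cball z r) f g sequentially"
  shows "holomorphic_fun U g"
proof (rule holomorphic_funI)
  fix z assume z: "z \<in> U"
  obtain r where r: "0 < r" "cball z r \<subseteq> U" and ul: "uniform_limit (cball z r) f g sequentially"
   using lim[OF z] by blast
  let ?L = "\<lambda>n. fd (f n) z"
  have hom: "?L n (c *s v) = c * ?L n v" for n c v using holomorphic_funD(2)[OF hol z] .
  have lin: "linear (?L n)" for n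
   using holomorphic_funD(1)[OF hol z] by (meson has_derivative_linear)
  have diff: "cmod (?L n v - ?L m v) \<le> 2 * e * (norm v / r)"
   if "\<And>w. w \<in> cball z r \<Longrightarrow> cmod (f n w - f m w) \<le> e" "norm v \<le> r" for n m e v
  proof -
   have "((\<lambda>w. f n w - f m w) has_derivative (\<lambda>v. ?L n v - ?L m v)) (at z)"
    by (intro has_derivative_diff holomorphic_funD(1)[OF hol z])
   hence "fd (\<lambda>w. f n w - f m w) z = (\<lambda>v. ?L n v - ?L m v)"
    using frechet_derivative_at by metis
   thus ?thesis
    using taylor_estimate(3)[OF holomorphic_fun_diff[OF hol[of n] hol[of m]] U r(2,1) that] by simp
  qed
  have conv: "convergent (\<lambda>n. ?L n v)" if v: "norm v \<le> r" for v
   unfolding Cauchy_convergent_iff[symmetric]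
  proof (rule metric_CauchyI)
   fix e :: real assume "0 < e"
   hence "\<forall>\<^sub>F n in sequentially. \<forall>w\<in>cball z r. dist (f n w) (g w) < e / 8"
    using uniform_limitD[OF ul, of "e / 8"] by simp
   then obtain N where N: "\<And>n w. n \<ge> N \<Longrightarrow> w \<in> cball z r \<Longrightarrow> dist (f n w) (g w) < e / 8"
    unfolding eventually_sequentially by blast
   have "dist (?L n v) (?L m v) < e" if "n \<ge> N" "m \<ge> N" for n m
   proof -
    have "cmod (?L n v - ?L m v) \<le> 2 * (e / 4) * (norm v / r)"
    proof (rule diff[OF _ v])
     fix w assume "w \<in> cball z r"
     thus "cmod (f n w - f m w) \<le> e / 4"
      using N[OF that(1), of w] N[OF that(2), of w] dist_triangle2[of "f n w" "f m w" "g w"]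
      by (simp add: dist_norm)
    qed
    also have "\<dots> \<le> 2 * (e / 4) * 1" using v r \<open>0 < e\<close> by (intro mult_left_mono) auto
    also have "\<dots> < e" using \<open>0 < e\<close> by simp
    finally show ?thesis by (simp add: dist_norm)
   qed
   thus "\<exists>M. \<forall>m\<ge>M. \<forall>n\<ge>M. dist (?L m v) (?L n v) < e" by blast
  qed
  have conv': "convergent (\<lambda>n. ?L n v)" for v
  proof (cases "v = 0")
   case False
   define c where "c = complex_of_real (norm v / r)"
   have "c \<noteq> 0" using False r by (simp add: c_def)
   have "v = c *s ((1 / c) *s v)" using \<open>c \<noteq> 0\<close> by simp
   hence "(\<lambda>n. ?L n v) = (\<lambda>n. c * ?L n ((1 / c) *s v))" using hom by metis
   moreover have "convergent (\<lambda>n. ?L n ((1 / c) *s v))"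
    using False r by (intro conv) (simp add: c_def norm_smult norm_divide)
   ultimately show ?thesis using \<open>c \<noteq> 0\<close> by (simp add: convergent_mult_const_iff)
  qed (use conv r in auto)
  define L where "L v = lim (\<lambda>n. ?L n v)" for v
  have L: "(\<lambda>n. ?L n v) \<longlonglongrightarrow> L v" for v
   using conv' by (simp add: L_def convergent_LIMSEQ_iff)
  have homL: "L (c *s v) = c * L v" for c v
   by (rule LIMSEQ_unique[OF L]) (simp only: hom, intro tendsto_intros L)
  have "linear L"
  proof (rule linearI)
   show "L (u + v) = L u + L v" for u v
    by (rule LIMSEQ_unique[OF L]) (simp only: linear_add[OF lin], intro tendsto_intros L)
   show "L (c *\<^sub>R u) = c *\<^sub>R L u" for c u
    by (rule LIMSEQ_unique[OF L]) (simp only: linear_scale[OF lin], intro tendsto_intros L)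
  qed
  hence bl: "bounded_linear L" by (simp add: linear_conv_bounded_linear)
  obtain N where N: "\<And>n w. n \<ge> N \<Longrightarrow> w \<in> cball z r \<Longrightarrow> dist (f n w) (g w) < 1"
   using uniform_limitD[OF ul, of 1, OF zero_less_one] unfolding eventually_sequentially by blast
  obtain B where B: "\<And>w. w \<in> cball z r \<Longrightarrow> cmod (f N w) \<le> B"
   using holomorphic_fun_bounded_cball[OF hol r(2)] by metis
  have fB: "cmod (f n w) \<le> B + 2" if "n \<ge> N" "w \<in> cball z r" for n w
  proof -
   have "cmod (f n w) \<le> dist (f n w) (g w) + dist (f N w) (g w) + cmod (f N w)"
    using dist_triangle2[of "f n w" "f N w" "g w"] norm_triangle_sub[of "f n w" "f N w"] by (simp add: dist_norm)
   thus ?thesis using N[OF that] N[OF order_refl that(2)] B[OF that(2)] by simp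
  qed
  have pt: "(\<lambda>n. f n w) \<longlonglongrightarrow> g w" if "w \<in> cball z r" for w
   using tendsto_uniform_limitI[OF ul that] .
  have "(g has_derivative L) (at z)"
  proof (rule has_derivative_quadratic[OF bl r(1)])
   fix v :: "complex^'n" assume v: "norm v \<le> r"
   have in_cball: "z + v \<in> cball z r" "z \<in> cball z r" using v r by (auto simp: dist_norm)
   have "cmod (g (z + v) - g z - L v) \<le> 4 * (B + 2) * (norm v / r)\<^sup>2"
   proof (rule LIMSEQ_le_const2)
    show "(\<lambda>n. cmod (f n (z + v) - f n z - ?L n v)) \<longlonglongrightarrow> cmod (g (z + v) - g z - L v)"
     by (intro tendsto_intros L pt in_cball)
    show "\<exists>M. \<forall>n\<ge>M. cmod (f n (z + v) - f n z - ?L n v) \<le> 4 * (B + 2) * (norm v / r)\<^sup>2"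
     using taylor_estimate(2)[OF hol U r(2,1) fB v] by blast
   qed
   thus "cmod (g (z + v) - g z - L v) \<le> (4 * (B + 2) / r\<^sup>2) * (norm v)\<^sup>2"
    by (simp add: power_divide)
  qed
  thus "\<exists>L. (g has_derivative L) (at z) \<and> (\<forall>c v. L (c *s v) = c * L v)" using homL by blast
qed

definition dd :: "complex^'n \<Rightarrow> (complex^'n \<Rightarrow> complex) \<Rightarrow> complex^'n \<Rightarrow> complex" where
  "dd v f z = fd f z v"

lemma holomorphic_map_translate: "holomorphic_map U (\<lambda>z. z + a)"
  unfolding holomorphic_map_def
  by (auto intro!: holomorphic_fun_add holomorphic_fun_nth holomorphic_fun_const)

lemma difference_quotient_estimate:
  fixes f :: "complex^'n \<Rightarrow> complex"
  assumes f: "holomorphic_fun U f" and U: "open U" "cball z r \<subseteq> U" "0 < r"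
   and B: "\<And>w. w \<in> cball z r \<Longrightarrow> cmod (f w) \<le> B" and c: "0 < c" "norm v / r \<le> c"
  shows "cmod (of_real c * (f (z + of_real (1 / c) *s v) - f z) - dd v f z) \<le> 4 * B * (norm v / r)\<^sup>2 / c"
proof -
  have z: "z \<in> U" using U by auto
  let ?v = "of_real (1 / c) *s v"
  have nv: "norm ?v = norm v / c" using c by (simp add: norm_smult norm_divide)
  have "norm v / c \<le> r" using c U(3) by (simp add: field_simps)
  hence "norm ?v \<le> r" using nv by simp
  have "of_real c * (f (z + ?v) - f z) - dd v f z = of_real c * (f (z + ?v) - f z - fd f z ?v)"
   unfolding holomorphic_funD(2)[OF f z] dd_def using c by (simp add: algebra_simps)
  hence "cmod (of_real c * (f (z + ?v) - f z) - dd v f z) = c * cmod (f (z + ?v) - f z - fd f z ?v)"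
   using c by (simp add: norm_mult)
  also have "\<dots> \<le> c * (4 * B * (norm ?v / r)\<^sup>2)"
   using c taylor_estimate(2)[OF f U B \<open>norm ?v \<le> r\<close>] by (intro mult_left_mono) auto
  also have "\<dots> = 4 * B * (norm v / r)\<^sup>2 / c"
   unfolding nv using c by (simp add: power2_eq_square field_simps)
  finally show ?thesis .
qed

text \<open>A directional derivative is a locally uniform limit of difference quotients.\<close>

lemma holomorphic_fun_dd:
  assumes f: "holomorphic_fun U f" and U: "open U"
  shows "holomorphic_fun U (dd v f)"
proof (rule holomorphic_fun_local)
  fix z0 assume "z0 \<in> U"
  then obtain r0 where r0: "0 < r0" "cball z0 r0 \<subseteq> U" using U open_contains_cball by blast
  define r where "r = r0 / 2"
  have r: "0 < r" "cball z0 (2 * r) \<subseteq> U" using r0 by (auto simp: r_def)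
  obtain B where B: "0 < B" "\<And>w. w \<in> cball z0 (2 * r) \<Longrightarrow> cmod (f w) \<le> B"
   using holomorphic_fun_bounded_cball[OF f r(2)] by metis
  define K where "K = norm v / r + 1"
  have K: "0 < K" using r by (simp add: K_def add_nonneg_pos)
  define c where "c n = K * real (Suc n)" for n
  have c: "0 < c n" "norm v / r \<le> c n" for n
  proof -
   show "0 < c n" using K by (simp add: c_def)
   have "norm v / r \<le> K * 1" by (simp add: K_def)
   also have "\<dots> \<le> c n" unfolding c_def using K by (intro mult_left_mono) auto
   finally show "norm v / r \<le> c n" .
  qed
  define F where "F n z = of_real (c n) * (f (z + of_real (1 / c n) *s v) - f z)" for n z
  have sub: "cball z r \<subseteq> cball z0 (2 * r)" if "z \<in> cball z0 r" for z
   using that by (auto simp: dist_norm) (smt (verit, best) dist_norm dist_triangle)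
  have est: "cmod (F n z - dd v f z) \<le> 4 * B * (norm v / r)\<^sup>2 / c n" if "z \<in> cball z0 r" for n z
   unfolding F_def using sub[OF that] r
   by (intro difference_quotient_estimate[OF f U _ r(1) B(2)] c) auto
  have "holomorphic_fun (ball z0 r) (dd v f)"
  proof (rule holomorphic_fun_limit[where f = F])
   show "holomorphic_fun (ball z0 r) (F n)" for n
    unfolding F_def
   proof (intro holomorphic_fun_cmult holomorphic_fun_diff holomorphic_fun_compose[OF holomorphic_map_translate _ f]
     holomorphic_fun_subset[OF f])
    show "ball z0 r \<subseteq> U" using r by auto
    show "(\<lambda>z. z + of_real (1 / c n) *s v) ` ball z0 r \<subseteq> U"
    proof safe
     fix z assume "z \<in> ball z0 r"
     have "norm v / c n \<le> r" using c[of n] r by (simp add: field_simps)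
     hence "z + of_real (1 / c n) *s v \<in> cball z r"
      using c[of n] by (simp add: dist_norm norm_smult norm_divide)
     moreover have "cball z r \<subseteq> U" using sub[of z] \<open>z \<in> ball z0 r\<close> r by (auto simp: subset_iff)
     ultimately show "z + of_real (1 / c n) *s v \<in> U" by blast
    qed
   qed
   have lim0: "(\<lambda>n. 4 * B * (norm v / r)\<^sup>2 / c n) \<longlonglongrightarrow> 0"
   proof -
    have "(\<lambda>n. (4 * B * (norm v / r)\<^sup>2 / K) * inverse (real (Suc n))) \<longlonglongrightarrow> (4 * B * (norm v / r)\<^sup>2 / K) * 0"
     by (intro tendsto_intros LIMSEQ_inverse_real_of_nat)
    thus ?thesis by (simp add: c_def divide_simps mult_ac)
   qed
   show "\<exists>s>0. cball z s \<subseteq> ball z0 r \<and> uniform_limit (cball z s) F (dd v f) sequentially"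
    if "z \<in> ball z0 r" for z
   proof -
    obtain s where s: "0 < s" "cball z s \<subseteq> ball z0 r"
     using \<open>z \<in> ball z0 r\<close> open_contains_cball open_ball by metis
    have "uniform_limit (cball z s) F (dd v f) sequentially"
    proof (rule uniform_limitI)
     fix e :: real assume "0 < e"
     with lim0 have "\<forall>\<^sub>F n in sequentially. 4 * B * (norm v / r)\<^sup>2 / c n < e"
      by (auto dest: order_tendstoD)
     thus "\<forall>\<^sub>F n in sequentially. \<forall>x\<in>cball z s. dist (F n x) (dd v f x) < e"
     proof eventually_elim
      case (elim n)
      show ?case
      proof
       fix x assume "x \<in> cball z s"
       hence "x \<in> cball z0 r" using s by (auto simp: subset_iff)
       from est[OF this, of n] elim show "dist (F n x) (dd v f x) < e" by (simp add: dist_norm)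
      qed
     qed
    qed
    thus ?thesis using s by blast
   qed
  qed auto
  thus "\<exists>V. z0 \<in> V \<and> holomorphic_fun V (dd v f)" using r by (intro exI[of _ "ball z0 r"]) auto
qed

section \<open>Mean values\<close>

text \<open>
  The average kills the powers of \<open>\<zeta>\<close> whose exponent is not a multiple of the number of roots; what remains of the
  power series tends to its constant term.
\<close>

lemma root_of_unity_average:
  assumes g: "g holomorphic_on ball 0 R" "1 < R"
  shows "(\<lambda>m. (\<Sum>k<Suc m. g (exp (2 * of_real pi * \<i> * (of_nat k / of_nat (Suc m))))) / of_nat (Suc m)) \<longlonglongrightarrow> g 0"
proof -
  define a where "a n = (deriv ^^ n) g 0 / fact n" for n
  have sums: "(\<lambda>n. a n * \<zeta> ^ n) sums g \<zeta>" if "cmod \<zeta> < R" for \<zeta>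
   using holomorphic_power_series[OF g(1), of \<zeta>] that by (simp add: a_def)
  have summ: "summable (\<lambda>n. cmod (a n))"
  proof -
   define \<rho> where "\<rho> = complex_of_real ((1 + R) / 2)"
   have \<rho>: "cmod \<rho> = (1 + R) / 2" using g(2) by (simp add: \<rho>_def del: of_real_divide of_real_add)
   have "summable (\<lambda>n. cmod (a n * 1 ^ n))"
    by (rule powser_insidea[of _ \<rho>]) (use sums[of \<rho>] \<rho> g(2) in \<open>auto simp: sums_iff\<close>)
   thus ?thesis by simp
  qed
  define \<omega> where "\<omega> m k = exp (2 * of_real pi * \<i> * (of_nat k / of_nat (Suc m)))" for m k :: nat
  have n1: "cmod (\<omega> m k) = 1" for m k
   by (simp add: \<omega>_def norm_exp_eq_Re)
  define s where "s m n = (\<Sum>k<Suc m. \<omega> m k ^ n) / of_nat (Suc m)" for m n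
  have s0: "s m 0 = 1" for m by (simp add: s_def del: of_nat_Suc)
  have s_le: "cmod (s m n) \<le> 1" for m n
  proof -
   have "cmod (\<Sum>k<Suc m. \<omega> m k ^ n) \<le> (\<Sum>k<Suc m. 1)"
    by (intro sum_norm_le) (simp add: norm_power n1)
   thus ?thesis by (simp add: s_def norm_divide divide_simps del: of_nat_Suc)
  qed
  have s_zero: "s m n = 0" if "0 < n" "n < Suc m" for m n
  proof -
   have "\<omega> m k ^ n = \<omega> m n ^ k" for k
    by (simp add: \<omega>_def exp_of_nat_mult[symmetric] mult_ac)
   hence "(\<Sum>k<Suc m. \<omega> m k ^ n) = (\<Sum>k<Suc m. \<omega> m n ^ k)" by simp
   moreover have "\<omega> m n \<noteq> 1"
    using complex_root_unity_eq_1[of "Suc m" n] that by (auto simp: \<omega>_def dest: dvd_imp_le)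
   moreover have "\<omega> m n ^ Suc m = 1"
    using complex_root_unity[of "Suc m" n] by (simp add: \<omega>_def del: of_nat_Suc)
   ultimately show ?thesis by (simp add: s_def geometric_sum del: power_Suc of_nat_Suc sum.lessThan_Suc)
  qed
  have key: "cmod ((\<Sum>k<Suc m. g (\<omega> m k)) / of_nat (Suc m) - g 0) \<le> (\<Sum>n. cmod (a (n + Suc m)))" for m
  proof -
   have "(\<lambda>n. (\<Sum>k<Suc m. a n * \<omega> m k ^ n) / of_nat (Suc m)) sums ((\<Sum>k<Suc m. g (\<omega> m k)) / of_nat (Suc m))"
    using g(2) by (intro sums_divide sums_sum sums) (simp add: n1)
   moreover have "(\<Sum>k<Suc m. a n * \<omega> m k ^ n) / of_nat (Suc m) = a n * s m n" for n
    by (simp add: s_def sum_distrib_left[symmetric] del: of_nat_Suc sum.lessThan_Suc)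
   ultimately have S: "(\<lambda>n. a n * s m n) sums ((\<Sum>k<Suc m. g (\<omega> m k)) / of_nat (Suc m))" by simp
   have "(\<Sum>n. a n * s m n) = (\<Sum>n. a (n + Suc m) * s m (n + Suc m)) + (\<Sum>n<Suc m. a n * s m n)"
    by (rule suminf_split_initial_segment) (use S in \<open>simp add: sums_iff\<close>)
   moreover have "(\<Sum>n<Suc m. a n * s m n) = a 0"
   proof -
    have "(\<Sum>n<Suc m. a n * s m n) = (\<Sum>n\<in>{0}. a n * s m n)"
     by (rule sum.mono_neutral_right) (auto simp: s_zero)
    thus ?thesis by (simp add: s0)
   qed
   moreover have "a 0 = g 0" by (simp add: a_def)
   ultimately have "(\<Sum>n. a (n + Suc m) * s m (n + Suc m)) + g 0 = (\<Sum>k<Suc m. g (\<omega> m k)) / of_nat (Suc m)"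
    using S by (simp add: sums_iff del: of_nat_Suc sum.lessThan_Suc)
   hence "(\<Sum>k<Suc m. g (\<omega> m k)) / of_nat (Suc m) - g 0 = (\<Sum>n. a (n + Suc m) * s m (n + Suc m))"
    by (metis add_diff_cancel_right')
   moreover have le: "cmod (a (n + Suc m) * s m (n + Suc m)) \<le> cmod (a (n + Suc m))" for n
    using s_le[of m "n + Suc m"] by (simp add: norm_mult mult_left_le)
   moreover have "summable (\<lambda>n. cmod (a (n + Suc m)))"
    using summ by (rule summable_ignore_initial_segment)
   ultimately show ?thesis
    by (metis (no_types, lifting) norm_suminf_le)
  qed
  have "(\<lambda>m. (\<Sum>n. cmod (a (n + Suc m)))) \<longlonglongrightarrow> 0"
  proof -
   have "(\<Sum>n. cmod (a (n + m))) = (\<Sum>n. cmod (a n)) - (\<Sum>n<m. cmod (a n))" for m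
    by (rule suminf_minus_initial_segment[OF summ])
   moreover have "(\<lambda>m. (\<Sum>n. cmod (a n)) - (\<Sum>n<m. cmod (a n))) \<longlonglongrightarrow> (\<Sum>n. cmod (a n)) - (\<Sum>n. cmod (a n))"
    by (intro tendsto_intros summable_LIMSEQ summ)
   ultimately have "(\<lambda>m. (\<Sum>n. cmod (a (n + m)))) \<longlonglongrightarrow> 0" by simp
   thus ?thesis by (rule LIMSEQ_Suc)
  qed
  hence "(\<lambda>m. (\<Sum>k<Suc m. g (\<omega> m k)) / of_nat (Suc m) - g 0) \<longlonglongrightarrow> 0"
   by (rule Lim_null_comparison[rotated]) (use key in auto)
  thus ?thesis unfolding \<omega>_def by (simp only: LIM_zero_iff)
qed

text \<open>
  Replacing the integrand by its average over the rotations by roots of unity leaves the integral unchanged,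
  since \<open>\<phi>\<close> and Lebesgue measure are invariant, and these averages tend pointwise to \<open>\<phi> x * f 0\<close>. This does
  the work of polar coordinates, both for balls and for Gaussian weights.
\<close>

lemma circled_mean_value:
  fixes f :: "complex^'n \<Rightarrow> complex" and \<phi> :: "complex^'n \<Rightarrow> real"
  assumes hol: "\<And>x. \<phi> x \<noteq> 0 \<Longrightarrow> \<exists>R>1. (\<lambda>\<zeta>. f (\<zeta> *s x)) holomorphic_on ball 0 R"
   and inv: "\<And>c x. cmod c = 1 \<Longrightarrow> \<phi> (c *s x) = \<phi> x" "\<And>c x. cmod c = 1 \<Longrightarrow> h (c *s x) = h x"
   and dom: "\<And>x. \<bar>\<phi> x\<bar> * cmod (f x) \<le> h x" and h: "integrable lborel h"
   and m: "(\<lambda>x. of_real (\<phi> x) * f x) \<in> borel_measurable borel" and \<phi>: "\<phi> \<in> borel_measurable borel"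
  shows "(LINT x|lborel. of_real (\<phi> x) * f x) = f 0 * of_real (LINT x|lborel. \<phi> x)"
proof -
  define G where "G x = of_real (\<phi> x) * f x" for x
  define \<omega> where "\<omega> m k = exp (2 * of_real pi * \<i> * (of_nat k / of_nat (Suc m)))" for m k :: nat
  have n1: "cmod (\<omega> m k) = 1" for m k
   by (simp add: \<omega>_def norm_exp_eq_Re)
  have mG [measurable]: "G \<in> borel_measurable borel" using m by (simp add: G_def[abs_def])
  have ms [measurable]: "(\<lambda>x::complex^'n. c *s x) \<in> borel_measurable borel" for c
   by (intro borel_measurable_continuous_onI linear_continuous_on bounded_linear_smult_right)
  have Gh: "cmod (G x) \<le> h x" for x using dom[of x] by (simp add: G_def norm_mult)
  have intG: "integrable lborel G"
   by (rule Bochner_Integration.integrable_bound[OF h]) (use order_trans[OF Gh abs_ge_self] in auto)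
  have rot: "integrable lborel (\<lambda>x. G (c *s x))" "(LINT x|lborel. G (c *s x)) = (LINT x|lborel. G x)"
   if "cmod c = 1" for c
  proof -
   have "integrable (distr lborel borel (\<lambda>x. c *s x)) G" using intG that by (simp add: lborel_unimodular)
   thus "integrable lborel (\<lambda>x. G (c *s x))" by (simp add: integrable_distr_eq)
   have "(LINT x|distr lborel borel (\<lambda>x. c *s x). G x) = (LINT x|lborel. G (c *s x))"
    by (rule integral_distr) auto
   thus "(LINT x|lborel. G (c *s x)) = (LINT x|lborel. G x)" using that by (simp add: lborel_unimodular)
  qed
  define X where "X m x = (\<Sum>k<Suc m. G (\<omega> m k *s x)) / of_nat (Suc m)" for m x
  have intX: "(LINT x|lborel. X m x) = (LINT x|lborel. G x)" for m
   using rot n1 by (simp add: X_def[abs_def] integral_sum del: of_nat_Suc sum.lessThan_Suc)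
  have mX [measurable]: "X m \<in> borel_measurable borel" for m
   unfolding X_def by measurable
  have "(\<lambda>m. LINT x|lborel. X m x) \<longlonglongrightarrow> (LINT x|lborel. of_real (\<phi> x) * f 0)"
  proof (rule integral_dominated_convergence[where w = h])
   show "(\<lambda>x. of_real (\<phi> x) * f 0) \<in> borel_measurable lborel" using \<phi> by simp
   show "AE x in lborel. (\<lambda>m. X m x) \<longlonglongrightarrow> of_real (\<phi> x) * f 0"
   proof (intro AE_I2)
    fix x :: "complex^'n"
    have eq: "X m x = of_real (\<phi> x) * ((\<Sum>k<Suc m. f (\<omega> m k *s x)) / of_nat (Suc m))" for m
     by (simp add: X_def G_def inv n1 sum_distrib_left[symmetric] del: of_nat_Suc sum.lessThan_Suc)
    show "(\<lambda>m. X m x) \<longlonglongrightarrow> of_real (\<phi> x) * f 0"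
    proof (cases "\<phi> x = 0")
     case False
     then obtain R where "R > 1" "(\<lambda>\<zeta>. f (\<zeta> *s x)) holomorphic_on ball 0 R" using hol by blast
     from root_of_unity_average[OF this(2,1)] show ?thesis
      unfolding eq \<omega>_def by (intro tendsto_intros) simp
    qed (simp add: eq)
   qed
   show "AE x in lborel. cmod (X m x) \<le> h x" for m
   proof (intro AE_I2)
    fix x :: "complex^'n"
    have "cmod (\<Sum>k<Suc m. G (\<omega> m k *s x)) \<le> (\<Sum>k<Suc m. h x)"
     by (rule sum_norm_le) (use Gh inv(2) n1 in metis)
    thus "cmod (X m x) \<le> h x"
     by (simp add: X_def norm_divide divide_simps mult_ac del: of_nat_Suc sum.lessThan_Suc)
   qed
  qed (use h in auto)
  hence "(LINT x|lborel. G x) = (LINT x|lborel. of_real (\<phi> x) * f 0)"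
   by (simp add: intX LIMSEQ_const_iff)
  thus ?thesis by (simp add: G_def)
qed

lemma indicator_scaleR_eq: "indicator S z *\<^sub>R (c::complex) = indicator S z * c"
  by (simp add: indicator_def)

lemma ball_mean_value:
  fixes f :: "complex^'n \<Rightarrow> complex"
  assumes f: "holomorphic_fun U f" and U: "open U" "cball w r \<subseteq> U" "0 < r"
  shows "(LINT z|lborel. indicator (ball w r) z * f z) = f w * of_real (measure lborel (ball w r))"
proof -
  obtain B where B: "0 < B" "\<And>z. z \<in> cball w r \<Longrightarrow> cmod (f z) \<le> B"
   using holomorphic_fun_bounded_cball[OF f U(2)] by metis
  define \<phi> :: "complex^'n \<Rightarrow> real" where "\<phi> = indicator (ball 0 r)"
  have contf: "continuous_on (ball w r) f"
   by (rule continuous_on_subset[OF holomorphic_fun_continuous[OF f]]) (use U in auto)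
  have m: "(\<lambda>z. indicator (ball w r) z * f z) \<in> borel_measurable borel"
   using borel_measurable_continuous_on_indicator[OF _ contf] by (simp add: indicator_scaleR_eq)
  have eq: "(indicator (ball w r) (w + x) :: complex) = of_real (\<phi> x)" for x
   by (simp add: \<phi>_def indicator_def dist_norm)
  have "(LINT z|lborel. indicator (ball w r) z * f z) = (LINT z|distr lborel borel ((+) w). indicator (ball w r) z * f z)"
   by (simp add: lborel_distr_plus)
  also have "\<dots> = (LINT x|lborel. indicator (ball w r) (w + x) * f (w + x))"
   using m by (intro integral_distr) auto
  also have "\<dots> = (LINT x|lborel. of_real (\<phi> x) * f (w + x))" by (simp add: eq)
  also have "\<dots> = f (w + 0) * of_real (LINT x|lborel. \<phi> x)"
  proof (rule circled_mean_value[where h = "\<lambda>x. B * \<phi> x"])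
   show "\<exists>R>1. (\<lambda>\<zeta>. f (w + \<zeta> *s x)) holomorphic_on ball 0 R" if "\<phi> x \<noteq> 0" for x
   proof -
    have x: "norm x < r" using that by (auto simp: \<phi>_def indicator_def split: if_splits)
    define R where "R = (if x = 0 then 2 else r / norm x)"
    have "R > 1" using x by (auto simp: R_def)
    moreover have "(\<lambda>\<zeta>. f (w + \<zeta> *s x)) holomorphic_on ball 0 R"
    proof (rule holomorphic_on_line[OF f])
     fix \<zeta> :: complex assume *: "\<zeta> \<in> ball 0 R"
     have "norm (\<zeta> *s x) \<le> r"
     proof (cases "x = 0")
      case False
      hence "cmod \<zeta> < r / norm x" using * by (simp add: R_def)
      thus ?thesis using False by (simp add: norm_smult pos_less_divide_eq)
     qed (use U(3) in simp)
     thus "w + \<zeta> *s x \<in> U" using U(2) by (auto simp: dist_norm)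
    qed
    ultimately show ?thesis by blast
   qed
   show "\<bar>\<phi> x\<bar> * cmod (f (w + x)) \<le> B * \<phi> x" for x
    using B(2)[of "w + x"] by (auto simp: \<phi>_def indicator_def dist_norm)
   show "(\<lambda>x. of_real (\<phi> x) * f (w + x)) \<in> borel_measurable borel"
    using measurable_compose[OF _ m, of "\<lambda>x. w + x" borel] by (simp add: eq)
   have "integrable lborel \<phi>"
    unfolding \<phi>_def by (rule integrable_real_indicator) (simp_all add: emeasure_bounded_finite[unfolded infinity_ennreal_def])
   thus "integrable lborel (\<lambda>x. B * \<phi> x)" by simp
  qed (auto simp: \<phi>_def indicator_def norm_smult)
  also have "(LINT x|lborel. \<phi> x) = measure lborel (ball w r)"
   by (simp add: \<phi>_def content_ball_conv_unit_ball[OF less_imp_le[OF U(3)], of w]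
    content_ball_conv_unit_ball[OF less_imp_le[OF U(3)], of 0])
  finally show ?thesis by simp
qed

section \<open>The identity theorem\<close>

lemma holomorphic_fun_zero_ball:
  fixes f :: "complex^'n \<Rightarrow> complex"
  assumes f: "holomorphic_fun U f" and U: "ball w r \<subseteq> U"
   and line: "\<And>u. norm u < r \<Longrightarrow> \<exists>e>0. \<forall>\<zeta>\<in>ball 0 e. f (w + \<zeta> *s u) = 0"
   and z: "z \<in> ball w r"
  shows "f z = 0"
proof -
  define u where "u = z - w"
  have u: "norm u < r" using z by (simp add: u_def dist_norm norm_minus_commute)
  define R where "R = (if u = 0 then 2 else r / norm u)"
  have "0 < R" "1 < R" using u using le_less_trans[OF norm_ge_zero u] by (auto simp: R_def)
  have hol: "(\<lambda>\<zeta>. f (w + \<zeta> *s u)) holomorphic_on ball 0 R"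
  proof (rule holomorphic_on_line[OF f])
   fix \<zeta> :: complex assume *: "\<zeta> \<in> ball 0 R"
   have "norm (\<zeta> *s u) < r"
   proof (cases "u = 0")
    case False
    thus ?thesis using * by (simp add: R_def norm_smult pos_less_divide_eq)
   qed (use u in simp)
   thus "w + \<zeta> *s u \<in> U" using U by (auto simp: dist_norm subset_iff)
  qed
  obtain e where e: "e > 0" "\<forall>\<zeta>\<in>ball 0 e. f (w + \<zeta> *s u) = 0" using line[OF u] by blast
  have "f (w + 1 *s u) = 0"
  proof (rule analytic_continuation_open[of "ball 0 (min e R)" "ball 0 R" "\<lambda>\<zeta>. f (w + \<zeta> *s u)" "\<lambda>_. 0"])
   show "ball 0 (min e R) \<noteq> ({}::complex set)" using e \<open>0 < R\<close> by simp
  qed (use e hol \<open>1 < R\<close> in auto)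
  thus ?thesis by (simp add: u_def)
qed

lemma holomorphic_fun_identity:
  fixes f :: "complex^'n \<Rightarrow> complex"
  assumes f: "holomorphic_fun U f" and U: "open U" "connected U"
   and w: "ball w e \<subseteq> U" "0 < e" "\<And>z. z \<in> ball w e \<Longrightarrow> f z = 0" and z: "z \<in> U"
  shows "f z = 0"
proof -
  define Z where "Z = {z \<in> U. \<exists>r>0. ball z r \<subseteq> U \<and> (\<forall>y\<in>ball z r. f y = 0)}"
  have "openin (top_of_set U) Z"
  proof -
   have "open Z"
    unfolding open_contains_ball
   proof
    fix x assume "x \<in> Z"
    then obtain r where r: "r > 0" "ball x r \<subseteq> U" "\<forall>y\<in>ball x r. f y = 0" by (auto simp: Z_def)
    have "ball x r \<subseteq> Z"
    proof
     fix y assume y: "y \<in> ball x r"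
     then obtain s where "s > 0" "ball y s \<subseteq> ball x r"
      using open_contains_ball open_ball by metis
     thus "y \<in> Z" using r y unfolding Z_def by blast
    qed
    thus "\<exists>e>0. ball x e \<subseteq> Z" using r by blast
   qed
   thus ?thesis by (simp add: Z_def open_openin_trans openin_open_eq U Collect_restrict)
  qed
  moreover have "closedin (top_of_set U) Z"
  proof -
   have "x \<in> Z" if x: "x \<in> U" "x \<in> closure Z" for x
   proof -
    obtain r where r: "r > 0" "ball x r \<subseteq> U" using U(1) x(1) open_contains_ball by blast
    obtain y where y: "y \<in> Z" "dist y x < r / 2" using x(2) r by (meson closure_approachable half_gt_zero)
    obtain s where s: "s > 0" "\<forall>y'\<in>ball y s. f y' = 0" using y(1) by (auto simp: Z_def)
    have sub: "ball y (r/2) \<subseteq> U"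
    proof
     fix y' assume "y' \<in> ball y (r/2)"
     hence "dist x y' < r" using y(2) dist_triangle_half_r[of y x r y'] by (simp add: dist_commute)
     thus "y' \<in> U" using r by auto
    qed
    have zero: "f y' = 0" if "y' \<in> ball y (r/2)" for y'
    proof (rule holomorphic_fun_zero_ball[OF f sub _ that])
     fix u :: "complex^'n"
     have "norm (\<zeta> *s u) < s" if "\<zeta> \<in> ball 0 (s / (norm u + 1))" for \<zeta>
     proof -
      have pos: "0 < norm u + 1" by (rule add_nonneg_pos) auto
      have "cmod \<zeta> * norm u \<le> cmod \<zeta> * (norm u + 1)" by (rule mult_left_mono) auto
      also have "\<dots> < s" using that pos by (simp add: pos_less_divide_eq)
      finally show ?thesis by (simp add: norm_smult)
     qed
     hence "\<forall>\<zeta>\<in>ball 0 (s / (norm u + 1)). f (y + \<zeta> *s u) = 0"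
      using s(2) by (auto simp: dist_norm)
     moreover have "0 < s / (norm u + 1)" using s(1) by (intro divide_pos_pos add_nonneg_pos) auto
     ultimately show "\<exists>e>0. \<forall>\<zeta>\<in>ball 0 e. f (y + \<zeta> *s u) = 0" by blast
    qed
    have "x \<in> ball y (r/2)" using y(2) by simp
    then obtain t where "t > 0" "ball x t \<subseteq> ball y (r/2)" using open_contains_ball open_ball by metis
    thus "x \<in> Z" using zero sub x unfolding Z_def by blast
   qed
   moreover have "Z \<subseteq> U" by (auto simp: Z_def)
   ultimately have "Z = U \<inter> closure Z" using closure_subset by blast
   thus ?thesis unfolding closedin_closed using closed_closure by blast
  qed
  moreover have "w \<in> Z" using w by (auto simp: Z_def)
  ultimately have "Z = U" using U(2) unfolding connected_clopen by blast
  thus ?thesis using z by (force simp: Z_def)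
qed

lemma holomorphic_fun_dd_funpow:
  assumes "holomorphic_fun U f" "open U"
  shows "holomorphic_fun U ((dd u ^^ k) f)"
  by (induction k) (auto intro: holomorphic_fun_dd assms)

lemma higher_deriv_line:
  fixes f :: "complex^'n \<Rightarrow> complex"
  assumes f: "holomorphic_fun U f" and U: "open U" and "w + \<zeta> *s u \<in> U"
  shows "(deriv ^^ k) (\<lambda>\<zeta>. f (w + \<zeta> *s u)) \<zeta> = (dd u ^^ k) f (w + \<zeta> *s u)"
  using assms(3)
proof (induction k arbitrary: \<zeta>)
  case (Suc k)
  define S where "S = {\<zeta>. w + \<zeta> *s u \<in> U}"
  have "open S"
  proof -
   have "continuous_on UNIV (\<lambda>\<zeta>. w + \<zeta> *s u)"
    by (intro continuous_intros linear_continuous_on bounded_linear_smult_left)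
   thus ?thesis unfolding S_def using U by (simp add: open_vimage[unfolded vimage_def])
  qed
  hence ev: "\<forall>\<^sub>F \<xi> in nhds \<zeta>. \<xi> \<in> S"
   using Suc.prems by (intro eventually_nhds_in_open) (auto simp: S_def)
  have "(deriv ^^ Suc k) (\<lambda>\<zeta>. f (w + \<zeta> *s u)) \<zeta> = deriv (\<lambda>\<zeta>. (dd u ^^ k) f (w + \<zeta> *s u)) \<zeta>"
   unfolding funpow.simps o_def
   by (rule deriv_cong_ev[OF _ refl]) (use ev in eventually_elim, simp add: S_def Suc.IH)
  also have "\<dots> = (dd u ^^ Suc k) f (w + \<zeta> *s u)"
   using DERIV_imp_deriv[OF holomorphic_fun_line[OF holomorphic_fun_dd_funpow[OF f U, where u=u and k=k] Suc.prems]]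
   by (simp add: dd_def)
  finally show ?case .
qed simp

text \<open>
  A vanishing jet makes \<open>f\<close> vanish on every complex line through \<open>w\<close> inside a ball, and then the identity theorem
  applies.
\<close>

lemma holomorphic_fun_zero_jet:
  fixes f :: "complex^'n \<Rightarrow> complex"
  assumes f: "holomorphic_fun U f" and U: "open U" "connected U" and w: "w \<in> U"
   and jet: "\<And>u k. (dd u ^^ k) f w = 0" and z: "z \<in> U"
  shows "f z = 0"
proof -
  obtain r where r: "0 < r" "ball w r \<subseteq> U" using U(1) w open_contains_ball by blast
  have "f y = 0" if y: "y \<in> ball w r" for y
  proof (rule holomorphic_fun_zero_ball[OF f r(2) _ y])
   fix u :: "complex^'n" assume u: "norm u < r"
   have inU: "w + \<zeta> *s u \<in> U" if "\<zeta> \<in> ball 0 1" for \<zeta>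
   proof -
    have "cmod \<zeta> * norm u \<le> 1 * norm u" using that by (intro mult_right_mono) auto
    thus ?thesis using u r(2) by (auto simp: dist_norm norm_smult subset_iff)
   qed
   have "f (w + \<zeta> *s u) = 0" if "\<zeta> \<in> ball 0 1" for \<zeta>
   proof (rule holomorphic_fun_eq_0_on_ball[OF _ that])
    show "(\<lambda>\<zeta>. f (w + \<zeta> *s u)) holomorphic_on ball 0 1" by (rule holomorphic_on_line[OF f inU])
    show "(deriv ^^ n) (\<lambda>\<zeta>. f (w + \<zeta> *s u)) 0 = 0" for n
     using higher_deriv_line[OF f U(1), of w 0 u n] w jet by simp
   qed
   thus "\<exists>e>0. \<forall>\<zeta>\<in>ball 0 e. f (w + \<zeta> *s u) = 0" by (intro exI[of _ 1]) auto
  qed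
  thus ?thesis using holomorphic_fun_identity[OF f U r(2,1) _ z] by blast
qed

section \<open>Sesquiholomorphic kernels\<close>

text \<open>
  The regularity shared by all kernels below. Separate holomorphy together with local bounds is what the Cauchy
  estimates need to yield differentiability in both variables jointly.
\<close>

definition sesqui :: "(complex^'n) set \<Rightarrow> (complex^'n \<Rightarrow> complex^'n \<Rightarrow> complex) \<Rightarrow> bool" where
  "sesqui U G \<longleftrightarrow>
    (\<forall>w\<in>U. holomorphic_fun U (\<lambda>z. G z w)) \<and>
    (\<forall>z\<in>U. holomorphic_fun U (\<lambda>w. cnj (G z w))) \<and>
    (\<forall>z\<in>U. \<forall>w\<in>U. \<exists>r>0. \<exists>B. cball z r \<subseteq> U \<and> cball w r \<subseteq> U \<and>
     (\<forall>z'\<in>cball z r. \<forall>w'\<in>cball w r. cmod (G z' w') \<le> B))"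

definition adj :: "(complex^'n \<Rightarrow> complex^'n \<Rightarrow> complex) \<Rightarrow> complex^'n \<Rightarrow> complex^'n \<Rightarrow> complex" where
  "adj G z w = cnj (G w z)"

definition d1 :: "complex^'n \<Rightarrow> (complex^'n \<Rightarrow> complex^'n \<Rightarrow> complex) \<Rightarrow> complex^'n \<Rightarrow> complex^'n \<Rightarrow> complex" where
  "d1 v G z w = dd v (\<lambda>z. G z w) z"

definition d2 :: "complex^'n \<Rightarrow> (complex^'n \<Rightarrow> complex^'n \<Rightarrow> complex) \<Rightarrow> complex^'n \<Rightarrow> complex^'n \<Rightarrow> complex" where
  "d2 v G = adj (d1 v (adj G))"

lemma adj_adj [simp]: "adj (adj G) = G" by (simp add: adj_def fun_eq_iff)

lemma sesqui_adj: "sesqui U G \<Longrightarrow> sesqui U (adj G)"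
  unfolding sesqui_def adj_def complex_cnj_cnj complex_mod_cnj
proof (elim conjE, intro conjI ballI)
  fix z w assume zw: "z \<in> U" "w \<in> U"
   and b: "\<forall>z\<in>U. \<forall>w\<in>U. \<exists>r>0. \<exists>B. cball z r \<subseteq> U \<and> cball w r \<subseteq> U \<and>
     (\<forall>z'\<in>cball z r. \<forall>w'\<in>cball w r. cmod (G z' w') \<le> B)"
  from b[rule_format, OF zw(2,1)] show "\<exists>r>0. \<exists>B. cball z r \<subseteq> U \<and> cball w r \<subseteq> U \<and>
     (\<forall>z'\<in>cball z r. \<forall>w'\<in>cball w r. cmod (G w' z') \<le> B)" by blast
qed auto

lemma sesqui_bound:
  assumes "sesqui U G" "z \<in> U" "w \<in> U"
  obtains r B where "0 < r" "cball z (2 * r) \<subseteq> U" "cball w (2 * r) \<subseteq> U" "0 < B"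
   "\<And>z' w'. z' \<in> cball z (2 * r) \<Longrightarrow> w' \<in> cball w (2 * r) \<Longrightarrow> cmod (G z' w') \<le> B"
proof -
  obtain r B where "r > 0" "cball z r \<subseteq> U" "cball w r \<subseteq> U"
   "\<forall>z'\<in>cball z r. \<forall>w'\<in>cball w r. cmod (G z' w') \<le> B"
   using assms unfolding sesqui_def by blast
  thus ?thesis by (intro that[of "r/2" "\<bar>B\<bar> + 1"]) force+
qed

lemma cball_subset_double: "z' \<in> cball z r \<Longrightarrow> cball z' r \<subseteq> cball z (2 * r)"
proof
  fix x assume "z' \<in> cball z r" "x \<in> cball z' r"
  thus "x \<in> cball z (2 * r)" using dist_triangle[of z x z'] by simp
qed

lemma uniform_limit_conv_le:
  fixes F :: "nat \<Rightarrow> 'a \<Rightarrow> complex"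
  assumes est: "\<And>n x. x \<in> S \<Longrightarrow> cmod (F n x - g x) \<le> C / (K * real (Suc n))"
  shows "uniform_limit S F g sequentially"
proof (rule uniform_limitI)
  fix e :: real assume "0 < e"
  have "(\<lambda>n. (C / K) * inverse (real (Suc n))) \<longlonglongrightarrow> (C / K) * 0"
   by (intro tendsto_intros LIMSEQ_inverse_real_of_nat)
  hence "(\<lambda>n. C / (K * real (Suc n))) \<longlonglongrightarrow> 0" by (simp add: divide_simps mult_ac)
  hence "\<forall>\<^sub>F n in sequentially. C / (K * real (Suc n)) < e" using \<open>0 < e\<close> by (auto dest: order_tendstoD)
  thus "\<forall>\<^sub>F n in sequentially. \<forall>x\<in>S. dist (F n x) (g x) < e"
   by eventually_elim (metis dist_norm est le_less_trans)
qed

lemma d1_scale_bound: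
  fixes G :: "complex^'n \<Rightarrow> complex^'n \<Rightarrow> complex"
  assumes hol: "holomorphic_fun U (\<lambda>z. G z w)" and U: "open U" "cball z r \<subseteq> U" "0 < r"
   and B: "\<And>z'. z' \<in> cball z r \<Longrightarrow> cmod (G z' w) \<le> B"
  shows "cmod (d1 v G z w) \<le> 2 * B * (norm v / r)"
proof (cases "v = 0")
  case True
  have "z \<in> U" using U by auto
  have "d1 0 G z w = 0" using holomorphic_funD(2)[OF hol \<open>z \<in> U\<close>, of 0 0] by (simp add: d1_def dd_def)
  thus ?thesis using True by simp
next
  case False
  have "z \<in> U" using U by auto
  define c where "c = complex_of_real (norm v / r)"
  define u where "u = (1 / c) *s v"
  have c: "c \<noteq> 0" "cmod c = norm v / r" using False U by (auto simp: c_def norm_divide)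
  have u: "norm u = r" "v = c *s u" using c False U by (auto simp: u_def norm_smult norm_divide)
  have "cmod (d1 u G z w) \<le> 2 * B * (norm u / r)"
   unfolding d1_def dd_def using u by (intro taylor_estimate(3)[OF hol U B]) auto
  moreover have "d1 v G z w = c * d1 u G z w"
   unfolding u(2) d1_def dd_def by (rule holomorphic_funD(2)[OF hol \<open>z \<in> U\<close>])
  ultimately have "cmod (d1 v G z w) = norm v / r * cmod (d1 u G z w)" and "cmod (d1 u G z w) \<le> 2 * B"
   using c(2) u(1) U by (simp_all add: norm_mult)
  thus ?thesis using mult_left_mono[of "cmod (d1 u G z w)" "2 * B" "norm v / r"] U by (simp add: mult_ac)
qed

lemma sesqui_d1:
  assumes G: "sesqui U G" and U: "open U"
  shows "sesqui U (d1 v G)"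
  unfolding sesqui_def
proof (intro conjI ballI)
  have hol1: "holomorphic_fun U (\<lambda>z. G z w)" if "w \<in> U" for w
   using G that by (auto simp: sesqui_def)
  have hol2: "holomorphic_fun U (\<lambda>w. cnj (G z w))" if "z \<in> U" for z
   using G that by (auto simp: sesqui_def)
  show "holomorphic_fun U (\<lambda>z. d1 v G z w)" if "w \<in> U" for w
   unfolding d1_def using holomorphic_fun_dd[OF hol1[OF that] U, of v] by (simp add: fun_eq_iff)
  show "\<exists>r>0. \<exists>B. cball z r \<subseteq> U \<and> cball w r \<subseteq> U \<and>
    (\<forall>z'\<in>cball z r. \<forall>w'\<in>cball w r. cmod (d1 v G z' w') \<le> B)" if zw: "z \<in> U" "w \<in> U" for z w
  proof -
   obtain r B where r: "0 < r" "cball z (2 * r) \<subseteq> U" "cball w (2 * r) \<subseteq> U" "0 < B"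
    and B: "\<And>z' w'. z' \<in> cball z (2 * r) \<Longrightarrow> w' \<in> cball w (2 * r) \<Longrightarrow> cmod (G z' w') \<le> B"
    using sesqui_bound[OF G zw] by metis
   have "cball z r \<subseteq> U" "cball w r \<subseteq> U" "cball w r \<subseteq> cball w (2 * r)" using r by (auto simp: subset_iff)
   moreover have "cmod (d1 v G z' w') \<le> 2 * B * (norm v / r)" if "z' \<in> cball z r" "w' \<in> cball w r" for z' w'
   proof (rule d1_scale_bound[OF hol1 U _ r(1)])
    show "w' \<in> U" using that \<open>cball w r \<subseteq> U\<close> by auto
    show "cball z' r \<subseteq> U" using cball_subset_double[OF that(1)] r by auto
    show "cmod (G y w') \<le> B" if "y \<in> cball z' r" for y
     using cball_subset_double[OF \<open>z' \<in> cball z r\<close>] that \<open>w' \<in> cball w r\<close> \<open>cball w r \<subseteq> cball w (2 * r)\<close>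
     by (intro B) auto
   qed
   ultimately show ?thesis using r(1) by blast
  qed
  show "holomorphic_fun U (\<lambda>w. cnj (d1 v G z w))" if z: "z \<in> U" for z
  proof (rule holomorphic_fun_local)
   fix w0 assume w0: "w0 \<in> U"
   obtain r B where r: "0 < r" "cball z (2 * r) \<subseteq> U" "cball w0 (2 * r) \<subseteq> U" "0 < B"
    and B: "\<And>z' w'. z' \<in> cball z (2 * r) \<Longrightarrow> w' \<in> cball w0 (2 * r) \<Longrightarrow> cmod (G z' w') \<le> B"
    using sesqui_bound[OF G z w0] by metis
   define K where "K = norm v / r + 1"
   have K: "0 < K" using r by (simp add: K_def add_nonneg_pos)
   define c where "c n = K * real (Suc n)" for n
   have c: "0 < c n" "norm v / r \<le> c n" for n
   proof -
    show "0 < c n" using K by (simp add: c_def)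
    have "norm v / r \<le> K * 1" by (simp add: K_def)
    also have "\<dots> \<le> c n" unfolding c_def using K by (intro mult_left_mono) auto
    finally show "norm v / r \<le> c n" .
   qed
   define F where "F n w = cnj (of_real (c n) * (G (z + of_real (1 / c n) *s v) w - G z w))" for n w
   have zin: "z + of_real (1 / c n) *s v \<in> U" for n
   proof -
    have "norm v / c n \<le> r" using c[of n] r by (simp add: field_simps)
    hence "z + of_real (1 / c n) *s v \<in> cball z (2 * r)"
     using c[of n] r by (simp add: dist_norm norm_smult norm_divide)
    thus ?thesis using r by blast
   qed
   have sub: "ball w0 r \<subseteq> U" using r by (auto simp: subset_iff)
   have est: "cmod (F n w - cnj (d1 v G z w)) \<le> (4 * B * (norm v / r)\<^sup>2) / (K * real (Suc n))"
    if "w \<in> ball w0 r" for n w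
   proof -
    have w: "w \<in> U" "w \<in> cball w0 (2 * r)" using that sub r by (auto simp: subset_iff)
    have "cmod (of_real (c n) * (G (z + of_real (1 / c n) *s v) w - G z w) - dd v (\<lambda>z. G z w) z)
      \<le> 4 * B * (norm v / r)\<^sup>2 / c n"
    proof (rule difference_quotient_estimate[OF hol1[OF w(1)] U _ r(1) _ c])
     show "cball z r \<subseteq> U" using r by (auto simp: subset_iff)
     show "cmod (G y w) \<le> B" if "y \<in> cball z r" for y using that r by (intro B w) auto
    qed
    moreover have "F n w - cnj (d1 v G z w) =
      cnj (of_real (c n) * (G (z + of_real (1 / c n) *s v) w - G z w) - dd v (\<lambda>z. G z w) z)"
     by (simp add: F_def d1_def)
    ultimately show ?thesis by (metis c_def complex_mod_cnj)
   qed
   have "holomorphic_fun (ball w0 r) (\<lambda>w. cnj (d1 v G z w))"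
   proof (rule holomorphic_fun_limit[where f = F])
    show "holomorphic_fun (ball w0 r) (F n)" for n
     unfolding F_def complex_cnj_mult complex_cnj_diff
     by (intro holomorphic_fun_cmult holomorphic_fun_diff holomorphic_fun_subset[OF hol2 sub] z zin)
    show "\<exists>s>0. cball w s \<subseteq> ball w0 r \<and> uniform_limit (cball w s) F (\<lambda>w. cnj (d1 v G z w)) sequentially"
     if "w \<in> ball w0 r" for w
    proof -
     obtain s where s: "0 < s" "cball w s \<subseteq> ball w0 r"
      using \<open>w \<in> ball w0 r\<close> open_contains_cball open_ball by metis
     have "uniform_limit (cball w s) F (\<lambda>w. cnj (d1 v G z w)) sequentially"
      by (rule uniform_limit_conv_le[OF est]) (use s in auto)
     thus ?thesis using s by blast
    qed
   qed auto
   thus "\<exists>V. w0 \<in> V \<and> holomorphic_fun V (\<lambda>w. cnj (d1 v G z w))"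
    using r by (intro exI[of _ "ball w0 r"]) auto
  qed
qed

lemma sesqui_d2: "sesqui U G \<Longrightarrow> open U \<Longrightarrow> sesqui U (d2 v G)"
  unfolding d2_def by (intro sesqui_adj sesqui_d1)

lemma d1_scale: "sesqui U G \<Longrightarrow> z \<in> U \<Longrightarrow> w \<in> U \<Longrightarrow> d1 (c *s v) G z w = c * d1 v G z w"
  unfolding d1_def dd_def by (rule holomorphic_funD(2)[of U]) (auto simp: sesqui_def)

lemma d2_scale: "sesqui U G \<Longrightarrow> z \<in> U \<Longrightarrow> w \<in> U \<Longrightarrow> d2 (c *s v) G z w = cnj c * d2 v G z w"
  using d1_scale[OF sesqui_adj, of U G w z c v] by (simp add: d2_def adj_def)

lemma linear_d1: "sesqui U G \<Longrightarrow> z \<in> U \<Longrightarrow> w \<in> U \<Longrightarrow> linear (\<lambda>v. d1 v G z w)"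
  unfolding d1_def dd_def by (rule has_derivative_linear[OF holomorphic_funD(1)[of U]]) (auto simp: sesqui_def)

lemma linear_d2: "sesqui U G \<Longrightarrow> z \<in> U \<Longrightarrow> w \<in> U \<Longrightarrow> linear (\<lambda>v. d2 v G z w)"
  using linear_compose[OF linear_d1[OF sesqui_adj, of U G w z] bounded_linear.linear[OF bounded_linear_cnj]]
  by (simp add: d2_def adj_def[abs_def] o_def)

text \<open>The Taylor estimates of the first variable are applied to \<open>G\<close>, and those of the second one to \<open>G\<close> and \<open>d1 u G\<close>.\<close>

lemma sesqui_taylor:
  fixes G :: "complex^'n \<Rightarrow> complex^'n \<Rightarrow> complex"
  assumes G: "sesqui U G" and U: "open U" and zw: "z \<in> U" "w \<in> U"
  obtains r C where "0 < r" "0 < C" "\<And>u v. norm u \<le> r \<Longrightarrow> norm v \<le> r \<Longrightarrow>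
   cmod (G (z + u) (w + v) - G z w - (d1 u G z w + d2 v G z w)) \<le> C * (norm u + norm v)\<^sup>2"
proof -
  have hol1: "holomorphic_fun U (\<lambda>z. G z w)" if "w \<in> U" for w
   using G that by (auto simp: sesqui_def)
  have hol2: "holomorphic_fun U (\<lambda>w. cnj (G z w))" if "z \<in> U" for z
   using G that by (auto simp: sesqui_def)
  obtain r B where r: "0 < r" "cball z (2 * r) \<subseteq> U" "cball w (2 * r) \<subseteq> U" "0 < B"
   and B: "\<And>z' w'. z' \<in> cball z (2 * r) \<Longrightarrow> w' \<in> cball w (2 * r) \<Longrightarrow> cmod (G z' w') \<le> B"
   using sesqui_bound[OF G zw] by metis
  have sub: "cball z r \<subseteq> cball z (2 * r)" "cball w r \<subseteq> cball w (2 * r)" using r by (auto simp: subset_iff)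
  hence subU: "cball z r \<subseteq> U" "cball w r \<subseteq> U" using r by auto
  have "cmod (G (z + u) (w + v) - G z w - (d1 u G z w + d2 v G z w)) \<le> (4 * B / r\<^sup>2) * (norm u + norm v)\<^sup>2"
   if u: "norm u \<le> r" and v: "norm v \<le> r" for u v
  proof -
   have wv: "w + v \<in> cball w r" "w + v \<in> U" using v subU by (auto simp: dist_norm subset_iff)
   have 1: "cmod (G (z + u) (w + v) - G z (w + v) - d1 u G z (w + v)) \<le> 4 * B * (norm u / r)\<^sup>2"
    unfolding d1_def dd_def
    by (rule taylor_estimate(2)[OF hol1[OF wv(2)] U subU(1) r(1) _ u]) (use B sub wv in blast)
   have 3: "cmod (G z (w + v) - G z w - d2 v G z w) \<le> 4 * B * (norm v / r)\<^sup>2"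
   proof -
    have "cmod (cnj (G z (w + v)) - cnj (G z w) - d1 v (adj G) w z) \<le> 4 * B * (norm v / r)\<^sup>2"
     unfolding d1_def dd_def adj_def
     by (rule taylor_estimate(2)[OF hol2[OF zw(1)] U subU(2) r(1) _ v])
      (use B[of z] sub r in auto)
    moreover have "cnj (G z (w + v)) - cnj (G z w) - d1 v (adj G) w z = cnj (G z (w + v) - G z w - d2 v G z w)"
     by (simp add: d2_def adj_def)
    ultimately show ?thesis by (metis complex_mod_cnj)
   qed
   have 2: "cmod (d1 u G z (w + v) - d1 u G z w) \<le> 2 * (2 * B * (norm u / r)) * (norm v / r)"
   proof -
    have "holomorphic_fun U (\<lambda>w. cnj (d1 u G z w))" using sesqui_d1[OF G U] zw by (auto simp: sesqui_def)
    moreover have "cmod (cnj (d1 u G z w')) \<le> 2 * B * (norm u / r)" if w': "w' \<in> cball w r" for w'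
     unfolding complex_mod_cnj
     by (rule d1_scale_bound[OF hol1 U subU(1) r(1)]) (use w' subU B sub in blast)+
    ultimately have "cmod (cnj (d1 u G z (w + v)) - cnj (d1 u G z w)) \<le> 2 * (2 * B * (norm u / r)) * (norm v / r)"
     using taylor_estimate(1)[OF _ U subU(2) r(1) _ v] by blast
    thus ?thesis by (metis complex_cnj_diff complex_mod_cnj)
   qed
   have "G (z + u) (w + v) - G z w - (d1 u G z w + d2 v G z w) =
     (G (z + u) (w + v) - G z (w + v) - d1 u G z (w + v)) + (d1 u G z (w + v) - d1 u G z w)
     + (G z (w + v) - G z w - d2 v G z w)" by simp
   hence "cmod (G (z + u) (w + v) - G z w - (d1 u G z w + d2 v G z w)) \<le>
     4 * B * (norm u / r)\<^sup>2 + 2 * (2 * B * (norm u / r)) * (norm v / r) + 4 * B * (norm v / r)\<^sup>2"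
    using 1 2 3 by (smt (verit, ccfv_SIG) norm_triangle_ineq)
   also have "\<dots> \<le> (4 * B / r\<^sup>2) * (norm u + norm v)\<^sup>2"
   proof -
    have "(4 * B / r\<^sup>2) * (norm u + norm v)\<^sup>2 - (4 * B * (norm u / r)\<^sup>2 + 2 * (2 * B * (norm u / r)) * (norm v / r) + 4 * B * (norm v / r)\<^sup>2)
      = 4 * B * (norm u / r) * (norm v / r)"
     using r by (simp add: field_simps power2_eq_square)
    also have "\<dots> \<ge> 0" using r by simp
    finally show ?thesis by linarith
   qed
   finally show ?thesis .
  qed
  moreover have "0 < 4 * B / r\<^sup>2" using r by simp
  ultimately show ?thesis using that r(1) by blast
qed

lemma sesqui_has_derivative_diag:
  assumes G: "sesqui U G" and U: "open U" and z: "z \<in> U"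
  shows "((\<lambda>z. G z z) has_derivative (\<lambda>u. d1 u G z z + d2 u G z z)) (at z)"
proof -
  obtain r C where r: "0 < r" "0 < C" "\<And>u v. norm u \<le> r \<Longrightarrow> norm v \<le> r \<Longrightarrow>
   cmod (G (z + u) (z + v) - G z z - (d1 u G z z + d2 v G z z)) \<le> C * (norm u + norm v)\<^sup>2"
   using sesqui_taylor[OF G U z z] by metis
  show ?thesis
  proof (rule has_derivative_quadratic[where C = "4 * C", OF _ r(1)])
   show "bounded_linear (\<lambda>u. d1 u G z z + d2 u G z z)"
    using linear_compose_add[OF linear_d1[OF G z z] linear_d2[OF G z z]]
    by (simp add: linear_conv_bounded_linear)
   show "cmod (G (z + v) (z + v) - G z z - (d1 v G z z + d2 v G z z)) \<le> 4 * C * (norm v)\<^sup>2"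
    if "norm v \<le> r" for v
    using r(3)[OF that that] by (simp add: power2_eq_square algebra_simps)
  qed
qed

lemma sesqui_diff: "sesqui U G \<Longrightarrow> sesqui U H \<Longrightarrow> sesqui U (\<lambda>z w. G z w - H z w)"
  unfolding sesqui_def
proof (intro conjI ballI; elim conjE)
  fix z w assume zw: "z \<in> U" "w \<in> U"
   and G: "\<forall>z\<in>U. \<forall>w\<in>U. \<exists>r>0. \<exists>B. cball z r \<subseteq> U \<and> cball w r \<subseteq> U \<and>
     (\<forall>z'\<in>cball z r. \<forall>w'\<in>cball w r. cmod (G z' w') \<le> B)"
   and H: "\<forall>z\<in>U. \<forall>w\<in>U. \<exists>r>0. \<exists>B. cball z r \<subseteq> U \<and> cball w r \<subseteq> U \<and>
     (\<forall>z'\<in>cball z r. \<forall>w'\<in>cball w r. cmod (H z' w') \<le> B)"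
  obtain r B where r: "r > 0" "cball z r \<subseteq> U" "cball w r \<subseteq> U"
   "\<forall>z'\<in>cball z r. \<forall>w'\<in>cball w r. cmod (G z' w') \<le> B" using G zw by blast
  obtain s C where s: "s > 0" "cball z s \<subseteq> U" "cball w s \<subseteq> U"
   "\<forall>z'\<in>cball z s. \<forall>w'\<in>cball w s. cmod (H z' w') \<le> C" using H zw by blast
  have "cmod (G z' w' - H z' w') \<le> B + C" if "z' \<in> cball z (min r s)" "w' \<in> cball w (min r s)" for z' w'
  proof -
   have "cmod (G z' w') \<le> B" "cmod (H z' w') \<le> C" using r(4) s(4) that by auto
   thus ?thesis using norm_triangle_ineq4[of "G z' w'" "H z' w'"] by linarith
  qed
  moreover have "cball z (min r s) \<subseteq> U" "cball w (min r s) \<subseteq> U" using r(2,3) by auto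
  ultimately show "\<exists>r>0. \<exists>B. cball z r \<subseteq> U \<and> cball w r \<subseteq> U \<and>
     (\<forall>z'\<in>cball z r. \<forall>w'\<in>cball w r. cmod (G z' w' - H z' w') \<le> B)"
   using r(1) s(1) by (intro exI[of _ "min r s"] exI[of _ "B + C"] conjI ballI) simp_all
qed (auto intro!: holomorphic_fun_diff)

lemma sesqui_cmult_power:
  assumes "sesqui U G" shows "sesqui U (\<lambda>z w. c * G z w ^ k)"
  unfolding sesqui_def
proof (intro conjI ballI)
  fix z w assume zw: "z \<in> U" "w \<in> U"
  obtain r B where r: "r > 0" "cball z r \<subseteq> U" "cball w r \<subseteq> U"
   "\<forall>z'\<in>cball z r. \<forall>w'\<in>cball w r. cmod (G z' w') \<le> B" using assms zw unfolding sesqui_def by blast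
  hence "\<forall>z'\<in>cball z r. \<forall>w'\<in>cball w r. cmod (c * G z' w' ^ k) \<le> cmod c * B ^ k"
   by (auto simp: norm_mult norm_power intro!: mult_left_mono power_mono)
  thus "\<exists>r>0. \<exists>B. cball z r \<subseteq> U \<and> cball w r \<subseteq> U \<and>
     (\<forall>z'\<in>cball z r. \<forall>w'\<in>cball w r. cmod (c * G z' w' ^ k) \<le> B)" using r by blast
qed (use assms in \<open>auto simp: sesqui_def intro!: holomorphic_fun_mult holomorphic_fun_power holomorphic_fun_const\<close>)

text \<open>
  Comparing the derivatives of \<open>G z z\<close> in the directions \<open>u\<close> and \<open>\<i> *s u\<close> separates the holomorphic derivative
  from the antiholomorphic one, so \<open>d1 u G\<close> vanishes on the diagonal as well. Iteration gives a vanishing jet of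
  the first variable.
\<close>

lemma sesqui_eq_on_diagonal:
  assumes G: "sesqui U G" and U: "open U" "connected U"
   and diag: "\<And>z. z \<in> U \<Longrightarrow> G z z = 0" and zw: "z \<in> U" "w \<in> U"
  shows "G z w = 0"
proof -
  have step: "d1 u H x x = 0" if H: "sesqui U H" "\<And>z. z \<in> U \<Longrightarrow> H z z = 0" and x: "x \<in> U" for H u x
  proof -
   have "((\<lambda>z. H z z) has_derivative (\<lambda>_. 0)) (at x)"
    by (rule has_derivative_transform_within_open[OF has_derivative_const U(1) x]) (simp add: H(2))
   hence eq: "d1 u H x x + d2 u H x x = 0" for u
    using has_derivative_unique[OF _ sesqui_has_derivative_diag[OF H(1) U(1) x]] by metis
   have "\<i> * d1 u H x x - \<i> * d2 u H x x = 0"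
    using eq[of "\<i> *s u"] by (simp add: d1_scale[OF H(1) x x] d2_scale[OF H(1) x x])
   thus ?thesis using eq[of u] by (simp add: algebra_simps)
  qed
  have "sesqui U ((d1 u ^^ k) G) \<and> (\<forall>x\<in>U. (d1 u ^^ k) G x x = 0)" for u k
  proof (induction k)
   case (Suc k)
   thus ?case using step[of "(d1 u ^^ k) G"] sesqui_d1[OF _ U(1)] by simp
  qed (use G diag in auto)
  moreover have "(d1 u ^^ k) G x w = (dd u ^^ k) (\<lambda>z. G z w) x" for u k x
   by (induction k arbitrary: x) (simp_all add: d1_def)
  ultimately have "(dd u ^^ k) (\<lambda>z. G z w) w = 0" for u k using zw by metis
  moreover have "holomorphic_fun U (\<lambda>z. G z w)" using G zw by (auto simp: sesqui_def)
  ultimately show ?thesis using holomorphic_fun_zero_jet[OF _ U zw(2) _ zw(1)] by blast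
qed

section \<open>Square integrable functions\<close>

definition nsq :: "'a measure \<Rightarrow> ('a \<Rightarrow> complex) \<Rightarrow> real" where
  "nsq M f = (LINT z|M. (cmod (f z))\<^sup>2)"

lemma nsq_nonneg: "0 \<le> nsq M f"
  by (simp add: nsq_def)

lemma square_integrable_mult:
  assumes "square_integrable M f" "square_integrable M g"
  shows "integrable M (\<lambda>z. f z * cnj (g z))"
proof (rule Bochner_Integration.integrable_bound)
  show "integrable M (\<lambda>z. (cmod (f z))\<^sup>2 + (cmod (g z))\<^sup>2)"
   using assms by (auto simp: square_integrable_def)
  have "cnj \<in> borel_measurable borel" by (intro borel_measurable_continuous_onI continuous_intros)
  thus "(\<lambda>z. f z * cnj (g z)) \<in> borel_measurable M"
   using assms by (auto simp: square_integrable_def intro!: borel_measurable_times measurable_compose[of g M borel cnj])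
  have "cmod (f z * cnj (g z)) \<le> (cmod (f z))\<^sup>2 + (cmod (g z))\<^sup>2" for z
  proof -
   have p: "0 \<le> cmod (f z) * cmod (g z)" by simp
   show ?thesis
    unfolding norm_mult complex_mod_cnj using p sum_squares_bound[of "cmod (f z)" "cmod (g z)"] by linarith
  qed
  thus "AE z in M. cmod (f z * cnj (g z)) \<le> norm ((cmod (f z))\<^sup>2 + (cmod (g z))\<^sup>2)" by simp
qed

lemma square_integrable_add:
  assumes "square_integrable M f" "square_integrable M g"
  shows "square_integrable M (\<lambda>z. f z + g z)"
  unfolding square_integrable_def
proof (intro conjI)
  show m: "(\<lambda>z. f z + g z) \<in> borel_measurable M" using assms by (auto simp: square_integrable_def)
  show "integrable M (\<lambda>z. (cmod (f z + g z))\<^sup>2)"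
  proof (rule Bochner_Integration.integrable_bound)
   show "integrable M (\<lambda>z. 2 * (cmod (f z))\<^sup>2 + 2 * (cmod (g z))\<^sup>2)"
    using assms by (auto simp: square_integrable_def)
   show "(\<lambda>z. (cmod (f z + g z))\<^sup>2) \<in> borel_measurable M" using m by measurable
   have "(cmod (f z + g z))\<^sup>2 \<le> 2 * (cmod (f z))\<^sup>2 + 2 * (cmod (g z))\<^sup>2" for z
   proof -
    have "(cmod (f z + g z))\<^sup>2 \<le> (cmod (f z) + cmod (g z))\<^sup>2"
     by (intro power_mono norm_triangle_ineq) auto
    also have "\<dots> \<le> 2 * (cmod (f z))\<^sup>2 + 2 * (cmod (g z))\<^sup>2"
     using sum_squares_bound[of "cmod (f z)" "cmod (g z)"] by (simp add: power2_sum)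
    finally show ?thesis .
   qed
   thus "AE z in M. norm ((cmod (f z + g z))\<^sup>2) \<le> norm (2 * (cmod (f z))\<^sup>2 + 2 * (cmod (g z))\<^sup>2)" by simp
  qed
qed

lemma square_integrable_cmult:
  "square_integrable M f \<Longrightarrow> square_integrable M (\<lambda>z. c * f z)"
  by (auto simp: square_integrable_def norm_mult power_mult_distrib)

lemma square_integrable_diff:
  "square_integrable M f \<Longrightarrow> square_integrable M g \<Longrightarrow> square_integrable M (\<lambda>z. f z - g z)"
  using square_integrable_add[OF _ square_integrable_cmult[of M g "-1"]] by simp

lemma l2_inner_self: "l2_inner M f f = of_real (nsq M f)"
  by (simp add: l2_inner_def nsq_def complex_norm_square[symmetric] del: of_real_power)

lemma l2_inner_cnj: "cnj (l2_inner M f g) = l2_inner M g f"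
proof -
  have "cnj (l2_inner M f g) = (LINT z|M. cnj (f z * cnj (g z)))"
   unfolding l2_inner_def by (rule Bochner_Integration.integral_cnj[symmetric])
  thus ?thesis by (simp add: l2_inner_def mult.commute)
qed

lemma l2_inner_diff_left:
  assumes "square_integrable M f" "square_integrable M g" "square_integrable M k"
  shows "l2_inner M (\<lambda>z. f z - g z) k = l2_inner M f k - l2_inner M g k"
  using assms by (simp add: l2_inner_def left_diff_distrib square_integrable_mult)

lemma l2_inner_cmult_left: "l2_inner M (\<lambda>z. c * f z) k = c * l2_inner M f k"
  by (simp add: l2_inner_def mult.assoc)

lemma l2_inner_diff_right:
  assumes "square_integrable M f" "square_integrable M g" "square_integrable M k"
  shows "l2_inner M k (\<lambda>z. f z - g z) = l2_inner M k f - l2_inner M k g"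
  using l2_inner_diff_left[OF assms] l2_inner_cnj by (metis complex_cnj_diff)

lemma l2_inner_cmult_right: "l2_inner M k (\<lambda>z. c * f z) = cnj c * l2_inner M k f"
  using l2_inner_cmult_left[of M c f k] l2_inner_cnj by (metis complex_cnj_mult)

lemma nsq_diff:
  assumes "square_integrable M f" "square_integrable M g"
  shows "nsq M (\<lambda>z. f z - g z) = nsq M f - 2 * Re (l2_inner M f g) + nsq M g"
proof -
  have "complex_of_real (nsq M (\<lambda>z. f z - g z)) =
    l2_inner M f f - l2_inner M g f - (l2_inner M f g - l2_inner M g g)"
   using assms by (simp add: l2_inner_self[symmetric] l2_inner_diff_left l2_inner_diff_right square_integrable_diff)
  moreover have "l2_inner M g f = cnj (l2_inner M f g)" by (simp add: l2_inner_cnj)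
  ultimately have "Re (complex_of_real (nsq M (\<lambda>z. f z - g z))) = nsq M f - Re (l2_inner M f g) - (Re (l2_inner M f g) - nsq M g)"
   by (simp add: l2_inner_self)
  thus ?thesis by simp
qed

lemma nsq_cmult: "nsq M (\<lambda>z. c * f z) = (cmod c)\<^sup>2 * nsq M f"
  by (simp add: nsq_def norm_mult power_mult_distrib)

lemma nsq_parallelogram:
  assumes f: "square_integrable M f" and g: "square_integrable M g"
  shows "nsq M (\<lambda>z. f z - g z) = 2 * nsq M f + 2 * nsq M g - nsq M (\<lambda>z. f z + g z)"
  using nsq_diff[OF f g] nsq_diff[OF f square_integrable_cmult[OF g, of "-1"]] nsq_cmult[of M "-1" g]
   l2_inner_cmult_right[of M f "-1" g] by simp

lemma l2_cauchy_schwarz: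
  assumes f: "square_integrable M f" and g: "square_integrable M g"
  shows "(cmod (l2_inner M f g))\<^sup>2 \<le> nsq M f * nsq M g"
proof -
  define b where "b = nsq M g"
  define c where "c = l2_inner M f g"
  have b: "0 \<le> b" by (simp add: b_def nsq_nonneg)
  show ?thesis
  proof (cases "b = 0")
   case True
   have "AE z in M. (cmod (g z))\<^sup>2 = 0"
    using True g unfolding b_def nsq_def square_integrable_def
    by (subst (asm) integral_nonneg_eq_0_iff_AE) auto
   hence "l2_inner M f g = (LINT z|M. 0)"
    unfolding l2_inner_def using square_integrable_mult[OF f g]
    by (intro integral_cong_AE) auto
   thus ?thesis by (simp add: nsq_nonneg)
  next
   case False
   have "0 \<le> nsq M (\<lambda>z. b * f z - c * g z)" by (rule nsq_nonneg)
   also have "\<dots> = b\<^sup>2 * nsq M f - 2 * Re (b * (cnj c * c)) + (cmod c)\<^sup>2 * b"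
    using f g b
    by (subst nsq_diff)
     (auto simp: square_integrable_cmult nsq_cmult l2_inner_cmult_left l2_inner_cmult_right c_def[symmetric] b_def[symmetric] norm_mult)
   also have "cnj c * c = of_real ((cmod c)\<^sup>2)" by (metis complex_norm_square mult.commute)
   finally have "0 \<le> b * (b * nsq M f - (cmod c)\<^sup>2)"
    by (simp add: power2_eq_square algebra_simps)
   thus ?thesis using False b by (simp add: zero_le_mult_iff b_def c_def mult.commute)
  qed
qed

section \<open>Weighted Bergman spaces\<close>

locale weighted_domain =
  fixes D :: "(complex^'n) set" and \<rho> :: "complex^'n \<Rightarrow> real"
  assumes open_D: "open D" and connected_D: "connected D"
   and cont_\<rho>: "continuous_on D \<rho>" and pos_\<rho>: "\<And>z. z \<in> D \<Longrightarrow> 0 < \<rho> z"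
begin

definition M :: "(complex^'n) measure" where
  "M = density (lebesgue_on D) (\<lambda>z. ennreal (\<rho> z))"

definition H :: "(complex^'n \<Rightarrow> complex) set" where
  "H = holomorphic_l2 D M"

lemma D_sets: "D \<in> sets lebesgue" "D \<in> sets borel"
  using open_D by auto

lemma measurable_continuous: "continuous_on D f \<Longrightarrow> f \<in> borel_measurable (lebesgue_on D)" for f :: "_ \<Rightarrow> 'b::{second_countable_topology, real_normed_vector}"
  using D_sets by (intro continuous_imp_measurable_on_sets_lebesgue) auto

lemma measurable_M [simp]: "borel_measurable M = borel_measurable (lebesgue_on D)"
  unfolding M_def by (rule measurable_cong_sets) auto

lemma space_M [simp]: "space M = D"
  by (simp add: M_def space_restrict_space)

lemma measurable_\<rho> [measurable]: "\<rho> \<in> borel_measurable (lebesgue_on D)"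
  by (rule measurable_continuous[OF cont_\<rho>])

lemma AE_\<rho>: "AE z in lebesgue_on D. 0 \<le> \<rho> z"
  using pos_\<rho> by (intro AE_I2) (auto simp: space_restrict_space less_imp_le)

lemma integral_M:
  fixes f :: "complex^'n \<Rightarrow> 'b::{second_countable_topology, banach}"
  assumes "f \<in> borel_measurable (lebesgue_on D)"
  shows "(LINT z|M. f z) = (LINT z|lebesgue_on D. \<rho> z *\<^sub>R f z)"
  unfolding M_def by (rule integral_density[OF assms measurable_\<rho> AE_\<rho>])

lemma integrable_M:
  fixes f :: "complex^'n \<Rightarrow> 'b::{second_countable_topology, banach}"
  assumes "f \<in> borel_measurable (lebesgue_on D)"
  shows "integrable M f \<longleftrightarrow> integrable (lebesgue_on D) (\<lambda>z. \<rho> z *\<^sub>R f z)"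
  unfolding M_def by (rule integrable_density[OF assms measurable_\<rho> AE_\<rho>])

lemma integral_lborel:
  fixes f :: "complex^'n \<Rightarrow> 'b::{second_countable_topology, banach}"
  assumes "(\<lambda>z. indicator D z *\<^sub>R f z) \<in> borel_measurable borel"
  shows "(LINT z|lebesgue_on D. f z) = (LINT z|lborel. indicator D z *\<^sub>R f z)"
   and "integrable (lebesgue_on D) f \<longleftrightarrow> integrable lborel (\<lambda>z. indicator D z *\<^sub>R f z)"
  using D_sets assms
  by (simp_all add: integral_restrict_space integrable_restrict_space integral_completion integrable_completion
    set_integrable_def)

lemma HD:
  assumes "f \<in> H"
  shows "holomorphic_fun D f" "square_integrable M f" "z \<notin> D \<Longrightarrow> f z = 0" "continuous_on D f"
  using assms holomorphic_fun_continuous by (auto simp: H_def holomorphic_l2_def)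

lemma H_add: "f \<in> H \<Longrightarrow> g \<in> H \<Longrightarrow> (\<lambda>z. f z + g z) \<in> H"
  by (auto simp: H_def holomorphic_l2_def holomorphic_fun_add square_integrable_add)

lemma H_cmult: "f \<in> H \<Longrightarrow> (\<lambda>z. c * f z) \<in> H"
  by (auto simp: H_def holomorphic_l2_def holomorphic_fun_cmult square_integrable_cmult)

lemma H_diff: "f \<in> H \<Longrightarrow> g \<in> H \<Longrightarrow> (\<lambda>z. f z - g z) \<in> H"
  by (auto simp: H_def holomorphic_l2_def holomorphic_fun_diff square_integrable_diff)

lemma H_zero: "(\<lambda>z. 0) \<in> H"
  by (auto simp: H_def holomorphic_l2_def holomorphic_fun_const square_integrable_def)

text \<open>By the mean value property, evaluation at \<open>w\<close> is the inner product with this element of \<open>L\<^sup>2\<close>.\<close>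

definition avg :: "complex^'n \<Rightarrow> real \<Rightarrow> complex^'n \<Rightarrow> complex" where
  "avg w r z = of_real (indicator (ball w r) z / (measure lborel (ball w r) * \<rho> z))"

lemma measure_ball_pos: "0 < r \<Longrightarrow> 0 < measure lborel (ball (w :: complex^'n) r)"
  using content_ball_pos by blast

lemma avg_indicator_borel:
  fixes g :: "_ \<Rightarrow> 'b::{second_countable_topology, real_normed_vector}"
  assumes "cball w r \<subseteq> D" "continuous_on D g"
  shows "(\<lambda>z. indicator (ball w r) z *\<^sub>R g z) \<in> borel_measurable borel"
  by (rule borel_measurable_continuous_on_indicator)
   (use assms(1) in \<open>auto intro!: continuous_on_subset[OF assms(2)]\<close>)

lemma avg_square_integrable:
  assumes r: "0 < r" "cball w r \<subseteq> D" and m: "0 < m" "\<And>z. z \<in> cball w r \<Longrightarrow> m \<le> \<rho> z"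
  shows "square_integrable M (avg w r)" "nsq M (avg w r) \<le> 1 / (m * measure lborel (ball w r))"
proof -
  define vol where "vol = measure lborel (ball w r)"
  have vol: "0 < vol" using measure_ball_pos r by (simp add: vol_def)
  have bD: "ball w r \<subseteq> D" using r by auto
  have contr: "continuous_on D (\<lambda>z. 1 / (vol * \<rho> z))"
   using pos_\<rho> vol by (intro continuous_intros cont_\<rho>) force
  have contr2: "continuous_on D (\<lambda>z. 1 / (vol\<^sup>2 * \<rho> z))"
   using pos_\<rho> vol by (intro continuous_intros cont_\<rho>) force
  have mind: "indicator (ball w r) \<in> borel_measurable (lebesgue_on D)"
   using bD by (intro borel_measurable_indicator) (auto simp: sets_restrict_space_iff D_sets)
  have meas: "avg w r \<in> borel_measurable (lebesgue_on D)"
  proof -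
   have [measurable]: "(\<lambda>z. indicator (ball w r) z * (1 / (vol * \<rho> z))) \<in> borel_measurable (lebesgue_on D)"
    by (rule borel_measurable_times[OF mind measurable_continuous[OF contr]])
   have "(\<lambda>z. complex_of_real (indicator (ball w r) z * (1 / (vol * \<rho> z)))) \<in> borel_measurable (lebesgue_on D)"
    by measurable
   moreover have "avg w r = (\<lambda>z. complex_of_real (indicator (ball w r) z * (1 / (vol * \<rho> z))))"
    by (simp add: fun_eq_iff avg_def vol_def)
   ultimately show ?thesis by simp
  qed
  have eq: "\<rho> z *\<^sub>R (cmod (avg w r z))\<^sup>2 = indicator (ball w r) z * (1 / (vol\<^sup>2 * \<rho> z))" if "z \<in> D" for z
  proof (cases "z \<in> ball w r")
   case True
   have "cmod (avg w r z) = 1 / (vol * \<rho> z)"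
    using True pos_\<rho>[OF that] vol unfolding avg_def vol_def[symmetric] norm_of_real by simp
   thus ?thesis using True pos_\<rho>[OF that] vol by (simp add: power2_eq_square)
  qed (simp add: avg_def)
  define h where "h z = indicator (ball w r) z * (1 / (vol\<^sup>2 * \<rho> z))" for z
  have h0: "0 \<le> h z" and hle: "h z \<le> indicator (ball w r) z * (1 / (vol\<^sup>2 * m))" for z
  proof -
   have "0 \<le> h z \<and> h z \<le> indicator (ball w r) z * (1 / (vol\<^sup>2 * m))"
   proof (cases "z \<in> ball w r")
    case True
    hence "m \<le> \<rho> z" using m(2) by auto
    hence "vol\<^sup>2 * m \<le> vol\<^sup>2 * \<rho> z" "0 < vol\<^sup>2 * m" using vol m(1) by auto
    thus ?thesis using True by (simp add: h_def divide_left_mono frac_le)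
   qed (simp add: h_def)
   thus "0 \<le> h z" "h z \<le> indicator (ball w r) z * (1 / (vol\<^sup>2 * m))" by auto
  qed
  have hD: "indicator D z * h z = h z" for z using bD by (auto simp: h_def indicator_def)
  have hborel: "h \<in> borel_measurable borel"
   unfolding h_def using avg_indicator_borel[OF r(2) contr2] by simp
  have intind: "integrable lborel (\<lambda>z. indicator (ball w r) z * (1 / (vol\<^sup>2 * m)))"
   by (intro integrable_mult_left integrable_real_indicator)
     (simp_all add: emeasure_bounded_finite[unfolded infinity_ennreal_def])
  have inth: "integrable lborel h"
  proof (rule Bochner_Integration.integrable_bound[OF intind])
   show "AE x in lborel. norm (h x) \<le> norm (indicator (ball w r) x * (1 / (vol\<^sup>2 * m)))"
   proof (rule AE_I2)
    fix x
    have "norm (h x) = h x" using h0 by simp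
    thus "norm (h x) \<le> norm (indicator (ball w r) x * (1 / (vol\<^sup>2 * m)))"
     using order_trans[OF hle abs_ge_self] by simp
   qed
  qed (use hborel in simp)
  have intD: "integrable (lebesgue_on D) h"
   using inth hborel by (subst integral_lborel(2)) (simp_all add: hD)
  have msq: "(\<lambda>z. (cmod (avg w r z))\<^sup>2) \<in> borel_measurable (lebesgue_on D)" using meas by measurable
  have "integrable (lebesgue_on D) (\<lambda>z. \<rho> z *\<^sub>R (cmod (avg w r z))\<^sup>2)"
  proof (rule Bochner_Integration.integrable_cong[THEN iffD1, OF refl _ intD])
   fix z assume "z \<in> space (lebesgue_on D)"
   thus "h z = \<rho> z *\<^sub>R (cmod (avg w r z))\<^sup>2"
    using eq[of z] by (simp add: h_def space_restrict_space)
  qed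
  thus "square_integrable M (avg w r)"
   using meas msq by (simp add: square_integrable_def integrable_M)
  have "nsq M (avg w r) = (LINT z|lebesgue_on D. h z)"
   unfolding nsq_def integral_M[OF msq]
  proof (rule Bochner_Integration.integral_cong[OF refl])
   fix z assume "z \<in> space (lebesgue_on D)"
   thus "\<rho> z *\<^sub>R (cmod (avg w r z))\<^sup>2 = h z"
    using eq[of z] by (simp add: h_def space_restrict_space)
  qed
  also have "\<dots> = (LINT z|lborel. h z)" using hborel by (subst integral_lborel(1)) (simp_all add: hD)
  also have "\<dots> \<le> (LINT z|lborel. indicator (ball w r) z * (1 / (vol\<^sup>2 * m)))"
   by (intro integral_mono inth intind hle)
  also have "\<dots> = vol * (1 / (vol\<^sup>2 * m))" by (simp add: vol_def)
  also have "\<dots> = 1 / (m * vol)" using vol m by (simp add: power2_eq_square)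
  finally show "nsq M (avg w r) \<le> 1 / (m * measure lborel (ball w r))" by (simp add: vol_def)
qed

lemma avg_inner:
  assumes f: "f \<in> H" and r: "0 < r" "cball w r \<subseteq> D"
  shows "l2_inner M f (avg w r) = f w"
proof -
  define vol where "vol = measure lborel (ball w r)"
  have vol: "0 < vol" using measure_ball_pos r by (simp add: vol_def)
  have bD: "ball w r \<subseteq> D" using r by auto
  define h where "h z = indicator (ball w r) z * f z" for z
  have hborel: "h \<in> borel_measurable borel"
   using avg_indicator_borel[OF r(2) HD(4)[OF f]] by (simp add: indicator_scaleR_eq h_def[abs_def])
  have hD: "indicator D z *\<^sub>R h z = h z" for z using bD by (auto simp: h_def indicator_def)
  have eq: "\<rho> z *\<^sub>R (f z * cnj (avg w r z)) = (1 / of_real vol) * h z" if "z \<in> D" for z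
   using pos_\<rho>[OF that] vol by (auto simp: avg_def vol_def h_def indicator_def scaleR_conv_of_real)
  have m: "(\<lambda>z. f z * cnj (avg w r z)) \<in> borel_measurable (lebesgue_on D)"
  proof -
   have "(\<lambda>z. f z * cnj (avg w r z)) \<in> borel_measurable (lebesgue_on D) \<longleftrightarrow>
     (\<lambda>z. (1 / of_real vol) * h z * of_real (1 / \<rho> z)) \<in> borel_measurable (lebesgue_on D)"
    using pos_\<rho> by (intro measurable_cong) (auto simp: space_restrict_space avg_def vol_def h_def indicator_def)
   moreover have "h \<in> borel_measurable (lebesgue_on D)"
    using hborel by (simp add: measurable_completion measurable_restrict_space1)
   ultimately show ?thesis by simp
  qed
  have "l2_inner M f (avg w r) = (LINT z|lebesgue_on D. (1 / of_real vol) * h z)"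
   unfolding l2_inner_def integral_M[OF m]
   by (rule Bochner_Integration.integral_cong) (auto simp: eq space_restrict_space)
  also have "\<dots> = (1 / of_real vol) * (LINT z|lborel. h z)"
   using hborel by (simp add: integral_lborel(1) hD)
  also have "(LINT z|lborel. h z) = f w * of_real vol"
   unfolding h_def vol_def by (rule ball_mean_value[OF HD(1)[OF f] open_D r(2,1)])
  finally show ?thesis using vol by simp
qed

lemma ex_avg:
  assumes "w \<in> D"
  obtains e where "square_integrable M e" "\<And>f. f \<in> H \<Longrightarrow> l2_inner M f e = f w"
proof -
  obtain r where r: "0 < r" "cball w r \<subseteq> D" using assms open_D open_contains_cball by blast
  obtain z0 where "z0 \<in> cball w r" "\<And>z. z \<in> cball w r \<Longrightarrow> \<rho> z0 \<le> \<rho> z"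
   using continuous_attains_inf[of "cball w r" \<rho>] r continuous_on_subset[OF cont_\<rho> r(2)] by auto
  thus ?thesis using that avg_square_integrable(1)[OF r, of "\<rho> z0"] avg_inner[OF _ r] pos_\<rho> r by blast
qed

text \<open>The averages of all centres near \<open>z0\<close> may be taken over balls of one radius.\<close>

lemma point_bound:
  assumes "z0 \<in> D"
  obtains r C where "0 < r" "0 < C" "cball z0 r \<subseteq> D" "\<And>z f. z \<in> cball z0 r \<Longrightarrow> f \<in> H \<Longrightarrow> (cmod (f z))\<^sup>2 \<le> C * nsq M f"
proof -
  obtain r0 where r0: "0 < r0" "cball z0 r0 \<subseteq> D" using assms open_D open_contains_cball by blast
  define r where "r = r0 / 2"
  have r: "0 < r" "cball z0 (2 * r) \<subseteq> D" using r0 by (auto simp: r_def)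
  obtain z1 where z1: "z1 \<in> cball z0 (2 * r)" "\<And>z. z \<in> cball z0 (2 * r) \<Longrightarrow> \<rho> z1 \<le> \<rho> z"
   using continuous_attains_inf[of "cball z0 (2 * r)" \<rho>] r continuous_on_subset[OF cont_\<rho> r(2)] by auto
  define m where "m = \<rho> z1"
  have m: "0 < m" using z1 pos_\<rho> r by (auto simp: m_def)
  define C where "C = 1 / (m * measure lborel (ball z0 r))"
  have C: "0 < C" using m measure_ball_pos[OF r(1), of z0] by (simp add: C_def)
  have "(cmod (f z))\<^sup>2 \<le> C * nsq M f" if z: "z \<in> cball z0 r" and f: "f \<in> H" for z f
  proof -
   have sub: "cball z r \<subseteq> cball z0 (2 * r)" by (rule cball_subset_double[OF z])
   hence subD: "cball z r \<subseteq> D" using r by blast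
   have mz: "m \<le> \<rho> y" if "y \<in> cball z r" for y using z1(2) sub that by (auto simp: m_def)
   have "(cmod (f z))\<^sup>2 = (cmod (l2_inner M f (avg z r)))\<^sup>2" by (simp add: avg_inner[OF f r(1) subD])
   also have "\<dots> \<le> nsq M f * nsq M (avg z r)"
    by (intro l2_cauchy_schwarz HD f avg_square_integrable(1)[OF r(1) subD m mz])
   also have "\<dots> \<le> nsq M f * (1 / (m * measure lborel (ball z r)))"
    by (intro mult_left_mono avg_square_integrable(2)[OF r(1) subD m mz] nsq_nonneg)
   also have "measure lborel (ball z r) = measure lborel (ball z0 r)"
    using r by (simp add: content_ball_conv_unit_ball[of r z] content_ball_conv_unit_ball[of r z0])
   finally show ?thesis by (simp add: C_def mult.commute)
  qed
  moreover have "cball z0 r \<subseteq> D" using r by (auto simp: subset_iff)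
  ultimately show ?thesis using that r(1) C by blast
qed

lemma nsq_zero:
  assumes "f \<in> H" "nsq M f = 0"
  shows "f = (\<lambda>z. 0)"
proof
  fix z
  show "f z = 0"
  proof (cases "z \<in> D")
   case True
   then obtain r C where "0 < r" "\<And>w f. w \<in> cball z r \<Longrightarrow> f \<in> H \<Longrightarrow> (cmod (f w))\<^sup>2 \<le> C * nsq M f"
    using point_bound by metis
   from this(2)[of z f] this(1) assms show ?thesis by simp
  qed (use HD(3)[OF assms(1)] in auto)
qed

text \<open>
  By the parallelogram law a minimising sequence is Cauchy, so by the point bound it converges locally uniformly
  to a holomorphic function, which is a minimiser by Fatou's lemma.
\<close>

lemma nearest_point:
  assumes f: "square_integrable M f"
  shows "\<exists>g\<in>H. \<forall>g'\<in>H. nsq M (\<lambda>z. f z - g z) \<le> nsq M (\<lambda>z. f z - g' z)"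
proof -
  define d where "d = (INF g\<in>H. nsq M (\<lambda>z. f z - g z))"
  have bdd: "bdd_below ((\<lambda>g. nsq M (\<lambda>z. f z - g z)) ` H)"
   by (intro bdd_belowI[of _ 0]) (auto simp: nsq_nonneg)
  have d_le: "d \<le> nsq M (\<lambda>z. f z - g z)" if "g \<in> H" for g
   unfolding d_def using bdd that by (rule cINF_lower)
  have "\<exists>g\<in>H. nsq M (\<lambda>z. f z - g z) < d + inverse (real (Suc n))" for n
  proof -
   have "d < d + inverse (real (Suc n))" by simp
   moreover have "H \<noteq> {}" using H_zero by blast
   ultimately show ?thesis unfolding d_def using cINF_less_iff[OF _ bdd] by blast
  qed
  then obtain g where g: "\<And>n. g n \<in> H" "\<And>n. nsq M (\<lambda>z. f z - g n z) < d + inverse (real (Suc n))" by metis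
  have cauchy: "nsq M (\<lambda>z. g n z - g m z) \<le> 2 * inverse (real (Suc n)) + 2 * inverse (real (Suc m))" for n m
  proof -
   note sq = square_integrable_diff[OF f HD(2)[OF g(1)]]
   have "(\<lambda>z. (1/2) * (g m z + g n z)) \<in> H" by (intro H_cmult H_add g)
   hence "d \<le> nsq M (\<lambda>z. f z - (1/2) * (g m z + g n z))" by (rule d_le)
   moreover have "nsq M (\<lambda>z. (f z - g m z) + (f z - g n z)) = 4 * nsq M (\<lambda>z. f z - (1/2) * (g m z + g n z))"
    using nsq_cmult[of M 2 "\<lambda>z. f z - (1/2) * (g m z + g n z)"] by (simp add: algebra_simps)
   ultimately show ?thesis
    using nsq_parallelogram[OF sq sq, of m n] g(2)[of n] g(2)[of m] by simp
  qed
  define G where "G z = (if z \<in> D then lim (\<lambda>n. g n z) else 0)" for z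
  have ul: "\<exists>r>0. cball z r \<subseteq> D \<and> uniform_limit (cball z r) g G sequentially" if zD: "z \<in> D" for z
  proof -
   obtain r C where r: "0 < r" "0 < C" "cball z r \<subseteq> D"
    and C: "\<And>w f. w \<in> cball z r \<Longrightarrow> f \<in> H \<Longrightarrow> (cmod (f w))\<^sup>2 \<le> C * nsq M f"
    using point_bound[OF zD] by metis
   have "uniformly_Cauchy_on (cball z r) g"
    unfolding uniformly_Cauchy_on_def
   proof (intro allI impI)
    fix e :: real assume "0 < e"
    then obtain N where N: "inverse (real (Suc N)) < e\<^sup>2 / (4 * C)"
     using reals_Archimedean[of "e\<^sup>2 / (4 * C)"] r by auto
    have "dist (g n w) (g m w) < e" if w: "w \<in> cball z r" and nm: "n \<ge> N" "m \<ge> N" for w n m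
    proof -
     have "inverse (real (Suc n)) \<le> inverse (real (Suc N))" "inverse (real (Suc m)) \<le> inverse (real (Suc N))"
      using nm by auto
     hence "2 * inverse (real (Suc n)) + 2 * inverse (real (Suc m)) < 4 * (e\<^sup>2 / (4 * C))"
      using N by linarith
     hence "nsq M (\<lambda>z. g n z - g m z) < e\<^sup>2 / C" using cauchy[of n m] by simp
     hence "C * nsq M (\<lambda>z. g n z - g m z) < e\<^sup>2" using r(2) by (simp add: pos_less_divide_eq mult.commute)
     hence "(cmod (g n w - g m w))\<^sup>2 < e\<^sup>2" using C[OF w H_diff[OF g(1) g(1)], of n m] by simp
     thus ?thesis using \<open>0 < e\<close> by (simp add: dist_norm power_less_imp_less_base)
    qed
    thus "\<exists>M. \<forall>x\<in>cball z r. \<forall>m\<ge>M. \<forall>n\<ge>M. dist (g m x) (g n x) < e" by blast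
   qed
   hence "uniformly_convergent_on (cball z r) g" by (rule Cauchy_uniformly_convergent)
   hence "uniform_limit (cball z r) g (\<lambda>x. lim (\<lambda>n. g n x)) sequentially"
    by (simp add: uniformly_convergent_uniform_limit_iff)
   hence "uniform_limit (cball z r) g G sequentially"
    by (rule uniform_limit_cong'[THEN iffD1, rotated 2]) (use r(3) in \<open>auto simp: G_def subset_iff\<close>)
   thus ?thesis using r by blast
  qed
  have holG: "holomorphic_fun D G"
   by (rule holomorphic_fun_limit[OF open_D HD(1)[OF g(1)] ul])
  have pt: "(\<lambda>n. g n z) \<longlonglongrightarrow> G z" if z: "z \<in> D" for z
  proof -
   obtain r where "0 < r" "uniform_limit (cball z r) g G sequentially" using ul[OF z] by blast
   thus ?thesis by (auto intro: tendsto_uniform_limitI)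
  qed
  have mf: "f \<in> borel_measurable (lebesgue_on D)" using f by (simp add: square_integrable_def)
  have mG: "G \<in> borel_measurable (lebesgue_on D)"
   by (rule measurable_continuous[OF holomorphic_fun_continuous[OF holG]])
  have nn: "(\<integral>\<^sup>+z. ennreal ((cmod (f z - G z))\<^sup>2) \<partial>M) \<le> ennreal d"
  proof -
   have mg: "(\<lambda>z. ennreal ((cmod (f z - g n z))\<^sup>2)) \<in> borel_measurable M" for n
    using mf measurable_continuous[OF HD(4)[OF g(1)], of n] unfolding measurable_M by measurable
   have "(\<integral>\<^sup>+z. ennreal ((cmod (f z - G z))\<^sup>2) \<partial>M) = (\<integral>\<^sup>+z. liminf (\<lambda>n. ennreal ((cmod (f z - g n z))\<^sup>2)) \<partial>M)"
   proof (rule nn_integral_cong)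
    fix z assume "z \<in> space M"
    hence "(\<lambda>n. ennreal ((cmod (f z - g n z))\<^sup>2)) \<longlonglongrightarrow> ennreal ((cmod (f z - G z))\<^sup>2)"
     by (intro tendsto_intros tendsto_ennrealI pt) simp
    thus "ennreal ((cmod (f z - G z))\<^sup>2) = liminf (\<lambda>n. ennreal ((cmod (f z - g n z))\<^sup>2))"
     by (rule lim_imp_Liminf[OF trivial_limit_sequentially, symmetric])
   qed
   also have "\<dots> \<le> liminf (\<lambda>n. \<integral>\<^sup>+z. ennreal ((cmod (f z - g n z))\<^sup>2) \<partial>M)"
    by (rule nn_integral_liminf[OF mg])
   also have "\<dots> \<le> liminf (\<lambda>n. ennreal (d + inverse (real (Suc n))))"
   proof (rule Liminf_mono, rule always_eventually, rule allI)
    fix n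
    have "(\<integral>\<^sup>+z. ennreal ((cmod (f z - g n z))\<^sup>2) \<partial>M) = ennreal (nsq M (\<lambda>z. f z - g n z))"
     unfolding nsq_def using square_integrable_diff[OF f HD(2)[OF g(1)], of n]
     by (intro nn_integral_eq_integral) (auto simp: square_integrable_def)
    thus "(\<integral>\<^sup>+z. ennreal ((cmod (f z - g n z))\<^sup>2) \<partial>M) \<le> ennreal (d + inverse (real (Suc n)))"
     using g(2)[of n] by (simp add: ennreal_leI)
   qed
   also have "\<dots> = ennreal d"
   proof (rule lim_imp_Liminf)
    have "(\<lambda>n. d + inverse (real (Suc n))) \<longlonglongrightarrow> d + 0"
     by (intro tendsto_intros LIMSEQ_inverse_real_of_nat)
    thus "(\<lambda>n. ennreal (d + inverse (real (Suc n)))) \<longlonglongrightarrow> ennreal d"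
     by (intro tendsto_ennrealI) simp
   qed simp
   finally show ?thesis .
  qed
  have mfG: "(\<lambda>z. (cmod (f z - G z))\<^sup>2) \<in> borel_measurable (lebesgue_on D)"
   using mf mG by measurable
  have int: "integrable M (\<lambda>z. (cmod (f z - G z))\<^sup>2)"
   by (rule integrableI_bounded) (use mfG nn in \<open>auto simp: less_top[symmetric] top_unique\<close>)
  have d0: "0 \<le> d" unfolding d_def using H_zero by (intro cINF_greatest) (auto simp: nsq_nonneg)
  have le: "nsq M (\<lambda>z. f z - G z) \<le> d"
   using nn nn_integral_eq_integral[OF int] d0 by (simp add: nsq_def)
  have sq: "square_integrable M (\<lambda>z. f z - G z)"
   using int mf mG by (simp add: square_integrable_def)
  have "square_integrable M G" using square_integrable_diff[OF f sq] by simp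
  moreover have "\<And>z. z \<notin> D \<Longrightarrow> G z = 0" by (simp add: G_def)
  ultimately have "G \<in> H"
   using holG by (auto simp: H_def holomorphic_l2_def)
  thus ?thesis using le d_le order_trans by blast
qed

lemma ex_projection:
  assumes f: "square_integrable M f"
  shows "\<exists>!g. g \<in> H \<and> (\<forall>\<psi>\<in>H. l2_inner M (\<lambda>z. f z - g z) \<psi> = 0)"
proof -
  obtain g where g: "g \<in> H" "\<And>g'. g' \<in> H \<Longrightarrow> nsq M (\<lambda>z. f z - g z) \<le> nsq M (\<lambda>z. f z - g' z)"
   using nearest_point[OF f] by blast
  have sq: "square_integrable M (\<lambda>z. f z - g z)" by (intro square_integrable_diff f HD g)
  have orth: "l2_inner M (\<lambda>z. f z - g z) \<psi> = 0" if \<psi>: "\<psi> \<in> H" for \<psi>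
  proof (rule ccontr)
   define c where "c = l2_inner M (\<lambda>z. f z - g z) \<psi>"
   assume "l2_inner M (\<lambda>z. f z - g z) \<psi> \<noteq> 0"
   hence c: "c \<noteq> 0" by (simp add: c_def)
   define t where "t = 1 / (nsq M \<psi> + 1)"
   have b: "0 \<le> nsq M \<psi>" by (rule nsq_nonneg)
   have "nsq M (\<lambda>z. f z - g z) \<le> nsq M (\<lambda>z. f z - (g z + (of_real t * c) * \<psi> z))"
    by (intro g H_add H_cmult \<psi>)
   also have "\<dots> = nsq M (\<lambda>z. (f z - g z) - (of_real t * c) * \<psi> z)" by (simp add: algebra_simps)
   also have "\<dots> = nsq M (\<lambda>z. f z - g z) - 2 * Re (of_real t * (cnj c * c)) + t\<^sup>2 * (cmod c)\<^sup>2 * nsq M \<psi>"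
    by (subst nsq_diff[OF sq square_integrable_cmult[OF HD(2)[OF \<psi>]]])
     (simp add: l2_inner_cmult_right nsq_cmult c_def[symmetric] norm_mult power_mult_distrib mult_ac)
   also have "cnj c * c = of_real ((cmod c)\<^sup>2)" by (metis complex_norm_square mult.commute)
   finally have "2 * t * (cmod c)\<^sup>2 \<le> t\<^sup>2 * (cmod c)\<^sup>2 * nsq M \<psi>" by simp
   hence "2 * t \<le> t\<^sup>2 * nsq M \<psi>" using c by (simp add: mult.commute mult.left_commute)
   moreover have "0 < t" using b by (simp add: t_def)
   ultimately have "2 \<le> t * nsq M \<psi>" by (simp add: power2_eq_square)
   thus False using b by (simp add: t_def field_simps)
  qed
  show ?thesis
  proof (rule ex1I[of _ g])
   fix g' assume g': "g' \<in> H \<and> (\<forall>\<psi>\<in>H. l2_inner M (\<lambda>z. f z - g' z) \<psi> = 0)"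
   define \<psi> where "\<psi> z = g' z - g z" for z
   have \<psi>: "\<psi> \<in> H" unfolding \<psi>_def using g' g by (intro H_diff) auto
   have "l2_inner M \<psi> \<psi> = l2_inner M (\<lambda>z. (f z - g z) - (f z - g' z)) \<psi>"
    by (rule arg_cong[where f = "\<lambda>t. l2_inner M t \<psi>"]) (simp add: \<psi>_def fun_eq_iff)
   also have "\<dots> = 0"
    using orth[OF \<psi>] g' \<psi> by (subst l2_inner_diff_left) (auto intro: sq HD square_integrable_diff f)
   finally have "nsq M \<psi> = 0" by (simp add: l2_inner_self)
   hence "\<psi> z = 0" for z using nsq_zero[OF \<psi>] by metis
   thus "g' = g" by (auto simp: \<psi>_def fun_eq_iff)
  qed (use g orth in auto)
qed

definition proj :: "(complex^'n \<Rightarrow> complex) \<Rightarrow> complex^'n \<Rightarrow> complex" where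
  "proj f = (THE g. g \<in> H \<and> (\<forall>\<psi>\<in>H. l2_inner M (\<lambda>z. f z - g z) \<psi> = 0))"

lemma proj:
  assumes "square_integrable M f"
  shows "proj f \<in> H" "\<psi> \<in> H \<Longrightarrow> l2_inner M (proj f) \<psi> = l2_inner M f \<psi>"
proof -
  have *: "proj f \<in> H \<and> (\<forall>\<psi>\<in>H. l2_inner M (\<lambda>z. f z - proj f z) \<psi> = 0)"
   unfolding proj_def by (rule theI'[OF ex_projection[OF assms]])
  thus "proj f \<in> H" by blast
  assume \<psi>: "\<psi> \<in> H"
  have "l2_inner M (\<lambda>z. f z - proj f z) \<psi> = l2_inner M f \<psi> - l2_inner M (proj f) \<psi>"
   using * \<psi> by (intro l2_inner_diff_left assms HD) auto
  thus "l2_inner M (proj f) \<psi> = l2_inner M f \<psi>" using * \<psi> by simp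
qed

text \<open>The kernel function is the projection of an average that represents evaluation at \<open>w\<close>.\<close>

lemma ex_kernel:
  assumes "w \<in> D"
  shows "\<exists>!k. k \<in> H \<and> (\<forall>f\<in>H. f w = l2_inner M f k)"
proof -
  obtain e where e: "square_integrable M e" "\<And>f. f \<in> H \<Longrightarrow> l2_inner M f e = f w"
   using ex_avg[OF assms] by blast
  show ?thesis
  proof (rule ex1I[of _ "proj e"])
   show *: "proj e \<in> H \<and> (\<forall>f\<in>H. f w = l2_inner M f (proj e))"
    using proj[OF e(1)] e(2) by (metis l2_inner_cnj)
   fix k assume k: "k \<in> H \<and> (\<forall>f\<in>H. f w = l2_inner M f k)"
   define \<psi> where "\<psi> z = k z - proj e z" for z
   have \<psi>: "\<psi> \<in> H" unfolding \<psi>_def using * k by (intro H_diff) auto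
   have "l2_inner M \<psi> \<psi> = l2_inner M \<psi> (\<lambda>z. k z - proj e z)" by (simp add: \<psi>_def[abs_def])
   also have "\<dots> = l2_inner M \<psi> k - l2_inner M \<psi> (proj e)"
    using * k \<psi> by (intro l2_inner_diff_right HD) auto
   also have "\<dots> = 0" using * k \<psi> by (metis diff_self)
   finally have "nsq M \<psi> = 0" by (simp add: l2_inner_self)
   hence "\<psi> z = 0" for z using nsq_zero[OF \<psi>] by metis
   thus "k = proj e" by (auto simp: \<psi>_def fun_eq_iff)
  qed
qed

definition ker :: "complex^'n \<Rightarrow> complex^'n \<Rightarrow> complex" where
  "ker z w = (THE k. k \<in> H \<and> (\<forall>f\<in>H. f w = l2_inner M f k)) z"

lemma ker_H: "w \<in> D \<Longrightarrow> (\<lambda>z. ker z w) \<in> H"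
  and reproducing: "w \<in> D \<Longrightarrow> f \<in> H \<Longrightarrow> l2_inner M f (\<lambda>z. ker z w) = f w"
  using theI'[OF ex_kernel] by (auto simp: ker_def)

lemma ker_cnj: "z \<in> D \<Longrightarrow> w \<in> D \<Longrightarrow> cnj (ker z w) = ker w z"
  using reproducing[OF _ ker_H] l2_inner_cnj by metis

lemma nsq_ker: "w \<in> D \<Longrightarrow> ker w w = of_real (nsq M (\<lambda>z. ker z w))"
  using reproducing[OF _ ker_H, of w w] by (simp add: l2_inner_self)

lemma proj_eq:
  assumes "square_integrable M f" "z \<in> D"
  shows "proj f z = l2_inner M f (\<lambda>u. ker u z)"
  using proj[OF assms(1)] reproducing[OF assms(2)] ker_H[OF assms(2)] by metis

lemma ker_extremal:
  assumes "w \<in> D" "f \<in> H"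
  shows "(cmod (f w))\<^sup>2 \<le> nsq M f * Re (ker w w)"
  using l2_cauchy_schwarz[OF HD(2)[OF assms(2)] HD(2)[OF ker_H[OF assms(1)]]]
   reproducing[OF assms] nsq_ker[OF assms(1)] by simp

lemma ker_cs:
  assumes "z \<in> D" "w \<in> D"
  shows "(cmod (ker z w))\<^sup>2 \<le> Re (ker z z) * Re (ker w w)"
  using ker_extremal[OF assms(1) ker_H[OF assms(2)]] nsq_ker[OF assms(2)] by (simp add: mult.commute)

lemma ker_local_bound:
  assumes "z0 \<in> D"
  obtains r C where "0 < r" "0 < C" "cball z0 r \<subseteq> D" "\<And>z. z \<in> cball z0 r \<Longrightarrow> Re (ker z z) \<le> C"
proof -
  obtain r C where r: "0 < r" "0 < C" "cball z0 r \<subseteq> D"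
   and C: "\<And>z f. z \<in> cball z0 r \<Longrightarrow> f \<in> H \<Longrightarrow> (cmod (f z))\<^sup>2 \<le> C * nsq M f"
   using point_bound[OF assms] by metis
  have "Re (ker z z) \<le> C" if z: "z \<in> cball z0 r" for z
  proof -
   have zD: "z \<in> D" using z r by auto
   define t where "t = nsq M (\<lambda>u. ker u z)"
   have "t\<^sup>2 \<le> C * t" using C[OF z ker_H[OF zD]] by (simp add: nsq_ker[OF zD] t_def)
   moreover have "0 \<le> t" by (simp add: t_def nsq_nonneg)
   ultimately have "t \<le> C" using r(2) by (cases "t = 0") (auto simp: power2_eq_square)
   thus ?thesis by (simp add: nsq_ker[OF zD] t_def)
  qed
  thus ?thesis using that r by blast
qed

lemma sesqui_ker: "sesqui D ker"
  unfolding sesqui_def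
proof (intro conjI ballI)
  show "holomorphic_fun D (\<lambda>z. ker z w)" if "w \<in> D" for w using HD(1)[OF ker_H[OF that]] .
  show "holomorphic_fun D (\<lambda>w. cnj (ker z w))" if "z \<in> D" for z
   by (rule holomorphic_fun_cong[OF open_D _ HD(1)[OF ker_H[OF that]]]) (simp add: ker_cnj that)
  fix z w assume zw: "z \<in> D" "w \<in> D"
  obtain r C where r: "0 < r" "0 < C" "cball z r \<subseteq> D" "\<And>x. x \<in> cball z r \<Longrightarrow> Re (ker x x) \<le> C"
   using ker_local_bound[OF zw(1)] by metis
  obtain s E where s: "0 < s" "0 < E" "cball w s \<subseteq> D" "\<And>x. x \<in> cball w s \<Longrightarrow> Re (ker x x) \<le> E"
   using ker_local_bound[OF zw(2)] by metis
  have "cmod (ker x y) \<le> sqrt (C * E)" if "x \<in> cball z (min r s)" "y \<in> cball w (min r s)" for x y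
  proof (rule real_le_rsqrt)
   have xy: "x \<in> D" "y \<in> D" using that r(3) s(3) by auto
   have "(cmod (ker x y))\<^sup>2 \<le> Re (ker x x) * Re (ker y y)" by (rule ker_cs[OF xy])
   also have "\<dots> \<le> C * E" using that
   proof (intro mult_mono)
    show "0 \<le> Re (ker y y)" using nsq_ker[OF xy(2)] by (simp add: nsq_nonneg)
   qed (use that r s in auto)
   finally show "(cmod (ker x y))\<^sup>2 \<le> C * E" .
  qed
  moreover have "cball z (min r s) \<subseteq> D" "cball w (min r s) \<subseteq> D" using r(3) s(3) by auto
  ultimately show "\<exists>r>0. \<exists>B. cball z r \<subseteq> D \<and> cball w r \<subseteq> D \<and>
    (\<forall>z'\<in>cball z r. \<forall>w'\<in>cball w r. cmod (ker z' w') \<le> B)"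
   using r(1) s(1) by (intro exI[of _ "min r s"] exI[of _ "sqrt (C * E)"] conjI ballI) simp_all
qed

end

section \<open>The Bergman kernel of a bounded domain\<close>

context weighted_domain
begin

lemma square_integrable_iff:
  assumes "continuous_on D f"
  shows "square_integrable M f \<longleftrightarrow> integrable lborel (\<lambda>z. indicator D z * (\<rho> z * (cmod (f z))\<^sup>2))"
   and "nsq M f = (LINT z|lborel. indicator D z * (\<rho> z * (cmod (f z))\<^sup>2))"
proof -
  have m: "f \<in> borel_measurable (lebesgue_on D)" by (rule measurable_continuous[OF assms])
  hence m2: "(\<lambda>z. (cmod (f z))\<^sup>2) \<in> borel_measurable (lebesgue_on D)" by measurable
  have mb: "(\<lambda>z. indicator D z *\<^sub>R (\<rho> z *\<^sub>R (cmod (f z))\<^sup>2)) \<in> borel_measurable borel"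
   by (intro borel_measurable_continuous_on_indicator continuous_intros cont_\<rho> assms D_sets)
  show "square_integrable M f \<longleftrightarrow> integrable lborel (\<lambda>z. indicator D z * (\<rho> z * (cmod (f z))\<^sup>2))"
   using m integral_lborel(2)[OF mb] by (simp add: square_integrable_def integrable_M[OF m2])
  show "nsq M f = (LINT z|lborel. indicator D z * (\<rho> z * (cmod (f z))\<^sup>2))"
   using integral_lborel(1)[OF mb] by (simp add: nsq_def integral_M[OF m2])
qed

end

definition complex_jacobian :: "(complex^'n \<Rightarrow> complex^'n) \<Rightarrow> complex^'n \<Rightarrow> complex" where
  "complex_jacobian F z = det (\<chi> i j. dd (axis j 1) (\<lambda>z. F z $ i) z)"

definition deriv_map :: "(complex^'n \<Rightarrow> complex^'n) \<Rightarrow> complex^'n \<Rightarrow> complex^'n \<Rightarrow> complex^'n" where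
  "deriv_map F z v = (\<chi> i. fd (\<lambda>z. F z $ i) z v)"

lemma holomorphic_jacobian:
  assumes "holomorphic_map D F" "open D"
  shows "holomorphic_fun D (complex_jacobian F)"
proof -
  have "holomorphic_fun D (\<lambda>z. \<Sum>p\<in>{p. p permutes UNIV}. of_int (sign p) * (\<Prod>i\<in>UNIV. dd (axis (p i) 1) (\<lambda>z. F z $ i) z))"
   using assms unfolding holomorphic_map_def
   by (intro holomorphic_fun_sum holomorphic_fun_cmult holomorphic_fun_prod holomorphic_fun_dd[unfolded fun_eq_iff])
    (auto intro: holomorphic_fun_dd)
  thus ?thesis by (simp add: complex_jacobian_def[abs_def] det_def)
qed

lemma real_det_deriv_map:
  assumes "holomorphic_map D F" "z \<in> D"
  shows "real_det (deriv_map F z) = (cmod (complex_jacobian F z))\<^sup>2"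
proof -
  define A where "A = (\<chi> i j. dd (axis j 1) (\<lambda>z. F z $ i) z)"
  have "deriv_map F z v = A *v v" for v
  proof -
   have "fd (\<lambda>z. F z $ i) z v = (\<Sum>j\<in>UNIV. A $ i $ j * v $ j)" for i
   proof -
    have hol: "holomorphic_fun D (\<lambda>z. F z $ i)" using assms by (auto simp: holomorphic_map_def)
    have lin: "linear (fd (\<lambda>z. F z $ i) z)"
     by (rule has_derivative_linear[OF holomorphic_funD(1)[OF hol assms(2)]])
    have "v = (\<Sum>j\<in>UNIV. v $ j *s axis j 1)"
     by (simp add: vec_eq_iff axis_def if_distrib[of "\<lambda>t. _ * t"] cong: if_cong)
    hence "fd (\<lambda>z. F z $ i) z v = (\<Sum>j\<in>UNIV. fd (\<lambda>z. F z $ i) z (v $ j *s axis j 1))"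
     by (metis (no_types) linear_sum[OF lin])
    thus ?thesis by (simp add: holomorphic_funD(2)[OF hol assms(2)] A_def dd_def mult.commute)
   qed
   thus ?thesis by (simp add: deriv_map_def matrix_vector_mult_def)
  qed
  hence "deriv_map F z = (\<lambda>v. A *v v)" by (simp add: fun_eq_iff)
  thus ?thesis using real_det_complex_linear[of A] by (simp add: A_def complex_jacobian_def)
qed

text \<open>
  When the weight transforms suitably, multiplication by a power of the Jacobian determinant makes
  composition with an automorphism an isometry, which bounds the extremal function.
\<close>

lemma (in weighted_domain) kernel_transformation:
  assumes F: "biholomorphic_automorphism D F" and z: "z \<in> D"
   and J: "\<And>z. z \<in> D \<Longrightarrow> (cmod (complex_jacobian F z)) ^ (2 * m) * \<rho> z = (cmod (complex_jacobian F z))\<^sup>2 * \<rho> (F z)"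
  shows "Re (ker (F z) (F z)) * (cmod (complex_jacobian F z)) ^ (2 * m) \<le> Re (ker z z)"
proof -
  have bij: "bij_betw F D D" and hol: "holomorphic_map D F"
   using F by (auto simp: biholomorphic_automorphism_def)
  have FD: "F x \<in> D" if "x \<in> D" for x using bij that by (auto simp: bij_betw_def)
  have Fz: "F z \<in> D" using FD z .
  define f where "f u = ker u (F z)" for u
  have f: "f \<in> H" unfolding f_def by (rule ker_H[OF Fz])
  define g0 where "g0 u = f (F u) * complex_jacobian F u ^ m" for u
  define g where "g u = (if u \<in> D then g0 u else 0)" for u
  have "holomorphic_fun D g0" unfolding g0_def
   using FD by (intro holomorphic_fun_mult holomorphic_fun_power holomorphic_jacobian[OF hol open_D]
     holomorphic_fun_compose[OF hol _ HD(1)[OF f]]) auto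
  hence holg: "holomorphic_fun D g"
   by (rule holomorphic_fun_cong[OF open_D, rotated]) (simp add: g_def)
  have contg: "continuous_on D g" by (rule holomorphic_fun_continuous[OF holg])
  define G where "G u = \<rho> u * (cmod (f u))\<^sup>2" for u
  have eq: "indicator D u * (real_det (deriv_map F u) * G (F u)) = indicator D u * (\<rho> u * (cmod (g u))\<^sup>2)" for u
  proof (cases "u \<in> D")
   case True
   have "\<rho> u * (cmod (g u))\<^sup>2 = (cmod (f (F u)))\<^sup>2 * ((cmod (complex_jacobian F u)) ^ (2 * m) * \<rho> u)"
    using True by (simp add: g_def g0_def norm_mult norm_power power_mult_distrib power_mult[symmetric] mult.commute[of m])
   also have "\<dots> = (cmod (f (F u)))\<^sup>2 * ((cmod (complex_jacobian F u))\<^sup>2 * \<rho> (F u))"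
    by (simp only: J[OF True])
   also have "\<dots> = real_det (deriv_map F u) * G (F u)"
    by (simp only: real_det_deriv_map[OF hol True] G_def mult_ac)
   finally show ?thesis by simp
  qed simp
  have contG: "continuous_on D G" unfolding G_def by (intro continuous_intros cont_\<rho> HD(4)[OF f])
  have mG: "(\<lambda>u. indicator D u * G u) \<in> borel_measurable borel"
   using borel_measurable_continuous_on_indicator[OF D_sets(2) contG] by simp
  have "continuous_on D (\<lambda>u. \<rho> u * (cmod (g u))\<^sup>2)" by (intro continuous_intros cont_\<rho> contg)
  hence mg: "(\<lambda>u. indicator D u * (real_det (deriv_map F u) * G (F u))) \<in> borel_measurable borel"
   unfolding eq using borel_measurable_continuous_on_indicator[OF D_sets(2)] by fastforce
  have der: "(F has_derivative deriv_map F u) (at u)" if "u \<in> D" for u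
   using holomorphic_map_has_derivative[OF hol that] by (simp add: deriv_map_def[abs_def])
  have intG: "integrable lborel (\<lambda>u. indicator D u * G u)"
   using HD(2)[OF f] square_integrable_iff(1)[OF HD(4)[OF f]] by (simp add: G_def)
  have inj: "inj_on F D" and FDD: "F ` D = D" using bij by (auto simp: bij_betw_def)
  have cov: "integrable lborel (\<lambda>u. indicator D u * (real_det (deriv_map F u) * G (F u)))"
   "(LINT u|lborel. indicator D u * (real_det (deriv_map F u) * G (F u))) = (LINT u|lborel. indicator D u * G u)"
   by (rule change_of_variables_complex[OF D_sets(2) _ inj FDD mG mg intG], erule der)+
  have gH: "g \<in> H"
   using cov(1) holg square_integrable_iff(1)[OF contg] unfolding eq by (auto simp: H_def holomorphic_l2_def g_def)
  have nsq: "nsq M g = nsq M f"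
   using cov(2)[unfolded eq]
   by (simp only: square_integrable_iff(2)[OF contg] square_integrable_iff(2)[OF HD(4)[OF f]] G_def)
  define t where "t = nsq M f"
  have t: "Re (ker (F z) (F z)) = t" "f (F z) = of_real t" "0 \<le> t"
   using nsq_ker[OF Fz] by (auto simp: t_def f_def[abs_def] nsq_nonneg)
  have "(cmod (g z))\<^sup>2 \<le> t * Re (ker z z)" using ker_extremal[OF z gH] by (simp add: nsq t_def)
  moreover have "(cmod (g z))\<^sup>2 = t * (t * cmod (complex_jacobian F z) ^ (2 * m))"
   using z t by (simp add: g_def g0_def norm_mult norm_power power_mult_distrib power2_eq_square mult_2 power_add)
  ultimately have *: "t * (t * cmod (complex_jacobian F z) ^ (2 * m)) \<le> t * Re (ker z z)" by simp
  show ?thesis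
  proof (cases "t = 0")
   case True
   thus ?thesis using t nsq_ker[OF z] by (simp add: nsq_nonneg)
  next
   case False
   thus ?thesis using * t by simp
  qed
qed

lemma weighted_domain_one: "bounded_domain D \<Longrightarrow> weighted_domain D (\<lambda>_. 1)"
  by (simp add: weighted_domain_def bounded_domain_def)

lemma weighted_domain_one_M: "bounded_domain D \<Longrightarrow> weighted_domain.M D (\<lambda>_. 1) = lebesgue_on D"
  by (subst weighted_domain.M_def[OF weighted_domain_one]) (simp_all add: density_1)

lemma bergman_kernel_eq:
  assumes "bounded_domain D"
  shows "bergman_kernel D z w = weighted_domain.ker D (\<lambda>_. 1) z w"
  using weighted_domain_one[OF assms]
  by (simp add: bergman_kernel_def weighted_domain.ker_def weighted_domain.H_def weighted_domain_one_M[OF assms])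

locale bounded_dom =
  fixes D :: "(complex^'n) set"
  assumes bounded_domain: "bounded_domain D"
begin

sublocale B: weighted_domain D "\<lambda>_. 1"
  by (rule weighted_domain_one[OF bounded_domain])

abbreviation K :: "complex^'n \<Rightarrow> complex^'n \<Rightarrow> complex" where "K \<equiv> B.ker"
abbreviation k :: "complex^'n \<Rightarrow> real" where "k \<equiv> bergman_diag D"

lemma K_eq: "bergman_kernel D = K"
  using bergman_kernel_eq[OF bounded_domain] by (simp add: fun_eq_iff)

lemma k_eq: "k z = Re (K z z)"
  by (simp add: bergman_diag_def K_eq)

lemma K_diag: "z \<in> D \<Longrightarrow> K z z = of_real (k z)"
  using B.nsq_ker by (simp add: k_eq)

lemma D_facts: "open D" "connected D" "D \<noteq> {}" "bounded D"
  using bounded_domain by (auto simp: bounded_domain_def)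

definition vol :: real where "vol = measure lborel D"

lemma emeasure_D: "emeasure lborel D < \<infinity>"
  by (rule emeasure_bounded_finite[OF D_facts(4)])

lemma integrable_bounded:
  fixes f :: "complex^'n \<Rightarrow> real"
  assumes "continuous_on D f" "\<And>z. z \<in> D \<Longrightarrow> \<bar>f z\<bar> \<le> B"
  shows "integrable lborel (\<lambda>z. indicator D z * f z)"
proof (rule Bochner_Integration.integrable_bound)
  show "integrable lborel (\<lambda>z. indicator D z * B)"
   using emeasure_D B.D_sets(2) by (intro integrable_mult_left integrable_real_indicator) auto
  show "(\<lambda>z. indicator D z * f z) \<in> borel_measurable lborel"
   using borel_measurable_continuous_on_indicator[OF B.D_sets(2) assms(1)] by simp
  show "AE z in lborel. norm (indicator D z * f z) \<le> norm (indicator D z * B)"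
   using assms(2) by (intro AE_I2) (auto simp: indicator_def intro: order_trans[OF _ abs_ge_self])
qed

lemma vol_pos: "0 < vol"
proof -
  obtain w r where "0 < r" "ball w r \<subseteq> D" using D_facts open_contains_ball by blast
  hence "measure lborel (ball w r) \<le> vol"
   unfolding vol_def using emeasure_D B.D_sets(2) by (intro measure_mono_fmeasurable) (auto simp: fmeasurable_def)
  thus ?thesis using B.measure_ball_pos[OF \<open>0 < r\<close>, of w] by linarith
qed

definition ext :: "(complex^'n \<Rightarrow> complex) \<Rightarrow> complex^'n \<Rightarrow> complex" where
  "ext f z = (if z \<in> D then f z else 0)"

lemma ext_H:
  assumes "holomorphic_fun D f" "\<And>z. z \<in> D \<Longrightarrow> cmod (f z) \<le> C"
  shows "ext f \<in> B.H"
proof -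
  have hol: "holomorphic_fun D (ext f)"
   by (rule holomorphic_fun_cong[OF D_facts(1) _ assms(1)]) (simp add: ext_def)
  have "integrable lborel (\<lambda>z. indicator D z * (1 * (cmod (ext f z))\<^sup>2))"
   using assms(2)
   by (intro integrable_bounded[where B = "C\<^sup>2"] continuous_intros holomorphic_fun_continuous[OF hol])
    (auto simp: ext_def intro!: power_mono)
  thus ?thesis
   using hol B.square_integrable_iff(1)[OF holomorphic_fun_continuous[OF hol]]
   by (auto simp: B.H_def holomorphic_l2_def ext_def)
qed

lemma nsq_one: "nsq B.M (ext (\<lambda>_. 1)) = vol"
proof -
  have "continuous_on D (ext (\<lambda>_. 1))" using B.HD(4)[OF ext_H[of "\<lambda>_. 1" 1]] by (simp add: holomorphic_fun_const)
  moreover have "indicator D z * (1 * (cmod (ext (\<lambda>_. 1) z))\<^sup>2) = indicat_real D z" for z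
   by (simp add: ext_def indicator_def)
  ultimately have "nsq B.M (ext (\<lambda>_. 1)) = (LINT z|lborel. indicat_real D z)"
   by (simp only: B.square_integrable_iff(2))
  thus ?thesis by (simp add: vol_def)
qed

lemma k_lower: "z \<in> D \<Longrightarrow> 1 / vol \<le> k z"
  using B.ker_extremal[OF _ ext_H[of "\<lambda>_. 1" 1], of z] vol_pos
  by (simp add: holomorphic_fun_const nsq_one ext_def k_eq field_simps)

lemma k_pos: "z \<in> D \<Longrightarrow> 0 < k z"
  using k_lower[of z] vol_pos by (smt (verit) divide_pos_pos)

lemma k_continuous: "continuous_on D k"
proof -
  have "continuous_on D (\<lambda>z. K z z)"
   by (rule has_derivative_continuous_on, rule has_derivative_at_withinI,
     rule sesqui_has_derivative_diag[OF B.sesqui_ker D_facts(1)])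
  hence "continuous_on D (\<lambda>z. Re (K z z))" by (intro continuous_intros)
  thus ?thesis by (simp add: k_eq[abs_def])
qed

lemma k_transformation_le:
  assumes "biholomorphic_automorphism D F" "z \<in> D"
  shows "k (F z) * (cmod (complex_jacobian F z))\<^sup>2 \<le> k z"
  using B.kernel_transformation[OF assms, of 1] by (simp add: k_eq)

lemma k_transformation:
  assumes F: "biholomorphic_automorphism D F" and z: "z \<in> D"
  shows "k (F z) * (cmod (complex_jacobian F z))\<^sup>2 = k z"
proof (rule antisym[OF k_transformation_le[OF F z]])
  define G where "G = inv_into D F"
  have bij: "bij_betw F D D" and hol: "holomorphic_map D F" and holG: "holomorphic_map D G"
   using F by (auto simp: biholomorphic_automorphism_def G_def)
  have Fz: "F z \<in> D" using bij z by (auto simp: bij_betw_def)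
  have GF: "G (F x) = x" if "x \<in> D" for x
   using bij that by (simp add: G_def bij_betw_def)
  have FG: "F (G x) = x" "G x \<in> D" if "x \<in> D" for x
   using bij that by (auto simp: G_def bij_betw_def f_inv_into_f inv_into_into)
  have G: "biholomorphic_automorphism D G"
   unfolding biholomorphic_automorphism_def
  proof (intro conjI holG)
   show "bij_betw G D D" unfolding G_def by (rule bij_betw_inv_into[OF bij])
   have "inv_into D G x = F x" if "x \<in> D" for x
    using inv_into_inv_into_eq[OF bij that] by (simp add: G_def)
   show "holomorphic_map D (inv_into D G)"
    unfolding holomorphic_map_def
   proof
    fix j
    show "holomorphic_fun D (\<lambda>z. inv_into D G z $ j)"
     by (rule holomorphic_fun_cong[OF D_facts(1), of "\<lambda>z. F z $ j"])
      (use hol \<open>\<And>x. x \<in> D \<Longrightarrow> inv_into D G x = F x\<close> in \<open>auto simp: holomorphic_map_def\<close>)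
   qed
  qed
  have dF: "(F has_derivative deriv_map F z) (at z)" and dG: "(G has_derivative deriv_map G (F z)) (at (F z))"
   using holomorphic_map_has_derivative[OF hol z] holomorphic_map_has_derivative[OF holG Fz]
   by (simp_all add: deriv_map_def[abs_def])
  have "((\<lambda>x. G (F x)) has_derivative (\<lambda>x. deriv_map G (F z) (deriv_map F z x))) (at z)"
   by (rule has_derivative_compose[OF dF dG])
  moreover have "((\<lambda>x. G (F x)) has_derivative (\<lambda>x. x)) (at z)"
   by (rule has_derivative_transform_within_open[OF has_derivative_ident D_facts(1) z]) (simp add: GF)
  ultimately have id: "deriv_map G (F z) \<circ> deriv_map F z = (\<lambda>x. x)"
   unfolding o_def by (rule has_derivative_unique)
  have "real_det (deriv_map G (F z) \<circ> deriv_map F z) = real_det (deriv_map G (F z)) * real_det (deriv_map F z)"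
   by (rule real_det_compose) (use dF dG has_derivative_linear in auto)
  hence "(cmod (complex_jacobian G (F z)))\<^sup>2 * (cmod (complex_jacobian F z))\<^sup>2 = 1"
   using real_det_isometry[of "\<lambda>x::complex^'n. x"]
   by (simp add: id real_det_deriv_map[OF hol z] real_det_deriv_map[OF holG Fz] linear_id[unfolded id_def])
  moreover have "k z * (cmod (complex_jacobian G (F z)))\<^sup>2 * (cmod (complex_jacobian F z))\<^sup>2 \<le> k (F z) * (cmod (complex_jacobian F z))\<^sup>2"
   using k_transformation_le[OF G Fz] by (intro mult_right_mono) (auto simp: GF[OF z])
  ultimately show "k z \<le> k (F z) * (cmod (complex_jacobian F z))\<^sup>2" by (simp add: mult.assoc)
qed

end

section \<open>The weighted kernels of a homogeneous domain\<close>

locale homogeneous_dom = bounded_dom D for D :: "(complex^'n) set" +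
  fixes N :: nat and c :: real
  assumes homogeneous: "homogeneous_bounded_domain D" and N: "1 \<le> N" and c: "0 < c"
begin

text \<open>The density, with respect to Lebesgue measure, of the weighted volume with \<open>h = 1 / N\<close>.\<close>

definition wt :: "complex^'n \<Rightarrow> real" where "wt z = c * (1 / k z) ^ (N - 1)"

sublocale W: weighted_domain D wt
proof
  show "continuous_on D wt" unfolding wt_def
   by (intro continuous_intros k_continuous) (use k_pos in force)
  show "0 < wt z" if "z \<in> D" for z
   unfolding wt_def using c k_pos[OF that] by simp
qed (use D_facts in auto)

lemma ext_one_W: "ext (\<lambda>_. 1) \<in> W.H"
proof -
  have one: "ext (\<lambda>_. 1) \<in> B.H" by (rule ext_H[where C = 1]) (auto intro: holomorphic_fun_const)
  have "integrable lborel (\<lambda>z. indicator D z * (wt z * (cmod (ext (\<lambda>_. 1) z))\<^sup>2))"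
  proof (rule integrable_bounded)
   show "continuous_on D (\<lambda>z. wt z * (cmod (ext (\<lambda>_. 1) z))\<^sup>2)"
    by (intro continuous_intros W.cont_\<rho> B.HD(4)[OF one])
   fix z assume z: "z \<in> D"
   have "1 / k z \<le> vol" using k_lower[OF z] k_pos[OF z] vol_pos by (simp add: field_simps)
   hence "wt z \<le> c * vol ^ (N - 1)"
    unfolding wt_def using c k_pos[OF z] by (intro mult_left_mono power_mono) auto
   thus "\<bar>wt z * (cmod (ext (\<lambda>_. 1) z))\<^sup>2\<bar> \<le> c * vol ^ (N - 1)"
    using z W.pos_\<rho>[OF z] by (simp add: ext_def)
  qed
  thus ?thesis
   using B.HD[OF one] W.square_integrable_iff(1)[OF B.HD(4)[OF one]]
   by (auto simp: W.H_def holomorphic_l2_def)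
qed

lemma W_ker_pos: "z \<in> D \<Longrightarrow> 0 < Re (W.ker z z)"
proof -
  assume z: "z \<in> D"
  have "1 \<le> nsq W.M (ext (\<lambda>_. 1)) * Re (W.ker z z)"
   using W.ker_extremal[OF z ext_one_W] z by (simp add: ext_def)
  moreover have "0 \<le> Re (W.ker z z)" using W.nsq_ker[OF z] by (simp add: nsq_nonneg)
  ultimately show ?thesis by (cases "Re (W.ker z z) = 0") auto
qed

lemma W_ratio_le:
  assumes F: "biholomorphic_automorphism D F" and z: "z \<in> D"
  shows "Re (W.ker (F z) (F z)) / k (F z) ^ N \<le> Re (W.ker z z) / k z ^ N"
proof -
  have FD: "F x \<in> D" if "x \<in> D" for x
   using F that by (auto simp: biholomorphic_automorphism_def bij_betw_def)
  have J: "(cmod (complex_jacobian F x)) ^ (2 * N) * wt x = (cmod (complex_jacobian F x))\<^sup>2 * wt (F x)" if x: "x \<in> D" for x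
  proof -
   define j where "j = (cmod (complex_jacobian F x))\<^sup>2"
   have kx: "k x = k (F x) * j" using k_transformation[OF F x] by (simp add: j_def)
   have "j \<noteq> 0" using kx k_pos[OF x] by auto
   obtain m where m: "N = Suc m" using N by (cases N) auto
   have "(cmod (complex_jacobian F x)) ^ (2 * N) = j * j ^ m" by (simp only: j_def power_mult m power_Suc)
   moreover have "j ^ m * (1 / k x) ^ m = (1 / k (F x)) ^ m"
   proof -
    have "j * (1 / k x) = 1 / k (F x)" using kx \<open>j \<noteq> 0\<close> by simp
    thus ?thesis by (metis power_mult_distrib)
   qed
   moreover have "wt x = c * (1 / k x) ^ m" "wt (F x) = c * (1 / k (F x)) ^ m"
    unfolding wt_def using m by simp_all
   ultimately have "(cmod (complex_jacobian F x)) ^ (2 * N) * wt x = j * j ^ m * (c * (1 / k x) ^ m)"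
    and wF: "j * wt (F x) = j * (c * (1 / k (F x)) ^ m)" and jk: "j ^ m * (1 / k x) ^ m = (1 / k (F x)) ^ m"
    by simp_all
   moreover have "j * j ^ m * (c * (1 / k x) ^ m) = j * (c * (j ^ m * (1 / k x) ^ m))" by (simp only: mult_ac)
   ultimately show ?thesis unfolding j_def[symmetric] wF jk by simp
  qed
  define j where "j = (cmod (complex_jacobian F z))\<^sup>2"
  have kz: "k z = k (F z) * j" using k_transformation[OF F z] by (simp add: j_def)
  have "j \<noteq> 0" using kz k_pos[OF z] by auto
  have "Re (W.ker (F z) (F z)) * j ^ N \<le> Re (W.ker z z)"
   using W.kernel_transformation[OF F z J] by (simp add: j_def power_mult)
  hence "Re (W.ker (F z) (F z)) * j ^ N / k z ^ N \<le> Re (W.ker z z) / k z ^ N"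
   using k_pos[OF z] by (intro divide_right_mono) auto
  moreover have "Re (W.ker (F z) (F z)) * j ^ N / k z ^ N = Re (W.ker (F z) (F z)) / k (F z) ^ N"
   using \<open>j \<noteq> 0\<close> by (simp only: kz power_mult_distrib) simp
  ultimately show ?thesis by linarith
qed

text \<open>
  By the previous inequality, applied to automorphisms in both directions, the quotient of the two diagonals is
  constant by transitivity. Both sides are sesquiholomorphic, so they agree off the diagonal too.
\<close>

lemma W_ker_eq: "\<exists>C>0. \<forall>z\<in>D. \<forall>w\<in>D. W.ker z w = of_real C * K z w ^ N"
proof -
  obtain p where p: "p \<in> D" using D_facts by blast
  define C where "C = Re (W.ker p p) / k p ^ N"
  have C: "0 < C" unfolding C_def using W_ker_pos[OF p] k_pos[OF p] by simp
  have ratio: "Re (W.ker z z) / k z ^ N = C" if z: "z \<in> D" for z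
  proof (rule antisym)
   obtain F where "biholomorphic_automorphism D F" "F p = z"
    using homogeneous p z by (auto simp: homogeneous_bounded_domain_def)
   thus "Re (W.ker z z) / k z ^ N \<le> C" using W_ratio_le[of F p] p by (simp add: C_def)
   obtain F where "biholomorphic_automorphism D F" "F z = p"
    using homogeneous p z by (auto simp: homogeneous_bounded_domain_def)
   thus "C \<le> Re (W.ker z z) / k z ^ N" using W_ratio_le[of F z] z by (simp add: C_def)
  qed
  have diag: "W.ker z z - of_real C * K z z ^ N = 0" if z: "z \<in> D" for z
  proof -
   have "Re (W.ker z z) = C * k z ^ N" using ratio[OF z] k_pos[OF z] by (simp add: field_simps)
   moreover have "W.ker z z = of_real (Re (W.ker z z))" using W.nsq_ker[OF z] by simp
   ultimately show ?thesis by (simp add: K_diag[OF z])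
  qed
  have "W.ker z w - of_real C * K z w ^ N = 0" if "z \<in> D" "w \<in> D" for z w
   by (rule sesqui_eq_on_diagonal[OF sesqui_diff[OF W.sesqui_ker sesqui_cmult_power[OF B.sesqui_ker]]
     D_facts(1,2) diag that])
  thus ?thesis using C by auto
qed

end

section \<open>Local expansion of the normalised kernel\<close>

context bounded_dom
begin

text \<open>
  The functions that vanish at \<open>p\<close> see only the component of the kernel function of \<open>u\<close>
  orthogonal to that of \<open>p\<close>, whose norm is the quantity estimated here.
\<close>

definition defect :: "complex^'n \<Rightarrow> complex^'n \<Rightarrow> real" where
  "defect p u = k u - (cmod (K u p))\<^sup>2 / k p"

lemma defect_nonneg: "p \<in> D \<Longrightarrow> u \<in> D \<Longrightarrow> 0 \<le> defect p u"
  using B.ker_cs[of u p] k_pos[of p] by (simp add: defect_def k_eq field_simps)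

lemma defect_bound:
  assumes p: "p \<in> D" and u: "u \<in> D" and f: "f \<in> B.H"
  shows "(cmod (f u - K u p / of_real (k p) * f p))\<^sup>2 \<le> nsq B.M f * defect p u"
proof -
  let ?c = "K p u / of_real (k p)"
  define g where "g z = K z u - ?c * K z p" for z
  have sq: "square_integrable B.M (\<lambda>z. K z u)" "square_integrable B.M (\<lambda>z. ?c * K z p)"
   by (rule B.HD(2)[OF B.ker_H[OF u]]) (rule square_integrable_cmult[OF B.HD(2)[OF B.ker_H[OF p]]])
  have sqf: "square_integrable B.M f" using B.HD(2)[OF f] .
  have g: "square_integrable B.M g" unfolding g_def by (intro square_integrable_diff sq)
  have cc: "cnj ?c = K u p / of_real (k p)" using B.ker_cnj p u by simp
  have "l2_inner B.M f g = f u - cnj ?c * f p"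
   unfolding g_def l2_inner_diff_right[OF sq sqf] l2_inner_cmult_right B.reproducing[OF u f] B.reproducing[OF p f] ..
  moreover have "nsq B.M g = defect p u"
  proof -
   have Re_eq: "Re (cnj ?c * K p u) = (cmod (K u p))\<^sup>2 / k p"
   proof -
    have "cnj ?c * K p u = K u p * cnj (K u p) / of_real (k p)" by (simp add: B.ker_cnj[OF u p] B.ker_cnj[OF p u])
    also have "\<dots> = of_real ((cmod (K u p))\<^sup>2 / k p)" by (simp add: complex_norm_square[symmetric])
    finally show ?thesis by (metis Re_complex_of_real)
   qed
   have n: "nsq B.M (\<lambda>z. K z w) = k w" if "w \<in> D" for w using B.nsq_ker[OF that] by (simp add: k_eq)
   have cK: "cmod (K p u) = cmod (K u p)" using B.ker_cnj[OF u p] by (metis complex_mod_cnj)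
   have "nsq B.M g = k u - 2 * Re (l2_inner B.M (\<lambda>z. K z u) (\<lambda>z. ?c * K z p)) + (cmod ?c)\<^sup>2 * k p"
    unfolding g_def nsq_diff[OF sq] nsq_cmult n[OF p] n[OF u] ..
   also have "l2_inner B.M (\<lambda>z. K z u) (\<lambda>z. ?c * K z p) = cnj ?c * K p u"
    unfolding l2_inner_cmult_right B.reproducing[OF p B.ker_H[OF u]] ..
   also have "(cmod ?c)\<^sup>2 * k p = (cmod (K u p))\<^sup>2 / k p"
    using k_pos[OF p] cK by (simp add: norm_divide power_divide power2_eq_square)
   finally show ?thesis unfolding Re_eq defect_def by simp
  qed
  ultimately show ?thesis using l2_cauchy_schwarz[OF sqf g] by (simp add: B.ker_cnj[OF p u])
qed

definition \<beta> :: "complex^'n \<Rightarrow> complex^'n \<Rightarrow> real" where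
  "\<beta> u p = (cmod (K u p))\<^sup>2 / (k u * k p)"

lemma beta_defect: "u \<in> D \<Longrightarrow> p \<in> D \<Longrightarrow> defect p u = k u * (1 - \<beta> u p)"
  using k_pos[of u] k_pos[of p] by (simp add: \<beta>_def defect_def field_simps)

lemma beta_nonneg: "u \<in> D \<Longrightarrow> p \<in> D \<Longrightarrow> 0 \<le> \<beta> u p"
  using k_pos[of u] k_pos[of p] by (simp add: \<beta>_def)

lemma beta_le_1: "u \<in> D \<Longrightarrow> p \<in> D \<Longrightarrow> \<beta> u p \<le> 1"
  using defect_nonneg[of p u] k_pos[of u] beta_defect[of u p] by (simp add: zero_le_mult_iff)

text \<open>
  Testing with the coordinate functions bounds \<open>1 - \<beta>\<close> below by a multiple of \<open>|u - p|\<^sup>2 / k u\<close>;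
  testing with the constant \<open>1\<close> shows that \<open>k u\<close> stays bounded while \<open>\<beta>\<close> is close to \<open>1\<close>.
\<close>

lemma beta_bound:
  assumes p: "p \<in> D"
  obtains c where "0 < c" "\<And>u. u \<in> D \<Longrightarrow> \<beta> u p \<le> 1 - c * (norm (u - p))\<^sup>2"
proof -
  obtain R where R: "0 < R" "\<And>u. u \<in> D \<Longrightarrow> norm (u - p) \<le> R"
  proof -
   obtain b where b: "0 < b" "\<And>x. x \<in> D \<Longrightarrow> norm x \<le> b" using D_facts(4) bounded_pos by metis
   have "norm (u - p) \<le> b + b" if "u \<in> D" for u
    using norm_triangle_ineq4[of u p] b(2)[OF that] b(2)[OF p] by linarith
   thus ?thesis using that[of "b + b"] b(1) by auto
  qed
  define f where "f j = ext (\<lambda>z. z $ j - p $ j)" for j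
  have fH: "f j \<in> B.H" for j
   unfolding f_def
  proof (rule ext_H)
   show "holomorphic_fun D (\<lambda>z. z $ j - p $ j)" by (intro holomorphic_fun_diff holomorphic_fun_nth holomorphic_fun_const)
   show "cmod (z $ j - p $ j) \<le> R" if "z \<in> D" for z
    using Finite_Cartesian_Product.norm_nth_le[of "z - p" j] R(2)[OF that] by simp
  qed
  define Q where "Q = (\<Sum>j\<in>UNIV. nsq B.M (f j))"
  have Q: "0 \<le> Q" unfolding Q_def by (intro sum_nonneg nsq_nonneg)
  have coord: "(norm (u - p))\<^sup>2 \<le> Q * defect p u" if u: "u \<in> D" for u
  proof -
   have "(norm (u - p))\<^sup>2 = (\<Sum>j\<in>UNIV. (cmod (u $ j - p $ j))\<^sup>2)"
    by (simp add: norm_vec_def L2_set_def sum_nonneg)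
   also have "\<dots> \<le> (\<Sum>j\<in>UNIV. nsq B.M (f j) * defect p u)"
   proof (rule sum_mono)
    fix j
    show "(cmod (u $ j - p $ j))\<^sup>2 \<le> nsq B.M (f j) * defect p u"
     using defect_bound[OF p u fH[of j]] u p by (simp add: f_def ext_def)
   qed
   finally show ?thesis by (simp add: Q_def sum_distrib_right)
  qed
  have one: "ext (\<lambda>_. 1) \<in> B.H" by (rule ext_H[where C = 1]) (auto intro: holomorphic_fun_const)
  have kp: "0 < k p" by (rule k_pos[OF p])
  define V where "V = vol * k p"
  have V: "1 \<le> V" using k_lower[OF p] vol_pos by (simp add: V_def field_simps)
  define \<delta> where "\<delta> = 1 / (16 * V)"
  have \<delta>: "0 < \<delta>" "\<delta> \<le> 1/16" "\<delta> * V = 1/16" using V by (auto simp: \<delta>_def field_simps)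
  have ku: "k u \<le> 4 * k p" if u: "u \<in> D" and b: "1 - \<beta> u p \<le> \<delta>" for u
  proof -
   define s where "s = sqrt (k u / k p)"
   have s: "0 < s" "s\<^sup>2 = k u / k p" using k_pos[OF u] kp by (auto simp: s_def)
   have "(cmod (1 - K u p / of_real (k p)))\<^sup>2 \<le> vol * (k u * (1 - \<beta> u p))"
    using defect_bound[OF p u one] u p by (simp add: nsq_one ext_def beta_defect)
   also have "\<dots> \<le> vol * (k u * \<delta>)" using b vol_pos k_pos[OF u] by (intro mult_left_mono) auto
   also have "\<dots> = s\<^sup>2 * (\<delta> * V)" using kp by (simp add: s(2) V_def)
   also have "\<dots> = (s / 4)\<^sup>2" by (simp add: \<delta>(3) power2_eq_square)
   finally have "cmod (1 - K u p / of_real (k p)) \<le> s / 4"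
    by (rule power2_le_imp_le) (use s(1) in simp)
   hence 1: "cmod (K u p) / k p \<le> 1 + s / 4"
    using norm_triangle_ineq2[of "K u p / of_real (k p)" 1] kp by (simp add: norm_divide norm_minus_commute)
   have "(s * (3/4))\<^sup>2 \<le> s\<^sup>2 * \<beta> u p"
   proof -
    have "9 / 16 \<le> \<beta> u p" using b \<delta>(2) by linarith
    from mult_left_mono[OF this, of "s\<^sup>2"] show ?thesis by (simp add: power_mult_distrib power2_eq_square)
   qed
   also have "\<dots> = (cmod (K u p) / k p)\<^sup>2"
    unfolding s(2) \<beta>_def using k_pos[OF u] kp by (simp add: power2_eq_square)
   finally have "s * (3/4) \<le> cmod (K u p) / k p" by (rule power2_le_imp_le) (use kp in simp)
   with 1 have "s \<le> 2" by linarith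
   hence "s\<^sup>2 \<le> 2\<^sup>2" using s(1) by (intro power_mono) auto
   thus ?thesis using s(2) kp by (simp add: field_simps)
  qed
  define c where "c = min (1 / (4 * k p * (Q + 1))) (\<delta> / R\<^sup>2)"
  have pos: "0 < 4 * k p * (Q + 1)" using kp Q by simp
  have "0 < c" using \<delta>(1) R(1) pos by (simp add: c_def)
  moreover have "\<beta> u p \<le> 1 - c * (norm (u - p))\<^sup>2" if u: "u \<in> D" for u
  proof (cases "1 - \<beta> u p \<le> \<delta>")
   case True
   have nn: "0 \<le> 1 - \<beta> u p" using beta_le_1[OF u p] by simp
   have "(norm (u - p))\<^sup>2 \<le> Q * (k u * (1 - \<beta> u p))" using coord[OF u] by (simp add: beta_defect[OF u p])
   also have "\<dots> \<le> (Q + 1) * (4 * k p * (1 - \<beta> u p))"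
    using ku[OF u True] nn Q k_pos[OF u] by (intro mult_mono) auto
   finally have "(norm (u - p))\<^sup>2 \<le> (4 * k p * (Q + 1)) * (1 - \<beta> u p)" by (simp only: mult_ac)
   hence "(1 / (4 * k p * (Q + 1))) * (norm (u - p))\<^sup>2 \<le> 1 - \<beta> u p"
    using pos by (simp add: divide_le_eq mult.commute)
   moreover have "c * (norm (u - p))\<^sup>2 \<le> (1 / (4 * k p * (Q + 1))) * (norm (u - p))\<^sup>2"
    by (intro mult_right_mono) (auto simp: c_def)
   ultimately show ?thesis by linarith
  next
   case False
   have "c * (norm (u - p))\<^sup>2 \<le> (\<delta> / R\<^sup>2) * R\<^sup>2"
    using R(2)[OF u] \<open>0 < c\<close> \<delta>(1) by (intro mult_mono power_mono) (auto simp: c_def)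
   also have "\<dots> = \<delta>" using R(1) by simp
   finally show ?thesis using False by simp
  qed
  ultimately show ?thesis using that by blast
qed

end

lemma sesqui_product:
  assumes "holomorphic_fun U a" "holomorphic_fun U b" "open U"
  shows "sesqui U (\<lambda>z w. a z * cnj (b w))"
  unfolding sesqui_def
proof (intro conjI ballI)
  fix z w assume zw: "z \<in> U" "w \<in> U"
  obtain r where r: "0 < r" "cball z r \<subseteq> U" using zw assms(3) open_contains_cball by blast
  obtain s where s: "0 < s" "cball w s \<subseteq> U" using zw assms(3) open_contains_cball by blast
  obtain B where B: "0 < B" "\<And>x. x \<in> cball z r \<Longrightarrow> cmod (a x) \<le> B"
   using holomorphic_fun_bounded_cball[OF assms(1) r(2)] by metis
  obtain C where C: "0 < C" "\<And>x. x \<in> cball w s \<Longrightarrow> cmod (b x) \<le> C"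
   using holomorphic_fun_bounded_cball[OF assms(2) s(2)] by metis
  have "cmod (a z' * cnj (b w')) \<le> B * C" if "z' \<in> cball z (min r s)" "w' \<in> cball w (min r s)" for z' w'
   using B C that by (auto simp: norm_mult intro!: mult_mono)
  moreover have "cball z (min r s) \<subseteq> U" "cball w (min r s) \<subseteq> U" using r s by auto
  ultimately show "\<exists>r>0. \<exists>B. cball z r \<subseteq> U \<and> cball w r \<subseteq> U \<and>
    (\<forall>z'\<in>cball z r. \<forall>w'\<in>cball w r. cmod (a z' * cnj (b w')) \<le> B)"
   using r(1) s(1) by (intro exI[of _ "min r s"] exI[of _ "B * C"] conjI ballI) simp_all
next
  fix w show "holomorphic_fun U (\<lambda>z. a z * cnj (b w))"
   using holomorphic_fun_mult[OF assms(1) holomorphic_fun_const] .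
next
  fix z show "holomorphic_fun U (\<lambda>w. cnj (a z * cnj (b w)))"
   using holomorphic_fun_cmult[OF assms(2), of "cnj (a z)"] by simp
qed

lemma d1_eqI:
  assumes "((\<lambda>z. G z w) has_derivative L) (at z)"
  shows "d1 v G z w = L v"
  using frechet_derivative_at[OF assms] by (simp add: d1_def dd_def)

lemma d2_eqI:
  assumes "((\<lambda>w. cnj (G z w)) has_derivative L) (at w)"
  shows "d2 v G z w = cnj (L v)"
  using frechet_derivative_at[OF assms] by (simp add: d2_def adj_def d1_def dd_def)

text \<open>A kernel that vanishes as soon as one variable equals \<open>p\<close> starts with its mixed second derivative.\<close>

lemma sesqui_axes_expansion:
  fixes E :: "complex^'n \<Rightarrow> complex^'n \<Rightarrow> complex"
  assumes E: "sesqui U E" and U: "open U" and p: "p \<in> U"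
   and axes: "\<And>z. z \<in> U \<Longrightarrow> E z p = 0" "\<And>w. w \<in> U \<Longrightarrow> E p w = 0"
  obtains r C where "0 < r" "0 < C" "\<And>x y. norm x \<le> r \<Longrightarrow> norm y \<le> r \<Longrightarrow>
    cmod (E (p + x) (p + y) - d1 x (d2 y E) p p) \<le> C * norm x * norm y * (norm x + norm y)"
proof -
  have hol1: "holomorphic_fun U (\<lambda>z. E z w)" if "w \<in> U" for w
   using E that by (auto simp: sesqui_def)
  have hol2: "holomorphic_fun U (\<lambda>w. cnj (E z w))" if "z \<in> U" for z
   using E that by (auto simp: sesqui_def)
  obtain r B where r: "0 < r" "cball p (2 * r) \<subseteq> U" "0 < B"
   and B: "\<And>z' w'. z' \<in> cball p (2 * r) \<Longrightarrow> w' \<in> cball p (2 * r) \<Longrightarrow> cmod (E z' w') \<le> B"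
   using sesqui_bound[OF E p p] by metis
  have sub: "cball p r \<subseteq> cball p (2 * r)" using r by (auto simp: subset_iff)
  hence subU: "cball p r \<subseteq> U" using r by auto
  have "cmod (E (p + x) (p + y) - d1 x (d2 y E) p p) \<le> (8 * B / r ^ 3) * norm x * norm y * (norm x + norm y)"
   if x: "norm x \<le> r" and y: "norm y \<le> r" for x y
  proof -
   have px: "p + x \<in> cball p r" "p + x \<in> U" using x subU by (auto simp: dist_norm subset_iff)
   \<comment> \<open>Schwarz in the first variable, then the Taylor formula in the second.\<close>
   have s1: "cmod (cnj (E (p + x) w)) \<le> 2 * B * (norm x / r)" if w: "w \<in> cball p r" for w
   proof -
    have wU: "w \<in> U" using w subU by auto
    have "cmod (E (p + x) w - E p w) \<le> 2 * B * (norm x / r)"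
     by (rule taylor_estimate(1)[OF hol1[OF wU] U subU r(1) _ x]) (use B sub w in blast)
    thus ?thesis using axes(2)[OF wU] by simp
   qed
   have 1: "cmod (E (p + x) (p + y) - d2 y E (p + x) p) \<le> 4 * (2 * B * (norm x / r)) * (norm y / r)\<^sup>2"
   proof -
    have "cmod (cnj (E (p + x) (p + y)) - cnj (E (p + x) p) - fd (\<lambda>w. cnj (E (p + x) w)) p y)
      \<le> 4 * (2 * B * (norm x / r)) * (norm y / r)\<^sup>2"
     by (rule taylor_estimate(2)[OF hol2[OF px(2)] U subU r(1) s1 y])
    moreover have "cnj (E (p + x) (p + y)) - cnj (E (p + x) p) - fd (\<lambda>w. cnj (E (p + x) w)) p y
      = cnj (E (p + x) (p + y) - d2 y E (p + x) p)"
     using axes(1)[OF px(2)] by (simp add: d2_def adj_def d1_def dd_def)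
    ultimately show ?thesis by (metis complex_mod_cnj)
   qed
   have 2: "cmod (d2 y E (p + x) p - d1 x (d2 y E) p p) \<le> 4 * (2 * B * (norm y / r)) * (norm x / r)\<^sup>2"
   proof -
    have hol: "holomorphic_fun U (\<lambda>z. d2 y E z p)" using sesqui_d2[OF E U] p by (auto simp: sesqui_def)
    have bd: "cmod (d2 y E z p) \<le> 2 * B * (norm y / r)" if z: "z \<in> cball p r" for z
    proof -
     have "cmod (d1 y (adj E) p z) \<le> 2 * B * (norm y / r)"
      by (rule d1_scale_bound[OF _ U subU r(1)])
       (use z subU sub B hol2 in \<open>auto simp: adj_def subset_iff\<close>)
     thus ?thesis by (simp add: d2_def adj_def)
    qed
    have "d2 y E p p = 0"
    proof -
     have "((\<lambda>w. cnj (E p w)) has_derivative (\<lambda>_. 0)) (at p)"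
      by (rule has_derivative_transform_within_open[OF has_derivative_const U p]) (simp add: axes(2))
     thus ?thesis by (subst d2_eqI) auto
    qed
    thus ?thesis
     using taylor_estimate(2)[OF hol U subU r(1) bd x] by (simp add: d1_def dd_def)
   qed
   have "cmod (E (p + x) (p + y) - d1 x (d2 y E) p p) \<le>
    4 * (2 * B * (norm x / r)) * (norm y / r)\<^sup>2 + 4 * (2 * B * (norm y / r)) * (norm x / r)\<^sup>2"
    using 1 2 norm_triangle_ineq[of "E (p + x) (p + y) - d2 y E (p + x) p" "d2 y E (p + x) p - d1 x (d2 y E) p p"]
    by simp
   also have "\<dots> = (8 * B / r ^ 3) * norm x * norm y * (norm x + norm y)"
    using r(1) by (simp add: power2_eq_square power3_eq_cube field_simps)
   finally show ?thesis .
  qed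
  moreover have "0 < 8 * B / r ^ 3" using r by simp
  ultimately show ?thesis using that r(1) by blast
qed

lemma exp_limit_complex:
  fixes a :: "nat \<Rightarrow> complex"
  assumes "(\<lambda>n. of_nat n * (a n - 1)) \<longlonglongrightarrow> L"
  shows "(\<lambda>n. a n ^ n) \<longlonglongrightarrow> exp L"
proof -
  define h where "h n = a n - 1" for n
  have nh: "(\<lambda>n. of_nat n * h n) \<longlonglongrightarrow> L" using assms by (simp add: h_def)
  have h0: "h \<longlonglongrightarrow> 0"
  proof -
   have "(\<lambda>n. (of_nat n * h n) * inverse (of_nat n)) \<longlonglongrightarrow> L * 0"
    by (intro tendsto_mult nh lim_inverse_n)
   moreover have "\<forall>\<^sub>F n in sequentially. (of_nat n * h n) * inverse (of_nat n) = h n"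
    using eventually_gt_at_top[of 0] by eventually_elim simp
   ultimately show ?thesis by (simp add: tendsto_cong)
  qed
  have ev: "\<forall>\<^sub>F n in sequentially. cmod (h n) < 1/2"
   using tendsto_norm[OF h0] by (intro order_tendstoD(2)[where y = 0 and f = "\<lambda>n. cmod (h n)"]) auto
  have "(\<lambda>n. of_nat n * ln (1 + h n) - of_nat n * h n) \<longlonglongrightarrow> 0"
  proof (rule Lim_null_comparison)
   show "\<forall>\<^sub>F n in sequentially. cmod (of_nat n * ln (1 + h n) - of_nat n * h n) \<le> 2 * (cmod (of_nat n * h n) * cmod (h n))"
    using ev
   proof eventually_elim
    case (elim n)
    have "cmod (ln (1 + h n) - h n) \<le> (cmod (h n))\<^sup>2 / (1 - cmod (h n))"
     using elim by (intro Ln_approx_linear) simp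
    also have "\<dots> \<le> (cmod (h n))\<^sup>2 / (1/2)" using elim by (intro divide_left_mono) auto
    finally have "cmod (ln (1 + h n) - h n) \<le> 2 * (cmod (h n))\<^sup>2" by simp
    hence "real n * cmod (ln (1 + h n) - h n) \<le> real n * (2 * (cmod (h n))\<^sup>2)" by (intro mult_left_mono) auto
    moreover have "of_nat n * ln (1 + h n) - of_nat n * h n = of_nat n * (ln (1 + h n) - h n)" by (simp add: algebra_simps)
    ultimately show ?case by (simp add: norm_mult power2_eq_square mult_ac)
   qed
   have "(\<lambda>n. 2 * (cmod (of_nat n * h n) * cmod (h n))) \<longlonglongrightarrow> 2 * (cmod L * cmod 0)"
    by (intro tendsto_intros nh h0)
   thus "(\<lambda>n. 2 * (cmod (of_nat n * h n) * cmod (h n))) \<longlonglongrightarrow> 0" by simp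
  qed
  hence "(\<lambda>n. (of_nat n * ln (1 + h n) - of_nat n * h n) + of_nat n * h n) \<longlonglongrightarrow> 0 + L"
   by (intro tendsto_add nh)
  hence "(\<lambda>n. exp (of_nat n * ln (1 + h n))) \<longlonglongrightarrow> exp L" by (intro tendsto_exp) simp
  moreover have "\<forall>\<^sub>F n in sequentially. exp (of_nat n * ln (1 + h n)) = a n ^ n"
   using ev
  proof eventually_elim
   case (elim n)
   have "a n \<noteq> 0" using elim by (auto simp: h_def)
   thus ?case by (simp add: exp_of_nat_mult h_def)
  qed
  ultimately show ?thesis by (simp add: tendsto_cong)
qed

context bounded_dom
begin

text \<open>The polarised defect; unlike the logarithm of the kernel it is sesquiholomorphic on all of \<open>D\<close>.\<close>

definition Ed :: "complex^'n \<Rightarrow> complex^'n \<Rightarrow> complex^'n \<Rightarrow> complex" where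
  "Ed p z w = of_real (k p) * K z w ^ 1 - K z p * cnj (K w p)"

text \<open>
  The hermitian form of the Bergman metric, that is, the mixed second derivative of \<open>ln k\<close> at \<open>p\<close>. Because the
  polarised defect vanishes on both axes, the logarithm contributes nothing beyond the factor \<open>1 / (k p)\<^sup>2\<close>.
\<close>

definition Hm :: "complex^'n \<Rightarrow> complex^'n \<Rightarrow> complex^'n \<Rightarrow> complex" where
  "Hm p x y = d1 x (d2 y (Ed p)) p p / (of_real (k p))\<^sup>2"

lemma sesqui_Ed: "p \<in> D \<Longrightarrow> sesqui D (Ed p)"
  unfolding Ed_def
  by (intro sesqui_diff sesqui_cmult_power B.sesqui_ker sesqui_product B.HD(1)[OF B.ker_H] D_facts)

lemma Ed_axes: "p \<in> D \<Longrightarrow> z \<in> D \<Longrightarrow> Ed p z p = 0" "p \<in> D \<Longrightarrow> w \<in> D \<Longrightarrow> Ed p p w = 0"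
  using B.ker_cnj[of w p] by (simp_all add: Ed_def K_diag)

lemma Ed_cnj: "p \<in> D \<Longrightarrow> z \<in> D \<Longrightarrow> w \<in> D \<Longrightarrow> cnj (Ed p z w) = Ed p w z"
  using B.ker_cnj[of z w] by (simp add: Ed_def mult.commute)

lemma Hm_scale_left: "p \<in> D \<Longrightarrow> Hm p (c *s x) y = c * Hm p x y"
  by (simp add: Hm_def d1_scale[OF sesqui_d2[OF sesqui_Ed D_facts(1)]])

lemma Hm_add_left: "p \<in> D \<Longrightarrow> Hm p (x + x') y = Hm p x y + Hm p x' y"
  using linear_add[OF linear_d1[OF sesqui_d2[OF sesqui_Ed D_facts(1)], of p p p y], of x x']
  by (simp add: Hm_def add_divide_distrib)

lemma Ed_limit:
  assumes p: "p \<in> D"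
  shows "(\<lambda>n. of_nat n * Ed p (p + (1 / sqrt (real n)) *\<^sub>R x) (p + (1 / sqrt (real n)) *\<^sub>R y))
    \<longlonglongrightarrow> d1 x (d2 y (Ed p)) p p"
proof -
  define s where "s n = 1 / sqrt (real n)" for n
  let ?z = "\<lambda>n x. p + s n *\<^sub>R x"
  have s0: "s \<longlonglongrightarrow> 0" unfolding s_def by real_asymp
  obtain r C where r: "0 < r" "0 < C" "\<And>x y. norm x \<le> r \<Longrightarrow> norm y \<le> r \<Longrightarrow>
    cmod (Ed p (p + x) (p + y) - d1 x (d2 y (Ed p)) p p) \<le> C * norm x * norm y * (norm x + norm y)"
   using sesqui_axes_expansion[OF sesqui_Ed[OF p] D_facts(1) p Ed_axes[OF p]] by metis
  have small: "\<forall>\<^sub>F n in sequentially. norm (s n *\<^sub>R v) \<le> r" for v :: "complex^'n"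
  proof -
   have "(\<lambda>n. norm (s n *\<^sub>R v)) \<longlonglongrightarrow> norm ((0::real) *\<^sub>R v)" by (intro tendsto_intros s0)
   hence "\<forall>\<^sub>F n in sequentially. norm (s n *\<^sub>R v) < r" using r(1) by (intro order_tendstoD(2)) auto
   thus ?thesis by eventually_elim simp
  qed
  have scale: "d1 (c *\<^sub>R x) (d2 (c *\<^sub>R y) (Ed p)) p p = of_real (c\<^sup>2) * d1 x (d2 y (Ed p)) p p" for c :: real
  proof -
   have S: "sesqui D (Ed p)" by (rule sesqui_Ed[OF p])
   have eq: "d2 (of_real c *s y) (Ed p) z p = of_real c * d2 y (Ed p) z p" if "z \<in> D" for z
    using d2_scale[OF S that p, of "of_real c" y] by simp
   have hol: "holomorphic_fun D (\<lambda>z. d2 y (Ed p) z p)" using sesqui_d2[OF S D_facts(1)] p by (auto simp: sesqui_def)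
   have "((\<lambda>z. of_real c * d2 y (Ed p) z p) has_derivative (\<lambda>v. of_real c * fd (\<lambda>z. d2 y (Ed p) z p) p v)) (at p)"
    by (rule has_derivative_mult_right[OF holomorphic_funD(1)[OF hol p]])
   hence "((\<lambda>z. d2 (of_real c *s y) (Ed p) z p) has_derivative (\<lambda>v. of_real c * fd (\<lambda>z. d2 y (Ed p) z p) p v)) (at p)"
    by (rule has_derivative_transform_within_open[OF _ D_facts(1) p]) (simp add: eq)
   from d1_eqI[where G = "d2 (of_real c *s y) (Ed p)" and z = p and w = p, OF this, of x]
   have "d1 x (d2 (of_real c *s y) (Ed p)) p p = of_real c * d1 x (d2 y (Ed p)) p p"
    by (simp add: d1_def dd_def)
   hence "d1 (of_real c *s x) (d2 (of_real c *s y) (Ed p)) p p = of_real c * (of_real c * d1 x (d2 y (Ed p)) p p)"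
    by (simp add: d1_scale[OF sesqui_d2[OF S D_facts(1)] p p])
   thus ?thesis by (simp add: scaleR_smult power2_eq_square)
  qed
  have "(\<lambda>n. of_nat n * Ed p (?z n x) (?z n y) - d1 x (d2 y (Ed p)) p p) \<longlonglongrightarrow> 0"
  proof (rule Lim_null_comparison)
   show "\<forall>\<^sub>F n in sequentially. cmod (of_nat n * Ed p (?z n x) (?z n y) - d1 x (d2 y (Ed p)) p p)
     \<le> s n * (C * norm x * norm y * (norm x + norm y))"
    using small[of x] small[of y] eventually_gt_at_top[of 0]
   proof eventually_elim
    case (elim n)
    have sn: "0 < s n" "real n * (s n)\<^sup>2 = 1" using elim(3) by (auto simp: s_def power_divide)
    have "cmod (Ed p (?z n x) (?z n y) - of_real ((s n)\<^sup>2) * d1 x (d2 y (Ed p)) p p)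
      \<le> C * norm (s n *\<^sub>R x) * norm (s n *\<^sub>R y) * (norm (s n *\<^sub>R x) + norm (s n *\<^sub>R y))"
     using r(3)[OF elim(1,2)] by (simp only: scale)
    also have "\<dots> = (s n)\<^sup>2 * (s n * (C * norm x * norm y * (norm x + norm y)))"
     using sn(1) by (simp add: power2_eq_square algebra_simps)
    finally have "real n * cmod (Ed p (?z n x) (?z n y) - of_real ((s n)\<^sup>2) * d1 x (d2 y (Ed p)) p p)
      \<le> real n * ((s n)\<^sup>2 * (s n * (C * norm x * norm y * (norm x + norm y))))"
     by (rule mult_left_mono) simp
    also have "\<dots> = s n * (C * norm x * norm y * (norm x + norm y))"
     by (metis sn(2) mult.assoc mult_1)
    finally have "real n * cmod (Ed p (?z n x) (?z n y) - of_real ((s n)\<^sup>2) * d1 x (d2 y (Ed p)) p p)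
      \<le> s n * (C * norm x * norm y * (norm x + norm y))" .
    moreover have "of_nat n * Ed p (?z n x) (?z n y) - d1 x (d2 y (Ed p)) p p =
      of_nat n * (Ed p (?z n x) (?z n y) - of_real ((s n)\<^sup>2) * d1 x (d2 y (Ed p)) p p)"
    proof -
     have t: "of_nat n * of_real ((s n)\<^sup>2) = (1::complex)" using sn(2) by (metis of_real_1 of_real_mult of_real_of_nat_eq)
     show ?thesis unfolding right_diff_distrib mult.assoc[symmetric] t by simp
    qed
    ultimately show ?case by (simp only: norm_mult norm_of_nat)
   qed
   have "(\<lambda>n. s n * (C * norm x * norm y * (norm x + norm y))) \<longlonglongrightarrow> 0 * (C * norm x * norm y * (norm x + norm y))"
    by (intro tendsto_intros s0)
   thus "(\<lambda>n. s n * (C * norm x * norm y * (norm x + norm y))) \<longlonglongrightarrow> 0" by simp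
  qed
  thus ?thesis by (simp only: LIM_zero_iff s_def)
qed

lemma scaled_in_D:
  assumes "p \<in> D"
  shows "\<forall>\<^sub>F n in sequentially. p + (1 / sqrt (real n)) *\<^sub>R x \<in> D"
proof -
  have "(\<lambda>n. 1 / sqrt (real n)) \<longlonglongrightarrow> 0" by real_asymp
  hence "(\<lambda>n. p + (1 / sqrt (real n)) *\<^sub>R x) \<longlonglongrightarrow> p + 0 *\<^sub>R x" by (intro tendsto_intros)
  thus ?thesis using assms D_facts(1) by (simp add: topological_tendstoD)
qed

lemma Hm_cnj:
  assumes p: "p \<in> D"
  shows "cnj (Hm p x y) = Hm p y x"
proof -
  have "(\<lambda>n. cnj (of_nat n * Ed p (p + (1 / sqrt (real n)) *\<^sub>R x) (p + (1 / sqrt (real n)) *\<^sub>R y)))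
    \<longlonglongrightarrow> cnj (d1 x (d2 y (Ed p)) p p)"
   by (intro tendsto_cnj Ed_limit p)
  moreover have "\<forall>\<^sub>F n in sequentially. cnj (of_nat n * Ed p (p + (1 / sqrt (real n)) *\<^sub>R x) (p + (1 / sqrt (real n)) *\<^sub>R y))
    = of_nat n * Ed p (p + (1 / sqrt (real n)) *\<^sub>R y) (p + (1 / sqrt (real n)) *\<^sub>R x)"
   using scaled_in_D[OF p, of x] scaled_in_D[OF p, of y] by eventually_elim (simp add: Ed_cnj p)
  ultimately have "(\<lambda>n. of_nat n * Ed p (p + (1 / sqrt (real n)) *\<^sub>R y) (p + (1 / sqrt (real n)) *\<^sub>R x))
    \<longlonglongrightarrow> cnj (d1 x (d2 y (Ed p)) p p)"
   by (rule Lim_transform_eventually)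
  hence "cnj (d1 x (d2 y (Ed p)) p p) = d1 y (d2 x (Ed p)) p p"
   by (rule LIMSEQ_unique[OF _ Ed_limit[OF p]])
  thus ?thesis by (simp add: Hm_def)
qed

lemma Hm_scale_right: "p \<in> D \<Longrightarrow> Hm p x (c *s y) = cnj c * Hm p x y"
  using Hm_cnj[of p "c *s y" x] Hm_cnj[of p y x] by (metis Hm_scale_left complex_cnj_mult)

text \<open>The quadratic bound on \<open>\<beta>\<close>, to second order at \<open>p\<close>.\<close>

lemma Hm_pos:
  assumes p: "p \<in> D" and c: "\<And>u. u \<in> D \<Longrightarrow> \<beta> u p \<le> 1 - c * (norm (u - p))\<^sup>2"
  shows "c * (norm x)\<^sup>2 \<le> Re (Hm p x x)"
proof -
  define s where "s n = 1 / sqrt (real n)" for n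
  let ?z = "\<lambda>n x. p + s n *\<^sub>R x"
  have kp: "0 < k p" by (rule k_pos[OF p])
  have s0: "s \<longlonglongrightarrow> 0" unfolding s_def by real_asymp
  have cont: "(\<lambda>n. k (?z n x)) \<longlonglongrightarrow> k (p + 0 *\<^sub>R x)"
  proof -
   have "isCont k p" using k_continuous D_facts(1) p continuous_on_eq_continuous_at by blast
   hence "isCont k (p + 0 *\<^sub>R x)" by simp
   moreover have "(\<lambda>n. ?z n x) \<longlonglongrightarrow> p + 0 *\<^sub>R x" by (intro tendsto_intros s0)
   ultimately show ?thesis by (rule isCont_tendsto_compose)
  qed
  have "k p * k p * (c * (norm x)\<^sup>2) \<le> Re (d1 x (d2 x (Ed p)) p p)"
  proof (rule LIMSEQ_le)
   show "(\<lambda>n. k p * k (?z n x) * (c * (norm x)\<^sup>2)) \<longlonglongrightarrow> k p * k p * (c * (norm x)\<^sup>2)"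
    using cont by (intro tendsto_intros) simp
   show "(\<lambda>n. Re (of_nat n * Ed p (?z n x) (?z n x))) \<longlonglongrightarrow> Re (d1 x (d2 x (Ed p)) p p)"
    unfolding s_def by (intro tendsto_Re Ed_limit p)
   have "\<forall>\<^sub>F n in sequentially. k p * k (?z n x) * (c * (norm x)\<^sup>2) \<le> Re (of_nat n * Ed p (?z n x) (?z n x))"
    using scaled_in_D[OF p, of x] eventually_gt_at_top[of 0]
   proof eventually_elim
    case (elim n)
    define u where "u = ?z n x"
    have u: "u \<in> D" using elim by (simp add: u_def s_def)
    have "K u p * cnj (K u p) = of_real ((cmod (K u p))\<^sup>2)" by (simp add: complex_norm_square[symmetric])
    hence "Ed p u u = of_real (k p * k u - (cmod (K u p))\<^sup>2)" by (simp add: Ed_def K_diag[OF u])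
    also have "k p * k u - (cmod (K u p))\<^sup>2 = k p * (k u * (1 - \<beta> u p))"
     using k_pos[OF u] kp by (simp add: \<beta>_def field_simps)
    finally have E: "Ed p u u = of_real (k p * (k u * (1 - \<beta> u p)))" .
    have "real n * (s n)\<^sup>2 = 1" using elim by (auto simp: s_def power_divide)
    moreover have "(norm (u - p))\<^sup>2 = (s n)\<^sup>2 * (norm x)\<^sup>2" by (simp add: u_def power_mult_distrib)
    ultimately have n: "real n * (norm (u - p))\<^sup>2 = (norm x)\<^sup>2" by (metis mult.assoc mult_1)
    have "c * (norm (u - p))\<^sup>2 \<le> 1 - \<beta> u p" using c[OF u] by simp
    hence "real n * (c * (norm (u - p))\<^sup>2) \<le> real n * (1 - \<beta> u p)" by (rule mult_left_mono) simp
    moreover have "real n * (c * (norm (u - p))\<^sup>2) = c * (real n * (norm (u - p))\<^sup>2)" by simp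
    ultimately have "c * (norm x)\<^sup>2 \<le> real n * (1 - \<beta> u p)" using n by simp
    hence "(k p * k u) * (c * (norm x)\<^sup>2) \<le> (k p * k u) * (real n * (1 - \<beta> u p))"
     using k_pos[OF u] kp by (intro mult_left_mono) auto
    also have "\<dots> = Re (of_nat n * Ed p u u)" by (simp add: E mult_ac)
    finally show ?case by (simp add: u_def)
   qed
   thus "\<exists>N. \<forall>n\<ge>N. k p * k (?z n x) * (c * (norm x)\<^sup>2) \<le> Re (of_nat n * Ed p (?z n x) (?z n x))"
    by (simp add: eventually_sequentially)
  qed
  moreover have "Re (Hm p x x) = Re (d1 x (d2 x (Ed p)) p p) / (k p * k p)"
  proof -
   have "(of_real (k p))\<^sup>2 = complex_of_real (k p * k p)" by (simp add: power2_eq_square)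
   thus ?thesis unfolding Hm_def by (simp only: Re_divide_of_real)
  qed
  ultimately show ?thesis using kp by (simp add: pos_le_divide_eq mult_ac)
qed

text \<open>
  The cyclic product of normalised kernel values. Its square has absolute value \<open>\<beta> z u * \<beta> u p * \<beta> z p\<close>, so its powers
  concentrate at \<open>u = z = p\<close>.
\<close>

definition \<Phi> :: "complex^'n \<Rightarrow> complex^'n \<Rightarrow> complex^'n \<Rightarrow> complex" where
  "\<Phi> p u z = K z u * K u p * K p z / of_real (k u * k z * k p)"

lemma Phi_norm:
  assumes p: "p \<in> D" and u: "u \<in> D" and z: "z \<in> D"
  shows "(cmod (\<Phi> p u z))\<^sup>2 \<le> \<beta> u p * \<beta> z p"
proof -
  have pos: "0 < k p" "0 < k u" "0 < k z" using k_pos p u z by auto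
  have "cmod (K p z) = cmod (K z p)" using B.ker_cnj[OF z p] by (metis complex_mod_cnj)
  hence "(cmod (\<Phi> p u z))\<^sup>2 = \<beta> z u * (\<beta> u p * \<beta> z p)"
   using pos by (simp add: \<Phi>_def \<beta>_def norm_divide norm_mult power_divide power_mult_distrib power2_eq_square mult_ac)
  also have "\<dots> \<le> 1 * (\<beta> u p * \<beta> z p)"
   using beta_le_1[OF z u] beta_nonneg p u z by (intro mult_right_mono) auto
  finally show ?thesis by simp
qed

text \<open>\<open>\<Phi>\<close> is bounded by \<open>sqrt (\<beta> u p * \<beta> z p)\<close>, and \<open>1 - t \<le> exp (- t)\<close>.\<close>

lemma Phi_power_bound:
  assumes p: "p \<in> D" and u: "u \<in> D" and z: "z \<in> D"
   and c: "0 < c" "\<And>u. u \<in> D \<Longrightarrow> \<beta> u p \<le> 1 - c * (norm (u - p))\<^sup>2"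
  shows "cmod (\<Phi> p u z ^ n) \<le> exp (- (c / 2) * real n * (norm (u - p))\<^sup>2) * exp (- (c / 2) * real n * (norm (z - p))\<^sup>2)"
proof -
  have b: "\<beta> v p \<le> exp (- c * (norm (v - p))\<^sup>2)" if "v \<in> D" for v
   using c(2)[OF that] exp_ge_add_one_self[of "- c * (norm (v - p))\<^sup>2"] by simp
  have "(cmod (\<Phi> p u z))\<^sup>2 \<le> exp (- c * (norm (u - p))\<^sup>2) * exp (- c * (norm (z - p))\<^sup>2)"
   using Phi_norm[OF p u z] b[OF u] b[OF z] beta_nonneg p u z
   by (meson exp_ge_zero mult_mono order_trans)
  also have "\<dots> = (exp (- (c / 2) * (norm (u - p))\<^sup>2) * exp (- (c / 2) * (norm (z - p))\<^sup>2))\<^sup>2"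
   by (simp add: power2_eq_square exp_add[symmetric])
  finally have "cmod (\<Phi> p u z) \<le> exp (- (c / 2) * (norm (u - p))\<^sup>2) * exp (- (c / 2) * (norm (z - p))\<^sup>2)"
   by (rule power2_le_imp_le) simp
  hence "cmod (\<Phi> p u z) ^ n \<le> (exp (- (c / 2) * (norm (u - p))\<^sup>2) * exp (- (c / 2) * (norm (z - p))\<^sup>2)) ^ n"
   by (intro power_mono) auto
  thus ?thesis by (simp add: norm_power power_mult_distrib exp_of_nat_mult[symmetric] mult_ac)
qed

text \<open>
  At distance \<open>1 / sqrt n\<close> from \<open>p\<close> each normalised kernel value is \<open>1\<close> plus a term of order \<open>1 / n\<close>, so that
  the \<open>n\<close>-th power tends to an exponential.
\<close>

lemma Phi_limit:
  assumes p: "p \<in> D"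
  shows "(\<lambda>n. \<Phi> p (p + (1 / sqrt (real n)) *\<^sub>R x) (p + (1 / sqrt (real n)) *\<^sub>R y) ^ n)
    \<longlonglongrightarrow> exp (Hm p y x - Hm p x x - Hm p y y)"
proof -
  define t where "t v n = p + (1 / sqrt (real n)) *\<^sub>R v" for v n
  have kp: "0 < k p" by (rule k_pos[OF p])
  have tp: "t v \<longlonglongrightarrow> p" for v
  proof -
   have "(\<lambda>n. 1 / sqrt (real n)) \<longlonglongrightarrow> 0" by real_asymp
   hence "(\<lambda>n. p + (1 / sqrt (real n)) *\<^sub>R v) \<longlonglongrightarrow> p + 0 *\<^sub>R v" by (intro tendsto_intros)
   thus ?thesis by (simp add: t_def[abs_def])
  qed
  have Kt: "(\<lambda>n. K (t v n) p) \<longlonglongrightarrow> of_real (k p)" for v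
  proof -
   have "isCont (\<lambda>z. K z p) p"
    using B.HD(4)[OF B.ker_H[OF p]] D_facts(1) p continuous_on_eq_continuous_at by blast
   from isCont_tendsto_compose[OF this tp] show ?thesis by (simp add: K_diag[OF p])
  qed
  have ev: "\<forall>\<^sub>F n in sequentially. t v n \<in> D \<and> K (t v n) p \<noteq> 0" for v
  proof -
   have "\<forall>\<^sub>F n in sequentially. t v n \<in> D" unfolding t_def by (rule scaled_in_D[OF p])
   moreover have "\<forall>\<^sub>F n in sequentially. K (t v n) p \<noteq> 0"
    using kp by (intro tendsto_imp_eventually_ne[OF Kt]) simp
   ultimately show ?thesis by eventually_elim simp
  qed
  define Kn where "Kn v w n = of_real (k p) * K (t v n) (t w n) / (K (t v n) p * cnj (K (t w n) p))" for v w n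
  have lim: "(\<lambda>n. Kn v w n ^ n) \<longlonglongrightarrow> exp (Hm p v w)" for v w
  proof (rule exp_limit_complex)
   have "(\<lambda>n. of_nat n * Ed p (t v n) (t w n) / (K (t v n) p * cnj (K (t w n) p)))
     \<longlonglongrightarrow> d1 v (d2 w (Ed p)) p p / (of_real (k p) * cnj (of_real (k p)))"
    unfolding t_def[of v] t_def[of w]
    by (intro tendsto_divide Ed_limit p tendsto_mult tendsto_cnj Kt[unfolded t_def]) (use kp in auto)
   moreover have "d1 v (d2 w (Ed p)) p p / (of_real (k p) * cnj (of_real (k p))) = Hm p v w"
    by (simp add: Hm_def power2_eq_square)
   moreover have "\<forall>\<^sub>F n in sequentially. of_nat n * Ed p (t v n) (t w n) / (K (t v n) p * cnj (K (t w n) p)) = of_nat n * (Kn v w n - 1)"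
    using ev[of v] ev[of w] by eventually_elim (simp add: Ed_def Kn_def field_simps)
   ultimately show "(\<lambda>n. of_nat n * (Kn v w n - 1)) \<longlonglongrightarrow> Hm p v w"
    using Lim_transform_eventually by fastforce
  qed
  have "(\<lambda>n. Kn y x n ^ n / (Kn x x n ^ n * Kn y y n ^ n)) \<longlonglongrightarrow> exp (Hm p y x) / (exp (Hm p x x) * exp (Hm p y y))"
   by (intro tendsto_divide tendsto_mult lim) simp
  moreover have "exp (Hm p y x) / (exp (Hm p x x) * exp (Hm p y y)) = exp (Hm p y x - Hm p x x - Hm p y y)"
   by (simp add: exp_diff)
  moreover have "\<forall>\<^sub>F n in sequentially. Kn y x n ^ n / (Kn x x n ^ n * Kn y y n ^ n) = \<Phi> p (t x n) (t y n) ^ n"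
   using ev[of x] ev[of y]
  proof eventually_elim
   case (elim n)
   have xy: "t x n \<in> D" "t y n \<in> D" using elim by auto
   have "K p (t y n) = cnj (K (t y n) p)" using B.ker_cnj[OF xy(2) p] by simp
   hence "Kn y x n / (Kn x x n * Kn y y n) = \<Phi> p (t x n) (t y n)"
    using elim kp k_pos[OF xy(1)] k_pos[OF xy(2)]
    by (simp add: Kn_def \<Phi>_def K_diag[OF xy(1)] K_diag[OF xy(2)] divide_simps)
   thus ?case by (simp only: power_mult_distrib[symmetric] power_divide[symmetric])
  qed
  ultimately show ?thesis unfolding t_def using Lim_transform_eventually by fastforce
qed

section \<open>The Kaehler form\<close>

lemma axis_i: "axis j \<i> = \<i> *s axis j 1"
  by (simp add: vec_eq_iff axis_def)

lemma lnk_derivative: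
  assumes z: "z \<in> D"
  shows "((\<lambda>z. complex_of_real (ln (k z))) has_derivative (\<lambda>v. (d1 v K z z + d2 v K z z) / of_real (k z))) (at z)"
proof -
  let ?q = "\<lambda>v. d1 v K z z + d2 v K z z"
  have q: "((\<lambda>z. K z z) has_derivative ?q) (at z)"
   by (rule sesqui_has_derivative_diag[OF B.sesqui_ker D_facts(1) z])
  have Req: "(k has_derivative (\<lambda>v. Re (?q v))) (at z)"
   using has_derivative_Re[OF q] by (simp add: k_eq[abs_def])
  have "((\<lambda>z. of_real (k z)) has_derivative (\<lambda>v. of_real (Re (?q v)))) (at z)"
   by (rule has_derivative_of_real[OF Req])
  hence "((\<lambda>z. K z z) has_derivative (\<lambda>v. of_real (Re (?q v)))) (at z)"
   by (rule has_derivative_transform_within_open[OF _ D_facts(1) z]) (simp add: K_diag)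
  hence real: "of_real (Re (?q v)) = ?q v" for v
   using fun_cong[OF has_derivative_unique[OF _ q], of "\<lambda>v. of_real (Re (?q v))" v] by blast
  have "((\<lambda>z. ln (k z)) has_derivative (\<lambda>v. Re (?q v) * inverse (k z))) (at z)"
   by (rule has_derivative_ln[OF k_pos[OF z] Req])
  hence "((\<lambda>z. complex_of_real (ln (k z))) has_derivative (\<lambda>v. of_real (Re (?q v) * inverse (k z)))) (at z)"
   by (rule has_derivative_of_real)
  moreover have "(\<lambda>v. complex_of_real (Re (?q v) * inverse (k z))) = (\<lambda>v. ?q v / of_real (k z))"
   by (simp only: of_real_mult real of_real_inverse divide_inverse)
  ultimately show ?thesis by simp
qed

lemma wirtinger_bar_lnk:
  assumes z: "z \<in> D"
  shows "wirtinger_bar j (\<lambda>z. complex_of_real (ln (k z))) z = d2 (axis j 1) K z z / K z z"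
proof -
  have "fd (\<lambda>z. complex_of_real (ln (k z))) z = (\<lambda>v. (d1 v K z z + d2 v K z z) / of_real (k z))"
   using frechet_derivative_at[OF lnk_derivative[OF z]] by simp
  thus ?thesis
   using k_pos[OF z]
   by (simp add: wirtinger_bar_def axis_i d1_scale[OF B.sesqui_ker z z] d2_scale[OF B.sesqui_ker z z] K_diag[OF z] field_simps)
qed

lemma d2_Ed:
  assumes p: "p \<in> D" and z: "z \<in> D"
  shows "d2 y (Ed p) z p = of_real (k p) * d2 y K z p - K z p * d2 y K p p"
proof -
  have h1: "holomorphic_fun D (\<lambda>w. cnj (K z w))" and h2: "holomorphic_fun D (\<lambda>w. K w p)"
   using B.sesqui_ker p z by (auto simp: sesqui_def)
  have "((\<lambda>w. of_real (k p) * cnj (K z w) - cnj (K z p) * K w p) has_derivative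
    (\<lambda>v. of_real (k p) * fd (\<lambda>w. cnj (K z w)) p v - cnj (K z p) * fd (\<lambda>w. K w p) p v)) (at p)"
   by (intro derivative_intros holomorphic_funD(1)[OF h1 p] holomorphic_funD(1)[OF h2 p])
  hence "((\<lambda>w. cnj (Ed p z w)) has_derivative
    (\<lambda>v. of_real (k p) * fd (\<lambda>w. cnj (K z w)) p v - cnj (K z p) * fd (\<lambda>w. K w p) p v)) (at p)"
   by (simp add: Ed_def)
  from d2_eqI[where G = "Ed p" and z = z and w = p, OF this, of y] have "d2 y (Ed p) z p = of_real (k p) * d2 y K z p - K z p * cnj (d1 y K p p)"
   by (simp add: d2_def adj_def d1_def dd_def)
  moreover have "d2 y K p p = cnj (d1 y K p p)"
  proof -
   have "((\<lambda>w. K w p) has_derivative fd (\<lambda>w. K w p) p) (at p)"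
    by (rule holomorphic_funD(1)[OF h2 p])
   hence "((\<lambda>w. cnj (K p w)) has_derivative fd (\<lambda>w. K w p) p) (at p)"
    by (rule has_derivative_transform_within_open[OF _ D_facts(1) p]) (simp add: B.ker_cnj p)
   from d2_eqI[where G = K and z = p and w = p, OF this, of y] show ?thesis by (simp add: d1_def dd_def)
  qed
  ultimately show ?thesis by simp
qed

lemma Hm_eq:
  assumes p: "p \<in> D"
  shows "Hm p x y = (d1 x (d2 y K) p p * K p p - d2 y K p p * d1 x K p p) / (K p p * K p p)"
proof -
  have h1: "holomorphic_fun D (\<lambda>z. d2 y K z p)" and h2: "holomorphic_fun D (\<lambda>z. K z p)"
   using sesqui_d2[OF B.sesqui_ker D_facts(1)] B.sesqui_ker p by (auto simp: sesqui_def)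
  have "((\<lambda>z. of_real (k p) * d2 y K z p - K z p * d2 y K p p) has_derivative
    (\<lambda>v. of_real (k p) * fd (\<lambda>z. d2 y K z p) p v - fd (\<lambda>z. K z p) p v * d2 y K p p)) (at p)"
   by (intro derivative_intros holomorphic_funD(1)[OF h1 p] holomorphic_funD(1)[OF h2 p])
  hence "((\<lambda>z. d2 y (Ed p) z p) has_derivative
    (\<lambda>v. of_real (k p) * fd (\<lambda>z. d2 y K z p) p v - fd (\<lambda>z. K z p) p v * d2 y K p p)) (at p)"
   by (rule has_derivative_transform_within_open[OF _ D_facts(1) p]) (simp add: d2_Ed p)
  from d1_eqI[where G = "d2 y (Ed p)" and z = p and w = p, OF this, of x] show ?thesis
   by (simp add: Hm_def d1_def dd_def K_diag[OF p] power2_eq_square mult_ac)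
qed

lemma wirtinger_lnk:
  assumes p: "p \<in> D"
  shows "wirtinger i (wirtinger_bar j (\<lambda>z. complex_of_real (ln (k z)))) p = Hm p (axis i 1) (axis j 1)"
proof -
  let ?e = "axis j 1 :: complex^'n"
  have K0: "K p p \<noteq> 0" using K_diag[OF p] k_pos[OF p] by simp
  have S: "sesqui D (d2 ?e K)" by (rule sesqui_d2[OF B.sesqui_ker D_facts(1)])
  let ?L = "\<lambda>v. ((d1 v (d2 ?e K) p p + d2 v (d2 ?e K) p p) * K p p - d2 ?e K p p * (d1 v K p p + d2 v K p p)) / (K p p * K p p)"
  have "((\<lambda>z. d2 ?e K z z / K z z) has_derivative ?L) (at p)"
   by (rule has_derivative_divide'[OF sesqui_has_derivative_diag[OF S D_facts(1) p]
     sesqui_has_derivative_diag[OF B.sesqui_ker D_facts(1) p] K0])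
  hence "((wirtinger_bar j (\<lambda>z. complex_of_real (ln (k z)))) has_derivative ?L) (at p)"
   by (rule has_derivative_transform_within_open[OF _ D_facts(1) p]) (simp add: wirtinger_bar_lnk)
  from frechet_derivative_at[OF this, symmetric] show ?thesis
   using K0 by (simp add: wirtinger_def Hm_eq[OF p] axis_i d1_scale[OF B.sesqui_ker p p] d2_scale[OF B.sesqui_ker p p]
     d1_scale[OF S p p] d2_scale[OF S p p] field_simps)
qed

lemma Hm_sum_left: "p \<in> D \<Longrightarrow> Hm p (\<Sum>i\<in>I. f i) y = (\<Sum>i\<in>I. Hm p (f i) y)"
proof (induction I rule: infinite_finite_induct)
  case empty
  show ?case using Hm_scale_left[OF empty, of 0 0 y] by simp
next
  case (infinite I)
  thus ?case using Hm_scale_left[OF infinite(2), of 0 0 y] by simp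
qed (simp add: Hm_add_left)

lemma Hm_sum_right: "p \<in> D \<Longrightarrow> Hm p x (\<Sum>i\<in>I. f i) = (\<Sum>i\<in>I. Hm p x (f i))"
proof -
  assume p: "p \<in> D"
  have "Hm p x (\<Sum>i\<in>I. f i) = cnj (Hm p (\<Sum>i\<in>I. f i) x)" by (simp add: Hm_cnj[OF p])
  also have "\<dots> = (\<Sum>i\<in>I. Hm p x (f i))" by (simp add: Hm_sum_left[OF p] Hm_cnj[OF p])
  finally show ?thesis .
qed

lemma kaehler_form_eq:
  assumes p: "p \<in> D"
  shows "bergman_kaehler_form D p u v = - 2 * of_real (Im (Hm p u v))"
proof -
  have expand: "(\<Sum>i\<in>UNIV. \<Sum>j\<in>UNIV. Hm p (axis i 1) (axis j 1) * (a $ i * cnj (b $ j))) = Hm p a b" for a b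
  proof -
   have dec: "a = (\<Sum>i\<in>UNIV. a $ i *s axis i 1)" for a :: "complex^'n"
    by (simp add: vec_eq_iff axis_def if_distrib[of "\<lambda>t. _ * t"] cong: if_cong)
   have "Hm p a b = Hm p (\<Sum>i\<in>UNIV. a $ i *s axis i 1) (\<Sum>j\<in>UNIV. b $ j *s axis j 1)"
    using dec[of a] dec[of b] by simp
   thus ?thesis
    by (simp add: Hm_sum_left[OF p] Hm_sum_right[OF p] Hm_scale_left[OF p] Hm_scale_right[OF p] sum_distrib_left mult_ac)
     (rule sum.swap)
  qed
  have "bergman_kaehler_form D p u v = \<i> * (\<Sum>i\<in>UNIV. \<Sum>j\<in>UNIV.
    Hm p (axis i 1) (axis j 1) * (u $ i * cnj (v $ j) - v $ i * cnj (u $ j)))"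
   by (simp add: bergman_kaehler_form_def wirtinger_lnk[OF p])
  also have "\<dots> = \<i> * (Hm p u v - Hm p v u)"
   unfolding right_diff_distrib sum_subtractf expand ..
  also have "\<dots> = - 2 * of_real (Im (Hm p u v))"
   using Hm_cnj[OF p, of u v] by (simp add: complex_eq_iff flip: Hm_cnj[OF p, of u v])
  finally show ?thesis .
qed

end

section \<open>Gaussian integrals\<close>

lemma integrable_exp_square:
  assumes "0 < c"
  shows "integrable lborel (\<lambda>x::real. exp (- c * x\<^sup>2))"
proof -
  define \<sigma> where "\<sigma> = sqrt (1 / (2 * c))"
  have \<sigma>: "0 < \<sigma>" "2 * \<sigma>\<^sup>2 = 1 / c" using assms by (auto simp: \<sigma>_def)
  have "integrable lborel (\<lambda>x. sqrt (2 * pi * \<sigma>\<^sup>2) * normal_density 0 \<sigma> x)"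
   using integrable_normal_density[OF \<sigma>(1), of 0] by simp
  moreover have "sqrt (2 * pi * \<sigma>\<^sup>2) * normal_density 0 \<sigma> x = exp (- c * x\<^sup>2)" for x
   using \<sigma> assms by (simp add: normal_density_def)
  ultimately show ?thesis by simp
qed

lemma integrable_gaussian:
  assumes c: "0 < c"
  shows "integrable lborel (\<lambda>x::'a::euclidean_space. exp (- c * (norm x)\<^sup>2))"
proof (rule integrableI_nonneg)
  have eq: "ennreal (exp (- c * (norm x)\<^sup>2)) = (\<Prod>b\<in>Basis. ennreal (exp (- c * (x \<bullet> b)\<^sup>2)))" for x :: 'a
  proof -
   have "(norm x)\<^sup>2 = (\<Sum>b\<in>Basis. (x \<bullet> b)\<^sup>2)"
    by (simp add: norm_eq_sqrt_inner euclidean_inner[of x x] power2_eq_square sum_nonneg)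
   hence "exp (- c * (norm x)\<^sup>2) = (\<Prod>b\<in>Basis. exp (- c * (x \<bullet> b)\<^sup>2))"
    by (simp add: sum_distrib_left exp_sum[symmetric] sum_negf)
   thus ?thesis by (simp add: prod_ennreal)
  qed
  have "(\<integral>\<^sup>+x. ennreal (exp (- c * (norm (x::'a))\<^sup>2)) \<partial>lborel) = (\<Prod>b\<in>(Basis::'a set). (\<integral>\<^sup>+t. ennreal (exp (- c * t\<^sup>2)) \<partial>lborel))"
   unfolding eq by (rule nn_integral_lborel_prod) auto
  also have "(\<integral>\<^sup>+t. ennreal (exp (- c * t\<^sup>2)) \<partial>lborel) = ennreal (LINT t|lborel. exp (- c * t\<^sup>2))"
   by (rule nn_integral_eq_integral[OF integrable_exp_square[OF c]]) simp
  also have "(\<Prod>b\<in>(Basis::'a set). \<dots>) < \<infinity>" by (simp add: ennreal_power[symmetric] power_less_top_ennreal)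
  finally show "(\<integral>\<^sup>+x. ennreal (exp (- c * (norm (x::'a))\<^sup>2)) \<partial>lborel) < \<infinity>" .
qed auto

lemma self_le_exp: "t \<le> exp t" for t :: real
  using exp_ge_add_one_self[of t] by linarith

lemma gaussian_absorb:
  fixes M c t :: real
  assumes "0 < c"
  shows "M * t - c * t\<^sup>2 \<le> M\<^sup>2 / (2 * c) - (c / 2) * t\<^sup>2"
proof -
  have "0 \<le> (c * t - M)\<^sup>2 / (2 * c)" using assms by simp
  also have "\<dots> = (c / 2) * t\<^sup>2 - M * t + M\<^sup>2 / (2 * c)" using assms by (simp add: power2_eq_square field_simps)
  finally show ?thesis by simp
qed

lemma integrable_exp_gaussian:
  fixes M c :: real
  assumes c: "0 < c"
  shows "integrable lborel (\<lambda>x::'a::euclidean_space. exp (M * norm x - c * (norm x)\<^sup>2))"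
proof (rule Bochner_Integration.integrable_bound)
  show "integrable lborel (\<lambda>x::'a. exp (M\<^sup>2 / (2 * c)) * exp (- (c / 2) * (norm x)\<^sup>2))"
   by (intro integrable_mult_right integrable_gaussian) (use c in simp)
  show "AE x::'a in lborel. norm (exp (M * norm x - c * (norm x)\<^sup>2)) \<le> norm (exp (M\<^sup>2 / (2 * c)) * exp (- (c / 2) * (norm x)\<^sup>2))"
  proof (rule AE_I2)
   fix x :: 'a
   have "exp (M * norm x - c * (norm x)\<^sup>2) \<le> exp (M\<^sup>2 / (2 * c) - (c / 2) * (norm x)\<^sup>2)"
    using gaussian_absorb[OF c, of M "norm x"] by simp
   also have "\<dots> = exp (M\<^sup>2 / (2 * c)) * exp (- (c / 2) * (norm x)\<^sup>2)"
    by (simp add: exp_add[symmetric])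
   finally show "norm (exp (M * norm x - c * (norm x)\<^sup>2)) \<le> norm (exp (M\<^sup>2 / (2 * c)) * exp (- (c / 2) * (norm x)\<^sup>2))" by simp
  qed
qed measurable

lemma integrable_dominated_gaussian:
  fixes f :: "'a::euclidean_space \<Rightarrow> 'b::{banach, second_countable_topology}"
  assumes "0 < c" "f \<in> borel_measurable borel" "\<And>x. norm (f x) \<le> A * exp (M * norm x - c * (norm x)\<^sup>2)"
  shows "integrable lborel f"
proof (rule Bochner_Integration.integrable_bound)
  show "integrable lborel (\<lambda>x::'a. A * exp (M * norm x - c * (norm x)\<^sup>2))"
   by (intro integrable_mult_right integrable_exp_gaussian assms)
qed (use assms in \<open>auto intro!: AE_I2 intro: order_trans[OF _ abs_ge_self]\<close>)

locale herm_form =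
  fixes H :: "complex^'n \<Rightarrow> complex^'n \<Rightarrow> complex" and c :: real
  assumes add_left: "H (x + x') y = H x y + H x' y" and scale_left: "H (a *s x) y = a * H x y"
   and herm: "cnj (H x y) = H y x" and c: "0 < c" and pos: "c * (norm x)\<^sup>2 \<le> Re (H x x)"
begin

lemma add_right: "H x (y + y') = H x y + H x y'"
  by (metis herm add_left complex_cnj_add)

lemma scale_right: "H x (a *s y) = cnj a * H x y"
  by (metis herm scale_left complex_cnj_mult)

lemma minus_right: "H x (- y) = - H x y"
  using scale_right[of x "-1" y] by simp

lemma zero_left [simp]: "H 0 y = 0" using scale_left[of 0 0 y] by simp
lemma zero_right [simp]: "H x 0 = 0" using scale_right[of x 0 0] by simp

lemma self: "H x x = of_real (Re (H x x))"
  using herm[of x x] by (simp add: complex_eq_iff)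

lemma bounded: obtains C where "0 < C" "\<And>x y. cmod (H x y) \<le> C * norm x * norm y"
proof -
  have "bilinear H"
   unfolding bilinear_def
   by (auto intro!: linearI simp: add_left add_right scaleR_smult scale_left scale_right scaleR_conv_of_real)
  then obtain B where "\<And>x y. cmod (H x y) \<le> B * norm x * norm y" using bilinear_bounded by blast
  hence "cmod (H x y) \<le> (\<bar>B\<bar> + 1) * norm x * norm y" for x y
   by (rule order_trans) (auto intro!: mult_right_mono)
  thus ?thesis using that[of "\<bar>B\<bar> + 1"] by auto
qed

lemma bounded_bilinear: "bounded_bilinear H"
proof -
  obtain C where "\<And>x y. cmod (H x y) \<le> C * norm x * norm y" using bounded by metis
  thus ?thesis
   by (intro bounded_bilinear.intro) (auto simp: add_left add_right scaleR_smult scale_left scale_right scaleR_conv_of_real mult_ac)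
qed

lemmas cont = bounded_bilinear.continuous_on[OF bounded_bilinear]

definition E :: "complex^'n \<Rightarrow> real" where "E x = exp (- Re (H x x))"

lemma E_le: "E x \<le> exp (- c * (norm x)\<^sup>2)"
  using pos[of x] by (simp add: E_def)

lemma E_pos: "0 < E x" by (simp add: E_def)

lemma E_complex: "complex_of_real (E x) = exp (- H x x)"
  unfolding E_def by (metis exp_of_real of_real_minus self)

lemma E_cont: "continuous_on S E"
  unfolding E_def by (intro continuous_intros cont)

lemma E_rot: "cmod a = 1 \<Longrightarrow> E (a *s x) = E x"
proof -
  assume a: "cmod a = 1"
  have "H (a *s x) (a *s x) = (a * cnj a) * H x x" by (simp add: scale_left scale_right)
  also have "a * cnj a = 1" using a by (simp add: complex_norm_square[symmetric])
  finally show ?thesis by (simp add: E_def)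
qed

lemma E_integrable: "integrable lborel E"
  by (rule integrable_dominated_gaussian[OF c, where A = 1 and M = 0])
   (use E_cont E_le E_pos in \<open>auto intro!: borel_measurable_continuous_onI simp: less_imp_le\<close>)

definition c0 :: real where "c0 = (LINT x|lborel. E x)"

lemma c0_pos: "0 < c0"
proof -
  have "c0 \<noteq> 0"
  proof
   assume "c0 = 0"
   hence "AE x in lborel. E x = 0"
    unfolding c0_def using E_pos by (subst (asm) integral_nonneg_eq_0_iff_AE[OF E_integrable]) (auto simp: less_imp_le)
   hence "AE x in (lborel :: (complex^'n) measure). False" using E_pos by (simp add: less_le)
   thus False by (simp add: AE_iff_null null_sets_def emeasure_lborel_UNIV)
  qed
  moreover have "0 \<le> c0" unfolding c0_def using E_pos by (intro Bochner_Integration.integral_nonneg) (auto simp: less_imp_le)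
  ultimately show ?thesis by simp
qed

text \<open>The weight is invariant under rotations, so entire functions integrate to their value at \<open>0\<close>.\<close>

lemma mean_value:
  assumes hol: "\<And>x. (\<lambda>\<zeta>. f (\<zeta> *s x)) holomorphic_on UNIV" and cont: "continuous_on UNIV f"
   and bd: "\<And>x. cmod (f x) \<le> A * exp (M * norm x)"
  shows "integrable lborel (\<lambda>x. of_real (E x) * f x)" "(LINT x|lborel. of_real (E x) * f x) = of_real c0 * f 0"
proof -
  have A: "0 \<le> A" using bd[of 0] norm_ge_zero[of "f 0"] by (simp del: norm_ge_zero)
  have bdE: "\<bar>E x\<bar> * cmod (f x) \<le> A * exp (M * norm x - c * (norm x)\<^sup>2)" for x
  proof -
   have "\<bar>E x\<bar> * cmod (f x) \<le> exp (- c * (norm x)\<^sup>2) * (A * exp (M * norm x))"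
    using E_le[of x] E_pos[of x] bd[of x] by (intro mult_mono) auto
   also have "\<dots> = A * exp (M * norm x - c * (norm x)\<^sup>2)" by (simp add: exp_diff exp_minus divide_inverse)
   finally show ?thesis .
  qed
  have m: "(\<lambda>x. of_real (E x) * f x) \<in> borel_measurable borel"
   by (intro borel_measurable_continuous_onI continuous_intros E_cont cont)
  show "integrable lborel (\<lambda>x. of_real (E x) * f x)"
   by (rule integrable_dominated_gaussian[OF c m, of A M]) (use bdE in \<open>simp add: norm_mult\<close>)
  have "(LINT x|lborel. of_real (E x) * f x) = f 0 * of_real (LINT x|lborel. E x)"
  proof (rule circled_mean_value[OF _ E_rot _ bdE _ m])
   show "\<exists>R>1. (\<lambda>\<zeta>. f (\<zeta> *s x)) holomorphic_on ball 0 R" for x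
    by (intro exI[of _ 2]) (use holomorphic_on_subset[OF hol] in auto)
   show "integrable lborel (\<lambda>x::complex^'n. A * exp (M * norm x - c * (norm x)\<^sup>2))"
    by (intro integrable_mult_right integrable_exp_gaussian c)
   show "E \<in> borel_measurable borel" by (intro borel_measurable_continuous_onI E_cont)
  qed (auto simp: norm_smult)
  thus "(LINT x|lborel. of_real (E x) * f x) = of_real c0 * f 0" by (simp add: c0_def mult.commute)
qed

lemma exp_bounds:
  obtains C where "0 < C" "\<And>x y. cmod (H x y) \<le> C * norm x * norm y"
   "\<And>x y z. cmod (H x y * exp (H x z)) \<le> C * norm y * exp ((1 + C * norm z) * norm x)"
   "\<And>x z. cmod (exp (H x z)) \<le> exp ((C * norm z) * norm x)"
proof -
  obtain C where C: "0 < C" "\<And>x y. cmod (H x y) \<le> C * norm x * norm y" using bounded by metis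
  have e: "cmod (exp (H x z)) \<le> exp ((C * norm z) * norm x)" for x z
  proof -
   have "cmod (exp (H x z)) \<le> exp (cmod (H x z))" by (simp add: norm_exp_eq_Re complex_Re_le_cmod)
   also have "\<dots> \<le> exp ((C * norm z) * norm x)" using C(2)[of x z] by (simp add: mult_ac)
   finally show ?thesis .
  qed
  have "cmod (H x y * exp (H x z)) \<le> C * norm y * exp ((1 + C * norm z) * norm x)" for x y z
  proof -
   have "cmod (H x y * exp (H x z)) \<le> (C * norm x * norm y) * exp ((C * norm z) * norm x)"
    unfolding norm_mult by (intro mult_mono C e) (use C in auto)
   also have "\<dots> \<le> (C * exp (norm x) * norm y) * exp ((C * norm z) * norm x)"
    using C(1) by (intro mult_right_mono mult_left_mono self_le_exp) auto
   also have "\<dots> = C * norm y * exp ((1 + C * norm z) * norm x)"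
   proof -
    have e2: "exp ((1 + C * norm z) * norm x) = exp (norm x) * exp ((C * norm z) * norm x)"
     by (simp add: exp_add[symmetric] distrib_right)
    show ?thesis unfolding e2 by (simp only: mult_ac)
   qed
   finally show ?thesis .
  qed
  thus ?thesis using that C e by blast
qed

lemma holomorphic_line: "(\<lambda>\<zeta>. H (\<zeta> *s x) y * exp (H (\<zeta> *s x) z)) holomorphic_on UNIV"
  "(\<lambda>\<zeta>. exp (H (\<zeta> *s x) z)) holomorphic_on UNIV" "(\<lambda>\<zeta>. H (\<zeta> *s x) y * H (\<zeta> *s x) z) holomorphic_on UNIV"
  unfolding scale_left by (intro holomorphic_intros)+

lemma mean_exp:
  "integrable lborel (\<lambda>x. of_real (E x) * exp (H x z))"
  "(LINT x|lborel. of_real (E x) * exp (H x z)) = of_real c0"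
  "integrable lborel (\<lambda>x. of_real (E x) * (H x y * exp (H x z)))"
  "(LINT x|lborel. of_real (E x) * (H x y * exp (H x z))) = 0"
proof -
  obtain C where C: "0 < C" "\<And>x y. cmod (H x y) \<le> C * norm x * norm y"
   "\<And>x y z. cmod (H x y * exp (H x z)) \<le> C * norm y * exp ((1 + C * norm z) * norm x)"
   "\<And>x z. cmod (exp (H x z)) \<le> exp ((C * norm z) * norm x)" using exp_bounds by metis
  have c1: "continuous_on UNIV (\<lambda>x. exp (H x z))" and c2: "continuous_on UNIV (\<lambda>x. H x y * exp (H x z))"
   by (intro continuous_intros cont)+
  have "cmod (exp (H x z)) \<le> 1 * exp ((C * norm z) * norm x)" for x using C(4)[of x z] by simp
  from mean_value[OF holomorphic_line(2) c1 this]
  show "integrable lborel (\<lambda>x. of_real (E x) * exp (H x z))"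
   "(LINT x|lborel. of_real (E x) * exp (H x z)) = of_real c0" by simp_all
  from mean_value[OF holomorphic_line(1) c2 C(3)]
  show "integrable lborel (\<lambda>x. of_real (E x) * (H x y * exp (H x z)))"
   "(LINT x|lborel. of_real (E x) * (H x y * exp (H x z))) = 0" by simp_all
qed

lemma mean_square: "(LINT x|lborel. of_real (E x) * (H x y * H x z)) = 0"
  "integrable lborel (\<lambda>x. of_real (E x) * (H x y * H x z))"
proof -
  obtain C where C: "0 < C" "\<And>x y. cmod (H x y) \<le> C * norm x * norm y" using bounded by metis
  have bd: "cmod (H x y * H x z) \<le> (C * norm y * (C * norm z)) * exp (2 * norm x)" for x
  proof -
   have "cmod (H x y * H x z) \<le> (C * norm x * norm y) * (C * norm x * norm z)"
    unfolding norm_mult by (intro mult_mono C) (use C in auto)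
   also have "\<dots> = (C * norm y * (C * norm z)) * (norm x * norm x)" by simp
   also have "\<dots> \<le> (C * norm y * (C * norm z)) * (exp (norm x) * exp (norm x))"
    using C(1) by (intro mult_left_mono mult_mono self_le_exp) auto
   also have "exp (norm x) * exp (norm x) = exp (2 * norm x)" by (simp add: exp_add[symmetric])
   finally show ?thesis .
  qed
  have c1: "continuous_on UNIV (\<lambda>x. H x y * H x z)" by (intro continuous_intros cont)
  from mean_value[OF holomorphic_line(3) c1 bd]
  show "(LINT x|lborel. of_real (E x) * (H x y * H x z)) = 0"
   "integrable lborel (\<lambda>x. of_real (E x) * (H x y * H x z))"
   by simp_all
qed

text \<open>
  Integration against the antiholomorphic exponential reproduces complex linear functions. Completing
  the square gives the real part, and the invariance under multiplication by \<open>\<i>\<close> the imaginary part.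
\<close>

definition W :: "complex^'n \<Rightarrow> complex^'n \<Rightarrow> complex" where
  "W \<xi> y = (LINT x|lborel. of_real (E x) * (H x \<xi> * exp (H y x)))"

lemma conj_integral:
  "(LINT x|lborel. of_real (E x) * (H \<xi> x * exp (H z x))) = 0"
  "integrable lborel (\<lambda>x. of_real (E x) * (H \<xi> x * exp (H z x)))"
proof -
  have cc: "cnj (of_real (E x) * (H x \<xi> * exp (H x z))) = of_real (E x) * (H \<xi> x * exp (H z x))" for x
   by (simp add: herm exp_cnj)
  show "integrable lborel (\<lambda>x. of_real (E x) * (H \<xi> x * exp (H z x)))"
   using integrable_cnj[OF mean_exp(3)[of \<xi> z]] unfolding cc .
  have "(LINT x|lborel. cnj (of_real (E x) * (H x \<xi> * exp (H x z)))) = cnj (LINT x|lborel. of_real (E x) * (H x \<xi> * exp (H x z)))"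
   by (rule Bochner_Integration.integral_cnj)
  thus "(LINT x|lborel. of_real (E x) * (H \<xi> x * exp (H z x))) = 0" unfolding cc mean_exp(4) by simp
qed

lemma W_integrable: "integrable lborel (\<lambda>x. of_real (E x) * (H x \<xi> * exp (H y x)))"
proof -
  obtain C where C: "0 < C" "\<And>x y. cmod (H x y) \<le> C * norm x * norm y"
   "\<And>x y z. cmod (H x y * exp (H x z)) \<le> C * norm y * exp ((1 + C * norm z) * norm x)"
   "\<And>x z. cmod (exp (H x z)) \<le> exp ((C * norm z) * norm x)" using exp_bounds by metis
  have eq: "cmod (H x \<xi> * exp (H y x)) = cmod (H x \<xi> * exp (H x y))" for x
  proof -
   have "exp (H y x) = cnj (exp (H x y))" by (simp add: exp_cnj herm)
   thus ?thesis by (simp add: norm_mult)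
  qed
  show ?thesis
  proof (rule integrable_dominated_gaussian[OF c, of _ "C * norm \<xi>" "1 + C * norm y"])
   show "(\<lambda>x. of_real (E x) * (H x \<xi> * exp (H y x))) \<in> borel_measurable borel"
    by (intro borel_measurable_continuous_onI continuous_intros E_cont cont)
   fix x
   have "cmod (of_real (E x) * (H x \<xi> * exp (H y x))) = E x * cmod (H x \<xi> * exp (H x y))"
    using E_pos[of x] by (simp only: norm_mult[of "of_real (E x)"] eq norm_of_real abs_of_pos)
   also have "\<dots> \<le> exp (- c * (norm x)\<^sup>2) * (C * norm \<xi> * exp ((1 + C * norm y) * norm x))"
    using E_le[of x] C(3)[of x \<xi> y] E_pos[of x] by (intro mult_mono) auto
   also have "\<dots> = C * norm \<xi> * exp ((1 + C * norm y) * norm x - c * (norm x)\<^sup>2)"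
    by (simp add: exp_diff exp_minus divide_inverse)
   finally show "cmod (of_real (E x) * (H x \<xi> * exp (H y x))) \<le> \<dots>" .
  qed
qed

lemma W_rot: "W \<xi> (\<i> *s y) = \<i> * W \<xi> y"
proof -
  define g where "g x = of_real (E x) * (H x \<xi> * exp (H (\<i> *s y) x))" for x
  have mg: "g \<in> borel_measurable borel" unfolding g_def
   by (intro borel_measurable_continuous_onI continuous_intros E_cont cont)
  have ms: "(\<lambda>x::complex^'n. \<i> *s x) \<in> borel_measurable borel"
   by (intro borel_measurable_continuous_onI linear_continuous_on bounded_linear_smult_right)
  have "(LINT x|lborel. g x) = (LINT x|distr lborel borel (\<lambda>x. \<i> *s x). g x)"
   by (simp add: lborel_unimodular)
  also have "\<dots> = (LINT x|lborel. g (\<i> *s x))" using mg ms by (intro integral_distr) auto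
  also have "g (\<i> *s x) = \<i> * (of_real (E x) * (H x \<xi> * exp (H y x)))" for x
   by (simp add: g_def E_rot scale_left scale_right)
  hence "(LINT x|lborel. g (\<i> *s x)) = (LINT x|lborel. \<i> * (of_real (E x) * (H x \<xi> * exp (H y x))))" by simp
  also have "\<dots> = \<i> * W \<xi> y" unfolding W_def by (rule integral_mult_right_zero)
  finally show ?thesis by (simp add: W_def g_def)
qed

lemma W_minus: "W \<xi> (- y) = - W \<xi> y"
proof -
  have "- y = \<i> *s (\<i> *s y)" by (simp add: vec_eq_iff)
  thus ?thesis using W_rot[of \<xi> "\<i> *s y"] W_rot[of \<xi> y] by simp
qed

lemma W_shift: "W \<xi> y = of_real c0 * (H y \<xi> + H \<xi> y) + cnj (W \<xi> (- y))"
proof -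
  define B where "B x = H x \<xi> + H \<xi> x" for x
  define g where "g x = of_real (E x) * (B x * exp (H y x))" for x
  have mg: "g \<in> borel_measurable borel" unfolding g_def B_def
   by (intro borel_measurable_continuous_onI continuous_intros E_cont cont)
  have "(LINT x|lborel. g x) = (LINT x|lborel. of_real (E x) * (H x \<xi> * exp (H y x)) + of_real (E x) * (H \<xi> x * exp (H y x)))"
   by (simp add: g_def B_def algebra_simps)
  also have "\<dots> = W \<xi> y + (LINT x|lborel. of_real (E x) * (H \<xi> x * exp (H y x)))"
   unfolding W_def by (rule Bochner_Integration.integral_add[OF W_integrable conj_integral(2)])
  finally have 1: "(LINT x|lborel. g x) = W \<xi> y" using conj_integral(1) by simp
  have "(LINT x|lborel. g x) = (LINT x|distr lborel borel ((+) y). g x)" by (simp add: lborel_distr_plus)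
  also have "\<dots> = (LINT x|lborel. g (y + x))" using mg by (intro integral_distr) auto
  also have "g (y + x) = B y * (of_real (E x) * exp (H x (- y))) + of_real (E x) * (H x \<xi> * exp (H x (- y)))
    + of_real (E x) * (H \<xi> x * exp (H x (- y)))" for x
  proof -
   have "- H (y + x) (y + x) + H y (y + x) = - H x x + H x (- y)"
    by (simp add: add_left add_right minus_right)
   hence e: "of_real (E (y + x)) * exp (H y (y + x)) = of_real (E x) * exp (H x (- y))"
    unfolding E_complex exp_add[symmetric] by simp
   have "g (y + x) = (B y + B x) * (of_real (E (y + x)) * exp (H y (y + x)))"
    by (simp add: g_def B_def add_left add_right)
   thus ?thesis unfolding e by (simp add: B_def algebra_simps)
  qed
  hence "(LINT x|lborel. g (y + x)) = (LINT x|lborel. B y * (of_real (E x) * exp (H x (- y))) + of_real (E x) * (H x \<xi> * exp (H x (- y)))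
    + of_real (E x) * (H \<xi> x * exp (H x (- y))))" by simp
  also have "\<dots> = B y * of_real c0 + 0 + cnj (W \<xi> (- y))"
  proof -
   have cc: "cnj (of_real (E x) * (H x \<xi> * exp (H (- y) x))) = of_real (E x) * (H \<xi> x * exp (H x (- y)))" for x
    by (simp add: herm exp_cnj)
   have i3: "integrable lborel (\<lambda>x. of_real (E x) * (H \<xi> x * exp (H x (- y))))"
    using integrable_cnj[OF W_integrable[of \<xi> "- y"]] unfolding cc .
   have "(LINT x|lborel. cnj (of_real (E x) * (H x \<xi> * exp (H (- y) x)))) = cnj (W \<xi> (- y))"
    unfolding W_def by (rule Bochner_Integration.integral_cnj)
   hence "(LINT x|lborel. of_real (E x) * (H \<xi> x * exp (H x (- y)))) = cnj (W \<xi> (- y))" unfolding cc .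
   thus ?thesis
    using i3 mean_exp(1,2)[of "- y"] mean_exp(3,4)[of \<xi> "- y"]
    by simp
  qed
  finally show ?thesis using 1 by (simp add: B_def mult.commute)
qed

lemma W_eq: "W \<xi> y = of_real c0 * H y \<xi>"
proof -
  have real: "Re (W \<xi> y) = c0 * Re (H y \<xi>)" for y
  proof -
   have "W \<xi> y + cnj (W \<xi> y) = of_real c0 * (H y \<xi> + cnj (H y \<xi>))"
    using W_shift[of \<xi> y] by (simp add: W_minus herm eq_diff_eq)
   hence "complex_of_real (2 * Re (W \<xi> y)) = of_real (c0 * (2 * Re (H y \<xi>)))"
    by (simp only: complex_add_cnj of_real_mult)
   thus ?thesis by (simp only: of_real_eq_iff)
  qed
  have "Im (W \<xi> y) = c0 * Im (H y \<xi>)"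
   using real[of "\<i> *s y"] by (simp add: W_rot scale_left)
  thus ?thesis using real[of y] by (simp add: complex_eq_iff)
qed

lemma second_moment:
  "(LINT x|lborel. of_real (E x) * (H x \<xi> * H s x)) = of_real c0 * H s \<xi>"
  "integrable lborel (\<lambda>x. of_real (E x) * (H x \<xi> * H s x))"
proof -
  obtain C where C: "0 < C" "\<And>x y. cmod (H x y) \<le> C * norm x * norm y"
   "\<And>x y z. cmod (H x y * exp (H x z)) \<le> C * norm y * exp ((1 + C * norm z) * norm x)"
   "\<And>x z. cmod (exp (H x z)) \<le> exp ((C * norm z) * norm x)" using exp_bounds by metis
  define t where "t n = inverse (real (Suc n))" for n
  have t: "0 < t n" "t n \<le> 1" for n by (auto simp: t_def inverse_le_1_iff)
  have t0: "t \<longlonglongrightarrow> 0" unfolding t_def by (rule LIMSEQ_inverse_real_of_nat)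
  define q where "q n w = (exp (of_real (t n) * w) - 1) / of_real (t n)" for n and w :: complex
  have ql: "(\<lambda>n. q n w) \<longlonglongrightarrow> w" for w
  proof -
   have "((\<lambda>z. exp (z * w)) has_field_derivative w * exp (0 * w)) (at 0)" by (auto intro!: derivative_eq_intros)
   hence "(\<lambda>h. (exp (h * w) - 1) / h) \<midarrow>0\<rightarrow> w" by (simp add: DERIV_def)
   moreover have "filterlim (\<lambda>n. complex_of_real (t n)) (at 0) sequentially"
    unfolding filterlim_at using t(1) tendsto_of_real[OF t0, where 'a = complex] by (auto simp: less_imp_neq[symmetric])
   ultimately show ?thesis unfolding q_def by (rule filterlim_compose)
  qed
  have qb: "cmod (q n w) \<le> exp (2 * cmod w)" for n w
  proof -
   have "cmod (exp (of_real (t n) * w) - exp 0) \<le> exp (cmod (of_real (t n) * w)) * cmod (of_real (t n) * w - 0)"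
   proof (rule field_differentiable_bound[where S = "cball 0 (cmod (of_real (t n) * w))" and f' = exp])
    show "cmod (exp z) \<le> exp (cmod (of_real (t n) * w))" if "z \<in> cball 0 (cmod (of_real (t n) * w))" for z
     using that complex_Re_le_cmod[of z] by (simp add: norm_exp_eq_Re)
   qed (auto intro: derivative_eq_intros)
   also have "\<dots> \<le> exp (cmod w) * (t n * cmod w)"
    using t[of n] by (intro mult_mono) (auto simp: norm_mult mult_left_le_one_le)
   finally have "cmod (q n w) \<le> exp (cmod w) * cmod w"
    using t(1)[of n] by (simp add: q_def norm_divide divide_le_eq mult_ac)
   also have "\<dots> \<le> exp (cmod w) * exp (cmod w)" by (intro mult_left_mono self_le_exp) auto
   finally show ?thesis by (simp add: exp_add[symmetric])
  qed
  define h where "h x = (C * norm \<xi>) * exp ((1 + 2 * (C * norm s)) * norm x - c * (norm x)\<^sup>2)" for x :: "complex^'n"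
  have inth: "integrable lborel h" unfolding h_def by (intro integrable_mult_right integrable_exp_gaussian c)
  have bound: "cmod (of_real (E x) * (H x \<xi> * q)) \<le> h x" if q: "cmod q \<le> exp (2 * cmod (H s x))" for x q
  proof -
   have "cmod q \<le> exp (2 * (C * norm s) * norm x)"
   proof -
    have "2 * cmod (H s x) \<le> 2 * (C * norm s) * norm x" using C(2)[of s x] by simp
    hence "exp (2 * cmod (H s x)) \<le> exp (2 * (C * norm s) * norm x)" by (simp only: exp_le_cancel_iff)
    thus ?thesis using q by linarith
   qed
   moreover have "cmod (H x \<xi>) \<le> (C * norm \<xi>) * exp (norm x)"
   proof -
    have "cmod (H x \<xi>) \<le> (C * norm \<xi>) * norm x" using C(2)[of x \<xi>] by (simp add: mult_ac)
    also have "\<dots> \<le> (C * norm \<xi>) * exp (norm x)"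
     using C(1) by (intro mult_left_mono self_le_exp) auto
    finally show ?thesis .
   qed
   ultimately have "E x * (cmod (H x \<xi>) * cmod q) \<le> exp (- c * (norm x)\<^sup>2) * (((C * norm \<xi>) * exp (norm x)) * exp (2 * (C * norm s) * norm x))"
    using E_le[of x] E_pos[of x] C(1) by (intro mult_mono) auto
   also have "\<dots> = h x"
   proof -
    have ex: "(1 + 2 * (C * norm s)) * norm x - c * (norm x)\<^sup>2 = - c * (norm x)\<^sup>2 + (norm x + 2 * (C * norm s) * norm x)"
     by (simp add: distrib_right)
    show ?thesis unfolding h_def ex exp_add by (simp only: mult_ac)
   qed
   finally show ?thesis using E_pos[of x] by (simp add: norm_mult)
  qed
  have int0: "W \<xi> 0 = 0" by (simp add: W_eq)
  have each: "(LINT x|lborel. of_real (E x) * (H x \<xi> * q n (H s x))) = of_real c0 * H s \<xi>" for n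
  proof -
   have "of_real (E x) * (H x \<xi> * q n (H s x)) =
     (of_real (E x) * (H x \<xi> * exp (H (of_real (t n) *s s) x)) - of_real (E x) * (H x \<xi> * exp (H 0 x))) / of_real (t n)" for x
    using t(1)[of n] by (simp add: q_def scale_left field_simps)
   hence "(LINT x|lborel. of_real (E x) * (H x \<xi> * q n (H s x))) =
     (LINT x|lborel. (of_real (E x) * (H x \<xi> * exp (H (of_real (t n) *s s) x)) - of_real (E x) * (H x \<xi> * exp (H 0 x))) / of_real (t n))"
    by simp
   also have "\<dots> = (W \<xi> (of_real (t n) *s s) - W \<xi> 0) / of_real (t n)"
    unfolding W_def integral_divide_zero
    by (subst Bochner_Integration.integral_diff[OF W_integrable W_integrable]) simp
   also have "\<dots> = of_real c0 * H s \<xi>" using t(1)[of n] by (simp add: W_eq scale_left)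
   finally show ?thesis .
  qed
  have "(\<lambda>x. of_real (E x) * (H x \<xi> * H s x)) \<in> borel_measurable borel"
   by (intro borel_measurable_continuous_onI continuous_intros E_cont cont)
  hence m: "(\<lambda>x. of_real (E x) * (H x \<xi> * H s x)) \<in> borel_measurable lborel" by simp
  have "(\<lambda>n. (LINT x|lborel. of_real (E x) * (H x \<xi> * q n (H s x)))) \<longlonglongrightarrow> (LINT x|lborel. of_real (E x) * (H x \<xi> * H s x))"
  proof (rule integral_dominated_convergence[where w = h, OF m _ inth])
   show "(\<lambda>x. of_real (E x) * (H x \<xi> * q n (H s x))) \<in> borel_measurable lborel" for n
   proof -
    have "complex_of_real (t n) \<noteq> 0" using t(1)[of n] by simp
    hence "(\<lambda>x. of_real (E x) * (H x \<xi> * q n (H s x))) \<in> borel_measurable borel"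
     unfolding q_def by (intro borel_measurable_continuous_onI continuous_intros E_cont cont) simp
    thus ?thesis by simp
   qed
   show "AE x in lborel. (\<lambda>n. of_real (E x) * (H x \<xi> * q n (H s x))) \<longlonglongrightarrow> of_real (E x) * (H x \<xi> * H s x)"
    by (intro AE_I2 tendsto_intros ql)
   show "AE x in lborel. cmod (of_real (E x) * (H x \<xi> * q n (H s x))) \<le> h x" for n
    by (intro AE_I2 bound qb)
  qed
  thus "(LINT x|lborel. of_real (E x) * (H x \<xi> * H s x)) = of_real c0 * H s \<xi>"
   unfolding each by (simp add: LIMSEQ_const_iff)
  show "integrable lborel (\<lambda>x. of_real (E x) * (H x \<xi> * H s x))"
  proof (rule Bochner_Integration.integrable_bound[OF inth m])
   have "cmod (of_real (E x) * (H x \<xi> * H s x)) \<le> h x" for x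
    using exp_ge_add_one_self[of "2 * cmod (H s x)"] norm_ge_zero[of "H s x"] by (intro bound) linarith
   thus "AE x in lborel. cmod (of_real (E x) * (H x \<xi> * H s x)) \<le> norm (h x)"
    by (intro AE_I2) (auto intro: order_trans[OF _ abs_ge_self])
  qed
qed

text \<open>
  The inner integral is \<open>c0 * E y * H y b\<close>. Of the outer factor only the antilinear part \<open>H a y\<close> pairs with it,
  by the second moments.
\<close>

lemma gaussian_pairing:
  "(LINT y|lborel. (H y a + H a y) * (LINT x|lborel. (H x b + H b x) * exp (H y x - H x x - H y y)))
   = of_real (c0\<^sup>2) * H a b"
proof -
  have e: "exp (H y x - H x x - H y y) = of_real (E y) * (of_real (E x) * exp (H y x))" for x y
   unfolding E_complex by (simp add: exp_add[symmetric])
  have inner: "(LINT x|lborel. (H x b + H b x) * exp (H y x - H x x - H y y)) = of_real (E y) * (of_real c0 * H y b)" for y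
  proof -
   have "(H x b + H b x) * exp (H y x - H x x - H y y) =
     of_real (E y) * (of_real (E x) * (H x b * exp (H y x)) + of_real (E x) * (H b x * exp (H y x)))" for x
    unfolding e by (simp add: algebra_simps)
   hence "(LINT x|lborel. (H x b + H b x) * exp (H y x - H x x - H y y)) =
     of_real (E y) * ((LINT x|lborel. of_real (E x) * (H x b * exp (H y x))) + (LINT x|lborel. of_real (E x) * (H b x * exp (H y x))))"
    using W_integrable[of b y] conj_integral(2)[of b y] by simp
   thus ?thesis by (simp add: conj_integral(1) W_eq flip: W_def)
  qed
  have "(H y a + H a y) * (of_real (E y) * (of_real c0 * H y b)) =
    of_real c0 * (of_real (E y) * (H y a * H y b) + of_real (E y) * (H y b * H a y))" for y
   by (simp add: algebra_simps)
  hence "(LINT y|lborel. (H y a + H a y) * (of_real (E y) * (of_real c0 * H y b))) =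
    (LINT y|lborel. of_real c0 * (of_real (E y) * (H y a * H y b) + of_real (E y) * (H y b * H a y)))"
   by (simp only:)
  also have "\<dots> = of_real c0 * (0 + of_real c0 * H a b)"
   using mean_square[of a b] second_moment[of b a] by simp
  finally show ?thesis unfolding inner by (simp add: power2_eq_square)
qed

end

section \<open>Products of Toeplitz operators on kernel functions\<close>

lemma sesqui_continuous:
  fixes G :: "complex^'n \<Rightarrow> complex^'n \<Rightarrow> complex"
  assumes G: "sesqui U G" and U: "open U"
  shows "continuous_on (U \<times> U) (\<lambda>x. G (fst x) (snd x))"
proof (rule continuous_at_imp_continuous_on, rule ballI)
  fix x :: "(complex^'n) \<times> (complex^'n)" assume "x \<in> U \<times> U"
  then obtain z w where x: "x = (z, w)" "z \<in> U" "w \<in> U" by auto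
  obtain r C where r: "0 < r" "0 < C" "\<And>u v. norm u \<le> r \<Longrightarrow> norm v \<le> r \<Longrightarrow>
   cmod (G (z + u) (w + v) - G z w - (d1 u G z w + d2 v G z w)) \<le> C * (norm u + norm v)\<^sup>2"
   using sesqui_taylor[OF G U x(2,3)] by metis
  have "linear (\<lambda>h. d1 (fst h) G z w + d2 (snd h) G z w)"
   using linear_compose_add[OF linear_compose[OF linear_fst linear_d1[OF G x(2,3)]] linear_compose[OF linear_snd linear_d2[OF G x(2,3)]]]
   by (simp add: o_def)
  hence bl: "bounded_linear (\<lambda>h. d1 (fst h) G z w + d2 (snd h) G z w)" by (simp add: linear_conv_bounded_linear)
  have "((\<lambda>x. G (fst x) (snd x)) has_derivative (\<lambda>h. d1 (fst h) G z w + d2 (snd h) G z w)) (at x)"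
  proof (rule has_derivative_quadratic[OF bl r(1), where C = "4 * C"])
   fix h :: "(complex^'n) \<times> (complex^'n)" assume h: "norm h \<le> r"
   have n: "norm (fst h) \<le> norm h" "norm (snd h) \<le> norm h"
    by (metis norm_fst_le prod.collapse, metis norm_snd_le prod.collapse)
   have "cmod (G (fst (x + h)) (snd (x + h)) - G (fst x) (snd x) - (d1 (fst h) G z w + d2 (snd h) G z w))
     \<le> C * (norm (fst h) + norm (snd h))\<^sup>2"
    using r(3)[of "fst h" "snd h"] n h by (simp add: x)
   also have "\<dots> \<le> C * (2 * norm h)\<^sup>2" using n r(2) by (intro mult_left_mono power_mono) auto
   finally show "cmod (G (fst (x + h)) (snd (x + h)) - G (fst x) (snd x) - (d1 (fst h) G z w + d2 (snd h) G z w))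
     \<le> 4 * C * (norm h)\<^sup>2" by (simp add: power2_eq_square)
  qed
  thus "isCont (\<lambda>x. G (fst x) (snd x)) x" by (rule has_derivative_continuous)
qed

context weighted_domain
begin

text \<open>Symbols are functions on \<open>D\<close>, so measurability is that of the zero extension.\<close>

definition adm :: "(complex^'n \<Rightarrow> complex) \<Rightarrow> real \<Rightarrow> bool" where
  "adm a A \<longleftrightarrow> (\<lambda>z. indicator D z * a z) \<in> borel_measurable borel \<and> 0 \<le> A \<and> (\<forall>z\<in>D. cmod (a z) \<le> A)"

lemma adm_measurable: "adm a A \<Longrightarrow> a \<in> borel_measurable (lebesgue_on D)"
proof -
  assume "adm a A"
  hence "(\<lambda>z. indicator D z * a z) \<in> borel_measurable (lebesgue_on D)"
   by (simp add: adm_def measurable_completion measurable_restrict_space1)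
  moreover have "a \<in> borel_measurable (lebesgue_on D) \<longleftrightarrow> (\<lambda>z. indicator D z * a z) \<in> borel_measurable (lebesgue_on D)"
   by (rule measurable_cong) (simp add: space_restrict_space)
  ultimately show ?thesis by simp
qed

lemma adm_continuous: "continuous_on D a \<Longrightarrow> 0 \<le> A \<Longrightarrow> (\<And>z. z \<in> D \<Longrightarrow> cmod (a z) \<le> A) \<Longrightarrow> adm a A"
  using borel_measurable_continuous_on_indicator[OF D_sets(2), of a] by (simp add: adm_def indicator_scaleR_eq)

lemma adm_diff: "adm a A \<Longrightarrow> adm b B \<Longrightarrow> adm (\<lambda>z. a z - b z) (A + B)"
  unfolding adm_def by (auto simp: right_diff_distrib intro!: borel_measurable_diff norm_triangle_le_diff add_mono)

lemma adm_cnj: "adm a A \<Longrightarrow> adm (\<lambda>z. cnj (a z)) A"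
proof -
  assume "adm a A"
  moreover have "cnj \<in> borel_measurable borel" by (intro borel_measurable_continuous_onI continuous_intros)
  ultimately have "(\<lambda>z. cnj (indicator D z * a z)) \<in> borel_measurable borel"
   using measurable_compose[of "\<lambda>z. indicator D z * a z" borel borel cnj borel] unfolding adm_def by blast
  moreover have "(\<lambda>z. cnj (indicator D z * a z)) = (\<lambda>z. indicator D z * cnj (a z))"
   by (simp add: fun_eq_iff indicator_def)
  ultimately have "(\<lambda>z. indicator D z * cnj (a z)) \<in> borel_measurable borel" by (simp only:)
  thus ?thesis using \<open>adm a A\<close> by (simp add: adm_def)
qed

lemma adm_indicator: "adm a A \<Longrightarrow> S \<in> sets borel \<Longrightarrow> adm (\<lambda>z. indicator S z * a z) A"
proof -
  assume a: "adm a A" and S: "S \<in> sets borel"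
  have "(\<lambda>z. indicator S z * (indicator D z * a z)) \<in> borel_measurable borel"
   by (rule borel_measurable_times[OF borel_measurable_indicator[OF S]]) (use a in \<open>simp add: adm_def\<close>)
  moreover have "(\<lambda>z. indicator S z * (indicator D z * a z)) = (\<lambda>z. indicator D z * (indicator S z * a z))"
   by (simp only: mult.left_commute)
  moreover have "cmod (indicator S z * a z) \<le> A" if "z \<in> D" for z
   using a that by (auto simp: adm_def indicator_def)
  ultimately show ?thesis using a unfolding adm_def by (metis (no_types, lifting))
qed

lemma adm_square_integrable:
  assumes "adm a A" "square_integrable M f"
  shows "square_integrable M (\<lambda>z. a z * f z)" "nsq M (\<lambda>z. a z * f z) \<le> A\<^sup>2 * nsq M f"
proof -
  have mf: "f \<in> borel_measurable (lebesgue_on D)" using assms(2) by (simp add: square_integrable_def)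
  have m: "(\<lambda>z. a z * f z) \<in> borel_measurable (lebesgue_on D)"
   by (rule borel_measurable_times[OF adm_measurable[OF assms(1)] mf])
  hence m2: "(\<lambda>z. (cmod (a z * f z))\<^sup>2) \<in> borel_measurable (lebesgue_on D)" by measurable
  have le: "(cmod (a z * f z))\<^sup>2 \<le> A\<^sup>2 * (cmod (f z))\<^sup>2" if "z \<in> D" for z
   using assms(1) that by (auto simp: adm_def norm_mult power_mult_distrib intro!: mult_right_mono power_mono)
  have int: "integrable M (\<lambda>z. A\<^sup>2 * (cmod (f z))\<^sup>2)" using assms(2) by (simp add: square_integrable_def)
  have int2: "integrable M (\<lambda>z. (cmod (a z * f z))\<^sup>2)"
   by (rule Bochner_Integration.integrable_bound[OF int]) (use m2 le in \<open>auto intro!: AE_I2\<close>)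
  thus "square_integrable M (\<lambda>z. a z * f z)" using m by (simp add: square_integrable_def)
  have "nsq M (\<lambda>z. a z * f z) \<le> (LINT z|M. A\<^sup>2 * (cmod (f z))\<^sup>2)"
   unfolding nsq_def using le by (intro integral_mono int int2) simp
  thus "nsq M (\<lambda>z. a z * f z) \<le> A\<^sup>2 * nsq M f" by (simp add: nsq_def)
qed

lemma proj_off: "square_integrable M f \<Longrightarrow> z \<notin> D \<Longrightarrow> proj f z = 0"
  using HD(3)[OF proj(1)] .

lemma proj_diff:
  assumes "square_integrable M f" "square_integrable M g"
  shows "proj (\<lambda>z. f z - g z) = (\<lambda>z. proj f z - proj g z)"
proof
  fix z
  show "proj (\<lambda>z. f z - g z) z = proj f z - proj g z"
  proof (cases "z \<in> D")
   case True
   thus ?thesis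
    by (simp add: proj_eq square_integrable_diff assms l2_inner_diff_left HD(2)[OF ker_H])
  qed (simp add: proj_off square_integrable_diff assms)
qed

lemma proj_self: "f \<in> H \<Longrightarrow> proj f = f"
proof
  fix z assume f: "f \<in> H"
  show "proj f z = f z"
   using f by (cases "z \<in> D") (simp_all add: proj_eq HD(2) reproducing proj_off HD(3))
qed

lemma nsq_proj: "square_integrable M f \<Longrightarrow> nsq M (proj f) \<le> nsq M f"
proof -
  assume f: "square_integrable M f"
  have sq: "square_integrable M (proj f)" using proj(1)[OF f] HD(2) by blast
  have "complex_of_real (nsq M (proj f)) = l2_inner M f (proj f)"
   using proj(2)[OF f proj(1)[OF f]] by (simp add: l2_inner_self)
  hence "(nsq M (proj f))\<^sup>2 \<le> nsq M f * nsq M (proj f)"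
   using l2_cauchy_schwarz[OF f sq] by (metis norm_of_real power2_abs)
  thus ?thesis
   using nsq_nonneg[of M "proj f"] nsq_nonneg[of M f] by (cases "nsq M (proj f) = 0") (auto simp: power2_eq_square)
qed

text \<open>
  \<open>\<Gamma> p a b\<close> is the value at \<open>p\<close> of the product of the Toeplitz operators with symbols \<open>a\<close> and \<open>b\<close>
  applied to the kernel function of \<open>p\<close>.
\<close>

definition \<Gamma> :: "complex^'n \<Rightarrow> (complex^'n \<Rightarrow> complex) \<Rightarrow> (complex^'n \<Rightarrow> complex) \<Rightarrow> complex" where
  "\<Gamma> p a b = l2_inner M (\<lambda>z. a z * proj (\<lambda>u. b u * ker u p) z) (\<lambda>z. ker z p)"

lemma ker_sq: "p \<in> D \<Longrightarrow> square_integrable M (\<lambda>u. ker u p)"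
  using HD(2)[OF ker_H] .

lemma proj_adm_sq: "p \<in> D \<Longrightarrow> adm b B \<Longrightarrow> square_integrable M (proj (\<lambda>u. b u * ker u p))"
  using HD(2)[OF proj(1)[OF adm_square_integrable(1)[OF _ ker_sq]]] .

lemma Gamma_diff_left:
  assumes "p \<in> D" "adm a A" "adm a' A'" "adm b B"
  shows "\<Gamma> p (\<lambda>z. a z - a' z) b = \<Gamma> p a b - \<Gamma> p a' b"
  unfolding \<Gamma>_def left_diff_distrib using assms
  by (intro l2_inner_diff_left adm_square_integrable(1) proj_adm_sq ker_sq)

lemma Gamma_diff_right:
  assumes "p \<in> D" "adm a A" "adm b B" "adm b' B'"
  shows "\<Gamma> p a (\<lambda>z. b z - b' z) = \<Gamma> p a b - \<Gamma> p a b'"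
proof -
  have "proj (\<lambda>u. (b u - b' u) * ker u p) = (\<lambda>z. proj (\<lambda>u. b u * ker u p) z - proj (\<lambda>u. b' u * ker u p) z)"
   unfolding left_diff_distrib using assms by (intro proj_diff adm_square_integrable(1) ker_sq)
  thus ?thesis
   unfolding \<Gamma>_def right_diff_distrib using assms
   by (simp only: right_diff_distrib) (intro l2_inner_diff_left adm_square_integrable(1) proj_adm_sq ker_sq)
qed

lemma Gamma_const_left:
  assumes p: "p \<in> D" and b: "adm b B"
  shows "\<Gamma> p (\<lambda>_. c) b = c * l2_inner M (\<lambda>z. b z * ker z p) (\<lambda>z. ker z p)"
  unfolding \<Gamma>_def l2_inner_cmult_left
  using proj(2)[OF adm_square_integrable(1)[OF b ker_sq[OF p]] ker_H[OF p]] by simp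

lemma Gamma_const_right:
  assumes p: "p \<in> D"
  shows "\<Gamma> p a (\<lambda>_. c) = c * l2_inner M (\<lambda>z. a z * ker z p) (\<lambda>z. ker z p)"
proof -
  have "proj (\<lambda>u. c * ker u p) = (\<lambda>u. c * ker u p)" by (intro proj_self H_cmult ker_H p)
  thus ?thesis unfolding \<Gamma>_def by (simp add: mult.left_commute[of _ c] l2_inner_cmult_left)
qed

lemma Gamma_bound:
  assumes p: "p \<in> D" and a: "adm a A" and b: "adm b B"
  shows "(cmod (\<Gamma> p a b))\<^sup>2 \<le> nsq M (\<lambda>u. a u * ker u p) * nsq M (\<lambda>u. b u * ker u p)"
proof -
  let ?P = "proj (\<lambda>u. b u * ker u p)"
  have "\<Gamma> p a b = l2_inner M ?P (\<lambda>z. cnj (a z) * ker z p)"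
   unfolding \<Gamma>_def l2_inner_def by (simp add: mult_ac)
  hence "(cmod (\<Gamma> p a b))\<^sup>2 \<le> nsq M ?P * nsq M (\<lambda>z. cnj (a z) * ker z p)"
   using l2_cauchy_schwarz[OF proj_adm_sq[OF p b] adm_square_integrable(1)[OF adm_cnj[OF a] ker_sq[OF p]]] by simp
  also have "\<dots> \<le> nsq M (\<lambda>u. b u * ker u p) * nsq M (\<lambda>z. cnj (a z) * ker z p)"
   by (intro mult_right_mono nsq_proj adm_square_integrable(1)[OF b] ker_sq p nsq_nonneg)
  also have "nsq M (\<lambda>z. cnj (a z) * ker z p) = nsq M (\<lambda>u. a u * ker u p)" by (simp add: nsq_def norm_mult)
  finally show ?thesis by (simp add: mult.commute)
qed

text \<open>Multiplication by a constant commutes with the projection, so it drops out of the commutator.\<close>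

lemma Gamma_commutator_shift:
  assumes p: "p \<in> D" and a: "adm a A" and b: "adm b B" and sym: "\<Gamma> p a b = \<Gamma> p b a"
  shows "\<Gamma> p (\<lambda>z. a z - \<alpha>) (\<lambda>z. b z - \<beta>) = \<Gamma> p (\<lambda>z. b z - \<beta>) (\<lambda>z. a z - \<alpha>)"
proof -
  have ca: "adm (\<lambda>_. \<alpha>) (cmod \<alpha>)" and cb: "adm (\<lambda>_. \<beta>) (cmod \<beta>)"
   by (auto intro!: adm_continuous continuous_intros)
  note ab = adm_diff[OF a ca] adm_diff[OF b cb]
  show ?thesis
   using sym
   by (simp add: Gamma_diff_left[OF p a ca ab(2)] Gamma_diff_left[OF p b cb ab(1)]
     Gamma_diff_right[OF p a b cb] Gamma_diff_right[OF p b a ca] Gamma_diff_right[OF p ca b cb] Gamma_diff_right[OF p cb a ca]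
     Gamma_const_left[OF p a] Gamma_const_left[OF p b] Gamma_const_left[OF p ca] Gamma_const_left[OF p cb]
     Gamma_const_right[OF p])
    (simp add: l2_inner_cmult_left)
qed

end

context bounded_dom
begin

text \<open>
  Up to constants, the part of \<open>\<Gamma> p a b\<close> that comes from the ball of radius \<open>r\<close>, when the weighted kernel is the
  power \<open>n\<close> of the unweighted one.
\<close>

definition II :: "complex^'n \<Rightarrow> real \<Rightarrow> nat \<Rightarrow> (complex^'n \<Rightarrow> complex) \<Rightarrow> (complex^'n \<Rightarrow> complex) \<Rightarrow> complex" where
  "II p r n a b = (LINT z|lborel. indicator (ball p r) z * (a z * of_real (k z) *
    (LINT u|lborel. indicator (ball p r) u * (b u * of_real (k u) * \<Phi> p u z ^ n))))"

end

context homogeneous_dom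
begin

lemma W_lborel:
  fixes f :: "complex^'n \<Rightarrow> complex"
  assumes "(\<lambda>z. indicator D z * f z) \<in> borel_measurable borel"
  shows "(LINT z|W.M. f z) = (LINT z|lborel. indicator D z * (of_real (wt z) * f z))"
proof -
  have f: "f \<in> borel_measurable (lebesgue_on D)"
   using W.adm_measurable[of f] W.adm_def assms
  proof -
   have "(\<lambda>z. indicator D z * f z) \<in> borel_measurable (lebesgue_on D)"
    using assms by (simp add: measurable_completion measurable_restrict_space1)
   moreover have "f \<in> borel_measurable (lebesgue_on D) \<longleftrightarrow> (\<lambda>z. indicator D z * f z) \<in> borel_measurable (lebesgue_on D)"
    by (rule measurable_cong) (simp add: space_restrict_space)
   ultimately show ?thesis by simp
  qed
  have "(\<lambda>z. (indicator D z *\<^sub>R wt z) *\<^sub>R (indicator D z * f z)) \<in> borel_measurable borel"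
   by (intro borel_measurable_scaleR borel_measurable_continuous_on_indicator W.cont_\<rho> W.D_sets assms)
  moreover have "(\<lambda>z. (indicator D z *\<^sub>R wt z) *\<^sub>R (indicator D z * f z)) = (\<lambda>z. indicator D z *\<^sub>R (wt z *\<^sub>R f z))"
   by (simp add: fun_eq_iff indicator_def)
  ultimately have "(\<lambda>z. indicator D z *\<^sub>R (wt z *\<^sub>R f z)) \<in> borel_measurable borel" by (simp only:)
  from W.integral_lborel(1)[OF this] show ?thesis
   by (simp add: W.integral_M[OF f] indicator_scaleR_eq scaleR_conv_of_real of_real_indicator)
qed

lemma Gamma_eq_II:
  assumes C: "0 < C" "\<And>z w. z \<in> D \<Longrightarrow> w \<in> D \<Longrightarrow> W.ker z w = of_real C * K z w ^ N"
   and p: "p \<in> D" and r: "ball p r \<subseteq> D" and a: "W.adm a A" and b: "W.adm b B"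
  shows "W.\<Gamma> p (\<lambda>z. indicator (ball p r) z * a z) (\<lambda>z. indicator (ball p r) z * b z) =
   of_real (C ^ 3 * c\<^sup>2 * k p ^ N) * II p r N a b"
proof -
  let ?F = "\<lambda>z u. of_real (C\<^sup>2) * (of_real (wt u) * (K u p ^ N * K z u ^ N))"
  let ?I = "\<lambda>z. LINT u|lborel. indicator (ball p r) u * (b u * of_real (k u) * \<Phi> p u z ^ N)"
  let ?\<chi> = "indicator (ball p r) :: _ \<Rightarrow> complex"
  have \<chi>a: "W.adm (\<lambda>z. ?\<chi> z * a z) A" and \<chi>b: "W.adm (\<lambda>z. ?\<chi> z * b z) B"
   by (intro W.adm_indicator a b; simp)+
  have borelD: "(\<lambda>z. indicator D z * g z) \<in> borel_measurable borel" if "continuous_on D g" for g :: "complex^'n \<Rightarrow> complex"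
   using borel_measurable_continuous_on_indicator[OF W.D_sets(2) that] by (simp add: indicator_scaleR_eq)
  have borel2: "(\<lambda>z. indicator D z * (g z * h z)) \<in> borel_measurable borel"
   if "(\<lambda>z. indicator D z * g z) \<in> borel_measurable borel" "continuous_on D h" for g h :: "complex^'n \<Rightarrow> complex"
  proof -
   have "(\<lambda>z. (indicator D z * g z) * (indicator D z * h z)) \<in> borel_measurable borel"
    by (intro borel_measurable_times that(1) borelD that(2))
   moreover have "(indicator D z * g z) * (indicator D z * h z) = indicator D z * (g z * h z)" for z
    by (simp add: indicator_def)
   ultimately show ?thesis by simp
  qed
  have Kc: "K u p * cnj (K u z) = K u p * K z u" if "u \<in> D" "z \<in> D" for u z
   using B.ker_cnj[OF that] by simp
  have phi: "of_real (wt u) * (K u p ^ N * K z u ^ N) * (of_real (wt z) * K p z ^ N) =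
    of_real (c\<^sup>2 * k p ^ N) * (of_real (k u) * of_real (k z) * \<Phi> p u z ^ N)" if u: "u \<in> D" and z: "z \<in> D" for u z
  proof -
   have pos: "k u \<noteq> 0" "k z \<noteq> 0" "k p \<noteq> 0" using k_pos[OF u] k_pos[OF z] k_pos[OF p] by auto
   have P: "\<Phi> p u z ^ N = (K u p ^ N * K z u ^ N * K p z ^ N) / (of_real (k u) ^ N * of_real (k z) ^ N * of_real (k p) ^ N)"
    by (simp add: \<Phi>_def power_mult_distrib power_divide mult_ac)
   have w: "complex_of_real (wt v) = of_real c / of_real (k v) ^ (N - 1)" for v
    by (simp add: wt_def power_divide)
   have pN: "complex_of_real (k v) ^ N = of_real (k v) * of_real (k v) ^ (N - 1)" for v
    using N by (cases N) auto
   have key: "c' / x * (X * Y) * (c' / y * Z) = c'\<^sup>2 * w * (x' * y' * (X * Y * Z / ((x' * x) * (y' * y) * w)))"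
    if "x \<noteq> 0" "y \<noteq> 0" "x' \<noteq> 0" "y' \<noteq> 0" "w \<noteq> 0" for c' x y X Y Z w x' y' :: complex
    using that by (simp add: power2_eq_square field_simps)
   show ?thesis
    unfolding P w pN[of u] pN[of z] of_real_mult of_real_power
    by (rule key) (use pos in auto)
  qed
  define P where "P = W.proj (\<lambda>u. (?\<chi> u * b u) * W.ker u p)"
  have sqb: "square_integrable W.M (\<lambda>u. (?\<chi> u * b u) * W.ker u p)"
   by (rule W.adm_square_integrable(1)[OF \<chi>b W.ker_sq[OF p]])
  have contK: "continuous_on D (\<lambda>u. W.ker u z)" if "z \<in> D" for z using W.HD(4)[OF W.ker_H[OF that]] .
  have Pz: "P z = (LINT u|lborel. ?\<chi> u * (b u * ?F z u))" if z: "z \<in> D" for z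
  proof -
   have "P z = (LINT u|W.M. ((?\<chi> u * b u) * W.ker u p) * cnj (W.ker u z))"
    unfolding P_def W.proj_eq[OF sqb z] l2_inner_def ..
   also have "\<dots> = (LINT u|lborel. indicator D u * (of_real (wt u) * (((?\<chi> u * b u) * W.ker u p) * cnj (W.ker u z))))"
    by (rule W_lborel[OF borel2[OF borel2[OF _ contK[OF p]] continuous_on_cnj[OF contK[OF z]]]])
     (use \<chi>b in \<open>simp add: W.adm_def\<close>)
   also have "\<dots> = (LINT u|lborel. ?\<chi> u * (b u * ?F z u))"
   proof (rule Bochner_Integration.integral_cong[OF refl])
    fix u
    show "indicator D u * (of_real (wt u) * (((?\<chi> u * b u) * W.ker u p) * cnj (W.ker u z))) =
     ?\<chi> u * (b u * ?F z u)"
    proof (cases "u \<in> ball p r")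
     case True
     hence u: "u \<in> D" using r by auto
     have "cnj (K u z) = K z u" by (rule B.ker_cnj[OF u z])
     thus ?thesis using True u by (simp add: C(2)[OF u p] C(2)[OF u z] power2_eq_square mult_ac)
    qed simp
   qed
   finally show ?thesis .
  qed
  have contP: "continuous_on D P" unfolding P_def by (rule W.HD(4)[OF W.proj(1)[OF sqb]])
  have "W.\<Gamma> p (\<lambda>z. ?\<chi> z * a z) (\<lambda>z. ?\<chi> z * b z) = (LINT z|W.M. ((?\<chi> z * a z) * P z) * cnj (W.ker z p))"
   unfolding W.\<Gamma>_def l2_inner_def P_def ..
  also have "\<dots> = (LINT z|lborel. indicator D z * (of_real (wt z) * (((?\<chi> z * a z) * P z) * cnj (W.ker z p))))"
   by (rule W_lborel[OF borel2[OF borel2[OF _ contP] continuous_on_cnj[OF contK[OF p]]]])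
    (use \<chi>a in \<open>simp add: W.adm_def\<close>)
  also have "\<dots> = (LINT z|lborel. of_real (C ^ 3 * c\<^sup>2 * k p ^ N) * (?\<chi> z * (a z * of_real (k z) *
    ?I z)))"
  proof (rule Bochner_Integration.integral_cong[OF refl])
   fix z
   show "indicator D z * (of_real (wt z) * (((?\<chi> z * a z) * P z) * cnj (W.ker z p))) =
    of_real (C ^ 3 * c\<^sup>2 * k p ^ N) * (?\<chi> z * (a z * of_real (k z) * ?I z))"
   proof (cases "z \<in> ball p r")
    case True
    hence z: "z \<in> D" using r by auto
    have "of_real (wt z) * K p z ^ N * P z =
      (LINT u|lborel. of_real (wt z) * K p z ^ N * (?\<chi> u * (b u * ?F z u)))"
     unfolding Pz[OF z] by (rule integral_mult_right_zero[symmetric])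
    also have "\<dots> = (LINT u|lborel. (of_real (C\<^sup>2 * c\<^sup>2 * k p ^ N) * of_real (k z)) * (?\<chi> u * (b u * of_real (k u) * \<Phi> p u z ^ N)))"
    proof (rule Bochner_Integration.integral_cong[OF refl])
     fix u
     show "of_real (wt z) * K p z ^ N * (?\<chi> u * (b u * ?F z u)) =
      (of_real (C\<^sup>2 * c\<^sup>2 * k p ^ N) * of_real (k z)) * (?\<chi> u * (b u * of_real (k u) * \<Phi> p u z ^ N))"
     proof (cases "u \<in> ball p r")
      case True
      hence u: "u \<in> D" using r by auto
      have "of_real (wt z) * K p z ^ N * (b u * ?F z u) =
        (b u * of_real (C\<^sup>2)) * (of_real (wt u) * (K u p ^ N * K z u ^ N) * (of_real (wt z) * K p z ^ N))"
       by (simp only: mult_ac)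
      also have "\<dots> = (of_real (C\<^sup>2 * c\<^sup>2 * k p ^ N) * of_real (k z)) * (b u * of_real (k u) * \<Phi> p u z ^ N)"
       unfolding phi[OF u z] by (simp only: of_real_mult mult_ac)
      finally show ?thesis using True by simp
     qed simp
    qed
    also have "\<dots> = (of_real (C\<^sup>2 * c\<^sup>2 * k p ^ N) * of_real (k z)) * ?I z"
     by (rule integral_mult_right_zero)
    finally have eq: "of_real (wt z) * K p z ^ N * P z = (of_real (C\<^sup>2 * c\<^sup>2 * k p ^ N) * of_real (k z)) * ?I z" .
    have cK: "cnj (W.ker z p) = of_real C * K p z ^ N"
     using B.ker_cnj[OF z p] by (simp add: C(2)[OF z p])
    have "of_real (wt z) * ((a z * P z) * (of_real C * K p z ^ N)) = (of_real C * a z) * (of_real (wt z) * K p z ^ N * P z)"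
     by (simp only: mult_ac)
    also have "\<dots> = of_real (C ^ 3 * c\<^sup>2 * k p ^ N) * (a z * of_real (k z) * ?I z)"
     unfolding eq by (simp add: power2_eq_square power3_eq_cube mult_ac)
    finally show ?thesis using True z by (simp add: cK)
   qed simp
  qed
  also have "\<dots> = of_real (C ^ 3 * c\<^sup>2 * k p ^ N) * II p r N a b"
   unfolding II_def by (rule integral_mult_right_zero)
  finally show ?thesis .
qed

text \<open>Outside a ball the kernel function of \<open>p\<close> carries an exponentially small part of its norm.\<close>

lemma tail_bound:
  assumes C: "0 < C" "\<And>z w. z \<in> D \<Longrightarrow> w \<in> D \<Longrightarrow> W.ker z w = of_real C * K z w ^ N"
   and p: "p \<in> D" and S: "S \<in> sets borel" and q: "0 \<le> q" "\<And>u. u \<in> D \<inter> S \<Longrightarrow> \<beta> u p \<le> q"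
  shows "nsq W.M (\<lambda>u. indicator S u * W.ker u p) \<le> C\<^sup>2 * c * k p ^ N * q ^ (N - 1)"
proof -
  define m where "m = N - 1"
  have pN: "x ^ N = x * x ^ m" for x :: real using N unfolding m_def by (cases N) auto
  have kp: "0 < k p" by (rule k_pos[OF p])
  have KH: "(\<lambda>u. K u p) \<in> B.H" by (rule B.ker_H[OF p])
  have meas: "(\<lambda>z. indicator D z * (of_real ((cmod (indicator S z * W.ker z p))\<^sup>2) :: complex)) \<in> borel_measurable borel"
  proof -
   have "(\<lambda>z. indicator S z * (indicator D z *\<^sub>R (complex_of_real ((cmod (W.ker z p))\<^sup>2)))) \<in> borel_measurable borel"
    by (intro borel_measurable_times borel_measurable_indicator S borel_measurable_continuous_on_indicator W.D_sets
      continuous_intros W.HD(4)[OF W.ker_H[OF p]])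
   moreover have "indicator S z * (indicator D z *\<^sub>R (complex_of_real ((cmod (W.ker z p))\<^sup>2))) =
    indicator D z * (of_real ((cmod (indicator S z * W.ker z p))\<^sup>2) :: complex)" for z
    by (simp add: indicator_def)
   ultimately show ?thesis by simp
  qed
  have "complex_of_real (nsq W.M (\<lambda>u. indicator S u * W.ker u p)) = (LINT z|W.M. of_real ((cmod (indicator S z * W.ker z p))\<^sup>2))"
   unfolding nsq_def by (rule integral_complex_of_real[symmetric])
  also have "\<dots> = (LINT z|lborel. indicator D z * (of_real (wt z) * of_real ((cmod (indicator S z * W.ker z p))\<^sup>2)))"
   by (rule W_lborel[OF meas])
  also have "\<dots> = (LINT z|lborel. complex_of_real (indicator D z * (wt z * (cmod (indicator S z * W.ker z p))\<^sup>2)))"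
   by (rule Bochner_Integration.integral_cong) (auto simp: indicator_def)
  also have "\<dots> = of_real (LINT z|lborel. indicator D z * (wt z * (cmod (indicator S z * W.ker z p))\<^sup>2))"
   by (rule integral_complex_of_real)
  finally have eq: "nsq W.M (\<lambda>u. indicator S u * W.ker u p) = (LINT z|lborel. indicator D z * (wt z * (cmod (indicator S z * W.ker z p))\<^sup>2))"
   by (simp only: of_real_eq_iff)
  have intK: "integrable lborel (\<lambda>z. indicator D z * (1 * (cmod (K z p))\<^sup>2))"
   using B.HD(2)[OF KH] B.square_integrable_iff(1)[OF B.HD(4)[OF KH]] by simp
  have nK: "(LINT z|lborel. indicator D z * (1 * (cmod (K z p))\<^sup>2)) = k p"
   using B.square_integrable_iff(2)[OF B.HD(4)[OF KH]] B.nsq_ker[OF p] by (simp add: k_eq)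
  have "nsq W.M (\<lambda>u. indicator S u * W.ker u p) \<le> (LINT z|lborel. (C\<^sup>2 * c * (k p * q) ^ m) * (indicator D z * (1 * (cmod (K z p))\<^sup>2)))"
   unfolding eq
  proof (rule integral_mono_AE')
   show "integrable lborel (\<lambda>z. (C\<^sup>2 * c * (k p * q) ^ m) * (indicator D z * (1 * (cmod (K z p))\<^sup>2)))"
    by (rule integrable_mult_right[OF intK])
   show "AE z in lborel. indicator D z * (wt z * (cmod (indicator S z * W.ker z p))\<^sup>2) \<le>
     (C\<^sup>2 * c * (k p * q) ^ m) * (indicator D z * (1 * (cmod (K z p))\<^sup>2))"
   proof (rule AE_I2)
    fix z
    show "indicator D z * (wt z * (cmod (indicator S z * W.ker z p))\<^sup>2) \<le>
     (C\<^sup>2 * c * (k p * q) ^ m) * (indicator D z * (1 * (cmod (K z p))\<^sup>2))"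
    proof (cases "z \<in> D \<inter> S")
     case True
     hence z: "z \<in> D" by simp
     have kz: "0 < k z" by (rule k_pos[OF z])
     have "wt z * (cmod (W.ker z p))\<^sup>2 = C\<^sup>2 * c * (k p * \<beta> z p) ^ m * (cmod (K z p))\<^sup>2"
     proof -
      have kb: "k p * \<beta> z p = (cmod (K z p))\<^sup>2 / k z" using kp by (simp add: \<beta>_def)
      have "cmod (W.ker z p) = C * (cmod (K z p) * cmod (K z p) ^ m)"
       using C(1) by (simp only: C(2)[OF z p] norm_mult norm_power norm_of_real abs_of_pos pN)
      hence "(cmod (W.ker z p))\<^sup>2 = C\<^sup>2 * ((cmod (K z p))\<^sup>2 * ((cmod (K z p))\<^sup>2) ^ m)"
       by (simp only: power_mult_distrib power2_eq_square mult_ac)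
      moreover have "wt z = c * (1 / k z) ^ m" by (simp add: wt_def m_def)
      ultimately show ?thesis unfolding kb by (simp add: power_divide mult_ac)
     qed
     also have "\<dots> \<le> C\<^sup>2 * c * (k p * q) ^ m * (cmod (K z p))\<^sup>2"
      using c kp q(2)[OF True] beta_nonneg[OF z p]
      by (intro mult_right_mono mult_left_mono power_mono) auto
     finally show ?thesis using True by simp
    next
     case False
     thus ?thesis using c kp q(1) by (auto simp: indicator_def)
    qed
   qed
   show "AE z in lborel. 0 \<le> (C\<^sup>2 * c * (k p * q) ^ m) * (indicator D z * (1 * (cmod (K z p))\<^sup>2))"
    using c kp q(1) by (intro AE_I2) auto
  qed
  also have "\<dots> = (C\<^sup>2 * c * (k p * q) ^ m) * k p" using nK by simp
  also have "\<dots> = C\<^sup>2 * c * k p ^ N * q ^ (N - 1)" by (simp add: pN m_def power_mult_distrib mult_ac)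
  finally show ?thesis .
qed

text \<open>
  \<open>\<Gamma>\<close> is bilinear and bounded by the norms of \<open>a R\<close> and \<open>b R\<close>, where \<open>R\<close> is the kernel function of \<open>p\<close>; cutting the
  symbols off outside the ball therefore costs at most the norm of the tail of \<open>R\<close>.
\<close>

lemma II_commutator:
  assumes p: "p \<in> D" and r: "ball p r \<subseteq> D" "0 < r"
   and a: "W.adm a s" and b: "W.adm b s" and sym: "W.\<Gamma> p a b = W.\<Gamma> p b a"
   and q: "0 \<le> q" "\<And>u. u \<in> D - ball p r \<Longrightarrow> \<beta> u p \<le> q"
  shows "cmod (II p r N a b - II p r N b a) \<le> 4 * s\<^sup>2 * sqrt q ^ (N - 1)"
proof -
  obtain C where C: "0 < C" "\<And>z w. z \<in> D \<Longrightarrow> w \<in> D \<Longrightarrow> W.ker z w = of_real C * K z w ^ N"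
   using W_ker_eq by blast
  let ?S = "- ball p r"
  let ?\<chi> = "indicator (ball p r) :: _ \<Rightarrow> complex"
  let ?\<eta> = "indicator ?S :: _ \<Rightarrow> complex"
  have kp: "0 < k p" by (rule k_pos[OF p])
  have s: "0 \<le> s" using a by (simp add: W.adm_def)
  have nR: "nsq W.M (\<lambda>u. W.ker u p) = C * k p ^ N"
  proof -
   have "complex_of_real (nsq W.M (\<lambda>u. W.ker u p)) = of_real (C * k p ^ N)"
    using W.nsq_ker[OF p] by (simp add: C(2)[OF p p] K_diag[OF p])
   thus ?thesis by (simp only: of_real_eq_iff)
  qed
  have Cc: "1 \<le> C * c"
  proof -
   have "nsq W.M (\<lambda>u. indicator UNIV u * W.ker u p) \<le> C\<^sup>2 * c * k p ^ N * 1 ^ (N - 1)"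
    by (rule tail_bound[OF C p]) (use beta_le_1 p in auto)
   hence "(C * k p ^ N) * 1 \<le> (C * k p ^ N) * (C * c)" by (simp add: nR power2_eq_square mult_ac)
   moreover have "0 < C * k p ^ N" using C(1) kp by simp
   ultimately show ?thesis by (rule mult_left_le_imp_le)
  qed
  have tail: "nsq W.M (\<lambda>u. ?\<eta> u * W.ker u p) \<le> C\<^sup>2 * c * k p ^ N * q ^ (N - 1)"
   by (rule tail_bound[OF C p]) (use q in auto)
  define T where "T = s\<^sup>2 * (C * k p ^ N * sqrt (C * c * q ^ (N - 1)))"
  have T: "0 \<le> T"
  proof -
   have "0 \<le> C * c" using Cc by linarith
   thus ?thesis unfolding T_def using C(1) kp q(1) by simp
  qed
  have T2: "(s\<^sup>2 * (C * k p ^ N)) * (s\<^sup>2 * (C\<^sup>2 * c * k p ^ N * q ^ (N - 1))) = T\<^sup>2"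
  proof -
   have "0 \<le> C * c" using Cc by linarith
   hence "0 \<le> C * c * q ^ (N - 1)" using q(1) by simp
   hence "(sqrt (C * c * q ^ (N - 1)))\<^sup>2 = C * c * q ^ (N - 1)" by simp
   thus ?thesis unfolding T_def by (simp only: power_mult_distrib power2_eq_square mult_ac)
  qed
  have full: "nsq W.M (\<lambda>u. f u * W.ker u p) \<le> s\<^sup>2 * (C * k p ^ N)" if "W.adm f s" for f
   using W.adm_square_integrable(2)[OF that W.ker_sq[OF p]] by (simp add: nR)
  have part: "nsq W.M (\<lambda>u. (?\<eta> u * f u) * W.ker u p) \<le> s\<^sup>2 * (C\<^sup>2 * c * k p ^ N * q ^ (N - 1))" if f: "W.adm f s" for f
  proof -
   have one: "W.adm (\<lambda>_. 1) 1" by (intro W.adm_continuous) auto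
   have "square_integrable W.M (\<lambda>u. (?\<eta> u * 1) * W.ker u p)"
    by (rule W.adm_square_integrable(1)[OF W.adm_indicator[OF one] W.ker_sq[OF p]]) simp
   hence "nsq W.M (\<lambda>u. f u * (?\<eta> u * W.ker u p)) \<le> s\<^sup>2 * nsq W.M (\<lambda>u. ?\<eta> u * W.ker u p)"
    using W.adm_square_integrable(2)[OF f] by simp
   also have "\<dots> \<le> s\<^sup>2 * (C\<^sup>2 * c * k p ^ N * q ^ (N - 1))" by (intro mult_left_mono tail) simp
   finally show ?thesis by (simp add: mult_ac)
  qed
  have T_bound: "cmod (W.\<Gamma> p f g) \<le> T"
   if "nsq W.M (\<lambda>u. f u * W.ker u p) * nsq W.M (\<lambda>u. g u * W.ker u p) \<le> T\<^sup>2" "W.adm f s" "W.adm g s" for f g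
   using order_trans[OF W.Gamma_bound[OF p that(2,3)] that(1)] T by (rule power2_le_imp_le)
  have split: "cmod (W.\<Gamma> p f g - W.\<Gamma> p (\<lambda>z. ?\<chi> z * f z) (\<lambda>z. ?\<chi> z * g z)) \<le> 2 * T"
   if f: "W.adm f s" and g: "W.adm g s" for f g
  proof -
   have Sb: "?S \<in> sets borel" "ball p r \<in> sets borel" by auto
   note \<chi>f = W.adm_indicator[OF f Sb(2)] and \<chi>g = W.adm_indicator[OF g Sb(2)]
   note \<eta>f = W.adm_indicator[OF f Sb(1)] and \<eta>g = W.adm_indicator[OF g Sb(1)]
   have \<eta>: "?\<chi> z * h z = h z - ?\<eta> z * h z" for z h by (simp add: indicator_def)
   have "W.\<Gamma> p (\<lambda>z. ?\<chi> z * f z) (\<lambda>z. ?\<chi> z * g z) = W.\<Gamma> p f (\<lambda>z. ?\<chi> z * g z) - W.\<Gamma> p (\<lambda>z. ?\<eta> z * f z) (\<lambda>z. ?\<chi> z * g z)"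
    unfolding \<eta>[of _ f] by (rule W.Gamma_diff_left[OF p f \<eta>f \<chi>g])
   moreover have "W.\<Gamma> p f (\<lambda>z. ?\<chi> z * g z) = W.\<Gamma> p f g - W.\<Gamma> p f (\<lambda>z. ?\<eta> z * g z)"
    unfolding \<eta>[of _ g] by (rule W.Gamma_diff_right[OF p f g \<eta>g])
   ultimately have "W.\<Gamma> p f g - W.\<Gamma> p (\<lambda>z. ?\<chi> z * f z) (\<lambda>z. ?\<chi> z * g z) =
     W.\<Gamma> p f (\<lambda>z. ?\<eta> z * g z) + W.\<Gamma> p (\<lambda>z. ?\<eta> z * f z) (\<lambda>z. ?\<chi> z * g z)" by simp
   moreover have "cmod (W.\<Gamma> p f (\<lambda>z. ?\<eta> z * g z)) \<le> T"
   proof (rule T_bound[OF _ f \<eta>g])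
    have "nsq W.M (\<lambda>u. f u * W.ker u p) * nsq W.M (\<lambda>u. (?\<eta> u * g u) * W.ker u p) \<le>
      (s\<^sup>2 * (C * k p ^ N)) * (s\<^sup>2 * (C\<^sup>2 * c * k p ^ N * q ^ (N - 1)))"
     using C(1) kp by (intro mult_mono full f part g nsq_nonneg) auto
    thus "nsq W.M (\<lambda>u. f u * W.ker u p) * nsq W.M (\<lambda>u. (?\<eta> u * g u) * W.ker u p) \<le> T\<^sup>2" by (simp only: T2)
   qed
   moreover have "cmod (W.\<Gamma> p (\<lambda>z. ?\<eta> z * f z) (\<lambda>z. ?\<chi> z * g z)) \<le> T"
   proof (rule T_bound[OF _ \<eta>f \<chi>g])
    have "nsq W.M (\<lambda>u. (?\<chi> u * g u) * W.ker u p) * nsq W.M (\<lambda>u. (?\<eta> u * f u) * W.ker u p) \<le>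
      (s\<^sup>2 * (C * k p ^ N)) * (s\<^sup>2 * (C\<^sup>2 * c * k p ^ N * q ^ (N - 1)))"
     using C(1) kp by (intro mult_mono full \<chi>g part f nsq_nonneg) auto
    thus "nsq W.M (\<lambda>u. (?\<eta> u * f u) * W.ker u p) * nsq W.M (\<lambda>u. (?\<chi> u * g u) * W.ker u p) \<le> T\<^sup>2"
     unfolding T2 by (subst mult.commute)
   qed
   ultimately show ?thesis
    using norm_triangle_ineq[of "W.\<Gamma> p f (\<lambda>z. ?\<eta> z * g z)" "W.\<Gamma> p (\<lambda>z. ?\<eta> z * f z) (\<lambda>z. ?\<chi> z * g z)"] by simp
  qed
  define L where "L = C ^ 3 * c\<^sup>2 * k p ^ N"
  have L: "0 < L" unfolding L_def using C(1) c kp by simp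
  define x where "x = W.\<Gamma> p (\<lambda>z. ?\<chi> z * a z) (\<lambda>z. ?\<chi> z * b z)"
  define y where "y = W.\<Gamma> p (\<lambda>z. ?\<chi> z * b z) (\<lambda>z. ?\<chi> z * a z)"
  have "x - y = (W.\<Gamma> p b a - y) - (W.\<Gamma> p a b - x)" using sym by simp
  hence "cmod (x - y) = cmod ((W.\<Gamma> p b a - y) - (W.\<Gamma> p a b - x))" by (rule arg_cong)
  hence "cmod (x - y) \<le> 4 * T"
   using split[OF a b, folded x_def] split[OF b a, folded y_def] norm_triangle_ineq4[of "W.\<Gamma> p b a - y" "W.\<Gamma> p a b - x"] by linarith
  moreover have "x = of_real L * II p r N a b" "y = of_real L * II p r N b a"
   unfolding x_def y_def L_def using Gamma_eq_II[OF C p r(1) a b] Gamma_eq_II[OF C p r(1) b a] by auto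
  ultimately have "L * cmod (II p r N a b - II p r N b a) \<le> 4 * T"
   using L by (simp add: right_diff_distrib[symmetric] norm_mult)
  also have "T \<le> L * (s\<^sup>2 * sqrt q ^ (N - 1))"
  proof -
   have "sqrt (C * c * q ^ (N - 1)) = sqrt (C * c) * sqrt q ^ (N - 1)" by (simp add: real_sqrt_mult real_sqrt_power)
   moreover have "sqrt (C * c) \<le> (C * c)\<^sup>2"
   proof -
    have "sqrt (C * c) \<le> C * c" using Cc self_le_power[OF Cc, of 2] by (intro real_le_lsqrt) auto
    also have "\<dots> \<le> (C * c)\<^sup>2" by (rule self_le_power[OF Cc]) simp
    finally show ?thesis .
   qed
   ultimately have "sqrt (C * c * q ^ (N - 1)) \<le> (C * c)\<^sup>2 * sqrt q ^ (N - 1)" using q(1) by (simp add: mult_right_mono)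
   hence "T \<le> s\<^sup>2 * (C * k p ^ N * ((C * c)\<^sup>2 * sqrt q ^ (N - 1)))"
    unfolding T_def using C(1) kp by (intro mult_left_mono) auto
   also have "\<dots> = L * (s\<^sup>2 * sqrt q ^ (N - 1))" by (simp add: L_def power2_eq_square power3_eq_cube mult_ac)
   finally show ?thesis .
  qed
  finally have "L * cmod (II p r N a b - II p r N b a) \<le> L * (4 * s\<^sup>2 * sqrt q ^ (N - 1))" by (simp add: mult_ac)
  thus ?thesis using L by simp
qed

end

section \<open>The semiclassical limit\<close>

lemma lborel_integral_affine:
  fixes f :: "'a::euclidean_space \<Rightarrow> complex"
  assumes f: "f \<in> borel_measurable borel" and c: "0 < c"
  shows "(LINT u|lborel. f u) = of_real (c ^ DIM('a)) * (LINT x|lborel. f (p + c *\<^sub>R x))"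
proof -
  have m: "(\<lambda>x. p + c *\<^sub>R x) \<in> borel_measurable borel"
   by (intro borel_measurable_continuous_onI continuous_intros)
  have "(LINT u|lborel. f u) = (LINT u|density (distr lborel borel (\<lambda>x. p + c *\<^sub>R x)) (\<lambda>_. ennreal (\<bar>c\<bar>^DIM('a))). f u)"
   using lborel_affine[of c p] c by simp
  also have "\<dots> = (LINT u|distr lborel borel (\<lambda>x. p + c *\<^sub>R x). (\<bar>c\<bar>^DIM('a)) *\<^sub>R f u)"
   using f c by (intro integral_density) auto
  also have "\<dots> = (LINT x|lborel. (\<bar>c\<bar>^DIM('a)) *\<^sub>R f (p + c *\<^sub>R x))"
   using f m by (intro integral_distr) auto
  also have "\<dots> = (\<bar>c\<bar>^DIM('a)) *\<^sub>R (LINT x|lborel. f (p + c *\<^sub>R x))" by (rule integral_scaleR_right)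
  finally show ?thesis using c by (simp add: scaleR_conv_of_real)
qed

lemma directional_limit:
  fixes a :: "'a::euclidean_space \<Rightarrow> complex"
  assumes a: "(a has_derivative a') (at p)" and a0: "a p = 0"
  shows "(\<lambda>n. of_real (sqrt (real (Suc n))) * a (p + (1 / sqrt (real (Suc n))) *\<^sub>R x)) \<longlonglongrightarrow> a' x"
proof -
  have "((\<lambda>t. p + t *\<^sub>R x) has_derivative (\<lambda>t. t *\<^sub>R x)) (at 0)"
   by (auto intro!: derivative_eq_intros)
  moreover have "(a has_derivative a') (at (p + 0 *\<^sub>R x))" using a by simp
  ultimately have "((\<lambda>t. a (p + t *\<^sub>R x)) has_derivative (\<lambda>t. a' (t *\<^sub>R x))) (at 0)"
   by (rule has_derivative_compose)
  moreover have "(\<lambda>t. a' (t *\<^sub>R x)) = (\<lambda>t. t *\<^sub>R a' x)"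
   using linear_cmul[OF has_derivative_linear[OF a]] by simp
  ultimately have "((\<lambda>t. a (p + t *\<^sub>R x)) has_vector_derivative a' x) (at 0)" by (simp add: has_vector_derivative_def)
  hence "((\<lambda>h. norm (a (p + (0 + h) *\<^sub>R x) - a (p + 0 *\<^sub>R x) - h *\<^sub>R a' x) / norm h) \<longlongrightarrow> 0) (at 0)"
   unfolding has_vector_derivative_def has_derivative_at by (rule conjunct2)
  moreover have "norm (a (p + (0 + h) *\<^sub>R x) - a (p + 0 *\<^sub>R x) - h *\<^sub>R a' x) / norm h = norm ((a (p + h *\<^sub>R x) - h *\<^sub>R a' x) /\<^sub>R norm h)" for h
   by (simp add: a0 divide_inverse mult.commute)
  ultimately have "((\<lambda>h. norm ((a (p + h *\<^sub>R x) - h *\<^sub>R a' x) /\<^sub>R norm h)) \<longlongrightarrow> 0) (at 0)" by simp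
  hence lim: "((\<lambda>h. (a (p + h *\<^sub>R x) - h *\<^sub>R a' x) /\<^sub>R norm h) \<longlongrightarrow> 0) (at 0)" by (rule tendsto_norm_zero_cancel)
  have fl: "filterlim (\<lambda>n. 1 / sqrt (real (Suc n))) (at 0) sequentially" by real_asymp
  have "(X - (1 / t) *\<^sub>R v) /\<^sub>R norm (1 / t) = of_real t * X - v" if "0 < t" for t :: real and X v :: complex
   using that by (simp add: scaleR_conv_of_real right_diff_distrib)
  hence eq: "(a (p + (1 / sqrt (real (Suc n))) *\<^sub>R x) - (1 / sqrt (real (Suc n))) *\<^sub>R a' x) /\<^sub>R norm (1 / sqrt (real (Suc n)))
    = of_real (sqrt (real (Suc n))) * a (p + (1 / sqrt (real (Suc n))) *\<^sub>R x) - a' x" for n by simp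
  have "(\<lambda>n. of_real (sqrt (real (Suc n))) * a (p + (1 / sqrt (real (Suc n))) *\<^sub>R x) - a' x) \<longlonglongrightarrow> 0"
   using filterlim_compose[OF lim fl] unfolding eq .
  thus ?thesis by (rule LIM_zero_cancel)
qed

context bounded_dom
begin

text \<open>
  Substituting \<open>z = p + y / sqrt n\<close> and \<open>u = p + x / sqrt n\<close> gives the factor \<open>1 / n ^ (2 d)\<close>, where \<open>d\<close> is the complex
  dimension, and the symbols, which vanish at \<open>p\<close>, give another \<open>1 / n\<close>. The Gaussian bound on the powers of \<open>\<Phi>\<close>
  dominates first the inner and then the outer integral.
\<close>

lemma II_limit:
  assumes p: "p \<in> D" and r: "0 < r" "cball p r \<subseteq> D" and L: "0 \<le> L"
   and a: "continuous_on D a" "a p = 0" "(a has_derivative a') (at p)" "\<And>u. u \<in> ball p r \<Longrightarrow> cmod (a u) \<le> L * norm (u - p)"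
   and b: "continuous_on D b" "b p = 0" "(b has_derivative b') (at p)" "\<And>u. u \<in> ball p r \<Longrightarrow> cmod (b u) \<le> L * norm (u - p)"
  shows "(\<lambda>n. of_nat (Suc n) ^ (2 * CARD('n) + 1) * II p r (Suc n) a b) \<longlonglongrightarrow>
   of_real ((k p)\<^sup>2) * (LINT y|lborel. a' y * (LINT x|lborel. b' x * exp (Hm p y x - Hm p x x - Hm p y y)))"
proof -
  let ?V = "ball p r"
  have VD: "?V \<subseteq> D" using r by auto
  obtain c where c: "0 < c" "\<And>u. u \<in> D \<Longrightarrow> \<beta> u p \<le> 1 - c * (norm (u - p))\<^sup>2" using beta_bound[OF p] by blast
  obtain z0 where z0: "\<And>z. z \<in> cball p r \<Longrightarrow> k z \<le> k z0" "z0 \<in> cball p r"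
  proof -
   have "cball p r \<noteq> {}" using r by auto
   thus ?thesis using continuous_attains_sup[OF compact_cball _ continuous_on_subset[OF k_continuous r(2)]] that by blast
  qed
  define kM where "kM = k z0"
  have kM: "0 < kM" using z0(2) r k_pos by (auto simp: kM_def)
  define s where "s n = 1 / sqrt (real (Suc n))" for n
  let ?z = "\<lambda>n x. p + s n *\<^sub>R x" and ?sq = "\<lambda>n. sqrt (real (Suc n))" and ?e = "\<lambda>y::complex^'n. exp (- (c / 2) * (norm y)\<^sup>2)"
  let ?E = "\<lambda>y x. exp (Hm p y x - Hm p x x - Hm p y y)"
  have s: "0 < s n" "real (Suc n) * (s n)\<^sup>2 = 1" "?sq n * s n = 1" for n
   by (auto simp: s_def power_divide simp del: of_nat_Suc)
  have s0: "s \<longlonglongrightarrow> 0" unfolding s_def by real_asymp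
  define Ind where "Ind n x = (indicator ?V (?z n x) :: complex)" for n x
  have Ind1: "(\<lambda>n. Ind n x) \<longlonglongrightarrow> 1" for x
  proof -
   have "(\<lambda>n. ?z n x) \<longlonglongrightarrow> p + 0 *\<^sub>R x" by (intro tendsto_intros s0)
   hence "\<forall>\<^sub>F n in sequentially. ?z n x \<in> ?V" using r(1) by (intro topological_tendstoD) auto
   hence "\<forall>\<^sub>F n in sequentially. Ind n x = 1" by eventually_elim (simp add: Ind_def)
   thus ?thesis by (rule tendsto_eventually)
  qed
  have k1: "(\<lambda>n. complex_of_real (k (?z n x))) \<longlonglongrightarrow> of_real (k p)" for x
  proof -
   have "isCont k p" using k_continuous D_facts(1) p continuous_on_eq_continuous_at by blast
   moreover have "(\<lambda>n. ?z n x) \<longlonglongrightarrow> p"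
    using tendsto_add[OF tendsto_const tendsto_scaleR[OF s0 tendsto_const], of p x] by simp
   ultimately have "(\<lambda>n. k (?z n x)) \<longlonglongrightarrow> k p" by (rule isCont_tendsto_compose)
   thus ?thesis by (rule tendsto_of_real)
  qed
  define T where "T f n x = Ind n x * (of_real (?sq n) * f (?z n x) * of_real (k (?z n x)))" for f n x
  have T_lim: "(\<lambda>n. T f n x) \<longlonglongrightarrow> of_real (k p) * f' x" if "f p = 0" "(f has_derivative f') (at p)" for f f' x
  proof -
   have "(\<lambda>n. Ind n x * (of_real (?sq n) * f (?z n x) * of_real (k (?z n x)))) \<longlonglongrightarrow> 1 * (f' x * of_real (k p))"
    unfolding s_def by (intro tendsto_mult Ind1 directional_limit that k1[unfolded s_def])
   thus ?thesis by (simp add: T_def mult.commute)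
  qed
  have T_bound: "cmod (T f n x) \<le> L * kM * norm x" if f: "\<And>u. u \<in> ?V \<Longrightarrow> cmod (f u) \<le> L * norm (u - p)" for f n x
  proof (cases "?z n x \<in> ?V")
   case True
   define u where "u = ?z n x"
   have u: "u \<in> ?V" "u \<in> D" "u \<in> cball p r" using True VD by (auto simp: u_def)
   have "?sq n * cmod (f u) \<le> ?sq n * (L * norm (u - p))"
    by (intro mult_left_mono f u) simp
   also have "norm (u - p) = s n * norm x" using s(1)[of n] by (simp add: u_def)
   also have "?sq n * (L * (s n * norm x)) = L * norm x * (?sq n * s n)" by (simp only: mult_ac)
   also have "\<dots> = L * norm x" by (simp only: s(3) mult_1_right)
   finally have 1: "?sq n * cmod (f u) \<le> L * norm x" .
   have "cmod (T f n x) = ?sq n * cmod (f u) * k u"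
    using True k_pos[OF u(2)] by (simp add: T_def Ind_def u_def norm_mult del: of_nat_Suc)
   also have "\<dots> \<le> (L * norm x) * kM"
    by (rule mult_mono) (use 1 z0(1)[OF u(3)] k_pos[OF u(2)] L in \<open>auto simp: kM_def\<close>)
   finally show ?thesis by (simp add: mult_ac)
  next
   case False
   thus ?thesis using L kM by (simp add: T_def Ind_def)
  qed
  define G where "G n y x = Ind n y * (T b n x * \<Phi> p (?z n x) (?z n y) ^ Suc n)" for n y x
  define g where "g x = L * kM * norm x * ?e x" for x :: "complex^'n"
  have g0: "0 \<le> g x" for x using L kM by (simp add: g_def)
  have intg: "integrable lborel g"
  proof (rule integrable_dominated_gaussian[of "c / 2" g "L * kM" 1])
   show "g \<in> borel_measurable borel" unfolding g_def by (intro borel_measurable_continuous_onI continuous_intros)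
   show "norm (g x) \<le> L * kM * exp (1 * norm x - c / 2 * (norm x)\<^sup>2)" for x
   proof -
    have "norm (g x) = L * kM * (norm x * ?e x)" using g0[of x] by (simp add: g_def)
    also have "\<dots> \<le> L * kM * (exp (norm x) * ?e x)"
     using L kM by (intro mult_left_mono mult_right_mono self_le_exp) auto
    also have "exp (norm x) * ?e x = exp (1 * norm x - c / 2 * (norm x)\<^sup>2)"
     by (simp add: exp_add[symmetric])
    finally show ?thesis .
   qed
  qed (use c in simp)
  have G_bound: "cmod (G n y x) \<le> ?e y * g x" for n y x
  proof (cases "?z n y \<in> ?V \<and> ?z n x \<in> ?V")
   case True
   hence D: "?z n y \<in> D" "?z n x \<in> D" using VD by auto
   have e: "(c / 2) * real (Suc n) * (norm (p + s n *\<^sub>R v - p))\<^sup>2 = (c / 2) * (norm v)\<^sup>2" for v :: "complex^'n"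
   proof -
    have "(norm (p + s n *\<^sub>R v - p))\<^sup>2 = (s n)\<^sup>2 * (norm v)\<^sup>2" by (simp add: power_mult_distrib)
    hence "(c / 2) * real (Suc n) * (norm (p + s n *\<^sub>R v - p))\<^sup>2 = (c / 2) * (real (Suc n) * (s n)\<^sup>2) * (norm v)\<^sup>2"
     by (simp only: mult_ac)
    thus ?thesis by (simp only: s(2) mult_1_right)
   qed
   have "cmod (\<Phi> p (?z n x) (?z n y) ^ Suc n) \<le> ?e x * ?e y"
    using Phi_power_bound[OF p D(2,1) c, of "Suc n"] e[of x] e[of y] by (simp only: minus_mult_left[symmetric])
   hence "cmod (T b n x * \<Phi> p (?z n x) (?z n y) ^ Suc n) \<le>
     (L * kM * norm x) * (?e x * ?e y)"
    unfolding norm_mult by (intro mult_mono[OF T_bound[OF b(4)]]) (use L kM in auto)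
   thus ?thesis using True by (simp add: G_def Ind_def g_def mult_ac)
  next
   case False
   thus ?thesis using g0[of x] by (auto simp: G_def Ind_def T_def)
  qed
  have G_lim: "(\<lambda>n. G n y x) \<longlonglongrightarrow> of_real (k p) * b' x * ?E y x" for y x
  proof -
   have "(\<lambda>n. \<Phi> p (?z n x) (?z n y) ^ Suc n) \<longlonglongrightarrow> ?E y x"
    unfolding s_def using LIMSEQ_Suc[OF Phi_limit[OF p, of x y]] .
   from tendsto_mult[OF Ind1[of y] tendsto_mult[OF T_lim[OF b(2,3), of x] this]] show ?thesis by (simp add: G_def)
  qed
  \<comment> \<open>Joint measurability, from the joint continuity of the kernel.\<close>
  define q where "q n z u = indicator ?V z * (indicator ?V u * (b u * of_real (k u) * \<Phi> p u z ^ Suc n))" for n z u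
  have q_meas: "(\<lambda>w. q n (fst w) (snd w)) \<in> borel_measurable borel" for n
  proof -
   have sub: "?V \<times> ?V \<subseteq> D \<times> D" using VD by auto
   have cf: "continuous_on (?V \<times> ?V) (\<lambda>w. f (fst w))" and cs: "continuous_on (?V \<times> ?V) (\<lambda>w. f (snd w))"
    if "continuous_on D f" for f :: "complex^'n \<Rightarrow> 'z::topological_space"
    using VD by (auto intro!: continuous_on_compose2[OF that] continuous_intros)
   have cK: "continuous_on (?V \<times> ?V) (\<lambda>w. K (fst w) (snd w))"
    by (rule continuous_on_subset[OF sesqui_continuous[OF B.sesqui_ker D_facts(1)] sub])
   have cKp: "continuous_on D (\<lambda>u. K u p)" by (rule B.HD(4)[OF B.ker_H[OF p]])
   have cpK: "continuous_on D (\<lambda>z. K p z)"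
    by (rule continuous_on_cong[THEN iffD1, OF refl _ continuous_on_cnj[OF cKp]]) (simp add: B.ker_cnj p)
   have nz: "of_real (k (snd w) * k (fst w) * k p) \<noteq> (0::complex)" if "w \<in> ?V \<times> ?V" for w
    using that k_pos VD p by (auto simp: subset_iff less_imp_neq[symmetric])
   have "continuous_on (?V \<times> ?V) (\<lambda>w. b (snd w) * of_real (k (snd w)) * \<Phi> p (snd w) (fst w) ^ Suc n)"
    unfolding \<Phi>_def
    by (intro continuous_intros cf cs cK cKp cpK b(1) k_continuous ballI nz)
   hence "(\<lambda>w. indicator (?V \<times> ?V) w *\<^sub>R (b (snd w) * of_real (k (snd w)) * \<Phi> p (snd w) (fst w) ^ Suc n)) \<in> borel_measurable borel"
    by (intro borel_measurable_continuous_on_indicator) (auto intro!: borel_open open_Times)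
   moreover have "indicator (?V \<times> ?V) w *\<^sub>R (b (snd w) * of_real (k (snd w)) * \<Phi> p (snd w) (fst w) ^ Suc n) = q n (fst w) (snd w)" for w
    by (auto simp: q_def indicator_def mem_Times_iff)
   ultimately show ?thesis by simp
  qed
  have aff: "(\<lambda>x. p + t *\<^sub>R x) \<in> borel_measurable borel" for t
   by (intro borel_measurable_continuous_onI continuous_intros)
  have qz_meas: "q n z \<in> borel_measurable borel" for n z
  proof -
   have "(\<lambda>u. (z, u)) \<in> borel_measurable borel" by (intro borel_measurable_continuous_onI continuous_intros)
   from measurable_compose[OF this q_meas[of n]] show ?thesis by simp
  qed
  have Q_meas: "(\<lambda>z. LINT u|lborel. q n z u) \<in> borel_measurable borel" for n
  proof -
   have "case_prod (q n) \<in> borel_measurable (borel \<Otimes>\<^sub>M lborel)"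
    using q_meas[of n] by (simp add: case_prod_unfold borel_prod cong: measurable_cong_sets)
     (simp add: borel_prod[symmetric] cong: measurable_cong_sets)
   thus ?thesis by (rule sigma_finite_measure.borel_measurable_lebesgue_integral[OF lborel.sigma_finite_measure_axioms])
  qed
  have G_q: "G n y x = of_real (?sq n) * q n (?z n y) (?z n x)" for n y x
   by (simp add: G_def T_def Ind_def q_def mult_ac)
  have G_meas: "G n y \<in> borel_measurable lborel" for n y
   using measurable_compose[OF aff qz_meas] unfolding G_q[abs_def] by simp
  define J where "J n y = (LINT x|lborel. G n y x)" for n y
  define Jl where "Jl y = (LINT x|lborel. of_real (k p) * b' x * ?E y x)" for y
  have J_meas: "J n \<in> borel_measurable lborel" for n
  proof -
   have m: "(\<lambda>y. of_real (?sq n) * (inverse (of_real (s n ^ DIM(complex^'n))) * (LINT u|lborel. q n (?z n y) u))) \<in> borel_measurable borel"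
    using measurable_compose[OF aff Q_meas] by measurable
   have "J n y = of_real (?sq n) * (inverse (of_real (s n ^ DIM(complex^'n))) * (LINT u|lborel. q n (?z n y) u))" for y
   proof -
    have "J n y = of_real (?sq n) * (LINT x|lborel. q n (?z n y) (?z n x))"
     unfolding J_def G_q by (rule integral_mult_right_zero)
    moreover have "(LINT u|lborel. q n (?z n y) u) = of_real (s n ^ DIM(complex^'n)) * (LINT x|lborel. q n (?z n y) (?z n x))"
     by (rule lborel_integral_affine[OF qz_meas s(1)])
    moreover have "complex_of_real (s n ^ DIM(complex^'n)) \<noteq> 0" using s(1)[of n] by simp
    ultimately show ?thesis by (simp del: of_real_power)
   qed
   hence "J n = (\<lambda>y. of_real (?sq n) * (inverse (of_real (s n ^ DIM(complex^'n))) * (LINT u|lborel. q n (?z n y) u)))"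
    by (rule ext)
   with m show ?thesis by (simp only: measurable_lborel1 measurable_lborel2)
  qed
  define g1 where "g1 = (LINT x|lborel. g x)"
  have g1: "0 \<le> g1" unfolding g1_def by (intro Bochner_Integration.integral_nonneg g0)
  have lim_meas: "(\<lambda>x. of_real (k p) * b' x * ?E y x) \<in> borel_measurable lborel" for y
   by (rule borel_measurable_LIMSEQ_metric[OF G_meas G_lim])
  have J_lim: "(\<lambda>n. J n y) \<longlonglongrightarrow> Jl y" for y
   unfolding J_def Jl_def
   by (rule integral_dominated_convergence[where w = "\<lambda>x. ?e y * g x", OF lim_meas G_meas])
    (use intg G_lim G_bound in auto)
  have J_bound: "cmod (J n y) \<le> ?e y * g1" for n y
  proof -
   have "cmod (J n y) \<le> (LINT x|lborel. ?e y * g x)"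
   proof -
    have i1: "integrable lborel (\<lambda>x. ?e y * g x)" by (rule integrable_mult_right[OF intg])
    have i2: "integrable lborel (G n y)"
     by (rule Bochner_Integration.integrable_bound[OF i1 G_meas]) (intro AE_I2, simp only: real_norm_def, rule order_trans[OF G_bound abs_ge_self])
    have "cmod (LINT x|lborel. G n y x) \<le> (LINT x|lborel. cmod (G n y x))" by (rule integral_norm_bound)
    also have "\<dots> \<le> (LINT x|lborel. ?e y * g x)"
     using G_bound by (intro integral_mono i1 integrable_norm i2)
    finally show ?thesis unfolding J_def .
   qed
   thus ?thesis by (simp add: g1_def)
  qed
  have chi_meas: "Ind n \<in> borel_measurable borel" for n
   unfolding Ind_def by (intro measurable_compose[OF aff] borel_measurable_indicator) auto
  have Ta_meas: "T a n \<in> borel_measurable borel" for n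
  proof -
   have "continuous_on ?V (\<lambda>u. a u * of_real (k u))"
    using VD by (intro continuous_intros continuous_on_subset[OF a(1)] continuous_on_subset[OF k_continuous])
   hence "(\<lambda>u. indicator ?V u *\<^sub>R (a u * of_real (k u))) \<in> borel_measurable borel"
    by (intro borel_measurable_continuous_on_indicator) auto
   from measurable_compose[OF aff this, of "s n"]
   have "(\<lambda>x. of_real (?sq n) * (indicator ?V (?z n x) *\<^sub>R (a (?z n x) * of_real (k (?z n x))))) \<in> borel_measurable borel"
    by (intro borel_measurable_times) auto
   moreover have "of_real (?sq n) * (indicator ?V (?z n x) *\<^sub>R (a (?z n x) * of_real (k (?z n x)))) = T a n x" for x
    by (simp add: T_def Ind_def indicator_def mult_ac)
   ultimately show ?thesis by simp
  qed
  have O_lim: "(\<lambda>n. T a n y * J n y) \<longlonglongrightarrow> of_real (k p) * a' y * Jl y" for y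
   by (intro tendsto_mult T_lim a J_lim)
  have "(\<lambda>n. LINT y|lborel. T a n y * J n y) \<longlonglongrightarrow> (LINT y|lborel. of_real (k p) * a' y * Jl y)"
  proof (rule integral_dominated_convergence[where w = "\<lambda>y. g1 * g y"])
   have mm: "(\<lambda>y. T a n y * J n y) \<in> borel_measurable lborel" for n
    using Ta_meas[of n] J_meas[of n] by simp
   thus "(\<lambda>y. T a n y * J n y) \<in> borel_measurable lborel" for n .
   show "(\<lambda>y. of_real (k p) * a' y * Jl y) \<in> borel_measurable lborel"
    by (rule borel_measurable_LIMSEQ_metric[OF mm O_lim])
   show "AE y in lborel. cmod (T a n y * J n y) \<le> g1 * g y" for n
   proof (rule AE_I2)
    fix y
    have "cmod (T a n y * J n y) \<le> (L * kM * norm y) * (?e y * g1)"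
     unfolding norm_mult by (intro mult_mono[OF T_bound[OF a(4)] J_bound]) (use L kM in auto)
    thus "cmod (T a n y * J n y) \<le> g1 * g y" by (simp add: g_def mult_ac)
   qed
  qed (use intg O_lim in auto)
  moreover have "(LINT y|lborel. of_real (k p) * a' y * Jl y) =
    of_real ((k p)\<^sup>2) * (LINT y|lborel. a' y * (LINT x|lborel. b' x * ?E y x))"
  proof -
   have "Jl y = of_real (k p) * (LINT x|lborel. b' x * ?E y x)" for y
    unfolding Jl_def mult.assoc by (rule integral_mult_right_zero)
   hence "of_real (k p) * a' y * Jl y = of_real ((k p)\<^sup>2) * (a' y * (LINT x|lborel. b' x * ?E y x))" for y
    by (simp add: power2_eq_square mult_ac)
   thus ?thesis by (simp only: integral_mult_right_zero)
  qed
  moreover have "of_nat (Suc n) ^ (2 * CARD('n) + 1) * II p r (Suc n) a b = (LINT y|lborel. T a n y * J n y)" for n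
  proof -
   let ?d = "DIM(complex^'n)"
   have dim: "?d = 2 * CARD('n)" by simp
   define inner where "inner z = (LINT u|lborel. q n z u)" for z
   have inner_eq: "indicator ?V z * (LINT u|lborel. indicator ?V u * (b u * of_real (k u) * \<Phi> p u z ^ Suc n)) = inner z" for z
    unfolding inner_def q_def by (rule integral_mult_right_zero[symmetric])
   define f where "f z = indicator ?V z *\<^sub>R (a z * of_real (k z)) * inner z" for z
   have f_meas: "f \<in> borel_measurable borel"
   proof -
    have "continuous_on ?V (\<lambda>u. a u * of_real (k u))"
     using VD by (intro continuous_intros continuous_on_subset[OF a(1)] continuous_on_subset[OF k_continuous])
    thus ?thesis unfolding f_def[abs_def] inner_def
     by (intro borel_measurable_times borel_measurable_continuous_on_indicator Q_meas) auto
   qed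
   have "II p r (Suc n) a b = (LINT z|lborel. f z)"
    unfolding II_def f_def inner_eq[symmetric] by (rule Bochner_Integration.integral_cong) (auto simp: indicator_def)
   also have "\<dots> = of_real (s n ^ ?d) * (LINT y|lborel. f (?z n y))"
    by (rule lborel_integral_affine[OF f_meas s(1)])
   also have "f (?z n y) = of_real (s n ^ ?d) * (of_real (1 / real (Suc n)) * (T a n y * J n y))" for y
   proof -
    have "inner (?z n y) = of_real (s n ^ ?d) * (LINT x|lborel. q n (?z n y) (?z n x))"
     unfolding inner_def by (rule lborel_integral_affine[OF qz_meas s(1)])
    moreover have "J n y = of_real (?sq n) * (LINT x|lborel. q n (?z n y) (?z n x))"
     unfolding J_def G_q by (rule integral_mult_right_zero)
    moreover have "T a n y = of_real (?sq n) * (indicator ?V (?z n y) *\<^sub>R (a (?z n y) * of_real (k (?z n y))))"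
     by (simp add: T_def Ind_def indicator_def mult_ac)
    moreover have "complex_of_real (1 / real (Suc n)) * (of_real (?sq n) * of_real (?sq n)) = 1"
     by (simp only: of_real_mult[symmetric] real_sqrt_mult_self) simp
    ultimately show ?thesis unfolding f_def by (simp only:) algebra
   qed
   hence "(LINT y|lborel. f (?z n y)) = of_real (s n ^ ?d) * (of_real (1 / real (Suc n)) * (LINT y|lborel. T a n y * J n y))"
    by (simp only: integral_mult_right_zero)
   finally have II: "II p r (Suc n) a b = of_real (s n ^ ?d) * (of_real (s n ^ ?d) * (of_real (1 / real (Suc n)) * (LINT y|lborel. T a n y * J n y)))" .
   have "of_nat (Suc n) ^ (2 * CARD('n) + 1) * (of_real (s n ^ ?d) * (of_real (s n ^ ?d) * of_real (1 / real (Suc n)))) =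
     complex_of_real ((real (Suc n) * (s n)\<^sup>2) ^ (2 * CARD('n)) * (real (Suc n) * (1 / real (Suc n))))"
   proof -
    have "m ^ (2 * d + 1) * (t ^ (2 * d) * (t ^ (2 * d) * (1 / m))) = (m * t\<^sup>2) ^ (2 * d) * (m * (1 / m))" for m t :: real and d :: nat
     by (simp only: power_mult_distrib power2_eq_square power_add power_one_right mult_ac)
    from arg_cong[OF this[of "real (Suc n)" "CARD('n)" "s n"], of complex_of_real] show ?thesis
     unfolding dim by (simp del: of_nat_Suc)
   qed
   also have "\<dots> = 1" unfolding s(2) by simp
   finally show ?thesis unfolding II by (simp only: mult.assoc[symmetric]) simp
  qed
  ultimately show ?thesis by (simp only:)
qed

end

section \<open>Commuting Toeplitz operators have gradients that commute\<close>

lemma power_times_exponential_tendsto_zero: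
  fixes t :: real
  assumes "0 \<le> t" "t < 1" "0 < m"
  shows "(\<lambda>n. real (Suc n) ^ m * t ^ n) \<longlonglongrightarrow> 0"
proof -
  define u where "u = root m t"
  have u: "0 \<le> u" "u < 1" "u ^ m = t"
   using assms by (auto simp: u_def real_root_ge_zero)
  have "(\<lambda>n. real n * u ^ n + u ^ n) \<longlonglongrightarrow> 0 + 0"
   using u by (intro tendsto_add powser_times_n_limit_0 LIMSEQ_power_zero) auto
  hence "(\<lambda>n. real (Suc n) * u ^ n) \<longlonglongrightarrow> 0" by (simp add: distrib_right add.commute)
  hence "(\<lambda>n. (real (Suc n) * u ^ n) ^ m) \<longlonglongrightarrow> 0 ^ m" by (rule tendsto_power)
  moreover have "(real (Suc n) * u ^ n) ^ m = real (Suc n) ^ m * t ^ n" for n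
   by (simp only: power_mult_distrib u(3)[symmetric] power_mult[symmetric] mult.commute[of n m])
  ultimately show ?thesis using assms(3) by (simp add: zero_power del: of_nat_Suc)
qed

lemma derivative_linear_bound:
  fixes a :: "'a::euclidean_space \<Rightarrow> 'b::real_normed_vector"
  assumes "(a has_derivative a') (at p)" "a p = 0"
  obtains L d where "0 \<le> L" "0 < d" "\<And>u. norm (u - p) < d \<Longrightarrow> norm (a u) \<le> L * norm (u - p)"
proof -
  obtain B where B: "0 < B" "\<And>v. norm (a' v) \<le> norm v * B"
   using bounded_linear.pos_bounded[OF has_derivative_bounded_linear[OF assms(1)]] by blast
  obtain d where d: "0 < d" "\<And>y. norm (y - p) < d \<Longrightarrow> norm (a y - a p - a' (y - p)) \<le> 1 * norm (y - p)"
   using assms(1) unfolding has_derivative_at_alt using zero_less_one by blast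
  have "norm (a u) \<le> (B + 1) * norm (u - p)" if "norm (u - p) < d" for u
   using d(2)[OF that] B(2)[of "u - p"] norm_triangle_sub[of "a u" "a' (u - p)"] assms(2) by (simp add: algebra_simps)
  thus ?thesis using that[of "B + 1" d] d(1) B(1) by auto
qed

context bounded_dom
begin

lemma Hm_herm_form: assumes "p \<in> D" obtains c where "herm_form (Hm p) c"
proof -
  obtain c where c: "0 < c" "\<And>u. u \<in> D \<Longrightarrow> \<beta> u p \<le> 1 - c * (norm (u - p))\<^sup>2" using beta_bound[OF assms] by blast
  have "herm_form (Hm p) c"
   by unfold_locales (use assms c Hm_add_left Hm_scale_left Hm_cnj Hm_pos in auto)
  thus ?thesis by (rule that)
qed

lemma riesz_Hm:
  fixes \<alpha> :: "complex^'n \<Rightarrow> real"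
  assumes p: "p \<in> D" and "linear \<alpha>"
  obtains s where "\<And>v. \<alpha> v = 2 * Re (Hm p v s)"
proof -
  obtain c where "herm_form (Hm p) c" using Hm_herm_form[OF p] by blast
  then interpret h: herm_form "Hm p" c .
  have lin: "linear (\<lambda>v. Re (Hm p v s))" for s
   using Hm_scale_left[OF p, of "of_real _"] by (intro linearI) (simp_all add: h.add_left scaleR_smult)
  define G where "G s = adjoint (\<lambda>v. Re (Hm p v s)) 1" for s
  have G: "v \<bullet> G s = Re (Hm p v s)" for v s using adjoint_works[OF lin, of v s 1] by (simp add: G_def)
  have "linear G"
  proof (rule linearI)
   show "G (x + y) = G x + G y" for x y
    by (rule vector_eq_ldot[THEN iffD1]) (simp add: inner_add_right G h.add_right)
   show "G (r *\<^sub>R x) = r *\<^sub>R G x" for r x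
    by (rule vector_eq_ldot[THEN iffD1]) (use h.scale_right[of _ "of_real r" x] in \<open>simp add: G scaleR_smult[symmetric]\<close>)
  qed
  moreover have "inj G"
  proof (subst linear_injective_0[OF \<open>linear G\<close>], intro allI impI)
   fix s assume "G s = 0"
   hence "Re (Hm p s s) = 0" using G[of s s] by simp
   hence "c * (norm s)\<^sup>2 \<le> 0" using h.pos[of s] by simp
   thus "s = 0" using h.c by (simp add: mult_le_0_iff)
  qed
  ultimately have "surj G" by (rule linear_injective_imp_surjective) simp
  then obtain s where s: "G s = adjoint \<alpha> (1/2)" by (metis surjD)
  have "\<alpha> v = 2 * Re (Hm p v s)" for v
   using adjoint_works[OF assms(2), of v "1/2"] G[of v s] s by simp
  thus ?thesis by (rule that)
qed

text \<open>The truncated double integrals of the two symbols in either order agree up to an exponentially small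
  error, hence so do their leading coefficients.\<close>

lemma leading_coefficients_agree:
  assumes hom: "homogeneous_bounded_domain D" and p: "p \<in> D"
   and a: "continuous_on D a" "\<And>z. z \<in> D \<Longrightarrow> cmod (a z) \<le> s" "a p = 0" "(a has_derivative a') (at p)"
   and b: "continuous_on D b" "\<And>z. z \<in> D \<Longrightarrow> cmod (b z) \<le> s" "b p = 0" "(b has_derivative b') (at p)"
   and sym: "\<And>N. 2 \<le> N \<Longrightarrow> \<exists>c>0. weighted_domain.\<Gamma> D (homogeneous_dom.wt D N c) p a b = weighted_domain.\<Gamma> D (homogeneous_dom.wt D N c) p b a"
  shows "(LINT y|lborel. a' y * (LINT x|lborel. b' x * exp (Hm p y x - Hm p x x - Hm p y y))) =
   (LINT y|lborel. b' y * (LINT x|lborel. a' x * exp (Hm p y x - Hm p x x - Hm p y y)))" (is "?J = ?J'")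
proof -
  obtain La da where La: "0 \<le> La" "0 < da" "\<And>u. norm (u - p) < da \<Longrightarrow> norm (a u) \<le> La * norm (u - p)"
   using derivative_linear_bound[OF a(4,3)] by blast
  obtain Lb db where Lb: "0 \<le> Lb" "0 < db" "\<And>u. norm (u - p) < db \<Longrightarrow> norm (b u) \<le> Lb * norm (u - p)"
   using derivative_linear_bound[OF b(4,3)] by blast
  obtain r0 where r0: "0 < r0" "cball p r0 \<subseteq> D" using D_facts(1) p open_contains_cball by blast
  define r where "r = min r0 (min da db)"
  define L where "L = max La Lb"
  have r: "0 < r" "cball p r \<subseteq> D" using r0 La(2) Lb(2) by (auto simp: r_def subset_iff)
  have L: "0 \<le> L" using La(1) by (simp add: L_def)
  have local_bound: "cmod (f u) \<le> L * norm (u - p)" if "\<And>u. norm (u - p) < d \<Longrightarrow> norm (f u) \<le> l * norm (u - p)"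
   "r \<le> d" "l \<le> L" "u \<in> ball p r" for f :: "complex^'n \<Rightarrow> complex" and d l u
  proof -
   have "cmod (f u) \<le> l * norm (u - p)" using that(2,4) by (intro that(1)) (auto simp: dist_norm norm_minus_commute)
   also have "\<dots> \<le> L * norm (u - p)" using that(3) by (intro mult_right_mono) auto
   finally show ?thesis .
  qed
  have rL: "r \<le> da" "r \<le> db" "La \<le> L" "Lb \<le> L" by (auto simp: r_def L_def)
  have aL: "cmod (a u) \<le> L * norm (u - p)" and bL: "cmod (b u) \<le> L * norm (u - p)" if "u \<in> ball p r" for u
   using local_bound[of da a La u] local_bound[of db b Lb u] La(3) Lb(3) rL that by blast+
  obtain c where c: "0 < c" "\<And>u. u \<in> D \<Longrightarrow> \<beta> u p \<le> 1 - c * (norm (u - p))\<^sup>2" using beta_bound[OF p] by blast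
  (* The maximum matters only when the ball contains D. *)
  define q where "q = max 0 (1 - c * r\<^sup>2)"
  have q: "0 \<le> q" "q < 1" using c r by (auto simp: q_def)
  have beta_q: "\<beta> u p \<le> q" if "u \<in> D - ball p r" for u
  proof -
   have "r\<^sup>2 \<le> (norm (u - p))\<^sup>2" using that r by (intro power_mono) (auto simp: dist_norm norm_minus_commute)
   hence "c * r\<^sup>2 \<le> c * (norm (u - p))\<^sup>2" using c(1) by (intro mult_left_mono) auto
   thus ?thesis using c(2)[of u] that by (auto simp: q_def)
  qed
  have s: "0 \<le> s" using a(2)[OF p] norm_ge_zero order_trans by blast
  define m where "m = 2 * CARD('n) + 1"
  have small: "cmod (II p r (Suc n) a b - II p r (Suc n) b a) \<le> 4 * s\<^sup>2 * sqrt q ^ n" if "1 \<le> n" for n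
  proof -
   note n1 = that
   obtain \<gamma> where g: "0 < \<gamma>" "weighted_domain.\<Gamma> D (homogeneous_dom.wt D (Suc n) \<gamma>) p a b = weighted_domain.\<Gamma> D (homogeneous_dom.wt D (Suc n) \<gamma>) p b a"
   proof -
    have "2 \<le> Suc n" using n1 by simp
    from sym[OF this] show ?thesis using that by blast
   qed
   interpret X: homogeneous_dom D "Suc n" \<gamma> by unfold_locales (use hom g in auto)
   have rb: "ball p r \<subseteq> D" using r(2) by auto
   have ab: "X.W.adm a s" "X.W.adm b s" using a b s by (auto intro!: X.W.adm_continuous)
   show ?thesis
    using X.II_commutator[OF p rb r(1) ab g(2) q(1) beta_q] by simp
  qed
  have "(\<lambda>n. of_nat (Suc n) ^ m * II p r (Suc n) a b - of_nat (Suc n) ^ m * II p r (Suc n) b a) \<longlonglongrightarrow> 0"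
  proof (rule Lim_null_comparison)
   show "\<forall>\<^sub>F n in sequentially. norm (of_nat (Suc n) ^ m * II p r (Suc n) a b - of_nat (Suc n) ^ m * II p r (Suc n) b a) \<le>
    (4 * s\<^sup>2) * (real (Suc n) ^ m * sqrt q ^ n)"
   proof (rule eventually_sequentiallyI[of 1])
    fix n :: nat assume "1 \<le> n"
    have "norm (of_nat (Suc n) ^ m * II p r (Suc n) a b - of_nat (Suc n) ^ m * II p r (Suc n) b a) =
     real (Suc n) ^ m * cmod (II p r (Suc n) a b - II p r (Suc n) b a)"
     by (simp only: right_diff_distrib[symmetric] norm_mult norm_power norm_of_nat)
    also have "\<dots> \<le> real (Suc n) ^ m * (4 * s\<^sup>2 * sqrt q ^ n)"
     by (rule mult_left_mono[OF small[OF \<open>1 \<le> n\<close>]]) simp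
    finally show "norm (of_nat (Suc n) ^ m * II p r (Suc n) a b - of_nat (Suc n) ^ m * II p r (Suc n) b a) \<le>
     (4 * s\<^sup>2) * (real (Suc n) ^ m * sqrt q ^ n)" by (simp only: mult_ac)
   qed
   show "(\<lambda>n. (4 * s\<^sup>2) * (real (Suc n) ^ m * sqrt q ^ n)) \<longlonglongrightarrow> 0"
    by (rule tendsto_mult_right_zero[OF power_times_exponential_tendsto_zero]) (use q in \<open>auto simp: m_def\<close>)
  qed
  moreover have "(\<lambda>n. of_nat (Suc n) ^ m * II p r (Suc n) a b - of_nat (Suc n) ^ m * II p r (Suc n) b a) \<longlonglongrightarrow> of_real ((k p)\<^sup>2) * ?J - of_real ((k p)\<^sup>2) * ?J'"
   unfolding m_def
   by (rule tendsto_diff[OF II_limit[OF p r L a(1,3,4) aL b(1,3,4) bL]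
     II_limit[OF p r L b(1,3,4) bL a(1,3,4) aL]])
  ultimately have "of_real ((k p)\<^sup>2) * ?J - of_real ((k p)\<^sup>2) * ?J' = 0" using LIMSEQ_unique by blast
  thus ?thesis using k_pos[OF p] by (simp add: right_diff_distrib[symmetric])
qed

lemma normalizing_const_pos:
  assumes hom: "homogeneous_bounded_domain D" and N: "1 \<le> N"
  shows "0 < normalizing_const D (1 / real N)"
proof -
  interpret X: homogeneous_dom D N 1 by unfold_locales (use hom N in auto)
  have mk: "k \<in> borel_measurable (lebesgue_on D)" by (rule B.measurable_continuous[OF k_continuous])
  have "(LINT z|bergman_volume D. k z powr (- 1 / (1 / real N))) = (LINT z|lebesgue_on D. k z *\<^sub>R (k z powr (- 1 / (1 / real N))))"
   unfolding bergman_volume_def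
   by (rule integral_density) (use mk k_pos in \<open>auto simp: space_restrict_space less_imp_le intro!: AE_I2\<close>)
  also have "\<dots> = (LINT z|lebesgue_on D. X.wt z *\<^sub>R (cmod (ext (\<lambda>_. 1) z))\<^sup>2)"
  proof (rule Bochner_Integration.integral_cong[OF refl])
   fix z assume "z \<in> space (lebesgue_on D)"
   hence z: "z \<in> D" by (simp add: space_restrict_space)
   have "k z ^ N = k z * k z ^ (N - 1)" using N by (cases N) auto
   thus "k z *\<^sub>R (k z powr (- 1 / (1 / real N))) = X.wt z *\<^sub>R (cmod (ext (\<lambda>_. 1) z))\<^sup>2"
    using z k_pos[OF z] by (simp add: X.wt_def ext_def powr_minus powr_realpow power_one_over field_simps)
  qed
  also have "\<dots> = nsq X.W.M (ext (\<lambda>_. 1))"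
   unfolding nsq_def
   by (rule X.W.integral_M[symmetric]) (intro X.W.measurable_continuous continuous_intros X.W.HD(4)[OF X.ext_one_W])
  finally have eq: "(LINT z|bergman_volume D. k z powr (- 1 / (1 / real N))) = nsq X.W.M (ext (\<lambda>_. 1))" .
  obtain z where z: "z \<in> D" using D_facts(3) by blast
  have "nsq X.W.M (ext (\<lambda>_. 1)) \<noteq> 0"
   using X.W.nsq_zero[OF X.ext_one_W] z by (auto simp: ext_def fun_eq_iff dest!: spec[of _ z])
  thus ?thesis unfolding normalizing_const_def eq using nsq_nonneg[of X.W.M "ext (\<lambda>_. 1)"] by simp
qed

end

context homogeneous_dom
begin

lemma weighted_volume_eq:
  assumes "c = normalizing_const D (1 / real N)"
  shows "weighted_volume D (1 / real N) = W.M"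
proof -
  have mk: "k \<in> borel_measurable (lebesgue_on D)" by (rule B.measurable_continuous[OF k_continuous])
  have "weighted_volume D (1 / real N) = density (lebesgue_on D) (\<lambda>z. ennreal (k z) * ennreal (c * k z powr (- 1 / (1 / real N))))"
   unfolding weighted_volume_def bergman_volume_def assms by (rule density_density_eq) (use mk in auto)
  also have "\<dots> = W.M"
   unfolding W.M_def
  proof (rule density_cong)
   show "AE z in lebesgue_on D. ennreal (k z) * ennreal (c * k z powr (- 1 / (1 / real N))) = ennreal (wt z)"
   proof (rule AE_I2)
    fix z assume "z \<in> space (lebesgue_on D)"
    hence z: "z \<in> D" by (simp add: space_restrict_space)
    have "k z ^ N = k z * k z ^ (N - 1)" using N by (cases N) auto
    hence "k z * (c * k z powr (- 1 / (1 / real N))) = wt z"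
     using k_pos[OF z] by (simp add: wt_def powr_minus powr_realpow power_one_over field_simps)
    thus "ennreal (k z) * ennreal (c * k z powr (- 1 / (1 / real N))) = ennreal (wt z)"
     using k_pos[OF z] c by (subst ennreal_mult[symmetric]) auto
   qed
  qed (use mk in auto)
  finally show ?thesis .
qed

text \<open>The two products of the Toeplitz operators are applied to the kernel function of \<open>p\<close> and evaluated at \<open>p\<close>.\<close>

lemma Gamma_symmetric:
  assumes wv: "weighted_volume D h = W.M" and comm: "commutative_on (weighted_bergman_space D h) (toeplitz_algebra D h A)"
   and ab: "a \<in> A" "b \<in> A" "W.adm a s" "W.adm b s" and p: "p \<in> D"
  shows "W.\<Gamma> p a b = W.\<Gamma> p b a"
proof -
  have T: "toeplitz_operator D h f \<phi> = W.proj (\<lambda>z. f z * \<phi> z)" for f \<phi>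
   unfolding toeplitz_operator_def bergman_projection_def W.proj_def weighted_bergman_space_def wv W.H_def ..
  have "(\<lambda>z. W.ker z p) \<in> weighted_bergman_space D h"
   using W.ker_H[OF p] by (simp add: weighted_bergman_space_def wv W.H_def)
  moreover have "toeplitz_operator D h a \<in> toeplitz_algebra D h A" "toeplitz_operator D h b \<in> toeplitz_algebra D h A"
   using ab by (auto intro: toeplitz_algebra.gen)
  ultimately have eq: "toeplitz_operator D h a (toeplitz_operator D h b (\<lambda>z. W.ker z p)) = toeplitz_operator D h b (toeplitz_operator D h a (\<lambda>z. W.ker z p))"
   using comm unfolding commutative_on_def by blast
  have G: "W.\<Gamma> p f g = toeplitz_operator D h f (toeplitz_operator D h g (\<lambda>z. W.ker z p)) p" if "W.adm f s" "W.adm g s" for f g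
   unfolding T W.\<Gamma>_def
   by (rule W.proj_eq[symmetric]) (use W.adm_square_integrable(1)[OF that(1) W.proj_adm_sq[OF p that(2)]] p in auto)
  show ?thesis unfolding G[OF ab(3,4)] G[OF ab(4,3)] eq ..
qed

end

lemma smooth_function_facts:
  assumes "a \<in> bounded_smooth_functions D"
  shows "continuous_on D a" "z \<in> D \<Longrightarrow> (a has_derivative fd a z) (at z)"
   "\<exists>s\<ge>0. \<forall>z\<in>D. cmod (a z) \<le> s"
proof -
  have sm: "ck_on k D a" for k using assms by (auto simp: bounded_smooth_functions_def smooth_functions_def smooth_on_def)
  show "continuous_on D a" using sm[of 0] by simp
  show "(a has_derivative fd a z) (at z)" if "z \<in> D"
   using sm[of "Suc 0"] that frechet_derivative_works by auto
  have "bounded (a ` D)" using assms by (simp add: bounded_smooth_functions_def)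
  then obtain s where "0 < s" "\<forall>x\<in>a ` D. cmod x \<le> s" unfolding bounded_pos by blast
  thus "\<exists>s\<ge>0. \<forall>z\<in>D. cmod (a z) \<le> s" by (intro exI[of _ s]) auto
qed

lemma real_valued_derivative:
  fixes a :: "'a::euclidean_space \<Rightarrow> complex"
  assumes "(a has_derivative a') (at p)" "open D" "p \<in> D" "\<And>z. z \<in> D \<Longrightarrow> a z \<in> \<real>"
  shows "a' v = of_real (Re (a' v))"
proof -
  have "((\<lambda>z. Im (a z)) has_derivative (\<lambda>v. Im (a' v))) (at p)" by (rule has_derivative_Im[OF assms(1)])
  hence "((\<lambda>z. 0) has_derivative (\<lambda>v. Im (a' v))) (at p)"
   by (rule has_derivative_transform_within_open[OF _ assms(2,3)]) (use assms(4) in \<open>simp add: complex_is_Real_iff\<close>)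
  hence "(\<lambda>v. Im (a' v)) = (\<lambda>v. 0)" by (rule has_derivative_unique[OF _ has_derivative_const])
  thus ?thesis by (simp add: complex_eq_iff fun_eq_iff)
qed

text \<open>
  The elements of \<open>A\<close> Poisson-commute: \<open>Im (Hm p s t)\<close> is, up to a constant, the Kaehler form on the
  gradients \<open>s\<close> and \<open>t\<close>. The Gaussian integrals of the two orders are proportional to \<open>Hm p s t\<close> and \<open>Hm p t s\<close>.
\<close>

lemma (in bounded_dom) gradients_commute:
  assumes hom: "homogeneous_bounded_domain D" and A: "A \<subseteq> bounded_smooth_functions D"
   and comm: "\<forall>h\<in>{0<..<1::real}. commutative_on (weighted_bergman_space D h) (toeplitz_algebra D h A)"
   and ab: "a \<in> A" "b \<in> A" "\<And>z. z \<in> D \<Longrightarrow> a z \<in> \<real>" "\<And>z. z \<in> D \<Longrightarrow> b z \<in> \<real>" and p: "p \<in> D"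
   and s: "\<And>v. Re (fd a p v) = 2 * Re (Hm p v s)"
   and t: "\<And>v. Re (fd b p v) = 2 * Re (Hm p v t)"
  shows "Im (Hm p s t) = 0"
proof -
  note fa = smooth_function_facts[OF subsetD[OF A ab(1)]] and fb = smooth_function_facts[OF subsetD[OF A ab(2)]]
  obtain c where "herm_form (Hm p) c" using Hm_herm_form[OF p] by blast
  then interpret h: herm_form "Hm p" c .
  obtain sa where sa: "0 \<le> sa" "\<And>z. z \<in> D \<Longrightarrow> cmod (a z) \<le> sa" using fa(3) by blast
  obtain sb where sb: "0 \<le> sb" "\<And>z. z \<in> D \<Longrightarrow> cmod (b z) \<le> sb" using fb(3) by blast
  define \<sigma> where "\<sigma> = max sa sb"
  have \<sigma>: "0 \<le> \<sigma>" "\<And>z. z \<in> D \<Longrightarrow> cmod (a z) \<le> \<sigma>" "\<And>z. z \<in> D \<Longrightarrow> cmod (b z) \<le> \<sigma>"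
   using sa sb by (auto simp: \<sigma>_def intro: le_max_iff_disj[THEN iffD2])
  have bound: "cmod (f z - f p) \<le> 2 * \<sigma>" if "\<And>z. z \<in> D \<Longrightarrow> cmod (f z) \<le> \<sigma>" "z \<in> D" for f :: "complex^'n \<Rightarrow> complex" and z
   using norm_triangle_ineq4[of "f z" "f p"] that(1)[OF that(2)] that(1)[OF p] by linarith
  have sym: "\<exists>c>0. weighted_domain.\<Gamma> D (homogeneous_dom.wt D N c) p (\<lambda>z. a z - a p) (\<lambda>z. b z - b p) =
    weighted_domain.\<Gamma> D (homogeneous_dom.wt D N c) p (\<lambda>z. b z - b p) (\<lambda>z. a z - a p)" if N: "2 \<le> N" for N
  proof -
   define \<gamma> where "\<gamma> = normalizing_const D (1 / real N)"
   have g: "0 < \<gamma>" unfolding \<gamma>_def by (rule normalizing_const_pos[OF hom]) (use N in simp)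
   interpret X: homogeneous_dom D N \<gamma> by unfold_locales (use hom N g in auto)
   have "1 / real N \<in> {0<..<1}" using N by auto
   note com = bspec[OF comm this]
   have adm: "X.W.adm a \<sigma>" "X.W.adm b \<sigma>" using \<sigma> fa(1) fb(1) by (auto intro!: X.W.adm_continuous)
   have "X.W.\<Gamma> p a b = X.W.\<Gamma> p b a"
    by (rule X.Gamma_symmetric[OF X.weighted_volume_eq[OF \<gamma>_def] com ab(1,2) adm p])
   from X.W.Gamma_commutator_shift[OF p adm this] show ?thesis using g by blast
  qed
  have da: "((\<lambda>z. f z - f p) has_derivative (\<lambda>v. Hm p v \<xi> + Hm p \<xi> v)) (at p)"
   if f: "(f has_derivative fd f p) (at p)" "\<And>z. z \<in> D \<Longrightarrow> f z \<in> \<real>"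
    "\<And>v. Re (fd f p v) = 2 * Re (Hm p v \<xi>)" for f \<xi>
  proof -
   have "fd f p v = Hm p v \<xi> + Hm p \<xi> v" for v
    using real_valued_derivative[OF f(1) D_facts(1) p f(2), of v] f(3)[of v] h.herm[of v \<xi>]
    by (auto simp: complex_eq_iff)
   hence "fd f p = (\<lambda>v. Hm p v \<xi> + Hm p \<xi> v)" by (rule ext)
   thus ?thesis using has_derivative_diff[OF f(1) has_derivative_const[of "f p"]] by simp
  qed
  have "(LINT y|lborel. (Hm p y s + Hm p s y) * (LINT x|lborel. (Hm p x t + Hm p t x) * exp (Hm p y x - Hm p x x - Hm p y y))) =
   (LINT y|lborel. (Hm p y t + Hm p t y) * (LINT x|lborel. (Hm p x s + Hm p s x) * exp (Hm p y x - Hm p x x - Hm p y y)))"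
   by (rule leading_coefficients_agree[OF hom p, where s = "2 * \<sigma>" and a = "\<lambda>z. a z - a p" and b = "\<lambda>z. b z - b p"])
    (use fa(1) fb(1) bound \<sigma> da[OF fa(2)[OF p] ab(3) s] da[OF fb(2)[OF p] ab(4) t] sym in \<open>auto intro!: continuous_intros\<close>)
  hence "of_real (h.c0\<^sup>2) * Hm p s t = of_real (h.c0\<^sup>2) * Hm p t s" by (simp only: h.gaussian_pairing)
  hence "Hm p s t = Hm p t s" using h.c0_pos by simp
  hence "Hm p s t = cnj (Hm p s t)" using h.herm[of s t] by simp
  thus ?thesis by (simp add: complex_eq_iff)
qed

section \<open>Calculus of smooth maps\<close>

lemma frechet_cong_open:
  assumes "open U" "x \<in> U" "\<And>y. y \<in> U \<Longrightarrow> f y = g y"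
  shows "fd f x = fd g x"
proof -
  have "(f has_derivative D) (at x) \<longleftrightarrow> (g has_derivative D) (at x)" for D
   using has_derivative_transform_within_open[of f D x UNIV U g] has_derivative_transform_within_open[of g D x UNIV U f] assms by auto
  thus ?thesis by (simp add: frechet_derivative_def)
qed

lemma ck_on_cong:
  assumes "open U" "\<And>x. x \<in> U \<Longrightarrow> f x = g x" "ck_on k U f"
  shows "ck_on k U g"
  using assms(2,3)
proof (induction k arbitrary: f g)
  case 0
  thus ?case using continuous_on_cong[of U U f g] by simp
next
  case (Suc k)
  show ?case
   unfolding ck_on.simps
  proof (intro conjI ballI allI)
   fix x assume x: "x \<in> U"
   have "(f has_derivative fd f x) (at x)" using Suc.prems(2) x frechet_derivative_works by auto
   from has_derivative_transform_within_open[OF this assms(1) x Suc.prems(1)]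
   show "g differentiable (at x)" unfolding differentiable_def by blast
  next
   fix v
   show "ck_on k U (\<lambda>x. fd g x v)"
   proof (rule Suc.IH)
    show "ck_on k U (\<lambda>x. fd f x v)" using Suc.prems(2) by simp
    show "fd f x v = fd g x v" if "x \<in> U" for x
     using frechet_cong_open[OF assms(1) that Suc.prems(1)] by simp
   qed
  qed
qed

lemma ck_on_Suc_iff:
  assumes "open U" "\<And>x. x \<in> U \<Longrightarrow> (f has_derivative f' x) (at x)"
  shows "ck_on (Suc k) U f \<longleftrightarrow> (\<forall>v. ck_on k U (\<lambda>x. f' x v))"
proof -
  have eq: "f' x v = fd f x v" if "x \<in> U" for x v
   using frechet_derivative_at[OF assms(2)[OF that]] by simp
  have "ck_on k U (\<lambda>x. f' x v) \<longleftrightarrow> ck_on k U (\<lambda>x. fd f x v)" for v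
   using ck_on_cong[OF assms(1), of "\<lambda>x. f' x v" "\<lambda>x. fd f x v"]
    ck_on_cong[OF assms(1), of "\<lambda>x. fd f x v" "\<lambda>x. f' x v"] eq by auto
  moreover have "\<forall>x\<in>U. f differentiable (at x)" using assms(2) unfolding differentiable_def by blast
  ultimately show ?thesis by simp
qed

lemma ck_on_Suc_derivative:
  "ck_on (Suc k) U f \<Longrightarrow> x \<in> U \<Longrightarrow> (f has_derivative fd f x) (at x)"
  using frechet_derivative_works by auto

lemma ck_on_SucD: "ck_on (Suc k) U f \<Longrightarrow> ck_on k U f"
proof (induction k arbitrary: f)
  case 0
  thus ?case by (auto intro!: continuous_at_imp_continuous_on differentiable_imp_continuous_within)
next
  case (Suc k)
  show ?case unfolding ck_on.simps(2)[of k]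
   using Suc.prems Suc.IH unfolding ck_on.simps(2)[of "Suc k"] by blast
qed

lemma ck_on_subset: "ck_on k U f \<Longrightarrow> V \<subseteq> U \<Longrightarrow> ck_on k V f"
  by (induction k arbitrary: f) (auto intro: continuous_on_subset)

lemma ck_on_local:
  assumes "\<And>x. x \<in> W \<Longrightarrow> \<exists>N. open N \<and> x \<in> N \<and> ck_on k N f"
  shows "ck_on k W f"
  using assms
proof (induction k arbitrary: f)
  case 0
  show ?case unfolding ck_on.simps
  proof (rule continuous_at_imp_continuous_on, rule ballI)
   fix x assume "x \<in> W"
   from 0[OF this] show "isCont f x" by (auto simp: continuous_on_eq_continuous_at)
  qed
next
  case (Suc k)
  have "ck_on k W (\<lambda>x. fd f x v)" for v
  proof (rule Suc.IH)
   fix x assume "x \<in> W"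
   from Suc.prems[OF this] show "\<exists>N. open N \<and> x \<in> N \<and> ck_on k N (\<lambda>x. fd f x v)" by auto
  qed
  moreover have "f differentiable (at x)" if "x \<in> W" for x using Suc.prems[OF that] by auto
  ultimately show ?case by simp
qed

lemma ck_on_const: "open U \<Longrightarrow> ck_on k U (\<lambda>x. c)"
proof (induction k arbitrary: c)
  case (Suc k)
  thus ?case by (subst ck_on_Suc_iff[where f' = "\<lambda>x v. 0"]) auto
qed simp

lemma ck_on_linear:
  fixes f :: "'a::euclidean_space \<Rightarrow> 'b::euclidean_space" and L :: "'b \<Rightarrow> 'c::euclidean_space"
  assumes "open U" "bounded_linear L" "ck_on k U f"
  shows "ck_on k U (\<lambda>x. L (f x))"
  using assms(3)
proof (induction k arbitrary: f)
  case 0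
  thus ?case using bounded_linear.continuous_on[OF assms(2)] by simp
next
  case (Suc k)
  show ?case
   by (subst ck_on_Suc_iff[OF assms(1) bounded_linear.has_derivative[OF assms(2) ck_on_Suc_derivative[OF Suc.prems]]])
    (use Suc in auto)
qed

lemma ck_on_add:
  assumes "open U" "ck_on k U f" "ck_on k U g"
  shows "ck_on k U (\<lambda>x. f x + g x)"
  using assms(2,3)
proof (induction k arbitrary: f g)
  case 0
  thus ?case by (auto intro: continuous_on_add)
next
  case (Suc k)
  show ?case
   by (subst ck_on_Suc_iff[OF assms(1) has_derivative_add[OF ck_on_Suc_derivative[OF Suc.prems(1)] ck_on_Suc_derivative[OF Suc.prems(2)]]])
    (use Suc in auto)
qed

lemma ck_on_sum:
  assumes "open U" "\<And>i. i \<in> I \<Longrightarrow> ck_on k U (f i)"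
  shows "ck_on k U (\<lambda>x. \<Sum>i\<in>I. f i x)"
  using assms(2)
proof (induction I rule: infinite_finite_induct)
  case (insert i I)
  thus ?case using ck_on_add[OF assms(1), of k "f i"] by simp
qed (use assms(1) ck_on_const in auto)

lemma ck_on_scaleR:
  assumes "open U" "ck_on k U f" "ck_on k U g"
  shows "ck_on k U (\<lambda>x. f x *\<^sub>R g x)"
  using assms(2,3)
proof (induction k arbitrary: f g)
  case 0
  thus ?case by (auto intro: continuous_on_scaleR)
next
  case (Suc k)
  have "ck_on k U (\<lambda>x. f x *\<^sub>R fd g x v + fd f x v *\<^sub>R g x)" for v
   using Suc ck_on_SucD[OF Suc.prems(1)] ck_on_SucD[OF Suc.prems(2)] by (intro ck_on_add assms(1)) auto
  thus ?case
   by (subst ck_on_Suc_iff[OF assms(1) has_derivative_scaleR[OF ck_on_Suc_derivative[OF Suc.prems(1)] ck_on_Suc_derivative[OF Suc.prems(2)]]]) auto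
qed

lemma linear_expand:
  fixes L :: "'a::euclidean_space \<Rightarrow> 'b::real_vector"
  assumes "linear L"
  shows "L v = (\<Sum>b\<in>Basis. (v \<bullet> b) *\<^sub>R L b)"
proof -
  have "L v = L (\<Sum>b\<in>Basis. (v \<bullet> b) *\<^sub>R b)" by (simp add: euclidean_representation)
  thus ?thesis by (simp only: linear_sum[OF assms] linear_cmul[OF assms])
qed

lemma ck_on_linear_family:
  fixes L :: "'a::euclidean_space \<Rightarrow> 'b::euclidean_space \<Rightarrow> 'c::euclidean_space"
  assumes "open U" "\<And>x. x \<in> U \<Longrightarrow> linear (L x)" "\<And>b. ck_on k U (\<lambda>x. L x b)" "ck_on k U w"
  shows "ck_on k U (\<lambda>x. L x (w x))"
proof (rule ck_on_cong[OF assms(1)])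
  show "ck_on k U (\<lambda>x. \<Sum>b\<in>Basis. (w x \<bullet> b) *\<^sub>R L x b)"
   by (intro ck_on_sum ck_on_scaleR assms(1,3) ck_on_linear[OF assms(1) bounded_linear_inner_left assms(4)])
  show "(\<Sum>b\<in>Basis. (w x \<bullet> b) *\<^sub>R L x b) = L x (w x)" if "x \<in> U" for x
   by (rule linear_expand[OF assms(2)[OF that], symmetric])
qed

lemma ck_on_compose:
  fixes f :: "'a::euclidean_space \<Rightarrow> 'b::euclidean_space" and g :: "'b \<Rightarrow> 'c::euclidean_space"
  assumes "open U" "open V" "f ` U \<subseteq> V" "ck_on k U f" "ck_on k V g"
  shows "ck_on k U (\<lambda>x. g (f x))"
  using assms(4,5)
proof (induction k arbitrary: g)
  case 0
  thus ?case using assms(3) by (auto intro: continuous_on_compose2)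
next
  case (Suc k)
  have d: "((\<lambda>x. g (f x)) has_derivative (\<lambda>v. fd g (f x) (fd f x v))) (at x)" if "x \<in> U" for x
   by (rule has_derivative_compose[OF ck_on_Suc_derivative[OF Suc.prems(1) that] ck_on_Suc_derivative[OF Suc.prems(2)]])
    (use that assms(3) in auto)
  have "ck_on k U (\<lambda>x. fd g (f x) (fd f x v))" for v
  proof (rule ck_on_linear_family[where L = "\<lambda>x. fd g (f x)", OF assms(1)])
   show "linear (fd g (f x))" if "x \<in> U" for x
    by (rule has_derivative_linear[OF ck_on_Suc_derivative[OF Suc.prems(2)]]) (use that assms(3) in auto)
   show "ck_on k U (\<lambda>x. fd g (f x) b)" for b
    by (rule Suc.IH[OF ck_on_SucD[OF Suc.prems(1)], of "\<lambda>z. fd g z b"]) (use Suc.prems(2) in simp)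
   show "ck_on k U (\<lambda>x. fd f x v)" using Suc.prems(1) by simp
  qed
  thus ?case using ck_on_Suc_iff[OF assms(1) d] by simp
qed

lemma ck_on_id: "open U \<Longrightarrow> ck_on k U (\<lambda>x. x)"
proof (cases k)
  case (Suc m)
  assume "open U"
  thus ?thesis unfolding Suc by (subst ck_on_Suc_iff[where f' = "\<lambda>x v. v"]) (auto intro: ck_on_const)
qed auto

lemma has_derivative_vanishing_scaleR:
  fixes r :: "'a::euclidean_space \<Rightarrow> real" and m :: "'a \<Rightarrow> 'b::real_normed_vector"
  assumes r: "(r has_derivative r') (at x)" "r x = 0" and m: "isCont m x"
  shows "((\<lambda>y. r y *\<^sub>R m y) has_derivative (\<lambda>u. r' u *\<^sub>R m x)) (at x)"
proof -
  obtain L d where L: "0 \<le> L" "0 < d" "\<And>u. norm (u - x) < d \<Longrightarrow> norm (r u) \<le> L * norm (u - x)"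
   using derivative_linear_bound[OF r] by blast
  have "((\<lambda>y. r y *\<^sub>R (m y - m x)) has_derivative (\<lambda>u. 0)) (at x)"
   unfolding has_derivative_at
  proof (intro conjI bounded_linear_zero)
   show "(\<lambda>h. norm (r (x + h) *\<^sub>R (m (x + h) - m x) - r x *\<^sub>R (m x - m x) - 0) / norm h) \<midarrow>0\<rightarrow> 0"
   proof (rule Lim_null_comparison)
    show "\<forall>\<^sub>F h in at 0. norm (norm (r (x + h) *\<^sub>R (m (x + h) - m x) - r x *\<^sub>R (m x - m x) - 0) / norm h) \<le> L * norm (m (x + h) - m x)"
    proof (rule eventually_at_ball'[OF L(2), THEN eventually_mono])
     fix h :: 'a assume h: "h \<in> ball 0 d \<and> h \<noteq> 0 \<and> h \<in> UNIV"
     have "\<bar>r (x + h)\<bar> * norm (m (x + h) - m x) \<le> (L * norm h) * norm (m (x + h) - m x)"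
      using L(3)[of "x + h"] h by (intro mult_right_mono) auto
     thus "norm (norm (r (x + h) *\<^sub>R (m (x + h) - m x) - r x *\<^sub>R (m x - m x) - 0) / norm h) \<le> L * norm (m (x + h) - m x)"
      using h by (simp add: divide_le_eq mult_ac)
    qed
    have "((\<lambda>h. norm (m (x + h) - m x)) \<longlongrightarrow> 0) (at 0)"
     using m by (intro tendsto_norm_zero LIM_zero) (simp add: isCont_iff)
    thus "((\<lambda>h. L * norm (m (x + h) - m x)) \<longlongrightarrow> 0) (at 0)" by (rule tendsto_mult_right_zero)
   qed
  qed
  from has_derivative_add[OF has_derivative_scaleR_left[OF r(1), of "m x"] this] show ?thesis
   by (simp add: scaleR_diff_right)
qed

text \<open>
  From \<open>L y d = L x w - L y w\<close> for the difference \<open>d\<close> of the two preimages and \<open>w = inv (L x) v\<close>, together with a lower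
  bound for \<open>L x\<close> that persists near \<open>x\<close>.
\<close>

lemma inverse_family_continuous:
  fixes L :: "'a::euclidean_space \<Rightarrow> 'b::euclidean_space \<Rightarrow> 'b"
  assumes U: "open U" and lin: "\<And>x. x \<in> U \<Longrightarrow> linear (L x)" "\<And>x. x \<in> U \<Longrightarrow> bij (L x)"
   and cont: "\<And>b. continuous_on U (\<lambda>x. L x b)" and x: "x \<in> U"
  shows "isCont (\<lambda>y. inv (L y) v) x"
proof -
  obtain c where c: "0 < c" "\<And>w. c * norm w \<le> norm (L x w)"
   using linear_inj_bounded_below_pos[OF lin(1)[OF x] bij_is_inj[OF lin(2)[OF x]]] by blast
  define \<delta> where "\<delta> y = (\<Sum>b\<in>Basis. norm (L y b - L x b))" for y
  have diff: "norm (L y w - L x w) \<le> \<delta> y * norm w" if "y \<in> U" for y w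
  proof -
   have "L y w - L x w = (\<Sum>b\<in>Basis. (w \<bullet> b) *\<^sub>R (L y b - L x b))"
    using linear_expand[OF lin(1)[OF that], of w] linear_expand[OF lin(1)[OF x], of w]
    by (simp add: sum_subtractf scaleR_diff_right)
   also have "norm \<dots> \<le> (\<Sum>b\<in>Basis. \<bar>w \<bullet> b\<bar> * norm (L y b - L x b))"
    by (rule norm_sum[THEN order_trans]) simp
   also have "\<dots> \<le> (\<Sum>b\<in>Basis. norm w * norm (L y b - L x b))"
    by (intro sum_mono mult_right_mono Basis_le_norm) auto
   finally show ?thesis by (simp add: \<delta>_def sum_distrib_left mult.commute)
  qed
  have lim: "((\<lambda>y. L y b) \<longlongrightarrow> L x b) (at x)" for b
   using cont[of b] U x continuous_on_eq_continuous_at isCont_def by blast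
  have "((\<lambda>y. \<Sum>b\<in>Basis. norm (L y b - L x b)) \<longlongrightarrow> (\<Sum>b\<in>(Basis :: 'b set). 0)) (at x)"
   by (intro tendsto_sum tendsto_norm_zero LIM_zero lim)
  hence \<delta>0: "(\<delta> \<longlongrightarrow> 0) (at x)" by (simp add: \<delta>_def[abs_def])
  define w where "w = inv (L x) v"
  have w: "L x w = v" unfolding w_def using bij_is_surj[OF lin(2)[OF x]] by (rule surj_f_inv_f)
  have ev: "\<forall>\<^sub>F y in at x. y \<in> U \<and> \<delta> y < c / 2"
   using eventually_at_in_open'[OF U x] order_tendstoD(2)[OF \<delta>0, of "c/2"] c(1) by (auto intro: eventually_conj)
  have "((\<lambda>y. inv (L y) v - w) \<longlongrightarrow> 0) (at x)"
  proof (rule Lim_null_comparison)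
   show "\<forall>\<^sub>F y in at x. norm (inv (L y) v - w) \<le> (2 / c * norm w) * \<delta> y"
    using ev
   proof eventually_elim
    fix y assume y: "y \<in> U \<and> \<delta> y < c / 2"
    hence yU: "y \<in> U" and dy: "\<delta> y \<le> c / 2" by auto
    define d where "d = inv (L y) v - w"
    have "L y (inv (L y) v) = v" using bij_is_surj[OF lin(2)[OF yU]] by (rule surj_f_inv_f)
    hence "L y d = - (L y w - L x w)" by (simp add: d_def linear_diff[OF lin(1)[OF yU]] w)
    hence "norm (L y d) \<le> \<delta> y * norm w" using diff[OF yU, of w] by (simp add: norm_minus_commute)
    moreover have "c * norm d \<le> norm (L y d) + \<delta> y * norm d"
     using c(2)[of d] diff[OF yU, of d] norm_triangle_sub[of "L x d" "L y d"] by (simp add: norm_minus_commute)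
    moreover have "\<delta> y * norm d \<le> c / 2 * norm d" using dy by (rule mult_right_mono) simp
    ultimately have "c / 2 * norm d \<le> \<delta> y * norm w" by simp
    thus "norm (inv (L y) v - w) \<le> (2 / c * norm w) * \<delta> y"
     using c(1) by (simp add: d_def field_simps)
   qed
   show "((\<lambda>y. (2 / c * norm w) * \<delta> y) \<longlongrightarrow> 0) (at x)" by (rule tendsto_mult_right_zero[OF \<delta>0])
  qed
  thus ?thesis unfolding isCont_def w_def by (rule LIM_zero_cancel)
qed

lemma linear_inverse: fixes L :: "'a::euclidean_space \<Rightarrow> 'a" shows "linear L \<Longrightarrow> bij L \<Longrightarrow> linear (inv L)"
  by (rule inj_linear_imp_inv_linear[OF _ bij_is_inj])

lemma inverse_family_derivative:
  fixes L :: "'a::euclidean_space \<Rightarrow> 'b::euclidean_space \<Rightarrow> 'b"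
  assumes U: "open U" and lin: "\<And>x. x \<in> U \<Longrightarrow> linear (L x)" "\<And>x. x \<in> U \<Longrightarrow> bij (L x)"
   and ck: "\<And>b. ck_on (Suc k) U (\<lambda>x. L x b)" and x: "x \<in> U"
  shows "((\<lambda>y. inv (L y) v) has_derivative
   (\<lambda>u. inv (L x) (- fd (\<lambda>y. L y (inv (L x) v)) x u))) (at x)"
proof -
  define w where "w = inv (L x) v"
  have w: "L x w = v" unfolding w_def using bij_is_surj[OF lin(2)[OF x]] by (rule surj_f_inv_f)
  have cont: "continuous_on U (\<lambda>x. L x b)" for b
   using ck[of b] by (auto intro!: continuous_at_imp_continuous_on differentiable_imp_continuous_within)
  define R where "R y = L x w - L y w" for y
  have R: "(R has_derivative (\<lambda>u. - fd (\<lambda>y. L y w) x u)) (at x)" "R x = 0"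
   using has_derivative_diff[OF has_derivative_const ck_on_Suc_derivative[OF ck x]] by (auto simp: R_def[abs_def])
  have "((\<lambda>y. w + (\<Sum>b\<in>Basis. (R y \<bullet> b) *\<^sub>R inv (L y) b)) has_derivative
    (\<lambda>u. 0 + (\<Sum>b\<in>Basis. ((- fd (\<lambda>y. L y w) x u) \<bullet> b) *\<^sub>R inv (L x) b))) (at x)"
   by (intro has_derivative_add has_derivative_const has_derivative_sum has_derivative_vanishing_scaleR
     has_derivative_inner_left R(1) inverse_family_continuous[OF U lin cont x]) (simp_all add: R(2))
  moreover have "0 + (\<Sum>b\<in>Basis. (z \<bullet> b) *\<^sub>R inv (L x) b) = inv (L x) z" for z
   using linear_expand[OF linear_inverse[OF lin(1,2)[OF x]], of z] by simp
  ultimately have "((\<lambda>y. w + (\<Sum>b\<in>Basis. (R y \<bullet> b) *\<^sub>R inv (L y) b)) has_derivative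
    (\<lambda>u. inv (L x) (- fd (\<lambda>y. L y w) x u))) (at x)" by (simp only:)
  thus ?thesis unfolding w_def[symmetric]
  proof (rule has_derivative_transform_within_open[OF _ U x])
   fix y assume y: "y \<in> U"
   have l: "linear (inv (L y))" by (rule linear_inverse[OF lin(1,2)[OF y]])
   have "inv (L y) (L y w) = w" using bij_is_inj[OF lin(2)[OF y]] by simp
   hence "w + inv (L y) (R y) = inv (L y) v" by (simp add: R_def linear_diff[OF l] w)
   thus "w + (\<Sum>b\<in>Basis. (R y \<bullet> b) *\<^sub>R inv (L y) b) = inv (L y) v" using linear_expand[OF l, of "R y"] by simp
  qed
qed

text \<open>
  The derivative of the inverse is an expression in the inverse itself and the derivative of \<open>L\<close>, which gains one
  order of smoothness at a time. The next lemma uses the same recursion for inverse maps.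
\<close>

lemma ck_on_inverse_family:
  fixes L :: "'a::euclidean_space \<Rightarrow> 'b::euclidean_space \<Rightarrow> 'b"
  assumes U: "open U" and lin: "\<And>x. x \<in> U \<Longrightarrow> linear (L x)" "\<And>x. x \<in> U \<Longrightarrow> bij (L x)"
   and ck: "\<And>b. ck_on k U (\<lambda>x. L x b)"
  shows "ck_on k U (\<lambda>x. inv (L x) v)"
  using ck
proof (induction k arbitrary: v)
  case 0
  thus ?case using inverse_family_continuous[OF U lin] by (simp add: continuous_at_imp_continuous_on)
next
  case (Suc k)
  have IH: "ck_on k U (\<lambda>x. inv (L x) v)" for v by (rule Suc.IH[OF ck_on_SucD[OF Suc.prems]])
  have flin: "linear (\<lambda>w. fd (\<lambda>y. L y w) x u)" if x: "x \<in> U" for x u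
  proof -
   note d = ck_on_Suc_derivative[OF Suc.prems x]
   have "fd (\<lambda>y. L y (a + b)) x = (\<lambda>u. fd (\<lambda>y. L y a) x u + fd (\<lambda>y. L y b) x u)" for a b
    by (rule frechet_derivative_at[symmetric], rule has_derivative_transform_within_open[OF has_derivative_add[OF d d] U x])
     (simp add: linear_add lin(1))
   moreover have "fd (\<lambda>y. L y (r *\<^sub>R a)) x = (\<lambda>u. r *\<^sub>R fd (\<lambda>y. L y a) x u)" for a r
    by (rule frechet_derivative_at[symmetric], rule has_derivative_transform_within_open[OF has_derivative_scaleR_right[OF d] U x])
     (simp add: linear_cmul lin(1))
   ultimately show "linear (\<lambda>w. fd (\<lambda>y. L y w) x u)" by (intro linearI) simp_all
  qed
  have "ck_on k U (\<lambda>x. inv (L x) (- fd (\<lambda>y. L y (inv (L x) v)) x u))" for u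
  proof (rule ck_on_linear_family[where L = "\<lambda>x. inv (L x)", OF U linear_inverse[OF lin] IH])
   have "ck_on k U (\<lambda>x. fd (\<lambda>y. L y (inv (L x) v)) x u)"
    by (rule ck_on_linear_family[where L = "\<lambda>x w. fd (\<lambda>y. L y w) x u", OF U flin _ IH])
     (use Suc.prems in auto)
   thus "ck_on k U (\<lambda>x. - fd (\<lambda>y. L y (inv (L x) v)) x u)"
    by (rule ck_on_linear[OF U bounded_linear_minus[OF bounded_linear_ident]])
  qed
  thus ?case using ck_on_Suc_iff[OF U inverse_family_derivative[OF U lin Suc.prems]] by simp
qed

lemma smooth_onD: "smooth_on U f \<Longrightarrow> ck_on k U f" by (simp add: smooth_on_def)

lemma smooth_on_derivative:
  assumes "smooth_on U f" "x \<in> U"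
  shows "(f has_derivative fd f x) (at x)"
  by (rule ck_on_Suc_derivative[OF smooth_onD[OF assms(1), of "Suc 0"] assms(2)])

lemma smooth_on_continuous: "smooth_on U f \<Longrightarrow> continuous_on U f"
  using smooth_onD[of U f 0] by simp

lemma ex_smooth_inverse:
  fixes f :: "'a::euclidean_space \<Rightarrow> 'a"
  assumes U: "open U" and f: "smooth_on U f" and x: "x \<in> U" and id: "(f has_derivative (\<lambda>v. v)) (at x)"
  obtains U' V g where "open U'" "U' \<subseteq> U" "x \<in> U'" "open V" "homeomorphism U' V f g" "smooth_on V g"
proof -
  define f' where "f' y = Blinfun (fd f y)" for y
  have f': "blinfun_apply (f' y) = fd f y" if "y \<in> U" for y
   unfolding f'_def by (rule bounded_linear_Blinfun_apply[OF has_derivative_bounded_linear[OF smooth_on_derivative[OF f that]]])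
  have der: "(f has_derivative blinfun_apply (f' y)) (at y)" if "y \<in> U" for y
   unfolding f'[OF that] by (rule smooth_on_derivative[OF f that])
  have cont: "continuous_on U f'"
  proof (rule continuous_on_blinfun_componentwise)
   fix i :: 'a
   have "continuous_on U (\<lambda>y. fd f y i)" using smooth_onD[OF f, of "Suc 0"] by simp
   thus "continuous_on U (\<lambda>y. blinfun_apply (f' y) i)" by (rule continuous_on_cong[THEN iffD1, rotated -1]) (simp_all add: f')
  qed
  have "blinfun_apply (f' x) = (\<lambda>v. v)" unfolding f'[OF x] by (rule frechet_derivative_at[OF id, symmetric])
  hence inv: "id_blinfun o\<^sub>L f' x = id_blinfun" by (intro blinfun_eqI) simp
  obtain U' V g g' where g: "open U'" "U' \<subseteq> U" "x \<in> U'" "open V" "f x \<in> V" "homeomorphism U' V f g"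
   "\<And>y. y \<in> V \<Longrightarrow> (g has_derivative (g' y)) (at y)" "\<And>y. y \<in> V \<Longrightarrow> g' y = inv (blinfun_apply (f'(g y)))"
   "\<And>y. y \<in> V \<Longrightarrow> bij (blinfun_apply (f'(g y)))"
   using inverse_function_theorem[OF U der cont x inv] by metis
  have gV: "g ` V \<subseteq> U" using g(2,6) by (auto simp: homeomorphism_def)
  have dg: "(g has_derivative inv (fd f (g y))) (at y)" if "y \<in> V" for y
   using g(7)[OF that] g(8)[OF that] f'[of "g y"] gV that by auto
  have "ck_on k V g" for k
  proof (induction k)
   case 0
   show ?case using dg by (auto intro!: continuous_at_imp_continuous_on has_derivative_continuous)
  next
   case (Suc k)
   have "ck_on k V (\<lambda>y. inv (fd f (g y)) v)" for v
   proof (rule ck_on_inverse_family[OF g(4)])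
    fix y assume y: "y \<in> V"
    hence gy: "g y \<in> U" using gV by auto
    show "linear (fd f (g y))" by (rule has_derivative_linear[OF smooth_on_derivative[OF f gy]])
    show "bij (fd f (g y))" using g(9)[OF y] f'[OF gy] by simp
   next
    show "ck_on k V (\<lambda>y. fd f (g y) b)" for b
     by (rule ck_on_compose[OF g(4) U gV Suc]) (use smooth_onD[OF f, of "Suc k"] in simp)
   qed
   thus ?case using ck_on_Suc_iff[OF g(4) dg] by simp
  qed
  thus ?thesis using that[OF g(1-4,6)] by (simp add: smooth_on_def)
qed

section \<open>Foliations by the level sets of a family of functions\<close>

text \<open>
  The diffeomorphism \<open>\<Psi>\<close> with inverse \<open>g\<close> straightens \<open>\<phi>\<close> to the linear map \<open>l\<close>. Convexity of \<open>B\<close> makes every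
  fibre of \<open>\<phi>\<close> in \<open>U\<close> connected, so that plaques and fibres coincide.
\<close>

locale flow_box =
  fixes U :: "'a::euclidean_space set" and \<phi> :: "'a \<Rightarrow> 'b::euclidean_space"
   and \<Psi> g :: "'a \<Rightarrow> 'a" and l :: "'a \<Rightarrow> 'b" and B :: "'a set"
  assumes U: "open U" and B: "open B" "convex B"
   and smooth: "smooth_on U \<Psi>" "smooth_on B g"
   and inverse: "\<And>z. z \<in> U \<Longrightarrow> \<Psi> z \<in> B" "\<And>y. y \<in> B \<Longrightarrow> g y \<in> U"
    "\<And>z. z \<in> U \<Longrightarrow> g (\<Psi> z) = z" "\<And>y. y \<in> B \<Longrightarrow> \<Psi> (g y) = y"
   and l: "linear l" "surj l" and \<phi>: "\<And>z. z \<in> U \<Longrightarrow> \<phi> z = l (\<Psi> z)"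

lemma ex_flow_box:
  fixes \<phi> :: "'a::euclidean_space \<Rightarrow> 'b::euclidean_space"
  assumes M: "open M" "p \<in> M" and \<phi>: "smooth_on M \<phi>" and surj: "surj (fd \<phi> p)"
  obtains U \<Psi> g l B where "flow_box U \<phi> \<Psi> g l B" "p \<in> U" "U \<subseteq> M"
proof -
  define l where "l = fd \<phi> p"
  note d\<phi> = smooth_on_derivative[OF \<phi> M(2), folded l_def]
  have l: "linear l" "surj l" "bounded_linear l"
   using has_derivative_linear[OF d\<phi>] has_derivative_bounded_linear[OF d\<phi>] surj by (auto simp: l_def)
  obtain \<sigma> where \<sigma>: "linear \<sigma>" "l \<circ> \<sigma> = id" using linear_surjective_right_inverse[OF l(1,2)] by blast
  have \<sigma>': "bounded_linear \<sigma>" using \<sigma>(1) by (simp add: linear_conv_bounded_linear)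
  (* With this correction l (\<Psi> z) = \<phi> z, while the derivative at p is the identity. *)
  define \<Psi> where "\<Psi> z = z + \<sigma> (\<phi> z - l z)" for z
  have l\<Psi>: "l (\<Psi> z) = \<phi> z" for z
   using fun_cong[OF \<sigma>(2), of "\<phi> z - l z"] by (simp add: \<Psi>_def linear_add[OF l(1)])
  have sm: "smooth_on M \<Psi>"
   unfolding smooth_on_def
  proof
   fix k
   have "ck_on k M (\<lambda>z. \<phi> z + (- l z))"
    by (intro ck_on_add M(1) smooth_onD[OF \<phi>] ck_on_linear[OF M(1) bounded_linear_minus[OF l(3)]] ck_on_id)
   from ck_on_linear[OF M(1) \<sigma>' this] have "ck_on k M (\<lambda>z. z + \<sigma> (\<phi> z + - l z))"
    by (intro ck_on_add M(1) ck_on_id)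
   thus "ck_on k M \<Psi>" by (simp add: \<Psi>_def[abs_def])
  qed
  have "(\<Psi> has_derivative (\<lambda>v. v + \<sigma> (l v - l v))) (at p)"
   unfolding \<Psi>_def[abs_def]
   by (intro has_derivative_add has_derivative_ident bounded_linear.has_derivative[OF \<sigma>'] has_derivative_diff d\<phi>
     bounded_linear_imp_has_derivative l(3))
  hence "(\<Psi> has_derivative (\<lambda>v. v)) (at p)" using linear_0[OF \<sigma>(1)] by simp
  from ex_smooth_inverse[OF M(1) sm M(2) this]
  obtain U' V g where g: "open U'" "U' \<subseteq> M" "p \<in> U'" "open V" "homeomorphism U' V \<Psi> g" "smooth_on V g" by blast
  have "\<Psi> p \<in> V" using g(3,5) by (auto simp: homeomorphism_def)
  then obtain e where e: "0 < e" "ball (\<Psi> p) e \<subseteq> V" using g(4) open_contains_ball by blast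
  define B where "B = ball (\<Psi> p) e"
  define U where "U = U' \<inter> \<Psi> -` B"
  have "flow_box U \<phi> \<Psi> g l B"
  proof (rule flow_box.intro)
   show "open U" unfolding U_def
    by (rule continuous_open_preimage[OF homeomorphism_cont1[OF g(5)] g(1)]) (simp add: B_def)
   show "smooth_on U \<Psi>" "smooth_on B g"
    using sm g(2,6) e(2) by (auto simp: smooth_on_def U_def B_def intro: ck_on_subset)
   show "\<Psi> z \<in> B" if "z \<in> U" for z using that by (simp add: U_def)
   show "g (\<Psi> z) = z" if "z \<in> U" for z using that g(5) by (auto simp: U_def homeomorphism_def)
   show inv: "\<Psi> (g y) = y" if "y \<in> B" for y using that g(5) e(2) by (auto simp: B_def homeomorphism_def)
   show "g y \<in> U" if "y \<in> B" for y using that g(5) e(2) inv[OF that] by (auto simp: U_def B_def homeomorphism_def)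
  qed (use l l\<Psi> in \<open>auto simp: B_def\<close>)
  moreover have "p \<in> U" "U \<subseteq> M" using g(2,3) e(1) by (auto simp: U_def B_def)
  ultimately show ?thesis by (rule that)
qed

context flow_box
begin

lemma d\<Psi>: "z \<in> U \<Longrightarrow> (\<Psi> has_derivative fd \<Psi> z) (at z)"
  and dg: "y \<in> B \<Longrightarrow> (g has_derivative fd g y) (at y)"
  using smooth_on_derivative smooth by blast+

lemma bounded_l: "bounded_linear l" using l(1) by (simp add: linear_conv_bounded_linear)

lemma derivative_inverse:
  assumes z: "z \<in> U"
  shows "fd g (\<Psi> z) (fd \<Psi> z v) = v"
   "fd \<Psi> z (fd g (\<Psi> z) v) = v"
proof -
  have B': "\<Psi> z \<in> B" using inverse(1)[OF z] .
  have "((\<lambda>x. g (\<Psi> x)) has_derivative (\<lambda>v. fd g (\<Psi> z) (fd \<Psi> z v))) (at z)"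
   by (rule has_derivative_compose[OF d\<Psi>[OF z] dg[OF B']])
  from has_derivative_unique[OF has_derivative_transform_within_open[OF this U z inverse(3)] has_derivative_ident]
  show "fd g (\<Psi> z) (fd \<Psi> z v) = v" by (rule fun_cong)
  have "((\<lambda>y. \<Psi> (g y)) has_derivative (\<lambda>v. fd \<Psi> (g (\<Psi> z)) (fd g (\<Psi> z) v))) (at (\<Psi> z))"
   by (rule has_derivative_compose[OF dg[OF B'] d\<Psi>]) (simp add: inverse(3)[OF z] z)
  hence "((\<lambda>y. \<Psi> (g y)) has_derivative (\<lambda>v. fd \<Psi> z (fd g (\<Psi> z) v))) (at (\<Psi> z))"
   by (simp only: inverse(3)[OF z])
  from has_derivative_unique[OF has_derivative_transform_within_open[OF this B(1) B' inverse(4)] has_derivative_ident]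
  show "fd \<Psi> z (fd g (\<Psi> z) v) = v" by (rule fun_cong)
qed

lemma d\<phi>: "z \<in> U \<Longrightarrow> (\<phi> has_derivative (\<lambda>v. l (fd \<Psi> z v))) (at z)"
  by (rule has_derivative_transform_within_open[OF bounded_linear.has_derivative[OF bounded_l d\<Psi>] U]) (simp_all add: \<phi>)

lemma frechet_\<phi>: "z \<in> U \<Longrightarrow> fd \<phi> z = (\<lambda>v. l (fd \<Psi> z v))"
  using frechet_derivative_at[OF d\<phi>] by simp

lemma surj_d\<phi>: "z \<in> U \<Longrightarrow> surj (fd \<phi> z)"
proof -
  assume z: "z \<in> U"
  have "\<exists>v. fd \<phi> z v = y" for y
  proof -
   obtain x where "l x = y" using l(2) by (metis surjD)
   thus ?thesis using derivative_inverse(2)[OF z, of x]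
    by (intro exI[of _ "fd g (\<Psi> z) x"]) (simp add: frechet_\<phi>[OF z])
  qed
  thus ?thesis by (metis surjI)
qed

lemma smooth_\<phi>: "smooth_on U \<phi>"
  unfolding smooth_on_def
proof
  fix k
  show "ck_on k U \<phi>"
   by (rule ck_on_cong[OF U _ ck_on_linear[OF U bounded_l smooth_onD[OF smooth(1)]]]) (simp add: \<phi>)
qed

lemma open_image:
  assumes N: "open N" "N \<subseteq> U"
  shows "open (\<phi> ` N)"
proof -
  have "\<Psi> ` N = B \<inter> g -` N"
  proof
   show "\<Psi> ` N \<subseteq> B \<inter> g -` N" using N(2) inverse(1,3) by auto
   show "B \<inter> g -` N \<subseteq> \<Psi> ` N" using inverse(4) by (metis IntE image_eqI subsetI vimageE)
  qed
  moreover have "open (B \<inter> g -` N)" by (rule continuous_open_preimage[OF smooth_on_continuous[OF smooth(2)] B(1) N(1)])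
  ultimately have "open (\<Psi> ` N)" by simp
  hence "open (l ` \<Psi> ` N)" by (rule open_surjective_linear_image[OF _ l])
  moreover have "l ` \<Psi> ` N = \<phi> ` N" unfolding image_image by (rule image_cong) (use N(2) \<phi> in auto)
  ultimately show ?thesis by simp
qed

lemma foliated_chart: "U \<subseteq> M \<Longrightarrow> foliated_chart M (U, \<phi>)"
  using U smooth_\<phi> open_image[OF U] surj_d\<phi> by (simp add: foliated_chart_def)

lemma fibre_image: "{z \<in> U. \<phi> z = y} = g ` (B \<inter> l -` {y})"
proof
  show "{z \<in> U. \<phi> z = y} \<subseteq> g ` (B \<inter> l -` {y})"
  proof
   fix z assume "z \<in> {z \<in> U. \<phi> z = y}"
   thus "z \<in> g ` (B \<inter> l -` {y})" using inverse(1,3)[of z] \<phi>[of z] by (intro image_eqI[of _ _ "\<Psi> z"]) auto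
  qed
  show "g ` (B \<inter> l -` {y}) \<subseteq> {z \<in> U. \<phi> z = y}" using inverse(2,4) \<phi> by auto
qed

lemma connected_fibre: "connected {z \<in> U. \<phi> z = y}"
proof -
  have "convex (l -` {y})" by (rule convex_linear_vimage[OF l(1)]) simp
  hence "connected (B \<inter> l -` {y})" using B(2) by (intro convex_connected convex_Int)
  thus ?thesis unfolding fibre_image
   by (rule connected_continuous_image[rotated]) (rule continuous_on_subset[OF smooth_on_continuous[OF smooth(2)]], auto)
qed

lemma components_fibre: "y \<in> \<phi> ` U \<Longrightarrow> components {z \<in> U. \<phi> z = y} = {{z \<in> U. \<phi> z = y}}"
  using connected_fibre[of y] by (subst components_eq_sing_iff) auto

text \<open>
  In the coordinates \<open>\<Psi>\<close> two points of a fibre are joined by a segment on which \<open>l\<close> is constant, and the derivative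
  of \<open>f\<close> vanishes along its image.
\<close>

lemma constant_on_fibre:
  fixes f :: "'a \<Rightarrow> 'c::euclidean_space"
  assumes f: "smooth_on U f"
   and kill: "\<And>z w. z \<in> U \<Longrightarrow> fd \<phi> z w = 0 \<Longrightarrow> fd f z w = 0"
   and z: "z \<in> U" "z' \<in> U" "\<phi> z = \<phi> z'"
  shows "f z = f z'"
proof -
  define v where "v = \<Psi> z' - \<Psi> z"
  have lv: "l v = 0" using z by (simp add: v_def linear_diff[OF l(1)] \<phi>)
  have inB: "\<Psi> z + t *\<^sub>R v \<in> B" if "t \<in> {0..1}" for t
  proof -
   have "(1 - t) *\<^sub>R \<Psi> z + t *\<^sub>R \<Psi> z' \<in> B"
    using B(2) that inverse(1)[OF z(1)] inverse(1)[OF z(2)] unfolding convex_alt by auto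
   thus ?thesis by (simp add: v_def algebra_simps)
  qed
  have "((\<lambda>t. f (g (\<Psi> z + t *\<^sub>R v))) has_derivative (\<lambda>h. 0)) (at t within {0..1})" if t: "t \<in> {0..1}" for t
  proof -
   define y where "y = \<Psi> z + t *\<^sub>R v"
   have y: "y \<in> B" "g y \<in> U" "\<Psi> (g y) = y" using inB[OF t] inverse by (auto simp: y_def)
   define w where "w = fd g y v"
   have "fd \<phi> (g y) w = 0"
    using derivative_inverse(2)[OF y(2), of v] y(3) lv by (simp add: frechet_\<phi>[OF y(2)] w_def)
   from kill[OF y(2) this] have fw: "fd f (g y) w = 0" .
   have "((\<lambda>t. \<Psi> z + t *\<^sub>R v) has_derivative (\<lambda>h. h *\<^sub>R v)) (at t)" by (auto intro!: derivative_eq_intros)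
   from has_derivative_compose[OF has_derivative_compose[OF this dg[OF y(1)[unfolded y_def]]] smooth_on_derivative[OF f y(2)[unfolded y_def]]]
   have "((\<lambda>t. f (g (\<Psi> z + t *\<^sub>R v))) has_derivative (\<lambda>h. fd f (g y) (fd g y (h *\<^sub>R v)))) (at t)"
    by (simp only: y_def)
   moreover have "fd f (g y) (fd g y (h *\<^sub>R v)) = 0" for h
    using fw linear_cmul[OF has_derivative_linear[OF dg[OF y(1)]], of h v]
     linear_cmul[OF has_derivative_linear[OF smooth_on_derivative[OF f y(2)]], of h w] by (simp add: w_def)
   ultimately have "((\<lambda>t. f (g (\<Psi> z + t *\<^sub>R v))) has_derivative (\<lambda>h. 0)) (at t)" by simp
   thus ?thesis by (rule has_derivative_at_withinI)
  qed
  from has_derivative_zero_constant[OF convex_real_interval(5) this]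
  obtain c where "\<And>t. t \<in> {0..1} \<Longrightarrow> f (g (\<Psi> z + t *\<^sub>R v)) = c" by blast
  from this[of 0] this[of 1] show ?thesis using inverse(3) z by (simp add: v_def)
qed

text \<open>
  Near each point \<open>\<phi>\<close> has a smooth section, obtained from a linear right inverse of \<open>l\<close>, and there the induced
  function is \<open>f\<close> composed with the section.
\<close>

lemma factor_smooth:
  fixes f :: "'a \<Rightarrow> 'c::euclidean_space"
  assumes N: "open N" "N \<subseteq> U" and f: "smooth_on N f"
   and const: "\<And>x x'. x \<in> N \<Longrightarrow> x' \<in> N \<Longrightarrow> \<phi> x = \<phi> x' \<Longrightarrow> f x = f x'"
  shows "smooth_on (\<phi> ` N) (\<lambda>y. f (inv_into N \<phi> y))"
  unfolding smooth_on_def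
proof (intro allI ck_on_local)
  fix k y0 assume "y0 \<in> \<phi> ` N"
  then obtain z0 where z0: "z0 \<in> N" "y0 = \<phi> z0" by blast
  obtain \<sigma> where \<sigma>: "linear \<sigma>" "l \<circ> \<sigma> = id" using linear_surjective_right_inverse[OF l] by blast
  have \<sigma>': "bounded_linear \<sigma>" using \<sigma>(1) by (simp add: linear_conv_bounded_linear)
  define s where "s y = \<Psi> z0 + \<sigma> (y - y0)" for y
  have cs: "continuous_on UNIV s" unfolding s_def
   by (intro continuous_intros bounded_linear.continuous_on[OF \<sigma>'])
  have BN: "open (B \<inter> g -` N)" by (rule continuous_open_preimage[OF smooth_on_continuous[OF smooth(2)] B(1) N(1)])
  define W where "W = s -` (B \<inter> g -` N)"
  have W: "open W" unfolding W_def using cs BN continuous_on_open_vimage[of UNIV s] by auto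
  have sW: "s ` W \<subseteq> B" "\<And>y. y \<in> W \<Longrightarrow> g (s y) \<in> N" by (auto simp: W_def)
  have z0': "z0 \<in> U" using z0 N by auto
  have "s y0 = \<Psi> z0" using linear_0[OF \<sigma>(1)] by (simp add: s_def)
  hence y0W: "y0 \<in> W" using z0' z0(1) inverse(1,3)[of z0] by (simp add: W_def)
  have sec: "\<phi> (g (s y)) = y" if "y \<in> W" for y
  proof -
   have "\<phi> (g (s y)) = l (s y)" using sW that inverse(2,4) \<phi> by auto
   also have "\<dots> = y" using fun_cong[OF \<sigma>(2), of "y - y0"] z0 z0' by (simp add: s_def linear_add[OF l(1)] \<phi>[symmetric])
   finally show ?thesis .
  qed
  have "ck_on k W s" unfolding s_def diff_conv_add_uminus
   by (intro ck_on_add ck_on_const ck_on_linear[OF _ \<sigma>'] ck_on_id W)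
  from ck_on_compose[OF W B(1) sW(1) this smooth_onD[OF smooth(2)]]
  have "ck_on k W (\<lambda>y. g (s y))" .
  from ck_on_compose[OF W N(1) _ this smooth_onD[OF f]]
  have "ck_on k W (\<lambda>y. f (g (s y)))" using sW(2) by auto
  hence "ck_on k W (\<lambda>y. f (inv_into N \<phi> y))"
  proof (rule ck_on_cong[OF W, rotated])
   fix y assume y: "y \<in> W"
   have im: "y \<in> \<phi> ` N" using sec[OF y] sW(2)[OF y] by (metis imageI)
   show "f (g (s y)) = f (inv_into N \<phi> y)"
    by (rule const) (use sW(2)[OF y] sec[OF y] inv_into_into[OF im] f_inv_into_f[OF im] in auto)
  qed
  thus "\<exists>W. open W \<and> y0 \<in> W \<and> ck_on k W (\<lambda>y. f (inv_into N \<phi> y))" using W y0W by blast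
qed

text \<open>A kernel vector is the velocity of the image under \<open>g\<close> of a line on which \<open>l\<close> is constant.\<close>

lemma tangent_fibre:
  assumes p: "p \<in> U"
  shows "tangent_vectors {z \<in> U. \<phi> z = \<phi> p} p = {v. fd \<phi> p v = 0}"
proof (intro set_eqI iffI)
  fix v assume "v \<in> tangent_vectors {z \<in> U. \<phi> z = \<phi> p} p"
  then obtain \<gamma> \<epsilon> where \<gamma>: "0 < \<epsilon>" "\<gamma> ` {-\<epsilon><..<\<epsilon>} \<subseteq> {z \<in> U. \<phi> z = \<phi> p}" "\<gamma> 0 = p" "(\<gamma> has_vector_derivative v) (at 0)"
   by (auto simp: tangent_vectors_def)
  have "(\<phi> has_derivative fd \<phi> p) (at (\<gamma> 0))" using smooth_on_derivative[OF smooth_\<phi> p] \<gamma>(3) by simp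
  from has_derivative_compose[OF \<gamma>(4)[unfolded has_vector_derivative_def] this]
  have "((\<lambda>t. \<phi> (\<gamma> t)) has_derivative (\<lambda>t. fd \<phi> p (t *\<^sub>R v))) (at 0)" .
  hence "((\<lambda>t. \<phi> p) has_derivative (\<lambda>t. fd \<phi> p (t *\<^sub>R v))) (at 0)"
   by (rule has_derivative_transform_within_open[where s = "{-\<epsilon><..<\<epsilon>}"]) (use \<gamma>(1,2) in \<open>auto simp: image_subset_iff\<close>)
  from has_derivative_unique[OF this has_derivative_const] have "fd \<phi> p (1 *\<^sub>R v) = 0" by (rule fun_cong)
  thus "v \<in> {v. fd \<phi> p v = 0}" by simp
next
  fix v assume v: "v \<in> {v. fd \<phi> p v = 0}"
  define w where "w = fd \<Psi> p v"
  have lw: "l w = 0" using v frechet_\<phi>[OF p] by (simp add: w_def)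
  have pB: "\<Psi> p \<in> B" by (rule inverse(1)[OF p])
  define s where "s t = \<Psi> p + t *\<^sub>R w" for t :: real
  have cs: "continuous_on UNIV s" unfolding s_def by (intro continuous_intros)
  have "open (s -` B)" using continuous_on_open_vimage[of UNIV s] cs B(1) by auto
  moreover have "0 \<in> s -` B" using pB by (simp add: s_def)
  ultimately obtain \<epsilon> where e: "0 < \<epsilon>" "ball 0 \<epsilon> \<subseteq> s -` B" using open_contains_ball by blast
  define I where "I = {-\<epsilon><..<\<epsilon>}"
  have sI: "s ` I \<subseteq> B" using e(2) by (auto simp: I_def ball_def dist_real_def subset_iff abs_less_iff)
  have I: "open I" by (simp add: I_def)
  have "smooth_on I (\<lambda>t. g (s t))"
   unfolding smooth_on_def
  proof
   fix k
   have "ck_on k I s" unfolding s_def by (intro ck_on_add ck_on_const ck_on_scaleR ck_on_id I)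
   thus "ck_on k I (\<lambda>t. g (s t))" by (rule ck_on_compose[OF I B(1) sI _ smooth_onD[OF smooth(2)]])
  qed
  moreover have "(\<lambda>t. g (s t)) ` I \<subseteq> {z \<in> U. \<phi> z = \<phi> p}"
  proof (rule image_subsetI)
   fix t assume "t \<in> I"
   hence "s t \<in> B" using sI by auto
   moreover have "l (s t) = l (\<Psi> p)" using lw by (simp add: s_def linear_add[OF l(1)] linear_cmul[OF l(1)])
   ultimately show "g (s t) \<in> {z \<in> U. \<phi> z = \<phi> p}" using inverse(2,4) \<phi> p by auto
  qed
  moreover have "g (s 0) = p" using inverse(3)[OF p] by (simp add: s_def)
  moreover have "((\<lambda>t. g (s t)) has_vector_derivative v) (at 0)"
  proof -
   have "(s has_derivative (\<lambda>t. t *\<^sub>R w)) (at 0)" unfolding s_def by (auto intro!: derivative_eq_intros)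
   moreover have "(g has_derivative fd g (\<Psi> p)) (at (s 0))" using dg[OF pB] by (simp add: s_def)
   ultimately have "((\<lambda>t. g (s t)) has_derivative (\<lambda>t. fd g (\<Psi> p) (t *\<^sub>R w))) (at 0)"
    by (rule has_derivative_compose)
   moreover have "fd g (\<Psi> p) (t *\<^sub>R w) = t *\<^sub>R v" for t
    using linear_cmul[OF has_derivative_linear[OF dg[OF pB]]] derivative_inverse(1)[OF p, of v] by (simp add: w_def)
   ultimately show ?thesis by (simp add: has_vector_derivative_def)
  qed
  ultimately show "v \<in> tangent_vectors {z \<in> U. \<phi> z = \<phi> p} p"
   using e(1) unfolding tangent_vectors_def I_def by blast
qed

end

lemma compatible_flow_boxes:
  assumes f1: "flow_box U \<phi> \<Psi> g l B" and f2: "flow_box V \<psi> \<Psi>' g' l' B'"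
   and same: "\<And>x x'. x \<in> U \<inter> V \<Longrightarrow> x' \<in> U \<inter> V \<Longrightarrow> \<phi> x = \<phi> x' \<longleftrightarrow> \<psi> x = \<psi> x'"
  shows "compatible_charts (U, \<phi>) (V, \<psi>)"
proof -
  interpret F1: flow_box U \<phi> \<Psi> g l B by fact
  interpret F2: flow_box V \<psi> \<Psi>' g' l' B' by fact
  define N where "N = U \<inter> V"
  have N: "open N" "N \<subseteq> U" "N \<subseteq> V" using F1.U F2.U by (auto simp: N_def)
  have s: "smooth_on N \<phi>" "smooth_on N \<psi>"
   using F1.smooth_\<phi> F2.smooth_\<phi> N by (auto simp: smooth_on_def intro: ck_on_subset)
  define \<xi> where "\<xi> y = \<psi> (inv_into N \<phi> y)" for y
  have \<xi>: "\<xi> (\<phi> x) = \<psi> x" if "x \<in> N" for x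
  proof -
   have im: "\<phi> x \<in> \<phi> ` N" using that by simp
   thus ?thesis unfolding \<xi>_def
    using same[of "inv_into N \<phi> (\<phi> x)" x] inv_into_into[OF im] f_inv_into_f[OF im] that by (simp add: N_def)
  qed
  have inj: "inj_on \<xi> (\<phi> ` N)"
  proof (rule inj_onI)
   fix y y' assume "y \<in> \<phi> ` N" "y' \<in> \<phi> ` N" and eq: "\<xi> y = \<xi> y'"
   then obtain x x' where x: "x \<in> N" "x' \<in> N" "y = \<phi> x" "y' = \<phi> x'" by blast
   with eq have "\<psi> x = \<psi> x'" by (simp add: \<xi>)
   thus "y = y'" using same[of x x'] x by (simp add: N_def)
  qed
  have im: "\<xi> ` \<phi> ` N = \<psi> ` N" unfolding image_image by (rule image_cong) (simp_all add: \<xi>)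
  have sm1: "smooth_on (\<phi> ` N) \<xi>"
   unfolding \<xi>_def by (rule F1.factor_smooth[OF N(1,2) s(2)]) (use same in \<open>simp add: N_def\<close>)
  have sm2: "smooth_on (\<psi> ` N) (\<lambda>y. \<phi> (inv_into N \<psi> y))"
   by (rule F2.factor_smooth[OF N(1,3) s(1)]) (use same in \<open>simp add: N_def\<close>)
  have "smooth_on (\<psi> ` N) (inv_into (\<phi> ` N) \<xi>)"
   unfolding smooth_on_def
  proof
   fix k
   show "ck_on k (\<psi> ` N) (inv_into (\<phi> ` N) \<xi>)"
   proof (rule ck_on_cong[OF F2.open_image[OF N(1,3)] _ smooth_onD[OF sm2]])
    fix y assume y: "y \<in> \<psi> ` N"
    define x where "x = inv_into N \<psi> y"
    have x: "x \<in> N" "\<psi> x = y" using inv_into_into[OF y] f_inv_into_f[OF y] by (auto simp: x_def)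
    have "inv_into (\<phi> ` N) \<xi> (\<xi> (\<phi> x)) = \<phi> x" by (rule inv_into_f_f[OF inj]) (use x in simp)
    thus "\<phi> (inv_into N \<psi> y) = inv_into (\<phi> ` N) \<xi> y" using x by (simp add: \<xi> x_def)
   qed
  qed
  hence "diffeomorphism_between (\<phi> ` N) (\<psi> ` N) \<xi>"
   using inj im sm1 by (simp add: diffeomorphism_between_def bij_betw_def)
  thus ?thesis using \<xi> unfolding compatible_charts_def N_def by auto
qed

lemma same_leaf_constant:
  assumes const: "\<And>P x y. P \<in> plaques \<F> \<Longrightarrow> x \<in> P \<Longrightarrow> y \<in> P \<Longrightarrow> f x = f y"
   and leaf: "same_leaf \<F> x y"
  shows "f x = f y"
proof -
  obtain n :: nat and P where P: "\<And>j. j \<le> n \<Longrightarrow> P j \<in> plaques \<F>" "x \<in> P 0" "y \<in> P n" "\<And>j. j \<in> {1..n} \<Longrightarrow> P (j - 1) \<inter> P j \<noteq> {}"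
   using leaf unfolding same_leaf_def by blast
  have "\<forall>z\<in>P j. f x = f z" if "j \<le> n" for j
   using that
  proof (induction j)
   case 0
   thus ?case using const[OF P(1)[of 0] P(2)] by simp
  next
   case (Suc j)
   obtain u where u: "u \<in> P j" "u \<in> P (Suc j)" using P(4)[of "Suc j"] Suc.prems by auto
   have "f x = f u" using Suc u by simp
   thus ?case using const[OF P(1)[OF Suc.prems] u(2)] by simp
  qed
  from this[of n] P(3) show ?thesis by simp
qed

text \<open>
  The atlas consists of all flow boxes of \<open>n\<close>-tuples from \<open>R\<close>. Every member of \<open>R\<close> is constant on the fibres of every
  such chart, so on overlaps each chart map is a function of the other one, which is compatibility.
\<close>

lemma foliation_by_common_level_sets:
  fixes M :: "'a::euclidean_space set" and R :: "('a \<Rightarrow> real) set" and \<omega> :: "'a \<Rightarrow> 'a \<Rightarrow> 'a \<Rightarrow> complex"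
  assumes M: "open M" and R: "\<And>r. r \<in> R \<Longrightarrow> smooth_on M r"
   and rich: "\<And>p. p \<in> M \<Longrightarrow> \<exists>a. (\<forall>j. a j \<in> R) \<and> surj (\<lambda>v. \<chi> j::'n::finite. fd (a j) p v)"
   and lag: "\<And>p a. p \<in> M \<Longrightarrow> (\<And>j. a j \<in> R) \<Longrightarrow> surj (\<lambda>v. \<chi> j::'n. fd (a j) p v) \<Longrightarrow>
    lagrangian_subspace (\<omega> p) {v. \<forall>j. fd (a j) p v = 0} \<and>
    (\<forall>r\<in>R. \<forall>v. (\<forall>j. fd (a j) p v = 0) \<longrightarrow> fd r p v = 0)"
  obtains \<F> :: "('a, real^'n) fol_chart set" where "lagrangian_foliation M \<omega> \<F>"
   "\<And>r x y. r \<in> R \<Longrightarrow> same_leaf \<F> x y \<Longrightarrow> r x = r y" "\<And>x y. same_leaf \<F> x y \<Longrightarrow> x \<in> M \<and> y \<in> M"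
proof -
  define \<F> :: "('a, real^'n) fol_chart set" where
   "\<F> = {(U, \<phi>). U \<subseteq> M \<and> (\<exists>a. (\<forall>j. a j \<in> R) \<and> \<phi> = (\<lambda>z. \<chi> j. a j z)) \<and> (\<exists>\<Psi> g l B. flow_box U \<phi> \<Psi> g l B)}"
  have df: "((\<lambda>z. \<chi> j. a j z) has_derivative (\<lambda>v. \<chi> j. fd (a j) z v)) (at z)"
   if "\<And>j. a j \<in> R" "z \<in> M" for a :: "'n \<Rightarrow> 'a \<Rightarrow> real" and z
   using smooth_on_derivative[OF R[OF that(1)] that(2)]
   by (intro has_derivative_componentwise_within[THEN iffD2]) (auto simp: Basis_vec_def inner_axis)
  have smooth_tuple: "smooth_on M (\<lambda>z. \<chi> j. a j z)" if "\<And>j. a j \<in> R" for a :: "'n \<Rightarrow> 'a \<Rightarrow> real"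
   unfolding smooth_on_def
  proof
   fix k
   have "ck_on k M (\<lambda>z. \<Sum>j\<in>UNIV. a j z *\<^sub>R (axis j 1 :: real^'n))"
    by (intro ck_on_sum ck_on_scaleR ck_on_const M smooth_onD[OF R[OF that]])
   moreover have "(\<Sum>j\<in>UNIV. a j z *\<^sub>R (axis j 1 :: real^'n)) = (\<chi> j. a j z)" for z
    by (simp add: vec_eq_iff axis_def if_distrib[of "\<lambda>x. _ * x"] cong: if_cong)
   ultimately show "ck_on k M (\<lambda>z. \<chi> j. a j z)" by simp
  qed
  have chartD: "\<exists>a \<Psi> g l B. (\<forall>j. a j \<in> R) \<and> \<phi> = (\<lambda>z. \<chi> j. a j z) \<and> U \<subseteq> M \<and> flow_box U \<phi> \<Psi> g l B" if "(U, \<phi>) \<in> \<F>" for U \<phi>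
   using that unfolding \<F>_def by blast
  have pointwise: "lagrangian_subspace (\<omega> z) {v. fd \<phi> z v = 0} \<and>
    (\<forall>r\<in>R. \<forall>v. fd \<phi> z v = 0 \<longrightarrow> fd r z v = 0)"
   if c: "(U, \<phi>) \<in> \<F>" and z: "z \<in> U" for U \<phi> z
  proof -
   obtain a \<Psi> g l B where a: "\<And>j. a j \<in> R" "\<phi> = (\<lambda>z. \<chi> j. a j z)" "U \<subseteq> M" and fb: "flow_box U \<phi> \<Psi> g l B"
    using chartD[OF c] by blast
   have zM: "z \<in> M" using z a(3) by auto
   have fr: "fd \<phi> z = (\<lambda>v. \<chi> j. fd (a j) z v)"
    unfolding a(2) by (rule frechet_derivative_at[OF df[OF a(1) zM], symmetric])
   have ker: "fd \<phi> z v = 0 \<longleftrightarrow> (\<forall>j. fd (a j) z v = 0)" for v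
    by (simp add: fr vec_eq_iff)
   from lag[OF zM a(1) flow_box.surj_d\<phi>[OF fb z, unfolded fr]] show ?thesis unfolding ker .
  qed
  have const: "r x = r y" if c: "(U, \<phi>) \<in> \<F>" and r: "r \<in> R" and x: "x \<in> U" "y \<in> U" "\<phi> x = \<phi> y" for U \<phi> r x y
  proof -
   obtain \<Psi> g l B where fb: "U \<subseteq> M" "flow_box U \<phi> \<Psi> g l B" using chartD[OF c] by blast
   have "smooth_on U r" using R[OF r] fb(1) by (auto simp: smooth_on_def intro: ck_on_subset)
   from flow_box.constant_on_fibre[OF fb(2) this _ x] show ?thesis using pointwise[OF c] r by blast
  qed
  have constF: "\<psi> x = \<psi> y" if c: "(U, \<phi>) \<in> \<F>" "(V, \<psi>) \<in> \<F>" and x: "x \<in> U" "y \<in> U" "\<phi> x = \<phi> y" for U \<phi> V \<psi> x y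
  proof -
   obtain a where a: "\<And>j. a j \<in> R" "\<psi> = (\<lambda>z. \<chi> j. a j z)" using chartD[OF c(2)] by blast
   show ?thesis using const[OF c(1) a(1) x] by (simp add: a(2))
  qed
  have cover: "\<exists>U \<phi>. (U, \<phi>) \<in> \<F> \<and> p \<in> U" if p: "p \<in> M" for p
  proof -
   obtain a where a: "\<And>j. a j \<in> R" "surj (\<lambda>v. \<chi> j::'n. fd (a j) p v)" using rich[OF p] by blast
   have "surj (fd (\<lambda>z. \<chi> j. a j z) p)"
    unfolding frechet_derivative_at[OF df[of a, OF a(1) p], symmetric] by (rule a(2))
   from ex_flow_box[OF M p smooth_tuple[OF a(1)] this] obtain U \<Psi> g l B where
    "flow_box U (\<lambda>z. \<chi> j. a j z) \<Psi> g l B" "p \<in> U" "U \<subseteq> M" by blast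
   thus ?thesis using a(1) unfolding \<F>_def by blast
  qed
  have plaque: "\<exists>U \<phi> p. (U, \<phi>) \<in> \<F> \<and> p \<in> U \<and> P = {z \<in> U. \<phi> z = \<phi> p}" if P: "P \<in> plaques \<F>" for P
  proof -
   obtain U \<phi> y where c: "(U, \<phi>) \<in> \<F>" "y \<in> \<phi> ` U" "P \<in> components {z \<in> U. \<phi> z = y}"
    using P unfolding plaques_def by fast
   obtain \<Psi> g l B where fb: "flow_box U \<phi> \<Psi> g l B" using chartD[OF c(1)] by blast
   have "P = {z \<in> U. \<phi> z = y}" using flow_box.components_fibre[OF fb c(2)] c(3) by simp
   thus ?thesis using c(1,2) by blast
  qed
  have plaque_M: "P \<subseteq> M" if "P \<in> plaques \<F>" for P
   using plaque[OF that] chartD by fastforce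
  have "foliated_atlas M \<F>"
   unfolding foliated_atlas_def
  proof (intro conjI ballI)
   fix c assume "c \<in> \<F>"
   moreover obtain U \<phi> where "c = (U, \<phi>)" by (cases c)
   ultimately show "foliated_chart M c" using chartD flow_box.foliated_chart by blast
  next
   fix c d assume cd: "c \<in> \<F>" "d \<in> \<F>"
   obtain U \<phi> V \<psi> where eq: "c = (U, \<phi>)" "d = (V, \<psi>)" by (cases c, cases d)
   obtain \<Psi> g l B \<Psi>' g' l' B' where fb: "flow_box U \<phi> \<Psi> g l B" "flow_box V \<psi> \<Psi>' g' l' B'"
    using chartD cd unfolding eq by metis
   show "compatible_charts c d" unfolding eq
    by (rule compatible_flow_boxes[OF fb]) (use constF cd[unfolded eq] in blast)
  next
   show "(\<Union>(U, \<phi>)\<in>\<F>. U) = M"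
   proof
    show "(\<Union>(U, \<phi>)\<in>\<F>. U) \<subseteq> M" using chartD by fastforce
    show "M \<subseteq> (\<Union>(U, \<phi>)\<in>\<F>. U)" using cover by fastforce
   qed
  qed
  moreover have "lagrangian_subspace (\<omega> p) (tangent_vectors P p)" if P: "P \<in> plaques \<F>" "p \<in> P" for P p
  proof -
   obtain U \<phi> q where c: "(U, \<phi>) \<in> \<F>" "P = {z \<in> U. \<phi> z = \<phi> q}" using plaque[OF P(1)] by blast
   have pU: "p \<in> U" and eq: "P = {z \<in> U. \<phi> z = \<phi> p}" using P(2) c(2) by auto
   obtain \<Psi> g l B where fb: "flow_box U \<phi> \<Psi> g l B" using chartD[OF c(1)] by blast
   show ?thesis unfolding eq flow_box.tangent_fibre[OF fb pU] using pointwise[OF c(1) pU] by blast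
  qed
  ultimately have "lagrangian_foliation M \<omega> \<F>" unfolding lagrangian_foliation_def by blast
  moreover have "r x = r y" if r: "r \<in> R" and "same_leaf \<F> x y" for r x y
  proof (rule same_leaf_constant[OF _ that(2)])
   fix P x y assume P: "P \<in> plaques \<F>" "x \<in> P" "y \<in> P"
   obtain U \<phi> q where c: "(U, \<phi>) \<in> \<F>" "P = {z \<in> U. \<phi> z = \<phi> q}" using plaque[OF P(1)] by blast
   show "r x = r y" by (rule const[OF c(1) r]) (use P(2,3) c(2) in auto)
  qed
  moreover have "x \<in> M \<and> y \<in> M" if "same_leaf \<F> x y" for x y
   using that plaque_M unfolding same_leaf_def by (metis order_refl subsetD zero_le)
  ultimately show ?thesis by (rule that)
qed

section \<open>The Lagrangian foliation\<close>

lemma surj_of_independent: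
  fixes \<alpha> :: "'n::finite \<Rightarrow> 'a::euclidean_space \<Rightarrow> real"
  assumes lin: "\<And>j. linear (\<alpha> j)" and ind: "\<And>c. (\<And>v. (\<Sum>j\<in>UNIV. c j * \<alpha> j v) = 0) \<Longrightarrow> \<forall>j. c j = 0"
  shows "surj (\<lambda>v. \<chi> j. \<alpha> j v)"
proof (rule ccontr)
  let ?l = "\<lambda>v. \<chi> j. \<alpha> j v"
  assume "range ?l \<noteq> UNIV"
  moreover have l: "linear ?l"
   by (rule linearI) (simp_all add: vec_eq_iff linear_add[OF lin] linear_cmul[OF lin])
  moreover from l have "span (range ?l) = range ?l" by (simp add: linear_subspace_image span_eq_iff)
  ultimately have "dim (range ?l) < DIM(real^'n)"
   using dim_eq_full[of "range ?l"] dim_subset_UNIV[of "range ?l"] by (metis le_neq_implies_less)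
  then obtain x :: "real^'n" where x: "x \<noteq> 0" "\<And>y. y \<in> span (range ?l) \<Longrightarrow> orthogonal x y"
   using orthogonal_to_subspace_exists[of "range ?l"] by blast
  have "(\<Sum>j\<in>UNIV. x $ j * \<alpha> j v) = 0" for v
   using x(2)[of "?l v"] by (simp add: span_base orthogonal_def inner_vec_def)
  from ind[OF this] have "x = 0" by (simp add: vec_eq_iff)
  with x(1) show False by simp
qed

lemma dim_joint_kernel:
  fixes l :: "'a::euclidean_space \<Rightarrow> 'b::euclidean_space"
  assumes l: "linear l" "surj l"
  shows "dim {v. l v = 0} + DIM('b) = DIM('a)"
proof -
  obtain \<sigma> where \<sigma>: "linear \<sigma>" "l \<circ> \<sigma> = id" using linear_surjective_right_inverse[OF l] by blast
  have l\<sigma>: "l (\<sigma> y) = y" for y using fun_cong[OF \<sigma>(2), of y] by simp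
  have "inj \<sigma>" using l\<sigma> by (rule inj_on_inverseI)
  hence d\<sigma>: "dim (range \<sigma>) = DIM('b)" using dim_image_eq[OF \<sigma>(1), of UNIV] by simp
  have sub: "subspace {v. l v = 0}" "subspace (range \<sigma>)"
   using linear_subspace_kernel[OF l(1)] linear_subspace_image[OF \<sigma>(1) subspace_UNIV] by auto
  have "v \<in> {x + y |x y. x \<in> {v. l v = 0} \<and> y \<in> range \<sigma>}" for v
  proof -
   have "v = (v - \<sigma> (l v)) + \<sigma> (l v)" "l (v - \<sigma> (l v)) = 0" using l\<sigma> by (auto simp: linear_diff[OF l(1)])
   thus ?thesis by blast
  qed
  hence "{x + y |x y. x \<in> {v. l v = 0} \<and> y \<in> range \<sigma>} = UNIV" by blast
  moreover have "{v. l v = 0} \<inter> range \<sigma> = {0}" using l\<sigma> linear_0[OF \<sigma>(1)] linear_0[OF l(1)] by auto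
  ultimately show ?thesis using dim_sums_Int[OF sub] d\<sigma> by simp
qed

text \<open>
  Let \<open>s j\<close> be the gradient of \<open>\<alpha> j\<close>. The vectors \<open>\<i> *s s j\<close> lie in the joint kernel, because
  \<open>Re (Hm p (\<i> *s s j) (s k)) = - Im (Hm p (s j) (s k)) = 0\<close>; they are independent and hence span it, by dimension.
  The conclusions need to be checked on these vectors only.
\<close>

lemma (in bounded_dom) isotropic_kernel:
  fixes \<alpha> :: "'n \<Rightarrow> complex^'n \<Rightarrow> real"
  assumes p: "p \<in> D" and lin: "\<And>j. linear (\<alpha> j)" and surj: "surj (\<lambda>v. \<chi> j. \<alpha> j v)"
   and comm: "\<And>j k s t. (\<And>v. \<alpha> j v = 2 * Re (Hm p v s)) \<Longrightarrow> (\<And>v. \<alpha> k v = 2 * Re (Hm p v t)) \<Longrightarrow> Im (Hm p s t) = 0"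
  shows "lagrangian_subspace (bergman_kaehler_form D p) {v. \<forall>j. \<alpha> j v = 0}"
   and "\<And>\<beta> v. linear \<beta> \<Longrightarrow>
    (\<And>j s t. (\<And>v. \<alpha> j v = 2 * Re (Hm p v s)) \<Longrightarrow> (\<And>v. \<beta> v = 2 * Re (Hm p v t)) \<Longrightarrow> Im (Hm p s t) = 0) \<Longrightarrow>
    (\<forall>j. \<alpha> j v = 0) \<Longrightarrow> \<beta> v = 0"
proof -
  obtain c where "herm_form (Hm p) c" using Hm_herm_form[OF p] by blast
  then interpret h: herm_form "Hm p" c .
  have "\<forall>j. \<exists>s. \<forall>v. \<alpha> j v = 2 * Re (Hm p v s)" using riesz_Hm[OF p lin] by metis
  then obtain s where s: "\<And>j v. \<alpha> j v = 2 * Re (Hm p v (s j))" by metis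
  have Im_s: "Im (Hm p (s j) (s k)) = 0" for j k by (rule comm[OF s s])
  define S where "S c = (\<Sum>j\<in>UNIV. (c $ j) *\<^sub>R s j)" for c :: "real^'n"
  have S_left: "Hm p (S c) t = (\<Sum>j\<in>UNIV. of_real (c $ j) * Hm p (s j) t)" for c t
   by (simp only: S_def Hm_sum_left[OF p] scaleR_smult h.scale_left)
  have S_right: "Hm p t (S c) = (\<Sum>j\<in>UNIV. of_real (c $ j) * Hm p t (s j))" for c t
   by (simp only: S_def Hm_sum_right[OF p] scaleR_smult h.scale_right complex_cnj_complex_of_real)
  have Im_S: "Im (Hm p (S c) t) = (\<Sum>j\<in>UNIV. c $ j * Im (Hm p (s j) t))" for c t by (simp add: S_left)
  define V where "V = {v. \<forall>j. \<alpha> j v = 0}"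
  define G where "G c = \<i> *s S c" for c
  have linS: "linear S"
   unfolding S_def by (rule linearI) (simp_all add: scaleR_add_left sum.distrib scaleR_sum_right)
  have linG: "linear G"
   unfolding G_def by (rule linearI) (simp_all add: linear_add[OF linS] linear_cmul[OF linS] vec_eq_iff algebra_simps)
  have GV: "range G \<subseteq> V"
  proof (rule image_subsetI)
   fix c
   have "\<alpha> k (G c) = 0" for k by (simp add: s G_def h.scale_left Im_S Im_s)
   thus "G c \<in> V" by (simp add: V_def)
  qed
  have injG: "inj G"
  proof (subst linear_injective_0[OF linG], intro allI impI)
   fix c assume "G c = 0"
   hence S0: "S c = 0" by (simp add: G_def vec_eq_iff)
   obtain v where "(\<chi> j. \<alpha> j v) = c" using surj by (metis surjD)
   hence v: "\<alpha> j v = c $ j" for j by (metis vec_lambda_beta)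
   have "(\<Sum>j\<in>UNIV. c $ j * c $ j) = 2 * Re (Hm p v (S c))"
    by (simp add: v[symmetric] S_right s sum_distrib_left mult_ac)
   hence "c \<bullet> c = 0" by (simp add: S0 inner_vec_def)
   thus "c = 0" by simp
  qed
  have linl: "linear (\<lambda>v. \<chi> j. \<alpha> j v)"
   by (rule linearI) (simp_all add: vec_eq_iff linear_add[OF lin] linear_cmul[OF lin])
  have V_ker: "V = {v. (\<chi> j. \<alpha> j v) = 0}" by (simp add: V_def vec_eq_iff)
  have dimV: "dim V = CARD('n)" using dim_joint_kernel[OF linl surj] by (simp add: V_ker)
  have subV: "subspace V" unfolding V_ker by (rule linear_subspace_kernel[OF linl])
  have "dim (range G) = CARD('n)" using dim_image_eq[OF linG, of UNIV] injG by simp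
  hence VG: "V = range G"
   using subspace_dim_equal[OF linear_subspace_image[OF linG subspace_UNIV] subV GV] dimV by simp
  have "bergman_kaehler_form D p (G c) (G c') = 0" for c c'
  proof -
   have "Hm p (G c) (G c') = Hm p (S c) (S c')" by (simp add: G_def h.scale_left h.scale_right)
   also have "\<dots> = (\<Sum>j\<in>UNIV. of_real (c' $ j) * Hm p (S c) (s j))" by (rule S_right)
   finally have "Im (Hm p (G c) (G c')) = 0" by (simp add: Im_S Im_s)
   thus ?thesis by (simp add: kaehler_form_eq[OF p])
  qed
  thus "lagrangian_subspace (bergman_kaehler_form D p) {v. \<forall>j. \<alpha> j v = 0}"
   unfolding lagrangian_subspace_def V_def[symmetric] using subV dimV by (auto simp: VG)
  fix \<beta> v
  assume \<beta>: "linear \<beta>" "\<And>j s t. (\<And>v. \<alpha> j v = 2 * Re (Hm p v s)) \<Longrightarrow> (\<And>v. \<beta> v = 2 * Re (Hm p v t)) \<Longrightarrow> Im (Hm p s t) = 0"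
   and v: "\<forall>j. \<alpha> j v = 0"
  obtain t where t: "\<And>v. \<beta> v = 2 * Re (Hm p v t)" using riesz_Hm[OF p \<beta>(1)] by blast
  have st: "Im (Hm p (s j) t) = 0" for j by (rule \<beta>(2)[OF s t])
  obtain c where "v = G c" using v VG unfolding V_def by blast
  thus "\<beta> v = 0" by (simp add: t G_def h.scale_left Im_S st)
qed

theorem mainTheorem1:
  fixes D S :: "(complex^'n) set"
    and A :: "(complex^'n \<Rightarrow> complex) set"
  assumes "homogeneous_bounded_domain D"
    and "A \<subseteq> bounded_smooth_functions D"
    and "complex_function_subspace A"
    and "\<forall>a\<in>A. (\<lambda>z. cnj (a z)) \<in> A"
    and "\<forall>h\<in>{0<..<1::real}. commutative_on (weighted_bergman_space D h) (toeplitz_algebra D h A)"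
    and "closedin (top_of_set D) S"
    and "(top_of_set D) interior_of ((top_of_set D) closure_of S) = {}"
    and "\<forall>p\<in>D - S. \<exists>a :: 'n \<Rightarrow> complex^'n \<Rightarrow> complex.
           (\<forall>j. a j \<in> A \<and> (\<forall>z\<in>D. a j z \<in> \<real>)) \<and>
           (\<forall>c :: 'n \<Rightarrow> real.
              (\<forall>v. (\<Sum>j\<in>UNIV. c j *\<^sub>R frechet_derivative (a j) (at p) v) = 0) \<longrightarrow>
              (\<forall>j. c j = 0))"
  shows "\<exists>\<F> :: (complex^'n, real^'n) fol_chart set.
           lagrangian_foliation (D - S) (bergman_kaehler_form D) \<F> \<and>
           zero_ext (D - S) ` A \<subseteq> leafwise_constant_functions (D - S) \<F>"
proof -
  note hom = assms(1) and A = assms(2) and comm = assms(5)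
  interpret bounded_dom D by unfold_locales (use hom in \<open>simp add: homogeneous_bounded_domain_def\<close>)
  define M where "M = D - S"
  define R where "R = (\<lambda>a z. Re (a z)) ` A"
  have M: "open M" "M \<subseteq> D"
   using assms(6) D_facts(1) by (auto simp: M_def closedin_def openin_open_eq)
  have scale: "(\<lambda>z. c * a z) \<in> A" and add: "(\<lambda>z. a z + b z) \<in> A" if "a \<in> A" "b \<in> A" for a b c
   using assms(3) that by (auto simp: complex_function_subspace_def)
  have smA: "smooth_on D a" if "a \<in> A" for a
   using that A by (auto simp: bounded_smooth_functions_def smooth_functions_def)
  have smR: "smooth_on D r" if "r \<in> R" for r
   using that smA ck_on_linear[OF D_facts(1) bounded_linear_Re] by (auto simp: R_def smooth_on_def)
  have real_part: "(\<lambda>z. complex_of_real (r z)) \<in> A" if r: "r \<in> R" for r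
  proof -
   obtain a where a: "a \<in> A" "r = (\<lambda>z. Re (a z))" using r by (auto simp: R_def)
   have "(\<lambda>z. (1/2) * (a z + cnj (a z))) \<in> A"
    using add[OF a(1) bspec[OF assms(4) a(1)]] scale[of "\<lambda>z. a z + cnj (a z)"] by blast
   thus ?thesis by (simp add: a(2) complex_add_cnj)
  qed
  have d_real: "Re (fd (\<lambda>z. complex_of_real (r z)) p v) = fd r p v" if "r \<in> R" "p \<in> D" for r p v
   using frechet_derivative_at[OF has_derivative_of_real[OF smooth_on_derivative[OF smR[OF that(1)] that(2)], where 'a = complex], symmetric] by simp
  have gc: "Im (Hm p s t) = 0" if "r \<in> R" "r' \<in> R" "p \<in> D"
   "\<And>v. fd r p v = 2 * Re (Hm p v s)" "\<And>v. fd r' p v = 2 * Re (Hm p v t)" for r r' p s t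
   by (rule gradients_commute[OF hom A comm real_part[OF that(1)] real_part[OF that(2)] _ _ that(3)])
    (simp_all add: d_real that)
  have linR: "linear (fd r p)" if "r \<in> R" "p \<in> D" for r p
   by (rule has_derivative_linear[OF smooth_on_derivative[OF smR[OF that(1)] that(2)]])
  obtain \<F> :: "(complex^'n, real^'n) fol_chart set" where F: "lagrangian_foliation M (bergman_kaehler_form D) \<F>"
   "\<And>r x y. r \<in> R \<Longrightarrow> same_leaf \<F> x y \<Longrightarrow> r x = r y" "\<And>x y. same_leaf \<F> x y \<Longrightarrow> x \<in> M \<and> y \<in> M"
  proof (rule foliation_by_common_level_sets[OF M(1)])
   show "smooth_on M r" if "r \<in> R" for r using smR[OF that] M(2) by (auto simp: smooth_on_def intro: ck_on_subset)
  next
   fix p assume p: "p \<in> M"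
   hence pD: "p \<in> D" using M(2) by auto
   obtain a :: "'n \<Rightarrow> complex^'n \<Rightarrow> complex" where a: "\<And>j. a j \<in> A" "\<And>j z. z \<in> D \<Longrightarrow> a j z \<in> \<real>"
    and ind: "\<And>c :: 'n \<Rightarrow> real. \<forall>v. (\<Sum>j\<in>UNIV. c j *\<^sub>R fd (a j) p v) = 0 \<Longrightarrow> \<forall>j. c j = 0"
    using assms(8) p unfolding M_def by meson
   define r where "r j z = Re (a j z)" for j z
   have rR: "r j \<in> R" for j using a(1) by (auto simp: r_def[abs_def] R_def)
   have da: "fd (a j) p v = of_real (fd (r j) p v)" for j v
   proof -
    note d = smooth_on_derivative[OF smA[OF a(1)] pD, of j]
    have "fd (r j) p v = Re (fd (a j) p v)"
     using frechet_derivative_at[OF has_derivative_Re[OF d]] by (simp add: r_def[abs_def] fun_eq_iff)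
    thus ?thesis using real_valued_derivative[OF d D_facts(1) pD a(2), of v] by simp
   qed
   have "surj (\<lambda>v. \<chi> j. fd (r j) p v)"
   proof (rule surj_of_independent[OF linR[OF rR pD]])
    fix c :: "'n \<Rightarrow> real" assume c: "\<And>v. (\<Sum>j\<in>UNIV. c j * fd (r j) p v) = 0"
    have "(\<Sum>j\<in>UNIV. c j *\<^sub>R fd (a j) p v) = of_real (\<Sum>j\<in>UNIV. c j * fd (r j) p v)" for v
     by (simp add: da scaleR_conv_of_real)
    thus "\<forall>j. c j = 0" using ind[of c] c by simp
   qed
   thus "\<exists>a. (\<forall>j. a j \<in> R) \<and> surj (\<lambda>v. \<chi> j::'n. fd (a j) p v)" using rR by blast
  next
   fix p and a :: "'n \<Rightarrow> complex^'n \<Rightarrow> real"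
   assume p: "p \<in> M" and a: "\<And>j. a j \<in> R" and surj: "surj (\<lambda>v. \<chi> j. fd (a j) p v)"
   have pD: "p \<in> D" using p M(2) by auto
   have cm: "Im (Hm p s t) = 0" if "\<And>v. fd (a j) p v = 2 * Re (Hm p v s)"
    "\<And>v. fd (a k) p v = 2 * Re (Hm p v t)" for j k s t
    by (rule gc[OF a a pD that])
   have "lagrangian_subspace (bergman_kaehler_form D p) {v. \<forall>j. fd (a j) p v = 0}"
    by (rule isotropic_kernel(1)[OF pD linR[OF a pD] surj]) (rule cm)
   moreover have "fd r p v = 0" if r: "r \<in> R" and v: "\<forall>j. fd (a j) p v = 0" for r v
   proof (rule isotropic_kernel(2)[OF pD linR[OF a pD] surj _ linR[OF r pD] _ v])
    show "Im (Hm p s t) = 0" if "\<And>v. fd (a j) p v = 2 * Re (Hm p v s)"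
     "\<And>v. fd (a k) p v = 2 * Re (Hm p v t)" for j k s t by (rule cm[OF that])
    show "Im (Hm p s t) = 0" if "\<And>v. fd (a j) p v = 2 * Re (Hm p v s)"
     "\<And>v. fd r p v = 2 * Re (Hm p v t)" for j s t
     by (rule gc[OF a r pD that])
   qed
   ultimately show "lagrangian_subspace (bergman_kaehler_form D p) {v. \<forall>j. fd (a j) p v = 0} \<and>
    (\<forall>r\<in>R. \<forall>v. (\<forall>j. fd (a j) p v = 0) \<longrightarrow> fd r p v = 0)" by blast
  qed (rule that)
  have const: "a x = a y" if a: "a \<in> A" and leaf: "same_leaf \<F> x y" for a x y
  proof -
   have "(\<lambda>z. Re (- \<i> * a z)) \<in> R"
    unfolding R_def by (rule image_eqI[OF refl scale[OF a a]])
   moreover have "(\<lambda>z. Re (a z)) \<in> R" unfolding R_def by (rule image_eqI[OF refl a])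
   ultimately have "Re (- \<i> * a x) = Re (- \<i> * a y)" "Re (a x) = Re (a y)" using F(2)[OF _ leaf] by blast+
   thus ?thesis by (simp add: complex_eq_iff)
  qed
  have "zero_ext M a \<in> leafwise_constant_functions M \<F>" if a: "a \<in> A" for a
  proof -
   have "smooth_on M (zero_ext M a)"
    unfolding smooth_on_def
   proof
    fix k
    show "ck_on k M (zero_ext M a)"
     by (rule ck_on_cong[OF M(1) _ ck_on_subset[OF smooth_onD[OF smA[OF a]] M(2)]]) (simp add: zero_ext_def)
   qed
   moreover have "zero_ext M a constant_on L" if L': "L \<in> leaves M \<F>" for L
   proof -
    obtain x where L: "L = {y. same_leaf \<F> x y}" using L' unfolding leaves_def by blast
    show ?thesis unfolding constant_on_def
     using const[OF a] F(3) by (intro exI[of _ "a x"]) (auto simp: L zero_ext_def)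
   qed
   ultimately show ?thesis by (auto simp: leafwise_constant_functions_def smooth_functions_def zero_ext_def)
  qed
  thus ?thesis using F(1) unfolding M_def by blast
qed

end
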